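(* Let $d\in\mathbb{N}$ and let $Z,Z_1,Z_2,\ldots$ be i.i.d. random vectors in $\mathbb{R}^d$ with $\mathbb{E}(\|Z\|^2)<\infty$, mean $\mu:=\mathbb{E}Z\neq\mathbf{0}$ and covariance $\Sigma:=\mathbb{E}((Z-\mu)(Z-\mu)^\top)$. Let $S_0=\mathbf{0}$, $S_n=\sum_{i=1}^nZ_i$, and $Y_n(t):=S_{\lfloor nt\rfloor}+(nt-\lfloor nt\rfloor)Z_{\lfloor nt\rfloor+1}$, $t\in[0,1]$. Then almost surely the sequence $\psi_n(Y_n)=(t\mapsto\psi_n(Y_n(t)))$ in $\mathcal{C}_d^0$ is relatively compact and its set of limit points is $W_{d,\mu,\Sigma}$. In particular, if $F:(\mathcal{C}_d^0,\rho_\infty)\to\mathbb{R}$ is continuous, then $\limsup_{n\to\infty}F(\psi_n(Y_n))=\sup_{h\in W_{d,\mu,\Sigma}}F(h)$ a.s.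
   Context: Fix an orthonormal basis $e_1,\ldots,e_d$ of $\mathbb{R}^d$ with $e_1=\mu/\|\mu\|$ and write vectors in coordinates with respect to it. $\ell(n):=1$ for $n\in\{0,1,2\}$ and $\ell(n):=\sqrt{2n\log\log n}$ for $n\ge3$. $\psi_n(x_1,\ldots,x_d):=(x_1/n,x_2/\ell(n),\ldots,x_d/\ell(n))$. $\mathcal{C}_d^0$ is the space of continuous $f:[0,1]\to\mathbb{R}^d$ with $f(0)=\mathbf{0}$, with the uniform metric $\rho_\infty$. $\Sigma_{\mu^\perp}$ is the $(d-1)\times(d-1)$ matrix $(e_{i+1}^\top\Sigma e_{j+1})_{i,j}$, and $\Sigma_{\mu^\perp}^{1/2}$ its symmetric non-negative definite square root. $U_{d-1}$ is the set of $f:[0,1]\to\mathbb{R}^{d-1}$ with $f(0)=\mathbf{0}$, absolutely continuous components, and $\int_0^1\|f'(s)\|^2ds\le1$. $I_\mu(t):=\|\mu\|t$. For $d\ge2$, $W_{d,\mu,\Sigma}:=\{t\mapsto(I_\mu(t),\Sigma_{\mu^\perp}^{1/2}f(t)):f\in U_{d-1}\}$; for $d=1$, $W_{1,\mu,\Sigma}:=\{I_\mu\}$. *)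

theory Defs
  imports "HOL-Probability.Probability"
begin

definition ell :: "nat \<Rightarrow> real" where
  "ell n = (if n \<le> 2 then 1 else sqrt (2 * real n * ln (ln (real n))))"

text \<open>Coordinates w.r.t. the orthonormal basis e (index i0 plays the role of e_1 = mu/|mu|),
  followed by the scaling psi_n.\<close>
definition psi :: "('d::finite \<Rightarrow> real^'d) \<Rightarrow> 'd \<Rightarrow> nat \<Rightarrow> real^'d \<Rightarrow> real^'d" where
  "psi e i0 n x = (\<chi> i. if i = i0 then (x \<bullet> e i) / real n else (x \<bullet> e i) / ell n)"

definition rho_inf :: "(real \<Rightarrow> 'a::real_normed_vector) \<Rightarrow> (real \<Rightarrow> 'a) \<Rightarrow> real" where
  "rho_inf f g = (SUP t\<in>{0..1}. norm (f t - g t))"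

text \<open>The space C_d^0 (functions are only relevant on [0,1]).\<close>
definition C0 :: "(real \<Rightarrow> 'a::real_normed_vector) set" where
  "C0 = {f. continuous_on {0..1} f \<and> f 0 = 0}"

definition rel_compact_seq :: "(nat \<Rightarrow> real \<Rightarrow> 'a::real_normed_vector) \<Rightarrow> bool" where
  "rel_compact_seq x \<longleftrightarrow> (\<forall>r::nat\<Rightarrow>nat. strict_mono r \<longrightarrow>
     (\<exists>(s::nat\<Rightarrow>nat) (g::real\<Rightarrow>'a). strict_mono s \<and> g \<in> C0 \<and> (\<lambda>k. rho_inf (x (r (s k))) g) \<longlonglongrightarrow> 0))"

definition limit_points :: "(nat \<Rightarrow> real \<Rightarrow> 'a::real_normed_vector) \<Rightarrow> (real \<Rightarrow> 'a) set" where
  "limit_points x = {g \<in> (C0::(real\<Rightarrow>'a) set). \<exists>r::nat\<Rightarrow>nat. strict_mono r \<and> (\<lambda>k. rho_inf (x (r k)) g) \<longlonglongrightarrow> 0}"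

definition abs_cont_on :: "real set \<Rightarrow> (real \<Rightarrow> real) \<Rightarrow> bool" where
  "abs_cont_on S f \<longleftrightarrow> (\<forall>\<epsilon>>0. \<exists>\<delta>>0. \<forall>n (a::nat\<Rightarrow>real) b.
     (\<forall>k<n. a k \<le> b k \<and> {a k..b k} \<subseteq> S) \<and>
     (\<forall>k<n. \<forall>k'<n. k \<noteq> k' \<longrightarrow> b k \<le> a k' \<or> b k' \<le> a k) \<and>
     (\<Sum>k<n. b k - a k) < \<delta> \<longrightarrow> (\<Sum>k<n. \<bar>f (b k) - f (a k)\<bar>) < \<epsilon>)"

text \<open>U_{d-1}, realised inside real^'d as the functions whose i0-coordinate vanishes
  (i.e. R^{d-1} = the coordinates other than i0).\<close>
definition U :: "'d::finite \<Rightarrow> (real \<Rightarrow> real^'d) set" where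
  "U i0 = {f. f 0 = 0 \<and> (\<forall>t. f t $ i0 = 0) \<and> (\<forall>i. abs_cont_on {0..1} (\<lambda>t. f t $ i)) \<and>
     (\<integral>\<^sup>+ s\<in>{0..1}. ennreal ((norm (vector_derivative f (at s)))\<^sup>2) \<partial>lebesgue) \<le> 1}"

definition psd :: "real^'n^'n \<Rightarrow> bool" where
  "psd A \<longleftrightarrow> transpose A = A \<and> (\<forall>x. 0 \<le> x \<bullet> (A *v x))"

definition matrix_sqrt :: "real^'n^'n \<Rightarrow> real^'n^'n" where
  "matrix_sqrt A = (THE B. psd B \<and> B ** B = A)"

text \<open>Sigma_{mu-perp}, written in the coordinates other than i0 (the i0 row/column is zero).\<close>
definition Sigma_perp :: "('d::finite \<Rightarrow> real^'d) \<Rightarrow> 'd \<Rightarrow> real^'d^'d \<Rightarrow> real^'d^'d" where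
  "Sigma_perp e i0 \<Sigma> = (\<chi> i j. if i = i0 \<or> j = i0 then 0 else e i \<bullet> (\<Sigma> *v e j))"

text \<open>W_{d,mu,Sigma} in coordinates w.r.t. e.\<close>
definition W :: "('d::finite \<Rightarrow> real^'d) \<Rightarrow> 'd \<Rightarrow> real^'d \<Rightarrow> real^'d^'d \<Rightarrow> (real \<Rightarrow> real^'d) set" where
  "W e i0 \<mu> \<Sigma> = {(\<lambda>t. (\<chi> i. if i = i0 then norm \<mu> * t else 0) + matrix_sqrt (Sigma_perp e i0 \<Sigma>) *v f t)
                   | f. f \<in> U i0}"

definition Ypoly :: "(nat \<Rightarrow> 'a \<Rightarrow> real^'d) \<Rightarrow> nat \<Rightarrow> 'a \<Rightarrow> real \<Rightarrow> real^'d" where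
  "Ypoly Z n \<omega> t = (\<Sum>i\<in>{1..nat \<lfloor>real n * t\<rfloor>}. Z i \<omega>)
      + (real n * t - of_int \<lfloor>real n * t\<rfloor>) *\<^sub>R Z (nat \<lfloor>real n * t\<rfloor> + 1) \<omega>"

end

theory Submission
  imports Defs "HOL-Complex_Analysis.Great_Picard"
begin

text \<open>
  Write \<open>A\<close> for the covariance matrix of the projection of \<open>Z - \<mu>\<close> onto the complement of \<open>\<mu>\<close>. The image of the
  energy ball under \<open>A\<^sup>1\<^sup>/\<^sup>2\<close> is the set of all paths \<open>g\<close> such that every linear functional
  \<open>L g = \<Sum>k<m. c k \<bullet> (g ((k+1)/m) - g (k/m))\<close> is at most \<open>s(c) = sqrt ((\<Sum>k<m. c k \<bullet> A c k) / m)\<close>, the standard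
  deviation of \<open>L\<close> of a Brownian motion with covariance \<open>A\<close>. So no Brownian motion is needed: it suffices to know,
  for each of countably many functionals, that the limsup of \<open>L\<close> along the normalised projected walk is \<open>s(c)\<close>, together
  with an almost sure modulus of continuity.

  The upper bound and the modulus come from truncation and an exponential maximal inequality along
  geometric subsequences, the lower bound from the central limit theorem on blocks and the second
  Borel-Cantelli lemma. A limit point \<open>g\<close> with \<open>L g = s(c)\<close> is the unique maximiser of \<open>L\<close> on the limit set, hence
  its increments are known; suitable \<open>c\<close> (oscillating on a fine grid so as to exhaust the energy)
  make these maximisers dense, and the set of limit points is closed.

  Along \<open>\<mu>\<close> the law of the iterated logarithm for \<open>Z - \<mu>\<close> divided by \<open>n\<close> leaves only the drift.
\<close>

section \<open>Absolutely continuous functions\<close>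

text \<open>A path of energy below 1 (energy taken of its preimage under the root) maximises no
  functional with \<open>s(c) > 0\<close>, and the walk is only known to follow maximisers. The way
  out is that uniform distance does not see energy on a small scale: a zigzag of mesh
  \<open>1/(2m)\<close> leaves the coarse increments alone and can carry any amount of energy, so
  every path of the limit set is close to one that uses up the whole energy.

  The second Borel-Cantelli lemma needs independent events along a sequence of scales, although the
  walks at different scales share their initial piece. Hence the functionals with
  \<open>c 0 = 0\<close>, which ignore the first cell: at the scales \<open>m^(j+1)\<close> they
  read disjoint ranges of indices. The price is the increment over one short cell, paid for by the
  modulus of continuity.

  The energy in \<open>U\<close> integrates a pointwise derivative, whereas functionals see finitely
  many increments. Passing between the two requires that an absolutely continuous function is
  differentiable almost everywhere and is the integral of its derivative; the real analysis up front
  supplies this for each coordinate.\<close>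

definition ac_modulus :: "real set \<Rightarrow> (real \<Rightarrow> real) \<Rightarrow> real \<Rightarrow> real \<Rightarrow> bool" where
  "ac_modulus S f e d \<longleftrightarrow> (\<forall>n (a::nat\<Rightarrow>real) b.
     (\<forall>k<n. a k \<le> b k \<and> {a k..b k} \<subseteq> S) \<and>
     (\<forall>k<n. \<forall>k'<n. k \<noteq> k' \<longrightarrow> b k \<le> a k' \<or> b k' \<le> a k) \<and>
     (\<Sum>k<n. b k - a k) < d \<longrightarrow> (\<Sum>k<n. \<bar>f (b k) - f (a k)\<bar>) < e)"

lemma abs_cont_on_ac_modulus: "abs_cont_on S f \<longleftrightarrow> (\<forall>e>0. \<exists>d>0. ac_modulus S f e d)"
  unfolding abs_cont_on_def ac_modulus_def ..

text \<open>Any finite index set can be enumerated, so the families of intervals met later (boxes of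
  a covering, pairs of an interval and a cell inside it) need no numbering.\<close>

lemma ac_modulusD:
  fixes f :: "real \<Rightarrow> real" and I :: "'i set"
  assumes d: "ac_modulus S f e d" and fin: "finite I" and A: "\<And>i. i \<in> I \<Longrightarrow> a i \<le> b i \<and> {a i..b i} \<subseteq> S"
      and N: "\<And>i j. i \<in> I \<Longrightarrow> j \<in> I \<Longrightarrow> i \<noteq> j \<Longrightarrow> b i \<le> a j \<or> b j \<le> a i"
      and L: "(\<Sum>i\<in>I. b i - a i) < d"
  shows "(\<Sum>i\<in>I. \<bar>f (b i) - f (a i)\<bar>) < e"
proof -
    obtain h n where h: "bij_betw h {..<n::nat} I"
      using fin by (metis bij_betw_inv ex_bij_betw_finite_nat atLeast0LessThan)
    have hI: "h k \<in> I" if "k < n" for k using h that by (auto simp: bij_betw_def)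
    have hinj: "h k \<noteq> h l" if "k < n" "l < n" "k \<noteq> l" for k l
      using h that by (auto simp: bij_betw_def inj_on_def)
    have "(\<Sum>k<n. \<bar>f (b (h k)) - f (a (h k))\<bar>) < e"
    proof (rule d[unfolded ac_modulus_def, rule_format, of n "a \<circ> h" "b \<circ> h", unfolded o_def], intro conjI allI impI)
      show "(\<Sum>k<n. b (h k) - a (h k)) < d"
        using L sum.reindex_bij_betw[OF h, of "\<lambda>i. b i - a i"] by simp
    qed (use A N hI hinj in auto)
    then show ?thesis
      using sum.reindex_bij_betw[OF h, of "\<lambda>i. \<bar>f (b i) - f (a i)\<bar>"] by simp
qed

lemma abs_cont_on_imp_continuous_on:
  fixes f :: "real \<Rightarrow> real"
  assumes "abs_cont_on S f" and S: "\<And>x y. x \<in> S \<Longrightarrow> y \<in> S \<Longrightarrow> {x..y} \<subseteq> S"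
  shows "continuous_on S f"
  unfolding continuous_on_iff dist_real_def
proof (intro ballI allI impI)
  fix x e :: real assume x: "x \<in> S" and e: "e > 0"
  obtain d where d: "d > 0" "ac_modulus S f e d"
    using assms e unfolding abs_cont_on_ac_modulus by blast
  have *: "\<bar>f y - f x\<bar> < e" if "x \<le> y" "x \<in> S" "y \<in> S" "\<bar>y - x\<bar> < d" for x y
    using ac_modulusD[OF d(2), of "{()}" "\<lambda>_. x" "\<lambda>_. y"] that S by auto
  show "\<exists>d>0. \<forall>y\<in>S. \<bar>y - x\<bar> < d \<longrightarrow> \<bar>f y - f x\<bar> < e"
    using * x d(1) by (metis abs_minus_commute linear)
qed

text \<open>Extending by constants makes the function global, so that it can be treated through
  measures and densities on the whole line. Clamping does not lengthen intervals and keeps them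
  non-overlapping.\<close>

lemma abs_cont_on_clamp:
  fixes f :: "real \<Rightarrow> real"
  assumes "abs_cont_on {0..1} f"
  shows "abs_cont_on UNIV (\<lambda>t. f (max 0 (min 1 t)))"
  unfolding abs_cont_on_ac_modulus
proof (intro allI impI)
  fix e :: real assume "e > 0"
  with assms obtain d where d: "d > 0" "ac_modulus {0..1} f e d"
    unfolding abs_cont_on_ac_modulus by blast
  define c where "c t = max 0 (min 1 (t::real))" for t
  have cm: "c x \<le> c y" if "x \<le> y" for x y using that by (auto simp: c_def)
  have cl: "c y - c x \<le> y - x" if "x \<le> y" for x y using that by (auto simp: c_def)
  have "ac_modulus UNIV (\<lambda>t. f (c t)) e d"
    unfolding ac_modulus_def
  proof (intro allI impI, elim conjE)
    fix n and a b :: "nat \<Rightarrow> real"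
    assume H: "\<forall>k<n. a k \<le> b k \<and> {a k..b k} \<subseteq> UNIV"
     "\<forall>k<n. \<forall>k'<n. k \<noteq> k' \<longrightarrow> b k \<le> a k' \<or> b k' \<le> a k" "(\<Sum>k<n. b k - a k) < d"
    show "(\<Sum>k<n. \<bar>f (c (b k)) - f (c (a k))\<bar>) < e"
    proof (rule ac_modulusD[OF d(2)])
      have "(\<Sum>k<n. c (b k) - c (a k)) \<le> (\<Sum>k<n. b k - a k)" by (rule sum_mono) (use cl H in auto)
      then show "(\<Sum>k<n. c (b k) - c (a k)) < d" using H by simp
      show "c (a k) \<le> c (b k) \<and> {c (a k)..c (b k)} \<subseteq> {0..1}" if "k \<in> {..<n}" for k
        using H(1) cm that by (auto simp: c_def)
      show "c (b k) \<le> c (a k') \<or> c (b k') \<le> c (a k)" if "k \<in> {..<n}" "k' \<in> {..<n}" "k \<noteq> k'" for k k'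
        using H(2) cm that by (meson lessThan_iff)
    qed simp
  qed
  then show "\<exists>d>0. ac_modulus UNIV (\<lambda>t. f (max 0 (min 1 t))) e d"
    using d(1) unfolding c_def by blast
qed

lemma abs_cont_on_diff:
  assumes "abs_cont_on S f" "abs_cont_on S g"
  shows "abs_cont_on S (\<lambda>t. f t - g t)"
  unfolding abs_cont_on_ac_modulus
proof (intro allI impI)
  fix e :: real assume "e > 0"
  then have e2: "e/2 > 0" by simp
  obtain d1 where d1: "d1 > 0" "ac_modulus S f (e/2) d1"
    using assms(1) e2 unfolding abs_cont_on_ac_modulus by blast
  obtain d2 where d2: "d2 > 0" "ac_modulus S g (e/2) d2"
    using assms(2) e2 unfolding abs_cont_on_ac_modulus by blast
  have "ac_modulus S (\<lambda>t. f t - g t) e (min d1 d2)"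
    unfolding ac_modulus_def
  proof (intro allI impI, elim conjE)
    fix n and a b :: "nat \<Rightarrow> real"
    assume H: "\<forall>k<n. a k \<le> b k \<and> {a k..b k} \<subseteq> S"
     "\<forall>k<n. \<forall>k'<n. k \<noteq> k' \<longrightarrow> b k \<le> a k' \<or> b k' \<le> a k" "(\<Sum>k<n. b k - a k) < min d1 d2"
    have "(\<Sum>k<n. \<bar>f (b k) - g (b k) - (f (a k) - g (a k))\<bar>)
       \<le> (\<Sum>k<n. \<bar>f (b k) - f (a k)\<bar> + \<bar>g (b k) - g (a k)\<bar>)"
      by (rule sum_mono) auto
    also have "\<dots> = (\<Sum>k<n. \<bar>f (b k) - f (a k)\<bar>) + (\<Sum>k<n. \<bar>g (b k) - g (a k)\<bar>)"
      by (rule sum.distrib)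
    also have "\<dots> < e/2 + e/2"
      using ac_modulusD[OF d1(2), of "{..<n}" a b] ac_modulusD[OF d2(2), of "{..<n}" a b] H
      by (intro add_strict_mono) auto
    finally show "(\<Sum>k<n. \<bar>f (b k) - g (b k) - (f (a k) - g (a k))\<bar>) < e" by simp
  qed
  moreover have "min d1 d2 > 0" using d1(1) d2(1) by simp
  ultimately show "\<exists>d>0. ac_modulus S (\<lambda>t. f t - g t) e d" by blast
qed

section \<open>Total variation and the decomposition into monotone functions\<close>

lemma sum_lessThan_add:
  fixes g :: "nat \<Rightarrow> 'a::comm_monoid_add"
  shows "(\<Sum>k<n+m. g k) = (\<Sum>k<n. g k) + (\<Sum>k<m. g (n + k))"
  by (induction m) (simp_all add: ac_simps)

definition parts :: "real \<Rightarrow> real \<Rightarrow> (nat \<times> (nat \<Rightarrow> real)) set" where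
  "parts a b = {(n, p). p 0 = a \<and> p n = b \<and> (\<forall>k<n. p k \<le> p (Suc k))}"

definition tvar :: "(real \<Rightarrow> real) \<Rightarrow> real \<Rightarrow> real \<Rightarrow> ennreal" where
  "tvar f a b = (SUP (n, p)\<in>parts a b. ennreal (\<Sum>k<n. \<bar>f (p (Suc k)) - f (p k)\<bar>))"

lemma parts_ordered:
  assumes "(n, p) \<in> parts a b" "i \<le> j" "j \<le> n"
  shows "p i \<le> p j" "a \<le> p i" "p j \<le> b"
proof -
  have *: "p i \<le> p j" if "i \<le> j" "j \<le> n" for i j
    using that(1,2) by (induction rule: dec_induct)
      (use assms(1) in \<open>auto simp: parts_def Suc_le_eq intro: order_trans\<close>)
  show "p i \<le> p j" "a \<le> p i" "p j \<le> b"
    using *[of i j] *[of 0 i] *[of j n] assms by (auto simp: parts_def)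
qed

lemma tvar_upper: "(n, p) \<in> parts a b \<Longrightarrow> ennreal (\<Sum>k<n. \<bar>f (p (Suc k)) - f (p k)\<bar>) \<le> tvar f a b"
  unfolding tvar_def by (rule SUP_upper2[of "(n,p)"]) auto

lemma abs_diff_le_tvar:
  assumes "a \<le> b" shows "ennreal \<bar>f b - f a\<bar> \<le> tvar f a b"
proof -
  have "(1, \<lambda>k. if k = 0 then a else b) \<in> parts a b" using assms by (auto simp: parts_def)
  from tvar_upper[OF this, of f] show ?thesis by simp
qed

text \<open>One inequality cuts a partition of the whole interval at \<open>b\<close>, which can
  only increase its sum; the other glues a partition of each part. With values in
  \<open>ennreal\<close> no finiteness has to be known beforehand.\<close>

lemma tvar_add:
  assumes "a \<le> b" "b \<le> c"
  shows "tvar f a c = tvar f a b + tvar f b c"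
proof (rule antisym)
  show "tvar f a c \<le> tvar f a b + tvar f b c"
    unfolding tvar_def[of f a c]
  proof (rule SUP_least, clarify)
    fix n p assume p: "(n, p) \<in> parts a c"
    let ?q = "\<lambda>k. min (p k) b" and ?r = "\<lambda>k. max (p k) b"
    have q: "(n, ?q) \<in> parts a b" and r: "(n, ?r) \<in> parts b c"
      using p assms by (auto simp: parts_def intro!: min.mono max.mono)
    have "(\<Sum>k<n. \<bar>f (p (Suc k)) - f (p k)\<bar>)
      \<le> (\<Sum>k<n. \<bar>f (?q (Suc k)) - f (?q k)\<bar> + \<bar>f (?r (Suc k)) - f (?r k)\<bar>)"
    proof (rule sum_mono)
      fix k assume "k \<in> {..<n}"
      then have k: "p k \<le> p (Suc k)" using p by (auto simp: parts_def)
      consider "p (Suc k) \<le> b" | "b \<le> p k" | "p k \<le> b" "b \<le> p (Suc k)" by linarith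
      then show "\<bar>f (p (Suc k)) - f (p k)\<bar> \<le> \<bar>f (?q (Suc k)) - f (?q k)\<bar> + \<bar>f (?r (Suc k)) - f (?r k)\<bar>"
      proof cases
        case 3
        then have "?q (Suc k) = b" "?q k = p k" "?r (Suc k) = p (Suc k)" "?r k = b" by auto
        then show ?thesis by (simp only:)
      qed (use k in \<open>simp_all add: min_absorb1 min_absorb2 max_absorb1 max_absorb2\<close>)
    qed
    also have "\<dots> = (\<Sum>k<n. \<bar>f (?q (Suc k)) - f (?q k)\<bar>) + (\<Sum>k<n. \<bar>f (?r (Suc k)) - f (?r k)\<bar>)"
      by (rule sum.distrib)
    finally have "ennreal (\<Sum>k<n. \<bar>f (p (Suc k)) - f (p k)\<bar>)
       \<le> ennreal (\<Sum>k<n. \<bar>f (?q (Suc k)) - f (?q k)\<bar>) + ennreal (\<Sum>k<n. \<bar>f (?r (Suc k)) - f (?r k)\<bar>)"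
      by (subst ennreal_plus[symmetric]) (auto intro!: ennreal_leI sum_nonneg simp del: ennreal_plus)
    also have "\<dots> \<le> tvar f a b + tvar f b c"
      by (intro add_mono tvar_upper q r)
    finally show "ennreal (\<Sum>k<n. \<bar>f (p (Suc k)) - f (p k)\<bar>) \<le> tvar f a b + tvar f b c" .
  qed
next
  have ne: "parts x y \<noteq> {}" if "x \<le> y" for x y
    using that by (auto simp: parts_def intro!: exI[of _ "1::nat"] exI[of _ "\<lambda>k. if k = 0 then x else y"])
  let ?s = "\<lambda>z. case z of (n, p) \<Rightarrow> ennreal (\<Sum>k<n. \<bar>f (p (Suc k)) - f (p k)\<bar>)"
  have pq: "?s x + ?s y \<le> tvar f a c" if "x \<in> parts a b" "y \<in> parts b c" for x y
  proof -
    obtain n p where x: "x = (n, p)" by force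
    obtain m q where y: "y = (m, q)" by force
    have xp: "(n, p) \<in> parts a b" and yq: "(m, q) \<in> parts b c" using that x y by auto
    define r where "r k = (if k \<le> n then p k else q (k - n))" for k
    have qn: "q 0 = p n" using xp yq by (auto simp: parts_def)
    have r2: "r (n + k) = q k" for k using qn by (cases k) (auto simp: r_def)
    have "r k \<le> r (Suc k)" if kl: "k < n + m" for k
    proof (cases "k < n")
      case True then show ?thesis using xp by (auto simp: parts_def r_def)
    next
      case False
      then obtain j where j: "k = n + j" using le_Suc_ex[of n k] by auto
      then have "j < m" using kl by simp
      then have "q j \<le> q (Suc j)" using yq by (simp add: parts_def)
      then show ?thesis unfolding j using r2[of j] r2[of "Suc j"] by simp
    qed
    moreover have "r (n + m) = c" using r2[of m] yq by (auto simp: parts_def)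
    ultimately have r: "(n + m, r) \<in> parts a c" using xp by (auto simp: parts_def r_def)
    have "(\<Sum>k<n+m. \<bar>f (r (Suc k)) - f (r k)\<bar>)
       = (\<Sum>k<n. \<bar>f (r (Suc k)) - f (r k)\<bar>) + (\<Sum>k<m. \<bar>f (r (Suc (n + k))) - f (r (n + k))\<bar>)"
      by (rule sum_lessThan_add)
    also have "(\<Sum>k<n. \<bar>f (r (Suc k)) - f (r k)\<bar>) = (\<Sum>k<n. \<bar>f (p (Suc k)) - f (p k)\<bar>)"
      by (rule sum.cong) (auto simp: r_def)
    also have "(\<Sum>k<m. \<bar>f (r (Suc (n + k))) - f (r (n + k))\<bar>) = (\<Sum>k<m. \<bar>f (q (Suc k)) - f (q k)\<bar>)"
      by (rule sum.cong) (simp_all only: r2 add_Suc_right[symmetric])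
    finally show ?thesis using tvar_upper[OF r, of f] by (simp add: x y ennreal_plus[symmetric] sum_nonneg del: ennreal_plus)
  qed
  have v: "tvar f u w = (SUP x\<in>parts u w. ?s x)" for u w by (simp add: tvar_def)
  have A: "tvar f a b + ?s y \<le> tvar f a c" if "y \<in> parts b c" for y
  proof -
    have "tvar f a b + ?s y = (SUP x\<in>parts a b. ?s x + ?s y)"
      unfolding v[of a b] by (rule ennreal_SUP_add_left[OF ne[OF assms(1)], symmetric])
    also have "\<dots> \<le> tvar f a c" by (rule SUP_least) (rule pq[OF _ that])
    finally show ?thesis .
  qed
  have B: "tvar f a b + tvar f b c = (SUP y\<in>parts b c. tvar f a b + ?s y)"
    unfolding v[of b c] by (rule ennreal_SUP_add_right[OF ne[OF assms(2)]])
  show "tvar f a b + tvar f b c \<le> tvar f a c" unfolding B by (rule SUP_least) (rule A)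
qed

text \<open>The modulus \<open>d\<close> for the value 1 bounds the variation by 1 on every interval
  shorter than \<open>d\<close>; by additivity finitely many steps of length \<open>d/2\<close>
  reach beyond \<open>t\<close>.\<close>

lemma tvar_finite:
  assumes ac: "abs_cont_on UNIV f" and "0 \<le> t"
  shows "tvar f 0 t < \<infinity>"
proof -
  obtain d where d: "d > 0" "ac_modulus UNIV f 1 d"
    using ac zero_less_one unfolding abs_cont_on_ac_modulus by blast
  have le1: "tvar f a b \<le> 1" if "b - a < d" for a b
    unfolding tvar_def
  proof (rule SUP_least, clarify)
    fix n p assume p: "(n, p) \<in> parts a b"
    have "(\<Sum>k<n. \<bar>f (p (Suc k)) - f (p k)\<bar>) < 1"
    proof (rule ac_modulusD[OF d(2), of "{..<n}" p "\<lambda>k. p (Suc k)"])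
      show "p (Suc i) \<le> p j \<or> p (Suc j) \<le> p i" if "i \<in> {..<n}" "j \<in> {..<n}" "i \<noteq> j" for i j
        using that parts_ordered(1)[OF p, of "Suc i" j] parts_ordered(1)[OF p, of "Suc j" i] by force
      show "(\<Sum>i<n. p (Suc i) - p i) < d"
        using p that by (simp add: sum_lessThan_telescope parts_def)
    qed (use parts_ordered(1)[OF p] in auto)
    then show "ennreal (\<Sum>k<n. \<bar>f (p (Suc k)) - f (p k)\<bar>) \<le> 1" by simp
  qed
  have fin: "tvar f 0 (real k * (d/2)) < \<infinity>" for k
  proof (induction k)
    case 0 then show ?case using le1[of 0 0] d(1) by (simp add: le_less_trans)
  next
    case (Suc k)
    have "tvar f 0 (real (Suc k) * (d/2)) = tvar f 0 (real k * (d/2)) + tvar f (real k * (d/2)) (real (Suc k) * (d/2))"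
      by (rule tvar_add) (use d(1) in \<open>auto simp: field_simps\<close>)
    moreover have "tvar f (real k * (d/2)) (real (Suc k) * (d/2)) \<le> 1"
      by (rule le1) (use d(1) in \<open>auto simp: field_simps\<close>)
    ultimately show ?case using Suc by (simp add: le_less_trans)
  qed
  obtain k where k: "t \<le> real k * (d/2)" using d(1) by (meson half_gt_zero reals_Archimedean3 less_imp_le)
  have "tvar f 0 t \<le> tvar f 0 (real k * (d/2))" using tvar_add[OF assms(2) k, of f] by simp
  then show ?thesis using fin[of k] by (rule le_less_trans)
qed

text \<open>Jordan decomposition with the variation function as \<open>F\<close>. Absolute
  continuity is inherited from \<open>f\<close>: each interval is replaced by a partition that
  nearly exhausts its variation, and all the cells together are no longer than the intervals
  were.\<close>

lemma abs_cont_mono_decomposition: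
  assumes ac: "abs_cont_on UNIV f" and const: "\<And>t. t \<le> 0 \<Longrightarrow> f t = f 0"
  obtains F where "mono F" "mono (\<lambda>t. F t - f t)" "abs_cont_on UNIV F"
proof
  \<comment> \<open>Variation is counted from 0; to the left of 0 the function is constant, so
    moving a point up to 0 loses nothing.\<close>
  define m where "m t = max 0 (t::real)" for t
  define F where "F t = enn2real (tvar f 0 (m t))" for t
  have m: "0 \<le> m t" "s \<le> t \<Longrightarrow> m s \<le> m t" "s \<le> t \<Longrightarrow> m t - m s \<le> t - s" for s t by (auto simp: m_def)
  have fm: "f (m t) = f t" for t using const[of t] by (auto simp: m_def max_def)
  have Fd: "ennreal (F b - F a) = tvar f (m a) (m b)" "F a \<le> F b" if "a \<le> b" for a b
  proof -
    have s: "tvar f 0 (m b) = tvar f 0 (m a) + tvar f (m a) (m b)" by (rule tvar_add) (use m that in auto)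
    have fin: "tvar f 0 (m a) \<noteq> \<infinity>" "tvar f 0 (m b) \<noteq> \<infinity>" using tvar_finite[OF ac] m(1) by (metis less_irrefl)+
    then have fin': "tvar f (m a) (m b) \<noteq> \<infinity>" using s by auto
    have "F b = F a + enn2real (tvar f (m a) (m b))"
      unfolding F_def s by (rule enn2real_plus) (use fin fin' in \<open>auto simp: top.not_eq_extremum\<close>)
    then show "ennreal (F b - F a) = tvar f (m a) (m b)" "F a \<le> F b" using fin' by (auto simp: top.not_eq_extremum)
  qed
  show "mono F" using Fd(2) by (auto intro: monoI)
  show "mono (\<lambda>t. F t - f t)"
  proof
    fix a b :: real assume ab: "a \<le> b"
    have "ennreal \<bar>f b - f a\<bar> \<le> ennreal (F b - F a)"
      using abs_diff_le_tvar[of "m a" "m b" f] ab m fm by (simp add: Fd)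
    then have "\<bar>f b - f a\<bar> \<le> F b - F a" using Fd(2)[OF ab] by (simp add: ennreal_le_iff)
    then show "F a - f a \<le> F b - f b" by linarith
  qed
  show "abs_cont_on UNIV F"
    unfolding abs_cont_on_ac_modulus
  proof (intro allI impI)
    fix e :: real assume e: "e > 0"
    obtain d where d: "d > 0" "ac_modulus UNIV f (e/2) d"
    using ac half_gt_zero[OF e] unfolding abs_cont_on_ac_modulus by blast
    have "(\<Sum>k<n. \<bar>F (b k) - F (a k)\<bar>) < e" if H: "(\<forall>k<n. a k \<le> b k \<and> {a k..b k} \<subseteq> UNIV) \<and>
     (\<forall>k<n. \<forall>k'<n. k \<noteq> k' \<longrightarrow> b k \<le> a k' \<or> b k' \<le> a k) \<and> (\<Sum>k<n. b k - a k) < d" for n and a b :: "nat \<Rightarrow> real"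
    proof -
      \<comment> \<open>A loss of \<open>\<eta>\<close> on each of the \<open>n\<close> intervals
        adds up to less than \<open>e/2\<close>; the modulus \<open>d\<close> belongs to the other
        half.\<close>
      define \<eta> where "\<eta> = e / (2 * (real n + 1))"
      have \<eta>: "\<eta> > 0" "real n * \<eta> < e/2" using e by (auto simp: \<eta>_def field_simps)
      have "\<exists>z\<in>parts (m (a k)) (m (b k)). F (b k) - F (a k) - \<eta> \<le> (\<Sum>j<fst z. \<bar>f (snd z (Suc j)) - f (snd z j)\<bar>)" if "k < n" for k
      proof (rule ccontr)
        assume neg: "\<not> ?thesis"
        have "tvar f (m (a k)) (m (b k)) \<le> ennreal (F (b k) - F (a k) - \<eta>)"
          unfolding tvar_def by (rule SUP_least) (use neg in \<open>force intro!: ennreal_leI\<close>)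
        then have "ennreal (F (b k) - F (a k)) \<le> ennreal (F (b k) - F (a k) - \<eta>)" using Fd H that by auto
        moreover have "m (a k) \<le> m (b k)" using m H that by auto
        then have "(1, \<lambda>j. if j = 0 then m (a k) else m (b k)) \<in> parts (m (a k)) (m (b k))" by (auto simp: parts_def)
        then have "0 \<le> F (b k) - F (a k) - \<eta>" using neg by fastforce
        ultimately show False using \<eta>(1) by (auto simp: ennreal_le_iff)
      qed
      then obtain z where z: "\<And>k. k < n \<Longrightarrow> z k \<in> parts (m (a k)) (m (b k))"
        "\<And>k. k < n \<Longrightarrow> F (b k) - F (a k) - \<eta> \<le> (\<Sum>j<fst (z k). \<bar>f (snd (z k) (Suc j)) - f (snd (z k) j)\<bar>)"
        by metis
      define N where "N k = fst (z k)" for k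
      define p where "p k = snd (z k)" for k
      have pp: "(N k, p k) \<in> parts (m (a k)) (m (b k))" if "k < n" for k using z(1)[OF that] by (simp add: N_def p_def)
      define I where "I = (SIGMA k:{..<n}. {..<N k})"
      have "(\<Sum>i\<in>I. \<bar>f (p (fst i) (Suc (snd i))) - f (p (fst i) (snd i))\<bar>) < e/2"
      proof (rule ac_modulusD[OF d(2), of I "\<lambda>i. p (fst i) (snd i)" "\<lambda>i. p (fst i) (Suc (snd i))"])
        show "finite I" by (auto simp: I_def)
        show "p (fst i) (snd i) \<le> p (fst i) (Suc (snd i)) \<and> {p (fst i) (snd i)..p (fst i) (Suc (snd i))} \<subseteq> UNIV" if "i \<in> I" for i
          using that pp by (auto simp: I_def parts_def)
        show "p (fst i) (Suc (snd i)) \<le> p (fst j) (snd j) \<or> p (fst j) (Suc (snd j)) \<le> p (fst i) (snd i)"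
          if "i \<in> I" "j \<in> I" "i \<noteq> j" for i j
        proof (cases "fst i = fst j")
          case True
          then have "snd i < snd j \<or> snd j < snd i" using that(3) by (metis linorder_neqE prod.expand)
          then show ?thesis using that True parts_ordered(1)[OF pp, of "fst i"]
            by (auto simp: I_def Suc_le_eq)
        next
          case False
          have "fst i < n" "fst j < n" using that by (auto simp: I_def)
          then have "b (fst i) \<le> a (fst j) \<or> b (fst j) \<le> a (fst i)" using H False by blast
          then have "m (b (fst i)) \<le> m (a (fst j)) \<or> m (b (fst j)) \<le> m (a (fst i))" using m by auto
          moreover have "p (fst l) (Suc (snd l)) \<le> m (b (fst l))" "m (a (fst l)) \<le> p (fst l) (snd l)" if "l \<in> I" for l
            using that parts_ordered(2,3)[OF pp, of "fst l" "snd l" "snd l"] parts_ordered(2,3)[OF pp, of "fst l" "Suc (snd l)" "Suc (snd l)"] by (auto simp: I_def)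
          ultimately show ?thesis using that(1,2) by (meson order_trans)
        qed
        have "(\<Sum>i\<in>I. p (fst i) (Suc (snd i)) - p (fst i) (snd i)) = (\<Sum>k<n. \<Sum>j<N k. p k (Suc j) - p k j)"
          unfolding I_def by (subst sum.Sigma) (auto simp: case_prod_beta)
        also have "\<dots> \<le> (\<Sum>k<n. b k - a k)"
        proof (rule sum_mono)
          fix k assume k: "k \<in> {..<n}"
          have "(\<Sum>j<N k. p k (Suc j) - p k j) = m (b k) - m (a k)"
            using pp[of k] k by (simp add: sum_lessThan_telescope parts_def)
          then show "(\<Sum>j<N k. p k (Suc j) - p k j) \<le> b k - a k" using m(3)[of "a k" "b k"] H k by auto
        qed
        finally show "(\<Sum>i\<in>I. p (fst i) (Suc (snd i)) - p (fst i) (snd i)) < d" using H by linarith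
      qed
      moreover have "(\<Sum>i\<in>I. \<bar>f (p (fst i) (Suc (snd i))) - f (p (fst i) (snd i))\<bar>)
          = (\<Sum>k<n. \<Sum>j<N k. \<bar>f (p k (Suc j)) - f (p k j)\<bar>)"
        unfolding I_def by (subst sum.Sigma) (auto simp: case_prod_beta)
      moreover have "(\<Sum>k<n. \<bar>F (b k) - F (a k)\<bar> - \<eta>) \<le> (\<Sum>k<n. \<Sum>j<N k. \<bar>f (p k (Suc j)) - f (p k j)\<bar>)"
        by (rule sum_mono) (use z(2) Fd(2) H in \<open>auto simp: N_def p_def\<close>)
      ultimately show ?thesis using \<eta>(2) by (simp add: sum_subtractf)
    qed
    then have "ac_modulus UNIV F e d" unfolding ac_modulus_def by blast
    then show "\<exists>d>0. ac_modulus UNIV F e d" using d(1) by blast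
  qed
qed

section \<open>Densities of absolutely continuous functions\<close>

text \<open>Radon-Nikodym for the Stieltjes measure \<open>N\<close> of \<open>F\<close>. The work
  lies in showing that Lebesgue null sets are \<open>N\<close>-null: such a set is covered by
  non-overlapping intervals inside an open set of small Lebesgue measure, and the modulus of
  absolute continuity is applied to finitely many of them at a time.\<close>

lemma mono_abs_cont_density:
  fixes F :: "real \<Rightarrow> real"
  assumes mono: "mono F" and ac: "abs_cont_on UNIV F"
  obtains h :: "real \<Rightarrow> ennreal" where "h \<in> borel_measurable borel"
    "\<And>a b. a \<le> b \<Longrightarrow> (\<integral>\<^sup>+x\<in>{a<..b}. h x \<partial>lborel) = ennreal (F b - F a)"
proof -
  have cont: "continuous_on UNIV F" by (rule abs_cont_on_imp_continuous_on[OF ac]) auto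
  have F: "F x \<le> F y" if "x \<le> y" for x y using mono that by (rule monoD)
  define N where "N = interval_measure F"
  have sN[measurable_cong, simp]: "sets N = sets borel" by (simp add: N_def)
  have Icc: "emeasure N {a..b} = ennreal (F b - F a)" if "a \<le> b" for a b
    unfolding N_def using emeasure_interval_measure_Icc[OF that F cont] .
  have rc: "continuous (at_right a) F" for a
    using cont by (meson UNIV_I continuous_on_eq_continuous_within continuous_within_subset subset_UNIV)
  have Ioc: "emeasure N {a<..b} = ennreal (F b - F a)" if "a \<le> b" for a b
    unfolding N_def using emeasure_interval_measure_Ioc[OF that F rc] .
  have null: "emeasure N (A \<inter> {-real n..real n}) = 0" if A: "A \<in> null_sets lborel" and n: "n > 0" for A n
  proof -
    have "emeasure N (A \<inter> {-real n..real n}) \<le> ennreal e" if e: "e > 0" for e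
    proof -
      obtain d where d: "d > 0" "ac_modulus UNIV F e d" using ac e unfolding abs_cont_on_ac_modulus by blast
      have Ab: "A \<in> sets borel" using A by auto
      obtain V where V: "open V" "A \<subseteq> V" "emeasure lborel (V - A) < d"
        using outer_regular_lborel[OF Ab d(1)] by blast
      have "emeasure lborel V = emeasure lborel (V - A)"
        using emeasure_Diff_null_set[OF A, of V] V(1) by simp
      with V have V3: "emeasure lborel V < d" by simp
      define S where "S = A \<inter> {-real n..real n}"
      \<comment> \<open>With this gauge a box tagged by a point of \<open>A\<close> has to lie
        inside \<open>V\<close>.\<close>
      have g: "gauge (\<lambda>x. if x \<in> V then V else UNIV)" unfolding gauge_def using V(1) by auto
      have "\<exists>D. countable D \<and> \<Union>D \<subseteq> cbox (- real n) (real n) \<and>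
        (\<forall>K\<in>D. interior K \<noteq> {} \<and> (\<exists>c d. K = cbox c d)) \<and>
        pairwise (\<lambda>A B. interior A \<inter> interior B = {}) D \<and>
        (\<forall>K\<in>D. \<exists>x \<in> S \<inter> K. K \<subseteq> (if x \<in> V then V else UNIV)) \<and> S \<subseteq> \<Union>D"
      proof (rule covering_lemma[of S "- real n" "real n", OF _ _ g], goal_cases)
        case 1 then show ?case by (auto simp: S_def)
      next
        case 2 then show ?case using n by simp
      next
        case (3 D)
        show ?case by (intro exI[of _ D] conjI ballI 3) (use 3(3) in auto)
      qed
      then obtain D where DD: "countable D \<and> \<Union>D \<subseteq> cbox (- real n) (real n) \<and>
        (\<forall>K\<in>D. interior K \<noteq> {} \<and> (\<exists>c d. K = cbox c d)) \<and>
        pairwise (\<lambda>A B. interior A \<inter> interior B = {}) D \<and>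
        (\<forall>K\<in>D. \<exists>x \<in> S \<inter> K. K \<subseteq> (if x \<in> V then V else UNIV)) \<and> S \<subseteq> \<Union>D"
        by (rule exE)
      note D' = conjunct2[OF DD] conjunct2[OF conjunct2[OF DD]] conjunct2[OF conjunct2[OF conjunct2[OF DD]]]
        conjunct2[OF conjunct2[OF conjunct2[OF conjunct2[OF DD]]]]
      note D = conjunct1[OF DD] D'(1)[THEN conjunct1] bspec[OF D'(2)[THEN conjunct1]] D'(3)[THEN conjunct1]
        bspec[OF D'(4)[THEN conjunct1]] D'(4)[THEN conjunct2]
      have KV: "K \<subseteq> V" if "K \<in> D" for K using D(5)[OF that] V(2) by (auto simp: S_def split: if_splits)
      \<comment> \<open>Nonempty interior makes each box a proper interval, recovered from its
        infimum and supremum; these are the endpoints handed to the modulus.\<close>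
      have KI: "K = {Inf K..Sup K}" "Inf K < Sup K" "interior K = {Inf K<..<Sup K}" if K: "K \<in> D" for K
      proof -
        obtain c d where cd: "K = {c..d}" using D(3)[OF K] by auto
        moreover have "c < d" using D(3)[OF K] unfolding cd by (auto simp: not_le)
        ultimately show "K = {Inf K..Sup K}" "Inf K < Sup K" "interior K = {Inf K<..<Sup K}" by auto
      qed
      have Ks: "K \<in> sets N" if "K \<in> D" for K using D(3)[OF that] by auto
      have fin: "emeasure N (\<Union>T) \<le> ennreal e" if T: "finite T" "T \<subseteq> D" for T
      proof -
        have "(\<Sum>K\<in>T. Sup K - Inf K) < d"
        proof -
          have "ennreal (\<Sum>K\<in>T. Sup K - Inf K) = (\<Sum>K\<in>T. emeasure lborel {Inf K<..<Sup K})"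
            using KI(2) T(2) by (subst sum_ennreal[symmetric]) (auto intro!: sum.cong less_imp_le emeasure_lborel_Ioo[symmetric])
          also have "\<dots> = emeasure lborel (\<Union>K\<in>T. {Inf K<..<Sup K})"
          proof (rule sum_emeasure)
            show "disjoint_family_on (\<lambda>K. {Inf K<..<Sup K}) T"
              unfolding disjoint_family_on_def
            proof (intro ballI impI)
              fix K L assume "K \<in> T" "L \<in> T" "K \<noteq> L"
              then show "{Inf K<..<Sup K} \<inter> {Inf L<..<Sup L} = {}"
                using pairwiseD[OF D(4), of K L] KI(3)[of K] KI(3)[of L] T(2) by auto
            qed
          qed (use T in auto)
          also have "\<dots> \<le> emeasure lborel V"
          proof (rule emeasure_mono)
            have "{Inf K<..<Sup K} \<subseteq> V" if "K \<in> T" for K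
              using KV[of K] KI(3)[of K] interior_subset[of K] that T(2) by auto
            then show "(\<Union>K\<in>T. {Inf K<..<Sup K}) \<subseteq> V" by blast
          qed (use V in auto)
          also have "\<dots> < ennreal d" by (rule V3)
          finally have lt: "ennreal (\<Sum>K\<in>T. Sup K - Inf K) < ennreal d" .
          have "0 \<le> (\<Sum>K\<in>T. Sup K - Inf K)"
            by (rule sum_nonneg) (use KI(2) T(2) in \<open>auto intro: less_imp_le\<close>)
          with lt show ?thesis by (simp add: ennreal_less_iff)
        qed
        then have Fe: "(\<Sum>K\<in>T. \<bar>F (Sup K) - F (Inf K)\<bar>) < e"
        proof (rule ac_modulusD[OF d(2) T(1), rotated 2])
          show "Inf K \<le> Sup K \<and> {Inf K..Sup K} \<subseteq> UNIV" if "K \<in> T" for K using KI(2) that T(2) by (auto intro: less_imp_le)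
          show "Sup K \<le> Inf L \<or> Sup L \<le> Inf K" if "K \<in> T" "L \<in> T" "K \<noteq> L" for K L
          proof (rule ccontr)
            assume neg: "\<not> ?thesis"
            have KL: "K \<in> D" "L \<in> D" using that T(2) by auto
            have "{Inf K<..<Sup K} \<inter> {Inf L<..<Sup L} = {}"
              using pairwiseD[OF D(4) KL that(3)] KI(3)[OF KL(1)] KI(3)[OF KL(2)] by simp
            moreover have "(max (Inf K) (Inf L) + min (Sup K) (Sup L)) / 2 \<in> {Inf K<..<Sup K} \<inter> {Inf L<..<Sup L}"
              using neg KI(2)[OF KL(1)] KI(2)[OF KL(2)] by (auto simp: max_def min_def)
            ultimately show False by blast
          qed
        qed
        have "emeasure N (\<Union>T) \<le> (\<Sum>K\<in>T. emeasure N K)"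
        proof -
          have "K \<in> sets N" if "K \<in> T" for K using Ks T(2) that by auto
          then show ?thesis using emeasure_subadditive_finite[OF T(1), of "\<lambda>K. K" N] by auto
        qed
        also have "(\<Sum>K\<in>T. emeasure N K) = (\<Sum>K\<in>T. ennreal \<bar>F (Sup K) - F (Inf K)\<bar>)"
        proof (rule sum.cong[OF refl])
          fix K assume "K \<in> T"
          then have K: "K \<in> D" using T(2) by auto
          have "emeasure N K = emeasure N {Inf K..Sup K}" using KI(1)[OF K] by simp
          also have "\<dots> = ennreal \<bar>F (Sup K) - F (Inf K)\<bar>" using Icc F KI(2)[OF K] by (simp add: less_imp_le)
          finally show "emeasure N K = ennreal \<bar>F (Sup K) - F (Inf K)\<bar>" .
        qed
        also have "\<dots> = ennreal (\<Sum>K\<in>T. \<bar>F (Sup K) - F (Inf K)\<bar>)" by (rule sum_ennreal) simp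
        also have "\<dots> \<le> ennreal e" using Fe by (intro ennreal_leI) simp
        finally show ?thesis .
      qed
      have "emeasure N S \<le> ennreal e"
      proof (cases "D = {}")
        case True then show ?thesis using D(6) by simp
      next
        case False
        define E where "E k = \<Union>(from_nat_into D ` {..k})" for k :: nat
        have sub: "from_nat_into D ` {..k} \<subseteq> D" for k using from_nat_into[OF False] by auto
        have Es: "E k \<in> sets N" for k unfolding E_def using Ks sub[of k] by (intro sets.finite_Union) auto
        have "\<Union>D = (\<Union>k. E k)"
        proof
          show "\<Union>D \<subseteq> (\<Union>k. E k)" using from_nat_into_surj[OF D(1)] unfolding E_def by blast
          show "(\<Union>k. E k) \<subseteq> \<Union>D" using sub unfolding E_def by blast
        qed
        then have "emeasure N S \<le> emeasure N (\<Union>k. E k)" using D(6) Es by (intro emeasure_mono) auto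
        also have "\<dots> = (SUP k. emeasure N (E k))"
          by (rule SUP_emeasure_incseq[symmetric]) (use Es in \<open>auto simp: E_def incseq_def intro: order_trans\<close>)
        also have "\<dots> \<le> ennreal e" unfolding E_def by (rule SUP_least, rule fin) (use sub in auto)
        finally show ?thesis .
      qed
      then show ?thesis by (simp add: S_def)
    qed
    then have "emeasure N (A \<inter> {-real n..real n}) \<le> 0 + ennreal e" if "e > 0" for e using that by simp
    then have "emeasure N (A \<inter> {-real n..real n}) \<le> 0" by (rule ennreal_le_epsilon)
    then show ?thesis by simp
  qed
  have "absolutely_continuous lborel N"
    unfolding absolutely_continuous_def
  proof
    fix A :: "real set" assume A: "A \<in> null_sets lborel"
    have "emeasure N (\<Union>n. A \<inter> {-real (Suc n)..real (Suc n)}) = 0"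
      by (rule emeasure_UN_eq_0) (use null[OF A, of "Suc n" for n] A in auto)
    moreover have "(\<Union>n. A \<inter> {-real (Suc n)..real (Suc n)}) = A"
    proof -
      have "\<exists>n. \<bar>x\<bar> \<le> real (Suc n)" for x :: real
      proof -
        obtain n where "\<bar>x\<bar> \<le> real n" using real_arch_simple by blast
        then have "\<bar>x\<bar> \<le> real (Suc n)" by simp
        then show ?thesis ..
      qed
      then have "\<exists>n. x \<in> {-real (Suc n)..real (Suc n)}" for x :: real
        unfolding atLeastAtMost_iff abs_le_iff minus_le_iff[of "real _"] by blast
      then show ?thesis by blast
    qed
    ultimately have "emeasure N A = 0" by simp
    then show "A \<in> null_sets N" using A by (auto simp: null_sets_def)
  qed
  then obtain h where h: "h \<in> borel_measurable lborel" "density lborel h = N"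
    using sigma_finite_measure.Radon_Nikodym[OF sigma_finite_lborel, of N] by auto
  show ?thesis
  proof (rule that)
    show hm: "h \<in> borel_measurable borel" using h(1) by simp
    show "(\<integral>\<^sup>+x\<in>{a<..b}. h x \<partial>lborel) = ennreal (F b - F a)" if "a \<le> b" for a b
      using Ioc[OF that] emeasure_density[OF h(1), of "{a<..b}"] h(2) by simp
  qed
qed

text \<open>The density of \<open>f\<close> is the difference of the densities of the monotone
  functions \<open>F\<close> and \<open>F - f\<close>.\<close>

lemma abs_cont_density:
  fixes f :: "real \<Rightarrow> real"
  assumes ac: "abs_cont_on UNIV f" and const: "\<And>t. t \<le> 0 \<Longrightarrow> f t = f 0"
  obtains g :: "real \<Rightarrow> real" where "g \<in> borel_measurable borel"
    "\<And>a b. set_integrable lborel {a<..b} g"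
    "\<And>a b. a \<le> b \<Longrightarrow> (LINT x:{a<..b}|lborel. g x) = f b - f a"
proof -
  obtain F where F: "mono F" "mono (\<lambda>t. F t - f t)" "abs_cont_on UNIV F"
    using abs_cont_mono_decomposition[OF ac const] by blast
  have real_density: "\<exists>g::real\<Rightarrow>real. g \<in> borel_measurable borel \<and>
     (\<forall>a b. a \<le> b \<longrightarrow> has_bochner_integral lborel (\<lambda>x. indicator {a<..b} x *\<^sub>R g x) (G b - G a))"
    if G: "mono G" "abs_cont_on UNIV G" for G
  proof -
    obtain h :: "real \<Rightarrow> ennreal" where h[measurable]: "h \<in> borel_measurable borel"
      and hi: "\<And>a b. a \<le> b \<Longrightarrow> (\<integral>\<^sup>+x\<in>{a<..b}. h x \<partial>lborel) = ennreal (G b - G a)"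
      using mono_abs_cont_density[OF G] by blast
    have "has_bochner_integral lborel (\<lambda>x. indicator {a<..b} x *\<^sub>R enn2real (h x)) (G b - G a)" if ab: "a \<le> b" for a b
    proof (rule has_bochner_integral_nn_integral)
      have "AE x in lborel. h x * indicator {a<..b} x \<noteq> \<infinity>"
        by (rule nn_integral_PInf_AE) (use hi[OF ab] in auto)
      then have "(\<integral>\<^sup>+x. ennreal (indicator {a<..b} x *\<^sub>R enn2real (h x)) \<partial>lborel) = (\<integral>\<^sup>+x\<in>{a<..b}. h x \<partial>lborel)"
        by (intro nn_integral_cong_AE) (auto simp: indicator_def top.not_eq_extremum elim!: eventually_mono)
      then show "(\<integral>\<^sup>+x. ennreal (indicator {a<..b} x *\<^sub>R enn2real (h x)) \<partial>lborel) = ennreal (G b - G a)"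
        using hi[OF ab] by simp
    qed (use monoD[OF G(1) ab] in auto)
    then show ?thesis by (intro exI[of _ "\<lambda>x. enn2real (h x)"] conjI allI impI) simp_all
  qed
  have "abs_cont_on UNIV (\<lambda>t. F t - f t)" using F(3) ac by (rule abs_cont_on_diff)
  note r2 = real_density[OF F(2) this]
  obtain g1 where g1: "g1 \<in> borel_measurable borel \<and> (\<forall>a b. a \<le> b \<longrightarrow> has_bochner_integral lborel (\<lambda>x. indicator {a<..b} x *\<^sub>R g1 x) (F b - F a))"
    using real_density[OF F(1,3)] by (rule exE)
  obtain g2 where g2: "g2 \<in> borel_measurable borel \<and> (\<forall>a b. a \<le> b \<longrightarrow> has_bochner_integral lborel (\<lambda>x. indicator {a<..b} x *\<^sub>R g2 x) ((F b - f b) - (F a - f a)))"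
    using r2 by (rule exE)
  note hb1 = conjunct2[OF g1, rule_format] and hb2 = conjunct2[OF g2, rule_format]
  have hb: "has_bochner_integral lborel (\<lambda>x. indicator {a<..b} x *\<^sub>R (g1 x - g2 x)) (f b - f a)" if "a \<le> b" for a b
  proof -
    have e: "(F b - F a) - ((F b - f b) - (F a - f a)) = f b - f a" by simp
    show ?thesis
      using has_bochner_integral_diff[OF hb1 hb2, OF that that] unfolding e scaleR_diff_right .
  qed
  show ?thesis
  proof (rule that[of "\<lambda>x. g1 x - g2 x"])
    show "(\<lambda>x. g1 x - g2 x) \<in> borel_measurable borel"
      using conjunct1[OF g1] conjunct1[OF g2] by simp
    show "(LINT x:{a<..b}|lborel. g1 x - g2 x) = f b - f a" if "a \<le> b" for a b
      using hb[OF that] unfolding set_lebesgue_integral_def by (rule has_bochner_integral_integral_eq)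
    show "set_integrable lborel {a<..b} (\<lambda>x. g1 x - g2 x)" for a b
      using hb[of a b] unfolding set_integrable_def by (cases "a \<le> b") (auto dest: integrable.intros)
  qed
qed

section \<open>Differentiability almost everywhere\<close>

text \<open>Vitali covering argument. The measure \<open>N\<close> with density \<open>h\<close>
  vanishes on \<open>{h = 0}\<close>, so some open \<open>V\<close> around this set has small
  \<open>N\<close>-mass. A bad point lies in arbitrarily short intervals inside \<open>V\<close>
  whose \<open>N\<close>-mass exceeds \<open>c\<close> times their length; disjoint ones among
  these, enlarged five times, still cover, and their total length is at most \<open>5/c\<close>
  times the mass of \<open>V\<close>. The outer criterion for negligibility spares the measurability
  of the bad set.\<close>

lemma negligible_upper_derivate:
  fixes h :: "real \<Rightarrow> real"
  assumes h[measurable]: "h \<in> borel_measurable borel" and nn: "\<And>x. 0 \<le> h x"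
    and int: "integrable lborel h" and c: "c > 0"
  shows "negligible {x. h x = 0 \<and> (\<forall>d>0. \<exists>u v. u \<le> x \<and> x \<le> v \<and> u < v \<and> v - u < d \<and>
             c * (v - u) < (LINT y:{u..v}|lborel. h y))}" (is "negligible ?S")
  unfolding negligible_outer_le
proof (intro allI impI)
  fix e :: real assume e: "e > 0"
  define N where "N = density lborel (\<lambda>x. ennreal (h x))"
  have sN[measurable_cong, simp]: "sets N = sets borel" by (simp add: N_def)
  have em: "emeasure N A = (\<integral>\<^sup>+x. ennreal (h x) * indicator A x \<partial>lborel)" if "A \<in> sets borel" for A
    unfolding N_def using that by (subst emeasure_density) auto
  have "emeasure N UNIV = ennreal (integral\<^sup>L lborel h)"
    using em[of UNIV] nn_integral_eq_integral[OF int] nn by simp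
  then have finN: "emeasure N (space N) \<noteq> \<infinity>" by (simp add: N_def)
  then interpret N: finite_measure N by (rule finite_measureI)
  have Ne: "measure N {u..v} = (LINT y:{u..v}|lborel. h y)" for u v
  proof -
    have i: "integrable lborel (\<lambda>y. indicator {u..v} y *\<^sub>R h y)" using int by (intro integrable_mult_indicator) auto
    have "emeasure N {u..v} = (\<integral>\<^sup>+x. ennreal (indicator {u..v} x *\<^sub>R h x) \<partial>lborel)"
      by (subst em) (auto intro!: nn_integral_cong simp: indicator_def)
    also have "\<dots> = ennreal (LINT y:{u..v}|lborel. h y)"
      unfolding set_lebesgue_integral_def by (rule nn_integral_eq_integral[OF i]) (use nn in auto)
    finally show ?thesis
      unfolding measure_def set_lebesgue_integral_def using nn by (simp add: integral_nonneg_AE)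
  qed
  define Z where "Z = {x. h x = 0}"
  have Zb[measurable]: "Z \<in> sets borel" unfolding Z_def by measurable
  have "emeasure N Z = 0"
    by (subst em) (auto simp: Z_def indicator_def intro!: nn_integral_zero' AE_I2)
  moreover have "emeasure N Z = (INF V \<in> {V. Z \<subseteq> V \<and> open V}. emeasure N V)"
    by (rule outer_regular) (use finN in auto)
  \<comment> \<open>The mass \<open>e * c / 5\<close> is what the factor \<open>5 / c\<close> of the
    enlarged intervals turns into \<open>e\<close>.\<close>
  ultimately have "(INF V \<in> {V. Z \<subseteq> V \<and> open V}. emeasure N V) < ennreal (e * c / 5)" using e c by simp
  then obtain V where V: "Z \<subseteq> V" "open V" "emeasure N V < ennreal (e * c / 5)"
    unfolding INF_less_iff by blast
  then have V3: "measure N V < e * c / 5"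
    by (simp add: N.emeasure_eq_measure ennreal_less_iff)
  define K where "K = {(u, v). u < v \<and> v - u < 1 \<and> {u..v} \<subseteq> V \<and> c * (v - u) < measure N {u..v}}"
  define a where "a i = (fst i + snd i) / 2" for i :: "real \<times> real"
  define r where "r i = (snd i - fst i) / 2" for i :: "real \<times> real"
  have cb: "cball (a i) (r i) = {fst i..snd i}" for i by (auto simp: a_def r_def cball_eq_atLeastAtMost field_simps)
  have Scov: "?S \<subseteq> (\<Union>i\<in>K. cball (a i) (r i))"
  proof
    fix x assume x: "x \<in> ?S"
    then have "x \<in> V" using V(1) by (auto simp: Z_def)
    then obtain \<delta> where \<delta>: "\<delta> > 0" "ball x \<delta> \<subseteq> V" using V(2) openE by blast
    have "min \<delta> 1 > 0" using \<delta> by simp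
    obtain u v where uv: "u \<le> x" "x \<le> v" "u < v" "v - u < min \<delta> 1" "c * (v - u) < (LINT y:{u..v}|lborel. h y)"
      using x[unfolded mem_Collect_eq, THEN conjunct2, rule_format, OF \<open>min \<delta> 1 > 0\<close>] by blast
    have "{u..v} \<subseteq> ball x \<delta>" using uv by (auto simp: dist_real_def abs_less_iff)
    then have "(u, v) \<in> K" using uv \<delta>(2) by (auto simp: K_def Ne)
    moreover have "x \<in> cball (a (u, v)) (r (u, v))" unfolding cb using uv by simp
    ultimately show "x \<in> (\<Union>i\<in>K. cball (a i) (r i))" by blast
  qed
  have rK: "0 < r i \<and> r i \<le> 1" if "i \<in> K" for i using that by (auto simp: K_def r_def)
  obtain C where C: "countable C" "C \<subseteq> K"
     "pairwise (\<lambda>i j. disjnt (cball (a i) (r i)) (cball (a j) (r j))) C"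
     "?S \<subseteq> (\<Union>i\<in>C. cball (a i) (5 * r i))"
    by (rule Vitali_covering_lemma_cballs[where S="?S" and K=K and a=a and r=r and B=1, OF Scov rK])
  have fin: "measure lebesgue (\<Union>i\<in>J. cball (a i) (5 * r i)) \<le> e" if J: "J \<subseteq> C" "finite J" for J
  proof -
    have JK: "i \<in> K" if "i \<in> J" for i using that J C(2) by auto
    have "measure lebesgue (\<Union>i\<in>J. cball (a i) (5 * r i)) \<le> (\<Sum>i\<in>J. measure lebesgue (cball (a i) (5 * r i)))"
      by (rule measure_UNION_le) (use J in auto)
    also have "\<dots> \<le> (\<Sum>i\<in>J. (5 / c) * measure N {fst i..snd i})"
    proof (rule sum_mono)
      fix i assume "i \<in> J"
      then have iK: "i \<in> K" by (rule JK)
      have "measure lebesgue (cball (a i) (5 * r i)) = 5 * (snd i - fst i)"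
      proof -
        have "measure lebesgue (cball (a i) (5 * r i)) = 10 * r i" using rK[OF iK] by (simp add: cball_eq_atLeastAtMost)
        then show ?thesis by (simp add: r_def)
      qed
      also have "\<dots> \<le> (5 / c) * measure N {fst i..snd i}"
        using iK c by (auto simp: K_def field_simps)
      finally show "measure lebesgue (cball (a i) (5 * r i)) \<le> (5 / c) * measure N {fst i..snd i}" .
    qed
    finally have le1: "measure lebesgue (\<Union>i\<in>J. cball (a i) (5 * r i)) \<le> (5 / c) * (\<Sum>i\<in>J. measure N {fst i..snd i})"
      by (simp add: sum_distrib_left)
    have "(\<Sum>i\<in>J. measure N {fst i..snd i}) = measure N (\<Union>i\<in>J. {fst i..snd i})"
    proof (rule N.finite_measure_finite_Union[symmetric])
      show "disjoint_family_on (\<lambda>i. {fst i..snd i}) J"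
        unfolding disjoint_family_on_def
      proof (intro ballI impI)
        fix i j assume "i \<in> J" "j \<in> J" "i \<noteq> j"
        then show "{fst i..snd i} \<inter> {fst j..snd j} = {}"
          using pairwiseD[OF C(3), of i j] J(1) unfolding cb disjnt_def by auto
      qed
    qed (use J in auto)
    also have "\<dots> \<le> measure N V"
    proof (rule N.finite_measure_mono)
      show "(\<Union>i\<in>J. {fst i..snd i}) \<subseteq> V" using JK by (fastforce simp: K_def)
    qed (use V in auto)
    finally have "(5 / c) * (\<Sum>i\<in>J. measure N {fst i..snd i}) \<le> (5 / c) * measure N V"
      using c by (intro mult_left_mono) auto
    also have "\<dots> \<le> e" using V3 c by (simp add: field_simps)
    finally show ?thesis using le1 by linarith
  qed
  have "(\<Union>i\<in>C. cball (a i) (5 * r i)) \<in> lmeasurable" "measure lebesgue (\<Union>i\<in>C. cball (a i) (5 * r i)) \<le> e"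
    using fmeasurable_UN_bound[OF C(1), of "\<lambda>i. cball (a i) (5 * r i)" lebesgue e] fin
      measure_UN_bound[OF C(1), of "\<lambda>i. cball (a i) (5 * r i)" lebesgue e] by auto
  with C(4) show "\<exists>T. ?S \<subseteq> T \<and> T \<in> lmeasurable \<and> measure lebesgue T \<le> e" by blast
qed

text \<open>The covering estimate is applied to the positive part of \<open>g - q\<close> with a
  rational \<open>q\<close> slightly above \<open>g x\<close>, where that function vanishes.
  Rational \<open>q\<close> and \<open>c\<close> leave countably many exceptional sets.\<close>

lemma upper_derivate_le_density:
  fixes f g :: "real \<Rightarrow> real"
  assumes g[measurable]: "g \<in> borel_measurable borel"
    and gi: "\<And>a b. set_integrable lborel {a<..b} g"
    and fg: "\<And>a b. a \<le> b \<Longrightarrow> (LINT x:{a<..b}|lborel. g x) = f b - f a"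
  shows "\<exists>N. negligible N \<and> (\<forall>x\<in>{0..1} - N. \<forall>e>0.
       \<exists>d>0. \<forall>u v. u \<le> x \<and> x \<le> v \<and> u < v \<and> v - u < d \<longrightarrow> f v - f u \<le> (g x + e) * (v - u))"
proof -
  \<comment> \<open>The window \<open>{-1<..2}\<close> makes \<open>h\<close> integrable and
    contains every interval of length below 1 that meets \<open>[0,1]\<close>.\<close>
  define h where "h q x = indicator {-1<..2} x * max 0 (g x - q)" for q x :: real
  have hm[measurable]: "h q \<in> borel_measurable borel" for q unfolding h_def by measurable
  have h0: "0 \<le> h q x" for q x by (simp add: h_def)
  have intI: "integrable lborel (indicator {a<..b} :: real \<Rightarrow> real)" for a b :: real
    by (cases "a \<le> b") (auto intro!: integrable_real_indicator)
  have gi': "integrable lborel (\<lambda>x. indicator {a<..b} x * (g x - q))" for a b q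
  proof -
    have "integrable lborel (\<lambda>x. indicator {a<..b} x *\<^sub>R g x - q * indicator {a<..b} x)"
      using gi[of a b] unfolding set_integrable_def
      by (intro Bochner_Integration.integrable_diff integrable_mult_right intI)
    then show ?thesis by (simp add: algebra_simps)
  qed
  have hint: "integrable lborel (h q)" for q
    by (rule Bochner_Integration.integrable_bound[OF gi'[of "-1" 2 q]]) (auto simp: h_def indicator_def)
  define S where "S q c = {x. h q x = 0 \<and> (\<forall>d>0. \<exists>u v. u \<le> x \<and> x \<le> v \<and> u < v \<and> v - u < d \<and>
             c * (v - u) < (LINT y:{u..v}|lborel. h q y))}" for q c :: real
  define N where "N = (\<Union>q\<in>\<rat>. \<Union>c\<in>{c\<in>\<rat>. c > 0}. S q c)"
  have "countable {c\<in>\<rat>. c > (0::real)}" using countable_rat by (rule countable_subset[rotated]) auto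
  moreover have "negligible (S q c)" if "c > 0" for q c
    unfolding S_def by (rule negligible_upper_derivate[OF hm h0 hint that])
  ultimately have neg: "negligible N" unfolding N_def
    by (intro negligible_countable_Union countable_image countable_rat) auto
  show ?thesis
  proof (intro exI[of _ N] conjI ballI allI impI neg)
    fix x e :: real assume x: "x \<in> {0..1} - N" and e: "e > 0"
    obtain q where q: "q \<in> \<rat>" "g x < q" "q < g x + e/2" using Rats_dense_in_real[of "g x" "g x + e/2"] e by auto
    obtain c where c: "c \<in> \<rat>" "0 < c" "c < e/2" using Rats_dense_in_real[of 0 "e/2"] e by auto
    have "x \<notin> S q c" using x q c by (auto simp: N_def)
    moreover have "h q x = 0" using q by (simp add: h_def)
    ultimately have "\<not> (\<forall>d>0. \<exists>u v. u \<le> x \<and> x \<le> v \<and> u < v \<and> v - u < d \<and>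
             c * (v - u) < (LINT y:{u..v}|lborel. h q y))" unfolding S_def by blast
    then obtain d where d: "d > 0" and "\<not> (\<exists>u v. u \<le> x \<and> x \<le> v \<and> u < v \<and> v - u < d \<and>
             c * (v - u) < (LINT y:{u..v}|lborel. h q y))" by blast
    then have d2: "(LINT y:{u..v}|lborel. h q y) \<le> c * (v - u)" if "u \<le> x" "x \<le> v" "u < v" "v - u < d" for u v
      using that by (meson not_less)
    have "f v - f u \<le> (g x + e) * (v - u)" if uv: "u \<le> x" "x \<le> v" "u < v" "v - u < min d 1" for u v
    proof -
      have sub: "{u<..v} \<subseteq> {-1<..2}" using uv x by auto
      have "f v - f u - q * (v - u) = (LINT y:{u<..v}|lborel. g y) - (LINT y:{u<..v}|lborel. q)"
        using fg[of u v] uv(3) by (simp add: set_integral_const)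
      also have "\<dots> = (LINT y:{u<..v}|lborel. g y - q)"
        by (rule set_integral_diff(2)[symmetric]) (use gi intI in \<open>simp_all add: set_integrable_def\<close>)
      also have "\<dots> \<le> (LINT y:{u..v}|lborel. h q y)"
        unfolding set_lebesgue_integral_def
      proof (rule integral_mono)
        show "integrable lborel (\<lambda>x. indicat_real {u<..v} x *\<^sub>R (g x - q))" using gi' by simp
        show "integrable lborel (\<lambda>x. indicat_real {u..v} x *\<^sub>R h q x)" using hint by (intro integrable_mult_indicator) auto
        show "indicat_real {u<..v} y *\<^sub>R (g y - q) \<le> indicat_real {u..v} y *\<^sub>R h q y" for y
          using sub by (auto simp: indicator_def h_def)
      qed
      also have "\<dots> \<le> c * (v - u)" using d2 uv by simp
      finally have "f v - f u \<le> (q + c) * (v - u)" by (simp add: algebra_simps)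
      also have "\<dots> \<le> (g x + e) * (v - u)" using q c uv(3) by (intro mult_right_mono) auto
      finally show ?thesis .
    qed
    then show "\<exists>d>0. \<forall>u v. u \<le> x \<and> x \<le> v \<and> u < v \<and> v - u < d \<longrightarrow> f v - f u \<le> (g x + e) * (v - u)"
      using d by (intro exI[of _ "min d 1"]) auto
  qed
qed

text \<open>The one-sided estimate for \<open>f\<close> with density \<open>g\<close> and for
  \<open>- f\<close> with density \<open>- g\<close> squeezes the difference quotient.\<close>

lemma negligible_not_differentiable:
  fixes f g :: "real \<Rightarrow> real"
  assumes g[measurable]: "g \<in> borel_measurable borel"
    and gi: "\<And>a b. set_integrable lborel {a<..b} g"
    and fg: "\<And>a b. a \<le> b \<Longrightarrow> (LINT x:{a<..b}|lborel. g x) = f b - f a"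
  shows "negligible {x \<in> {0..1}. \<not> (f has_real_derivative g x) (at x)}"
proof -
  obtain N1 where "negligible N1 \<and> (\<forall>x\<in>{0..1} - N1. \<forall>e>0.
       \<exists>d>0. \<forall>u v. u \<le> x \<and> x \<le> v \<and> u < v \<and> v - u < d \<longrightarrow> f v - f u \<le> (g x + e) * (v - u))"
    using upper_derivate_le_density[OF assms] by (rule exE)
  note N1 = conjunct1[OF this] conjunct2[OF this, rule_format]
  have gm: "(\<lambda>x. - g x) \<in> borel_measurable borel" by measurable
  have gn: "set_integrable lborel {a<..b} (\<lambda>x. - g x)" for a b
    using gi[of a b] unfolding set_integrable_def by simp
  have fn: "(LINT x:{a<..b}|lborel. - g x) = - f b - - f a" if "a \<le> b" for a b
    using fg[OF that] unfolding set_lebesgue_integral_def by simp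
  obtain N2 where "negligible N2 \<and> (\<forall>x\<in>{0..1} - N2. \<forall>e>0.
       \<exists>d>0. \<forall>u v. u \<le> x \<and> x \<le> v \<and> u < v \<and> v - u < d \<longrightarrow> - f v - - f u \<le> (- g x + e) * (v - u))"
    using upper_derivate_le_density[OF gm gn fn] by (rule exE)
  note N2 = conjunct1[OF this] conjunct2[OF this, rule_format]
  have "(f has_real_derivative g x) (at x)" if x: "x \<in> {0..1} - (N1 \<union> N2)" for x
    unfolding DERIV_def
  proof (rule LIM_I)
    fix e :: real assume e: "e > 0"
    obtain d1 where d1: "d1 > 0" "\<And>u v. u \<le> x \<Longrightarrow> x \<le> v \<Longrightarrow> u < v \<Longrightarrow> v - u < d1 \<Longrightarrow> f v - f u \<le> (g x + e/2) * (v - u)"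
      using N1(2)[of x "e/2"] x e by auto
    obtain d2 where d2: "d2 > 0" "\<And>u v. u \<le> x \<Longrightarrow> x \<le> v \<Longrightarrow> u < v \<Longrightarrow> v - u < d2 \<Longrightarrow> - f v - - f u \<le> (- g x + e/2) * (v - u)"
      using N2(2)[of x "e/2"] x e by auto
    have "norm ((f (x + h) - f x) / h - g x) < e" if h: "h \<noteq> 0" "norm (h - 0) < min d1 d2" for h
    proof -
      have "\<bar>(f (x + h) - f x) - g x * h\<bar> \<le> e/2 * \<bar>h\<bar>"
      proof (cases "h > 0")
        case True
        then have "f (x + h) - f x \<le> (g x + e/2) * h" "- f (x + h) + f x \<le> (- g x + e/2) * h"
          using d1(2)[of x "x + h"] d2(2)[of x "x + h"] h by auto
        then show ?thesis unfolding abs_le_iff using True by (simp add: algebra_simps)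
      next
        case False
        then have "h < 0" using h by simp
        then have "f x - f (x + h) \<le> (g x + e/2) * (- h)" "- f x + f (x + h) \<le> (- g x + e/2) * (- h)"
          using d1(2)[of "x + h" x] d2(2)[of "x + h" x] h by auto
        then show ?thesis unfolding abs_le_iff using \<open>h < 0\<close> by (simp add: algebra_simps)
      qed
      moreover have "(f (x + h) - f x) / h - g x = ((f (x + h) - f x) - g x * h) / h" using h by (simp add: field_simps)
      ultimately have "\<bar>(f (x + h) - f x) / h - g x\<bar> \<le> e/2" using h by (simp add: abs_divide divide_le_eq)
      then show ?thesis using e by simp
    qed
    then show "\<exists>s>0. \<forall>h. h \<noteq> 0 \<and> norm (h - 0) < s \<longrightarrow> norm ((f (x + h) - f x) / h - g x) < e"
      using d1(1) d2(1) by (intro exI[of _ "min d1 d2"]) auto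
  qed
  then have "{x \<in> {0..1}. \<not> (f has_real_derivative g x) (at x)} \<subseteq> N1 \<union> N2" by blast
  with N1(1) N2(1) show ?thesis using negligible_Un negligible_subset by metis
qed

section \<open>Finite energy\<close>

lemma power2_norm_vec: "(norm (x :: real^'n))\<^sup>2 = (\<Sum>i\<in>UNIV. (x $ i)\<^sup>2)"
  by (simp only: power2_norm_eq_inner inner_vec_def) (simp add: power2_eq_square)

lemma has_vector_derivative_vecI:
  fixes f :: "real \<Rightarrow> real^'n"
  assumes "\<And>i. ((\<lambda>t. f t $ i) has_real_derivative v $ i) (at x)"
  shows "(f has_vector_derivative v) (at x)"
  unfolding has_vector_derivative_def
proof (subst has_derivative_componentwise_within, rule ballI)
  fix b :: "real^'n" assume "b \<in> Basis"
  then obtain i where b: "b = axis i 1" by (auto simp: Basis_vec_def)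
  have "(\<lambda>t. t * v $ i) = (*) (v $ i)" by (auto simp: fun_eq_iff)
  then show "((\<lambda>t. f t \<bullet> b) has_derivative (\<lambda>t. (t *\<^sub>R v) \<bullet> b)) (at x)"
    using assms[of i] unfolding b has_field_derivative_def
    by (simp add: inner_axis)
qed

text \<open>Cauchy-Schwarz on one interval, obtained by integrating
  \<open>(g x - c)^2 \<ge> 0\<close> with \<open>c\<close> the mean of \<open>g\<close>. An infinite
  right side leaves nothing to show; otherwise \<open>g\<close> is square integrable on the
  interval.\<close>

lemma square_integral_le:
  fixes g :: "real \<Rightarrow> real"
  assumes g[measurable]: "g \<in> borel_measurable borel" and gi: "set_integrable lborel {a<..b} g" and ab: "a < b"
  shows "ennreal ((LINT x:{a<..b}|lborel. g x)\<^sup>2 / (b - a)) \<le> (\<integral>\<^sup>+x\<in>{a<..b}. ennreal ((g x)\<^sup>2) \<partial>lborel)"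
proof (cases "(\<integral>\<^sup>+x\<in>{a<..b}. ennreal ((g x)\<^sup>2) \<partial>lborel) = \<infinity>")
  case False
  define I where "I = (LINT x:{a<..b}|lborel. g x)"
  define c where "c = I / (b - a)"
  have e: "(\<integral>\<^sup>+x\<in>{a<..b}. ennreal ((g x)\<^sup>2) \<partial>lborel) = (\<integral>\<^sup>+x. ennreal (indicator {a<..b} x * (g x)\<^sup>2) \<partial>lborel)"
    by (intro nn_integral_cong) (auto simp: indicator_def)
  have i2: "integrable lborel (\<lambda>x. indicator {a<..b} x * (g x)\<^sup>2)"
    by (rule integrableI_nonneg) (use False e in \<open>auto simp: top.not_eq_extremum\<close>)
  have intI: "integrable lborel (indicator {a<..b} :: real \<Rightarrow> real)"
    using ab by (auto intro!: integrable_real_indicator)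
  have gi': "integrable lborel (\<lambda>x. indicator {a<..b} x * g x)" using gi by (simp add: set_integrable_def)
  have "I\<^sup>2 / (b - a) = 2 * c * I - c\<^sup>2 * (b - a)"
    using ab by (simp add: c_def power2_eq_square)
  also have "\<dots> = (LINT x|lborel. 2 * c * (indicator {a<..b} x * g x) - c\<^sup>2 * indicator {a<..b} x)"
    using ab by (subst Bochner_Integration.integral_diff)
      (auto intro!: integrable_mult_right gi' intI simp: I_def set_lebesgue_integral_def simp del: integrable_mult_right_iff)
  also have "\<dots> \<le> (LINT x|lborel. indicator {a<..b} x * (g x)\<^sup>2)"
  proof (rule integral_mono)
    show "integrable lborel (\<lambda>x. 2 * c * (indicat_real {a<..b} x * g x) - c\<^sup>2 * indicat_real {a<..b} x)"
      by (intro Bochner_Integration.integrable_diff integrable_mult_right gi' intI)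
    show "2 * c * (indicat_real {a<..b} x * g x) - c\<^sup>2 * indicat_real {a<..b} x \<le> indicat_real {a<..b} x * (g x)\<^sup>2" for x
      using zero_le_power2[of "g x - c"] by (auto simp: indicator_def power2_diff algebra_simps)
  qed (rule i2)
  finally have "ennreal (I\<^sup>2 / (b - a)) \<le> ennreal (LINT x|lborel. indicator {a<..b} x * (g x)\<^sup>2)" by (rule ennreal_leI)
  also have "\<dots> = (\<integral>\<^sup>+x\<in>{a<..b}. ennreal ((g x)\<^sup>2) \<partial>lborel)"
    unfolding e by (rule nn_integral_eq_integral[symmetric, OF i2]) auto
  finally show ?thesis by (simp add: I_def)
qed simp

definition grid :: "nat \<Rightarrow> nat \<Rightarrow> real" where "grid m k = real k / real m"

text \<open>Dirichlet energy of the polygon through the values of \<open>f\<close> on the grid of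
  mesh \<open>1/m\<close>: slopes are \<open>m\<close> times increments, and each cell has length
  \<open>1/m\<close>.\<close>

definition energy :: "nat \<Rightarrow> (real \<Rightarrow> 'a::real_normed_vector) \<Rightarrow> real" where
  "energy m f = (\<Sum>k<m. real m * (norm (f (grid m (Suc k)) - f (grid m k)))\<^sup>2)"

lemma grid_mem: "k \<le> m \<Longrightarrow> grid m k \<in> {0..1}"
  by (cases "m = 0") (auto simp: grid_def)

lemma grid_less: "0 < m \<Longrightarrow> grid m k < grid m (Suc k)"
  by (simp add: grid_def divide_strict_right_mono)

lemma grid_diff: "0 < m \<Longrightarrow> grid m (Suc k) - grid m k = 1 / real m"
  by (simp add: grid_def diff_divide_distrib[symmetric])

lemma grid_cells_disjoint:
  assumes "0 < m" "k < l" shows "grid m (Suc k) \<le> grid m l"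
  using assms by (simp add: grid_def divide_right_mono)

lemma abs_cont_vec_derivative:
  fixes f :: "real \<Rightarrow> real^'n"
  assumes ac: "\<And>i. abs_cont_on {0..1} (\<lambda>t. f t $ i)"
  shows "\<exists>g :: 'n \<Rightarrow> real \<Rightarrow> real. (\<forall>i. g i \<in> borel_measurable borel) \<and> (\<forall>i a b. set_integrable lborel {a<..b} (g i)) \<and>
    (\<forall>i a b. 0 \<le> a \<longrightarrow> a \<le> b \<longrightarrow> b \<le> 1 \<longrightarrow> (LINT x:{a<..b}|lborel. g i x) = f b $ i - f a $ i) \<and>
    (AE s in lebesgue. s \<in> {0..1} \<longrightarrow> (f has_vector_derivative (\<chi> i. g i s)) (at s))"
proof -
  define fc where "fc i t = f (max 0 (min 1 t)) $ i" for i t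
  have 1: "abs_cont_on UNIV (fc i)" for i unfolding fc_def by (rule abs_cont_on_clamp[OF ac])
  have 2: "fc i t = fc i 0" if "t \<le> 0" for i t using that by (simp add: fc_def)
  have ex: "\<exists>g::real\<Rightarrow>real. g \<in> borel_measurable borel \<and> (\<forall>a b. set_integrable lborel {a<..b} g) \<and>
     (\<forall>a b. a \<le> b \<longrightarrow> (LINT x:{a<..b}|lborel. g x) = fc i b - fc i a)" for i
    by (rule abs_cont_density[OF 1[of i] 2[of _ i]]) auto
  define g where "g i = (SOME g::real\<Rightarrow>real. g \<in> borel_measurable borel \<and> (\<forall>a b. set_integrable lborel {a<..b} g) \<and>
     (\<forall>a b. a \<le> b \<longrightarrow> (LINT x:{a<..b}|lborel. g x) = fc i b - fc i a))" for i
  note G = someI_ex[OF ex, folded g_def]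
  have g: "g i \<in> borel_measurable borel" "set_integrable lborel {a<..b} (g i)"
     "a \<le> b \<Longrightarrow> (LINT x:{a<..b}|lborel. g i x) = fc i b - fc i a" for i a b
    using G[of i] by auto
  define S where "S i = {x \<in> {0..1}. \<not> (fc i has_real_derivative g i x) (at x)}" for i
  have S: "negligible (S i)" for i unfolding S_def by (rule negligible_not_differentiable[OF g])
  \<comment> \<open>The endpoints join the exceptional set: the derivative in \<open>U\<close> is
    two-sided on the line, while \<open>f\<close> agrees with its clamped version only on
    \<open>[0,1]\<close>.\<close>
  define N where "N = {0, 1} \<union> \<Union>(range S)"
  have "negligible (\<Union>(range S))" by (rule negligible_Union) (auto intro: S)
  then have "negligible N" unfolding N_def by simp
  then have "N \<in> null_sets lebesgue" by (simp add: negligible_iff_null_sets)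
  then have "AE s in lebesgue. s \<notin> N" by (rule AE_not_in)
  then have "AE s in lebesgue. s \<in> {0..1} \<longrightarrow> (f has_vector_derivative (\<chi> i. g i s)) (at s)"
  proof (rule AE_mp, intro AE_I2 impI)
    fix s :: real assume "s \<notin> N" "s \<in> {0..1}"
    then have s: "s \<in> {0<..<1}" "\<And>i. (fc i has_real_derivative g i s) (at s)" by (auto simp: N_def S_def less_le)
    show "(f has_vector_derivative (\<chi> i. g i s)) (at s)"
    proof (rule has_vector_derivative_vecI)
      fix i
      have "((\<lambda>t. f t $ i) has_real_derivative g i s) (at s)"
        by (rule has_field_derivative_transform_within_open[OF s(2), of "{0<..<1}"]) (use s(1) in \<open>auto simp: fc_def\<close>)
      then show "((\<lambda>t. f t $ i) has_real_derivative (\<chi> i. g i s) $ i) (at s)" by simp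
    qed
  qed
  moreover have "(LINT x:{a<..b}|lborel. g i x) = f b $ i - f a $ i" if "0 \<le> a" "a \<le> b" "b \<le> 1" for i a b
    using g(3)[OF that(2), of i] that by (simp add: fc_def)
  ultimately show ?thesis using g(1,2) by (intro exI[of _ g] conjI allI impI)
qed

text \<open>On each grid cell, \<open>m\<close> times the squared increment is at most the integral
  of the squared speed. Together with the converse \<open>finite_energy_in_U\<close> this replaces
  the integral in \<open>U\<close> by grid energies, which depend on finitely many values.\<close>

lemma U_energy:
  fixes f :: "real \<Rightarrow> real^'n"
  assumes f: "f \<in> U i0" and m: "0 < m"
  shows "energy m f \<le> 1"
proof -
  have ac: "abs_cont_on {0..1} (\<lambda>t. f t $ i)" for i using f by (simp add: U_def)
  obtain g :: "'n \<Rightarrow> real \<Rightarrow> real" where G: "(\<forall>i. g i \<in> borel_measurable borel) \<and> (\<forall>i a b. set_integrable lborel {a<..b} (g i)) \<and>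
    (\<forall>i a b. 0 \<le> a \<longrightarrow> a \<le> b \<longrightarrow> b \<le> 1 \<longrightarrow> (LINT x:{a<..b}|lborel. g i x) = f b $ i - f a $ i) \<and>
    (AE s in lebesgue. s \<in> {0..1} \<longrightarrow> (f has_vector_derivative (\<chi> i. g i s)) (at s))"
    using abs_cont_vec_derivative[of f, OF ac] by (rule exE)
  note g = conjunct1[OF G, rule_format] conjunct1[OF conjunct2[OF G], rule_format]
    conjunct1[OF conjunct2[OF conjunct2[OF G]], rule_format] conjunct2[OF conjunct2[OF conjunct2[OF G]]]
  note g(1)[measurable]
  have "(\<integral>\<^sup>+s\<in>{0..1}. ennreal (\<Sum>i\<in>UNIV. (g i s)\<^sup>2) \<partial>lborel)
      = (\<integral>\<^sup>+s\<in>{0..1}. ennreal (\<Sum>i\<in>UNIV. (g i s)\<^sup>2) \<partial>lebesgue)"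
    by (rule nn_integral_completion[symmetric]) measurable
  also have "\<dots> = (\<integral>\<^sup>+s\<in>{0..1}. ennreal ((norm (vector_derivative f (at s)))\<^sup>2) \<partial>lebesgue)"
  proof (rule nn_integral_cong_AE)
    show "AE s in lebesgue. ennreal (\<Sum>i\<in>UNIV. (g i s)\<^sup>2) * indicator {0..1} s
        = ennreal ((norm (vector_derivative f (at s)))\<^sup>2) * indicator {0..1} s"
      using g(4) by (rule AE_mp) (auto intro!: AE_I2 simp: vector_derivative_at power2_norm_vec indicator_def)
  qed
  also have "\<dots> \<le> 1" using f by (simp add: U_def)
  finally have le1: "(\<integral>\<^sup>+s\<in>{0..1}. ennreal (\<Sum>i\<in>UNIV. (g i s)\<^sup>2) \<partial>lborel) \<le> 1" .
  define A where "A k = {grid m k<..grid m (Suc k)}" for k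
  have cell: "ennreal (real m * (norm (f (grid m (Suc k)) - f (grid m k)))\<^sup>2)
      \<le> (\<integral>\<^sup>+s. ennreal (\<Sum>i\<in>UNIV. (g i s)\<^sup>2) * indicator (A k) s \<partial>lborel)" if k: "k < m" for k
  proof -
    have lk: "grid m k < grid m (Suc k)" "0 \<le> grid m k" "grid m (Suc k) \<le> 1"
      using grid_less[OF m] grid_mem[of k m] grid_mem[of "Suc k" m] k by auto
    have "ennreal (real m * (norm (f (grid m (Suc k)) - f (grid m k)))\<^sup>2)
      = (\<Sum>i\<in>UNIV. ennreal ((LINT x:A k|lborel. g i x)\<^sup>2 / (grid m (Suc k) - grid m k)))"
      using lk m by (subst sum_ennreal) (auto simp: A_def g(3) power2_norm_vec grid_diff sum_distrib_left sum_divide_distrib mult.commute)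
    also have "\<dots> \<le> (\<Sum>i\<in>UNIV. \<integral>\<^sup>+x\<in>A k. ennreal ((g i x)\<^sup>2) \<partial>lborel)"
      unfolding A_def by (intro sum_mono square_integral_le g lk)
    also have "\<dots> = (\<integral>\<^sup>+x. (\<Sum>i\<in>UNIV. ennreal ((g i x)\<^sup>2) * indicator (A k) x) \<partial>lborel)"
      by (rule nn_integral_sum[symmetric]) (simp add: A_def)
    also have "\<dots> = (\<integral>\<^sup>+s. ennreal (\<Sum>i\<in>UNIV. (g i s)\<^sup>2) * indicator (A k) s \<partial>lborel)"
    proof (rule nn_integral_cong)
      fix s
      have "ennreal (\<Sum>i\<in>UNIV. (g i s)\<^sup>2) = (\<Sum>i\<in>UNIV. ennreal ((g i s)\<^sup>2))"
        by (rule sum_ennreal[symmetric]) simp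
      then show "(\<Sum>i\<in>UNIV. ennreal ((g i s)\<^sup>2) * indicator (A k) s) = ennreal (\<Sum>i\<in>UNIV. (g i s)\<^sup>2) * indicator (A k) s"
        by (simp only: sum_distrib_right)
    qed
    finally show ?thesis .
  qed
  have "ennreal (energy m f) = (\<Sum>k<m. ennreal (real m * (norm (f (grid m (Suc k)) - f (grid m k)))\<^sup>2))"
    unfolding energy_def by (rule sum_ennreal[symmetric]) auto
  also have "\<dots> \<le> (\<Sum>k<m. \<integral>\<^sup>+s. ennreal (\<Sum>i\<in>UNIV. (g i s)\<^sup>2) * indicator (A k) s \<partial>lborel)"
    by (rule sum_mono) (use cell in auto)
  also have "\<dots> = (\<integral>\<^sup>+s. (\<Sum>k<m. ennreal (\<Sum>i\<in>UNIV. (g i s)\<^sup>2) * indicator (A k) s) \<partial>lborel)"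
    by (rule nn_integral_sum[symmetric]) (simp add: A_def)
  also have "\<dots> \<le> (\<integral>\<^sup>+s. ennreal (\<Sum>i\<in>UNIV. (g i s)\<^sup>2) * indicator {0..1} s \<partial>lborel)"
  proof (rule nn_integral_mono)
    fix s
    have "disjoint_family_on A {..<m}"
      unfolding disjoint_family_on_def
    proof (intro ballI impI)
      fix k l assume "k \<in> {..<m}" "l \<in> {..<m}" "k \<noteq> l"
      then show "A k \<inter> A l = {}"
        using grid_cells_disjoint[OF m, of k l] grid_cells_disjoint[OF m, of l k] by (auto simp: A_def neq_iff)
    qed
    then have "(\<Sum>k<m. indicator (A k) s) = (indicator (\<Union>k<m. A k) s :: ennreal)"
      by (rule indicator_UN_disjoint[symmetric, OF finite_lessThan])
    also have "\<dots> \<le> indicator {0..1} s"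
    proof -
      have "A k \<subseteq> {0..1}" if "k < m" for k
        using grid_mem[of k m] grid_mem[of "Suc k" m] that by (auto simp: A_def)
      then have "(\<Union>k<m. A k) \<subseteq> {0..1}" by blast
      then show ?thesis by (auto simp: indicator_def)
    qed
    finally show "(\<Sum>k<m. ennreal (\<Sum>i\<in>UNIV. (g i s)\<^sup>2) * indicator (A k) s) \<le> ennreal (\<Sum>i\<in>UNIV. (g i s)\<^sup>2) * indicator {0..1} s"
      by (simp add: sum_distrib_left[symmetric] mult_left_mono)
  qed
  also have "\<dots> \<le> 1" by (rule le1)
  finally show ?thesis by simp
qed

text \<open>The grid cell around \<open>t\<close> need not have \<open>t\<close> as an endpoint. The
  increment is split at \<open>t\<close>; the two linearisation errors are small relative to
  \<open>w n - t\<close> and \<open>t - u n\<close>, which add up to the length of the cell.\<close>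

lemma vector_derivative_straddle:
  fixes f :: "real \<Rightarrow> 'a::real_normed_vector"
  assumes f: "(f has_vector_derivative v) (at t)"
    and uw: "\<And>n. u n \<le> t" "\<And>n. t \<le> w n" "\<And>n. u n < w n" "u \<longlonglongrightarrow> t" "w \<longlonglongrightarrow> t"
  shows "(\<lambda>n. (f (w n) - f (u n)) /\<^sub>R (w n - u n)) \<longlonglongrightarrow> v"
proof (rule LIMSEQ_I)
  fix e :: real assume e: "e > 0"
  obtain d where d: "d > 0" "\<And>y. norm (y - t) < d \<Longrightarrow> norm (f y - f t - (y - t) *\<^sub>R v) \<le> e/2 * norm (y - t)"
    using f e unfolding has_vector_derivative_def has_derivative_at_alt by (metis half_gt_zero)
  obtain n1 where n1: "\<And>n. n \<ge> n1 \<Longrightarrow> norm (u n - t) < d" using LIMSEQ_D[OF uw(4) d(1)] by blast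
  obtain n2 where n2: "\<And>n. n \<ge> n2 \<Longrightarrow> norm (w n - t) < d" using LIMSEQ_D[OF uw(5) d(1)] by blast
  have "norm ((f (w n) - f (u n)) /\<^sub>R (w n - u n) - v) < e" if n: "n \<ge> max n1 n2" for n
  proof -
    have eq: "f (w n) - f (u n) - (w n - u n) *\<^sub>R v = (f (w n) - f t - (w n - t) *\<^sub>R v) - (f (u n) - f t - (u n - t) *\<^sub>R v)"
      by (simp add: algebra_simps)
    have "norm (f (w n) - f (u n) - (w n - u n) *\<^sub>R v) \<le> e/2 * norm (w n - t) + e/2 * norm (u n - t)"
      unfolding eq by (rule order_trans[OF norm_triangle_ineq4 add_mono]) (use d(2) n1 n2 n in auto)
    also have "\<dots> = e/2 * (w n - u n)"
    proof -
      have "norm (w n - t) = w n - t" "norm (u n - t) = t - u n" using uw(1)[of n] uw(2)[of n] by auto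
      then show ?thesis by (simp add: field_simps)
    qed
    finally have le: "norm (f (w n) - f (u n) - (w n - u n) *\<^sub>R v) \<le> e/2 * (w n - u n)" .
    have "(f (w n) - f (u n)) /\<^sub>R (w n - u n) - v = (f (w n) - f (u n) - (w n - u n) *\<^sub>R v) /\<^sub>R (w n - u n)"
      using uw(3)[of n] by (simp add: scaleR_diff_right)
    then have "norm ((f (w n) - f (u n)) /\<^sub>R (w n - u n) - v) = norm (f (w n) - f (u n) - (w n - u n) *\<^sub>R v) / (w n - u n)"
      using uw(3)[of n] by (simp add: divide_inverse mult.commute)
    also have "\<dots> \<le> e/2" using le uw(3)[of n] by (simp add: divide_le_eq)
    finally show ?thesis using e by simp
  qed
  then show "\<exists>n0. \<forall>n\<ge>n0. norm ((f (w n) - f (u n)) /\<^sub>R (w n - u n) - v) < e" by blast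
qed

text \<open>Cauchy-Schwarz: the squared variation over the cells in \<open>J\<close> is at most
  their number times the sum of the squared increments, and the energy bounds that sum by
  \<open>1/m\<close>.\<close>

lemma energy_imp_sum_le:
  fixes f :: "real \<Rightarrow> real^'n"
  assumes E: "energy m f \<le> 1" and m: "0 < m" and J: "J \<subseteq> {..<m}"
  shows "(\<Sum>j\<in>J. norm (f (grid m (Suc j)) - f (grid m j))) \<le> sqrt (real (card J) / real m)"
proof (rule real_le_rsqrt)
  have fin: "finite J" using J finite_subset by blast
  have "(\<Sum>j\<in>J. norm (f (grid m (Suc j)) - f (grid m j)))\<^sup>2
      \<le> (\<Sum>j\<in>J. (norm (f (grid m (Suc j)) - f (grid m j)))\<^sup>2) * real (card J)"
    by (rule sum_squared_le_sum_of_squares)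
  also have "\<dots> \<le> (\<Sum>j<m. (norm (f (grid m (Suc j)) - f (grid m j)))\<^sup>2) * real (card J)"
    by (intro mult_right_mono sum_mono2) (use J in auto)
  also have "(\<Sum>j<m. (norm (f (grid m (Suc j)) - f (grid m j)))\<^sup>2) = energy m f / real m"
    using m by (simp add: energy_def sum_distrib_left[symmetric])
  also have "energy m f / real m * real (card J) \<le> 1 / real m * real (card J)"
    using E by (intro mult_right_mono divide_right_mono) auto
  finally show "(\<Sum>j\<in>J. norm (f (grid m (Suc j)) - f (grid m j)))\<^sup>2 \<le> real (card J) / real m" by simp
qed

lemma nat_floor_bounds:
  fixes y :: real
  assumes "0 \<le> y"
  shows "real (nat \<lfloor>y\<rfloor>) \<le> y" "y < real (nat \<lfloor>y\<rfloor>) + 1"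
  using assms by linarith+

lemma nat_floor_le: "0 \<le> y \<Longrightarrow> y \<le> real n \<Longrightarrow> nat \<lfloor>y\<rfloor> \<le> n"
  by linarith

lemma nat_floor_less: "0 \<le> y \<Longrightarrow> y < real n \<Longrightarrow> nat \<lfloor>y\<rfloor> < n"
  by linarith

lemma floor_grid_tendsto:
  assumes "0 \<le> x"
  shows "(\<lambda>m. grid (Suc m) (nat \<lfloor>real (Suc m) * x\<rfloor>)) \<longlonglongrightarrow> x"
proof (rule tendsto_sandwich[of "\<lambda>m. x - 1 / real (Suc m)" _ _ "\<lambda>_. x"])
  have *: "real (Suc m) * x - 1 \<le> real (nat \<lfloor>real (Suc m) * x\<rfloor>)" "real (nat \<lfloor>real (Suc m) * x\<rfloor>) \<le> real (Suc m) * x" for m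
    using nat_floor_bounds[of "real (Suc m) * x"] assms by auto
  show "eventually (\<lambda>m. x - 1 / real (Suc m) \<le> grid (Suc m) (nat \<lfloor>real (Suc m) * x\<rfloor>)) sequentially"
  proof (intro always_eventually allI)
    fix m
    have "x - 1 / real (Suc m) = (real (Suc m) * x - 1) / real (Suc m)" by (simp add: diff_divide_distrib)
    also have "\<dots> \<le> grid (Suc m) (nat \<lfloor>real (Suc m) * x\<rfloor>)"
      unfolding grid_def by (intro divide_right_mono *(1)) simp
    finally show "x - 1 / real (Suc m) \<le> grid (Suc m) (nat \<lfloor>real (Suc m) * x\<rfloor>)" .
  qed
  show "eventually (\<lambda>m. grid (Suc m) (nat \<lfloor>real (Suc m) * x\<rfloor>) \<le> x) sequentially"
    using *(2) by (intro always_eventually allI) (simp add: grid_def field_simps del: of_nat_Suc)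
  show "(\<lambda>m. x - 1 / real (Suc m)) \<longlonglongrightarrow> x"
    using tendsto_diff[OF tendsto_const[of x] LIMSEQ_inverse_real_of_nat] by (simp add: inverse_eq_divide)
qed simp

lemma floor_grid_Suc_tendsto:
  assumes "0 \<le> x"
  shows "(\<lambda>m. grid (Suc m) (Suc (nat \<lfloor>real (Suc m) * x\<rfloor>))) \<longlonglongrightarrow> x"
proof -
  have "grid (Suc m) (Suc k) = grid (Suc m) k + inverse (real (Suc m))" for m k
    by (simp add: grid_def field_simps)
  then show ?thesis
    using tendsto_add[OF floor_grid_tendsto[OF assms] LIMSEQ_inverse_real_of_nat] by simp
qed

text \<open>Bounded energy yields the explicit modulus \<open>e^2\<close>: the variation over
  non-overlapping intervals is at most the square root of their total length. With endpoints rounded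
  down to a grid this is \<open>energy_imp_sum_le\<close>; continuity of \<open>f\<close> removes
  the rounding as the grid is refined.\<close>

lemma finite_energy_abs_cont:
  fixes f :: "real \<Rightarrow> real^'n"
  assumes cont: "continuous_on {0..1} f" and E: "\<And>m. 0 < m \<Longrightarrow> energy m f \<le> 1"
  shows "abs_cont_on {0..1} (\<lambda>t. f t $ i)"
proof -
  have "(\<Sum>k<n. \<bar>f (b k) $ i - f (a k) $ i\<bar>) \<le> sqrt (\<Sum>k<n. b k - a k)"
    if H: "\<And>k. k < n \<Longrightarrow> a k \<le> b k \<and> {a k..b k} \<subseteq> {0..1}"
      "\<And>k l. k < n \<Longrightarrow> l < n \<Longrightarrow> k \<noteq> l \<Longrightarrow> b k \<le> a l \<or> b l \<le> a k" for n and a b :: "nat \<Rightarrow> real"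
  proof (rule LIMSEQ_le)
    define A where "A m k = nat \<lfloor>real (Suc m) * a k\<rfloor>" for m k
    define B where "B m k = nat \<lfloor>real (Suc m) * b k\<rfloor>" for m k
    have ab: "0 \<le> a k" "a k \<le> b k" "b k \<le> 1" if "k < n" for k using H(1)[OF that] by auto
    have conv: "(\<lambda>m. f (grid (Suc m) (nat \<lfloor>real (Suc m) * x\<rfloor>)) $ i) \<longlonglongrightarrow> f x $ i" if "0 \<le> x" "x \<le> 1" for x
    proof -
      have "(\<lambda>m. f (grid (Suc m) (nat \<lfloor>real (Suc m) * x\<rfloor>))) \<longlonglongrightarrow> f x"
      proof (rule continuous_on_tendsto_compose[OF cont floor_grid_tendsto])
        have "nat \<lfloor>real (Suc m) * x\<rfloor> \<le> Suc m" for m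
        proof -
          have "real (Suc m) * x \<le> real (Suc m) * 1" using that by (intro mult_left_mono) auto
          then show ?thesis using that by (intro nat_floor_le) auto
        qed
        then show "\<forall>\<^sub>F m in sequentially. grid (Suc m) (nat \<lfloor>real (Suc m) * x\<rfloor>) \<in> {0..1}"
          using grid_mem by (intro always_eventually allI) blast
      qed (use that in auto)
      then show ?thesis by (rule tendsto_vec_nth)
    qed
    show "(\<lambda>m. \<Sum>k<n. \<bar>f (grid (Suc m) (B m k)) $ i - f (grid (Suc m) (A m k)) $ i\<bar>) \<longlonglongrightarrow> (\<Sum>k<n. \<bar>f (b k) $ i - f (a k) $ i\<bar>)"
      unfolding A_def B_def
    proof (intro tendsto_sum tendsto_rabs tendsto_diff conv)
    qed (use ab in \<open>auto intro: order_trans\<close>)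
    show "(\<lambda>m. sqrt ((\<Sum>k<n. b k - a k) + real n / real (Suc m))) \<longlonglongrightarrow> sqrt (\<Sum>k<n. b k - a k)"
      using tendsto_real_sqrt[OF tendsto_add[OF tendsto_const tendsto_mult[OF tendsto_const[of "real n"] LIMSEQ_inverse_real_of_nat]]]
      by (simp add: divide_inverse)
    have "(\<Sum>k<n. \<bar>f (grid (Suc m) (B m k)) $ i - f (grid (Suc m) (A m k)) $ i\<bar>) \<le> sqrt ((\<Sum>k<n. b k - a k) + real n / real (Suc m))" for m
    proof -
      define D where "D j = norm (f (grid (Suc m) (Suc j)) - f (grid (Suc m) j))" for j
      have AB: "A m k \<le> B m k" if "k < n" for k
        unfolding A_def B_def using ab[OF that] by (intro nat_mono floor_mono mult_left_mono) auto
      have Bm: "B m k \<le> Suc m" if "k < n" for k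
      proof -
        have "real (Suc m) * b k \<le> real (Suc m) * 1" using ab[OF that] by (intro mult_left_mono) auto
        then show ?thesis unfolding B_def using ab[OF that] by (intro nat_floor_le) auto
      qed
      define J where "J = (\<Union>k<n. {A m k..<B m k})"
      have disj: "{A m k..<B m k} \<inter> {A m l..<B m l} = {}" if "k < n" "l < n" "k \<noteq> l" for k l
      proof -
        have "B m k \<le> A m l \<or> B m l \<le> A m k"
          using H(2)[OF that] unfolding A_def B_def
          by (auto intro!: nat_mono floor_mono mult_left_mono)
        then show ?thesis by auto
      qed
      have tele: "norm (f (grid (Suc m) q) - f (grid (Suc m) p)) \<le> (\<Sum>j\<in>{p..<q}. D j)" if "p \<le> q" for p q
        using that
      proof (induction q rule: dec_induct)
        case (step q)
        have "norm (f (grid (Suc m) (Suc q)) - f (grid (Suc m) p)) \<le> D q + norm (f (grid (Suc m) q) - f (grid (Suc m) p))"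
          unfolding D_def by (rule order_trans[OF _ norm_triangle_ineq]) simp
        then show ?case using step by simp
      qed simp
      have "(\<Sum>k<n. \<bar>f (grid (Suc m) (B m k)) $ i - f (grid (Suc m) (A m k)) $ i\<bar>) \<le> (\<Sum>k<n. \<Sum>j\<in>{A m k..<B m k}. D j)"
      proof (rule sum_mono)
        fix k assume "k \<in> {..<n}"
        then have "norm (f (grid (Suc m) (B m k)) - f (grid (Suc m) (A m k))) \<le> (\<Sum>j\<in>{A m k..<B m k}. D j)"
          using tele AB by auto
        then show "\<bar>f (grid (Suc m) (B m k)) $ i - f (grid (Suc m) (A m k)) $ i\<bar> \<le> (\<Sum>j\<in>{A m k..<B m k}. D j)"
          using component_le_norm_cart[of "f (grid (Suc m) (B m k)) - f (grid (Suc m) (A m k))" i] by simp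
      qed
      also have "\<dots> = (\<Sum>j\<in>J. D j)"
        unfolding J_def by (rule sum.UNION_disjoint[symmetric]) (use disj in auto)
      also have "\<dots> \<le> sqrt (real (card J) / real (Suc m))"
        unfolding D_def by (rule energy_imp_sum_le[OF E]) (use Bm in \<open>fastforce simp: J_def\<close>)+
      also have "\<dots> \<le> sqrt ((\<Sum>k<n. b k - a k) + real n / real (Suc m))"
      proof (rule real_sqrt_le_mono)
        have "card J = (\<Sum>k<n. B m k - A m k)"
          unfolding J_def by (subst card_UN_disjoint) (use disj in auto)
        also have "real \<dots> = (\<Sum>k<n. real (B m k) - real (A m k))"
          using AB by (simp add: of_nat_diff)
        \<comment> \<open>Rounding both endpoints down changes the number of cells by at most one,
          hence the \<open>+ 1\<close>; after division it becomes the vanishing term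
          \<open>n / (m + 1)\<close>.\<close>
        also have "\<dots> \<le> (\<Sum>k<n. real (Suc m) * (b k - a k) + 1)"
        proof (rule sum_mono)
          fix k assume "k \<in> {..<n}"
          then have "0 \<le> a k" "0 \<le> b k" using ab[of k] by auto
          then have "real (B m k) \<le> real (Suc m) * b k" "real (Suc m) * a k - 1 \<le> real (A m k)"
            unfolding A_def B_def using nat_floor_bounds[of "real (Suc m) * b k"] nat_floor_bounds[of "real (Suc m) * a k"] by auto
          then show "real (B m k) - real (A m k) \<le> real (Suc m) * (b k - a k) + 1"
            by (simp add: right_diff_distrib)
        qed
        also have "\<dots> = real (Suc m) * (\<Sum>k<n. b k - a k) + real n" by (simp add: sum.distrib sum_distrib_left)
        finally show "real (card J) / real (Suc m) \<le> (\<Sum>k<n. b k - a k) + real n / real (Suc m)"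
          by (simp add: field_simps del: of_nat_Suc)
      qed
      finally show ?thesis .
    qed
    then show "\<exists>N. \<forall>m\<ge>N. (\<Sum>k<n. \<bar>f (grid (Suc m) (B m k)) $ i - f (grid (Suc m) (A m k)) $ i\<bar>) \<le> sqrt ((\<Sum>k<n. b k - a k) + real n / real (Suc m))"
      by blast
  qed
  note key = this
  show ?thesis
    unfolding abs_cont_on_ac_modulus
  proof (intro allI impI)
    fix e :: real assume e: "e > 0"
    have "ac_modulus {0..1} (\<lambda>t. f t $ i) e (e\<^sup>2)"
      unfolding ac_modulus_def
    proof (intro allI impI, elim conjE)
      fix n and a b :: "nat \<Rightarrow> real"
      assume H: "\<forall>k<n. a k \<le> b k \<and> {a k..b k} \<subseteq> {0..1}"
        "\<forall>k<n. \<forall>l<n. k \<noteq> l \<longrightarrow> b k \<le> a l \<or> b l \<le> a k" "(\<Sum>k<n. b k - a k) < e\<^sup>2"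
      have "(\<Sum>k<n. \<bar>f (b k) $ i - f (a k) $ i\<bar>) \<le> sqrt (\<Sum>k<n. b k - a k)"
        by (rule key) (use H in blast)+
      also have "\<dots> < sqrt (e\<^sup>2)" using H(3) by (rule real_sqrt_less_mono)
      finally show "(\<Sum>k<n. \<bar>f (b k) $ i - f (a k) $ i\<bar>) < e" using e by simp
    qed
    then show "\<exists>d>0. ac_modulus {0..1} (\<lambda>t. f t $ i) e d" using e by (intro exI[of _ "e\<^sup>2"]) simp
  qed
qed

text \<open>Fatou's lemma: \<open>H m\<close> is the squared slope of the polygon on the grid with
  \<open>m + 1\<close> cells, its integral is the grid energy, and it converges to the squared speed
  wherever \<open>f\<close> is differentiable.\<close>

lemma finite_energy_in_U:
  fixes f :: "real \<Rightarrow> real^'n"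
  assumes cont: "continuous_on {0..1} f" and E: "\<And>m. 0 < m \<Longrightarrow> energy m f \<le> 1"
    and f0: "f 0 = 0" "\<And>t. f t $ i0 = 0"
  shows "f \<in> U i0"
proof -
  have ac: "abs_cont_on {0..1} (\<lambda>t. f t $ i)" for i by (rule finite_energy_abs_cont[OF cont E])
  obtain g :: "'n \<Rightarrow> real \<Rightarrow> real" where G: "(\<forall>i. g i \<in> borel_measurable borel) \<and> (\<forall>i a b. set_integrable lborel {a<..b} (g i)) \<and>
    (\<forall>i a b. 0 \<le> a \<longrightarrow> a \<le> b \<longrightarrow> b \<le> 1 \<longrightarrow> (LINT x:{a<..b}|lborel. g i x) = f b $ i - f a $ i) \<and>
    (AE s in lebesgue. s \<in> {0..1} \<longrightarrow> (f has_vector_derivative (\<chi> i. g i s)) (at s))"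
    using abs_cont_vec_derivative[of f, OF ac] by (rule exE)
  note D = conjunct2[OF conjunct2[OF conjunct2[OF G]]]
  define A where "A m k = {grid (Suc m) k..<grid (Suc m) (Suc k)}" for m k
  define d where "d m k = (norm ((f (grid (Suc m) (Suc k)) - f (grid (Suc m) k)) /\<^sub>R (grid (Suc m) (Suc k) - grid (Suc m) k)))\<^sup>2" for m k
  define H where "H m s = (\<Sum>k<Suc m. ennreal (d m k) * indicator (A m k) s)" for m s
  have Am[measurable]: "A m k \<in> sets lebesgue" for m k by (simp add: A_def)
  have hm: "(\<lambda>s. ennreal (d m k) * indicator (A m k) s) \<in> borel_measurable lebesgue" for m k by measurable
  have Hm: "H m \<in> borel_measurable lebesgue" for m
    unfolding H_def by (intro borel_measurable_sum hm)
  have Hi: "(\<integral>\<^sup>+s. H m s \<partial>lebesgue) \<le> 1" for m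
  proof -
    have "(\<integral>\<^sup>+s. H m s \<partial>lebesgue) = (\<Sum>k<Suc m. ennreal (d m k) * emeasure lebesgue (A m k))"
      unfolding H_def by (subst nn_integral_sum) (simp_all only: hm nn_integral_cmult_indicator[OF Am])
    also have "\<dots> = (\<Sum>k<Suc m. ennreal (real (Suc m) * (norm (f (grid (Suc m) (Suc k)) - f (grid (Suc m) k)))\<^sup>2))"
    proof (rule sum.cong[OF refl])
      fix k
      have "emeasure lebesgue (A m k) = ennreal (1 / real (Suc m))"
        using grid_diff[of "Suc m" k] grid_less[of "Suc m" k] by (simp add: A_def less_imp_le)
      moreover have "d m k = (real (Suc m))\<^sup>2 * (norm (f (grid (Suc m) (Suc k)) - f (grid (Suc m) k)))\<^sup>2"
        using grid_diff[of "Suc m" k] by (simp add: d_def power_mult_distrib del: of_nat_Suc)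
      ultimately show "ennreal (d m k) * emeasure lebesgue (A m k) = ennreal (real (Suc m) * (norm (f (grid (Suc m) (Suc k)) - f (grid (Suc m) k)))\<^sup>2)"
        by (simp add: ennreal_mult[symmetric] power2_eq_square del: of_nat_Suc)
    qed
    also have "\<dots> = ennreal (energy (Suc m) f)"
      unfolding energy_def by (rule sum_ennreal) auto
    finally show ?thesis using E[of "Suc m"] by simp
  qed
  have lim: "H m s = ennreal (d m (nat \<lfloor>real (Suc m) * s\<rfloor>))" if s: "0 \<le> s" "s < 1" for m s
  proof -
    let ?k = "nat \<lfloor>real (Suc m) * s\<rfloor>"
    have "real (Suc m) * s < real (Suc m) * 1" using s by (intro mult_strict_left_mono) auto
    then have k: "?k < Suc m" using s by (intro nat_floor_less) auto
    have in_iff: "s \<in> A m j \<longleftrightarrow> j = ?k" for j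
    proof -
      have "s \<in> A m j \<longleftrightarrow> real j \<le> real (Suc m) * s \<and> real (Suc m) * s < real j + 1"
        by (simp add: A_def grid_def field_simps del: of_nat_Suc) (simp add: field_simps)
      also have "\<dots> \<longleftrightarrow> \<lfloor>real (Suc m) * s\<rfloor> = int j" by (simp add: floor_eq_iff)
      also have "\<dots> \<longleftrightarrow> j = ?k" using s by (auto simp: nat_eq_iff2)
      finally show ?thesis .
    qed
    have "H m s = (\<Sum>j<Suc m. if j = ?k then ennreal (d m j) else 0)"
      unfolding H_def by (rule sum.cong) (auto simp: indicator_def in_iff)
    also have "\<dots> = ennreal (d m ?k)" using k by (subst sum.delta) auto
    finally show ?thesis .
  qed
  have "(\<integral>\<^sup>+ s\<in>{0..1}. ennreal ((norm (vector_derivative f (at s)))\<^sup>2) \<partial>lebesgue) \<le> (\<integral>\<^sup>+s. liminf (\<lambda>m. H m s) \<partial>lebesgue)"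
  proof (rule nn_integral_mono_AE)
    \<comment> \<open>The cells are half-open, so none of them contains the point 1; it is discarded
      as a null set.\<close>
    have "{1::real} \<in> null_sets lebesgue" using negligible_sing negligible_iff_null_sets by blast
    then have "AE s in lebesgue. s \<notin> {1::real}" by (rule AE_not_in)
    with D show "AE s in lebesgue. ennreal ((norm (vector_derivative f (at s)))\<^sup>2) * indicator {0..1} s \<le> liminf (\<lambda>m. H m s)"
    proof (rule AE_mp[OF AE_conjI AE_I2, rule_format], elim conjE)
      fix s :: real
      assume 1: "s \<in> {0..1} \<longrightarrow> (f has_vector_derivative (\<chi> i. g i s)) (at s)" and 2: "s \<notin> {1}"
      show "ennreal ((norm (vector_derivative f (at s)))\<^sup>2) * indicator {0..1} s \<le> liminf (\<lambda>m. H m s)"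
      proof (cases "s \<in> {0..1}")
        case True
        then have s: "0 \<le> s" "s < 1" using 2 by auto
        let ?v = "\<chi> i. g i s" let ?k = "\<lambda>m. nat \<lfloor>real (Suc m) * s\<rfloor>"
        have hv: "(f has_vector_derivative ?v) (at s)" using 1 True by blast
        have "(\<lambda>m. (f (grid (Suc m) (Suc (?k m))) - f (grid (Suc m) (?k m))) /\<^sub>R (grid (Suc m) (Suc (?k m)) - grid (Suc m) (?k m))) \<longlonglongrightarrow> ?v"
        proof (rule vector_derivative_straddle[OF hv])
          show "(\<lambda>m. grid (Suc m) (?k m)) \<longlonglongrightarrow> s" by (rule floor_grid_tendsto[OF s(1)])
          show "(\<lambda>m. grid (Suc m) (Suc (?k m))) \<longlonglongrightarrow> s" by (rule floor_grid_Suc_tendsto[OF s(1)])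
          show "grid (Suc m) (?k m) < grid (Suc m) (Suc (?k m))" for m by (rule grid_less) simp
          have *: "real (?k m) \<le> real (Suc m) * s" "real (Suc m) * s \<le> real (Suc (?k m))" for m
            using s by (auto simp: of_nat_nat) linarith+
          show "grid (Suc m) (?k m) \<le> s" "s \<le> grid (Suc m) (Suc (?k m))" for m
            using *[of m] by (simp_all add: grid_def field_simps del: of_nat_Suc)
        qed
        then have "(\<lambda>m. d m (?k m)) \<longlonglongrightarrow> (norm ?v)\<^sup>2"
          unfolding d_def by (intro tendsto_power tendsto_norm)
        then have "(\<lambda>m. ennreal (d m (?k m))) \<longlonglongrightarrow> ennreal ((norm ?v)\<^sup>2)" by (rule tendsto_ennrealI)
        then have "(\<lambda>m. H m s) \<longlonglongrightarrow> ennreal ((norm ?v)\<^sup>2)" using lim[OF s] by simp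
        then have "liminf (\<lambda>m. H m s) = ennreal ((norm ?v)\<^sup>2)" by (intro lim_imp_Liminf) auto
        then show ?thesis using True vector_derivative_at[OF hv] by simp
      qed simp
    qed
  qed
  also have "\<dots> \<le> liminf (\<lambda>m. \<integral>\<^sup>+s. H m s \<partial>lebesgue)" by (rule nn_integral_liminf[OF Hm])
  also have "\<dots> \<le> 1"
    by (rule order_trans[OF Liminf_le_Limsup Limsup_bounded]) (use Hi in auto)
  finally show ?thesis using ac f0 by (simp add: U_def)
qed

section \<open>The square root of a positive semidefinite matrix\<close>

text \<open>First variation: a quadratic without constant term that is never positive has no linear
  term. It makes maximisers of a quadratic form eigenvectors and later determines the maximisers of
  functionals.\<close>

lemma quadratic_nonpos_imp_zero:
  fixes a b :: real
  assumes "\<And>t. t * a + t\<^sup>2 * b \<le> 0"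
  shows "a = 0"
proof (rule ccontr)
  assume a: "a \<noteq> 0"
  \<comment> \<open>Since \<open>d + b > 0\<close>, the value at \<open>t = a / d\<close>, which is
    \<open>(a / d)^2 * (d + b)\<close>, is positive.\<close>
  define d where "d = 2 * (\<bar>b\<bar> + 1)"
  have d: "d > 0" "d + b > 0" by (auto simp: d_def abs_if)
  define t where "t = a / d"
  have "t * a + t\<^sup>2 * b = (a / d)\<^sup>2 * (d + b)"
    using d(1) by (simp add: t_def power2_eq_square field_simps)
  then have "t * a + t\<^sup>2 * b > 0" using a d by simp
  with assms[of t] show False by simp
qed

text \<open>Induction on the dimension: the quadratic form attains its maximum on the unit sphere of
  \<open>S\<close>, the maximiser is an eigenvector by first variation, and its orthogonal
  complement in \<open>S\<close> is again invariant.\<close>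

lemma self_adjoint_eigenbasis:
  fixes f :: "'a::euclidean_space \<Rightarrow> 'a"
  assumes lin: "linear f" and sa: "\<And>x y. f x \<bullet> y = x \<bullet> f y"
    and S: "subspace S" and inv: "f ` S \<subseteq> S"
  shows "\<exists>B. B \<subseteq> S \<and> finite B \<and> pairwise orthogonal B \<and> (\<forall>v\<in>B. norm v = 1 \<and> f v = (v \<bullet> f v) *\<^sub>R v) \<and>
           (\<forall>x\<in>S. (\<Sum>v\<in>B. (x \<bullet> v) *\<^sub>R v) = x)"
  using S inv
proof (induction "dim S" arbitrary: S rule: less_induct)
  case less
  interpret linear f by (rule lin)
  show ?case
  proof (cases "S = {0}")
    case True then show ?thesis by (intro exI[of _ "{}"]) auto
  next
    case False
    have "0 \<in> S" using less(2) by (rule subspace_0)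
    with False obtain x0 where x0: "x0 \<in> S" "x0 \<noteq> 0" by blast
    let ?K = "sphere 0 1 \<inter> S"
    have "compact ?K" using less(2) by (intro compact_Int_closed closed_subspace) auto
    moreover have "x0 /\<^sub>R norm x0 \<in> ?K" using x0 less(2) by (auto intro: subspace_scale)
    moreover have "continuous_on ?K (\<lambda>x. x \<bullet> f x)"
      by (intro continuous_on_inner continuous_on_id linear_continuous_on) (use lin linear_conv_bounded_linear in blast)
    ultimately obtain v where v: "v \<in> ?K" "\<And>x. x \<in> ?K \<Longrightarrow> x \<bullet> f x \<le> v \<bullet> f v"
      using continuous_attains_sup[of ?K "\<lambda>x. x \<bullet> f x"] by blast
    define l where "l = v \<bullet> f v"
    have v1: "norm v = 1" "v \<in> S" "v \<bullet> v = 1" using v(1) by (auto simp: norm_eq_1)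
    have ql: "x \<bullet> f x \<le> l * (x \<bullet> x)" if "x \<in> S" for x
    proof (cases "x = 0")
      case False
      have "x /\<^sub>R norm x \<in> ?K" using that False less(2) by (auto intro: subspace_scale)
      from v(2)[OF this] have "(x \<bullet> f x) / (norm x)\<^sup>2 \<le> l"
        by (simp add: l_def scale power2_eq_square divide_inverse mult.assoc mult.commute mult.left_commute)
      then show ?thesis using False by (simp add: divide_le_eq power2_norm_eq_inner)
    qed (simp add: zero)
    have orth: "w \<bullet> f v = 0" if w: "w \<in> S" "w \<bullet> v = 0" for w
    proof -
      \<comment> \<open>Comparing \<open>v + t w\<close> with the maximum, the terms free of
        \<open>t\<close> cancel, and the linear term is twice
        \<open>w \<bullet> f v\<close>.\<close>
      have "t * (2 * (w \<bullet> f v)) + t\<^sup>2 * (w \<bullet> f w - l * (w \<bullet> w)) \<le> 0" for t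
      proof -
        have "v + t *\<^sub>R w \<in> S" using v1 w less(2) by (intro subspace_add subspace_scale)
        from ql[OF this] have "(v + t *\<^sub>R w) \<bullet> f (v + t *\<^sub>R w) \<le> l * ((v + t *\<^sub>R w) \<bullet> (v + t *\<^sub>R w))" .
        moreover have "v \<bullet> f w = w \<bullet> f v" using sa[of v w] by (simp add: inner_commute)
        moreover have "v \<bullet> w = 0" using w(2) by (simp add: inner_commute)
        ultimately show ?thesis using w(2) v1(3)
          by (simp add: add scale inner_add_left inner_add_right l_def[symmetric] power2_eq_square algebra_simps)
      qed
      from quadratic_nonpos_imp_zero[OF this] show ?thesis by simp
    qed
    have fv: "f v = l *\<^sub>R v"
    proof -
      let ?w = "f v - l *\<^sub>R v"
      have wS: "?w \<in> S" using v1(2) less(2,3) by (auto intro!: subspace_diff subspace_scale)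
      have wv: "?w \<bullet> v = 0" using v1(3) by (simp only: inner_diff_left inner_scaleR_left) (simp add: l_def inner_commute)
      have "?w \<bullet> ?w = ?w \<bullet> f v - l * (?w \<bullet> v)" by (simp add: inner_diff_right)
      then have "?w \<bullet> ?w = 0" using orth[OF wS wv] wv by simp
      then show ?thesis by simp
    qed
    define T where "T = {x \<in> S. x \<bullet> v = 0}"
    have T: "subspace T" using less(2) unfolding T_def subspace_def by (auto simp: inner_add_left)
    have Tinv: "f ` T \<subseteq> T" using less(3) fv by (auto simp: T_def sa)
    have "v \<notin> T" using v1(3) by (simp add: T_def)
    then have TS: "T \<subset> S" using v1(2) unfolding T_def by blast
    then have "dim T < dim S" using T less(2) by (metis dim_psubset span_eq_iff)
    from less(1)[OF this T Tinv] obtain B where B: "B \<subseteq> T" "finite B" "pairwise orthogonal B"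
      "\<forall>v\<in>B. norm v = 1 \<and> f v = (v \<bullet> f v) *\<^sub>R v" "\<forall>x\<in>T. (\<Sum>v\<in>B. (x \<bullet> v) *\<^sub>R v) = x" by blast
    have Bv: "u \<bullet> v = 0" if "u \<in> B" for u using that B(1) by (auto simp: T_def)
    then have vB: "v \<notin> B" using v1(3) by auto
    have "(\<Sum>u\<in>insert v B. (x \<bullet> u) *\<^sub>R u) = x" if "x \<in> S" for x
    proof -
      let ?y = "x - (x \<bullet> v) *\<^sub>R v"
      have "?y \<in> T" using that v1 less(2) by (auto simp: T_def inner_diff_left intro: subspace_diff subspace_scale)
      then have "(\<Sum>u\<in>B. (?y \<bullet> u) *\<^sub>R u) = ?y" using B(5) by blast
      moreover have "(\<Sum>u\<in>B. (?y \<bullet> u) *\<^sub>R u) = (\<Sum>u\<in>B. (x \<bullet> u) *\<^sub>R u)"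
        by (rule sum.cong) (use Bv in \<open>auto simp: inner_diff_left inner_commute[of v]\<close>)
      ultimately have "(\<Sum>u\<in>B. (x \<bullet> u) *\<^sub>R u) = ?y" by simp
      then show ?thesis using B(2) vB by simp
    qed
    moreover have "pairwise orthogonal (insert v B)"
      using B(3) Bv by (auto simp: pairwise_insert orthogonal_def inner_commute)
    moreover have "f v = (v \<bullet> f v) *\<^sub>R v" using fv by (simp add: l_def)
    ultimately show ?thesis using B v1 TS by (intro exI[of _ "insert v B"]) auto
  qed
qed

lemma symmetric_matrix_iff: "transpose A = A \<longleftrightarrow> (\<forall>x y. (A *v x) \<bullet> y = x \<bullet> (A *v y))"
  for A :: "real^'n^'n"
proof
  assume "transpose A = A"
  then show "\<forall>x y. (A *v x) \<bullet> y = x \<bullet> (A *v y)"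
    by (metis dot_lmul_matrix transpose_matrix_vector)
next
  assume H: "\<forall>x y. (A *v x) \<bullet> y = x \<bullet> (A *v y)"
  have "transpose A *v x = A *v x" for x
  proof -
    have "(transpose A *v x - A *v x) \<bullet> y = 0" for y
    proof -
      have "(transpose A *v x) \<bullet> y = x \<bullet> (A *v y)" by (metis dot_lmul_matrix transpose_matrix_vector)
      then show ?thesis using H by (simp add: inner_diff_left)
    qed
    then have "transpose A *v x - A *v x = 0" by (metis inner_eq_zero_iff)
    then show ?thesis by simp
  qed
  then show "transpose A = A" by (simp add: matrix_eq)
qed

definition orthonormal_eigenbasis :: "real^'n^'n \<Rightarrow> (real^'n) set \<Rightarrow> bool" where
  "orthonormal_eigenbasis A B \<longleftrightarrow> finite B \<and> pairwise orthogonal B \<and>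
     (\<forall>v\<in>B. norm v = 1 \<and> A *v v = (v \<bullet> (A *v v)) *\<^sub>R v) \<and> (\<forall>x. (\<Sum>v\<in>B. (x \<bullet> v) *\<^sub>R v) = x)"

lemma orthonormal_eigenbasisD:
  assumes "orthonormal_eigenbasis A B"
  shows "finite B" "pairwise orthogonal B" "v \<in> B \<Longrightarrow> norm v = 1"
    "v \<in> B \<Longrightarrow> A *v v = (v \<bullet> (A *v v)) *\<^sub>R v" "(\<Sum>v\<in>B. (x \<bullet> v) *\<^sub>R v) = x"
  using assms unfolding orthonormal_eigenbasis_def by blast+

lemma psd_eigenbasis:
  fixes A :: "real^'n^'n"
  assumes "psd A"
  shows "\<exists>B. orthonormal_eigenbasis A B"
proof -
  have sa: "(A *v x) \<bullet> y = x \<bullet> (A *v y)" for x y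
    using assms unfolding psd_def symmetric_matrix_iff by blast
  have "\<exists>B. B \<subseteq> UNIV \<and> finite B \<and> pairwise orthogonal B \<and> (\<forall>v\<in>B. norm v = 1 \<and> A *v v = (v \<bullet> (A *v v)) *\<^sub>R v) \<and>
           (\<forall>x\<in>UNIV. (\<Sum>v\<in>B. (x \<bullet> v) *\<^sub>R v) = x)"
    by (rule self_adjoint_eigenbasis[OF matrix_vector_mul_linear sa]) auto
  then show ?thesis unfolding orthonormal_eigenbasis_def by blast
qed

text \<open>The function \<open>\<phi>\<close> is indexed by basis vectors, so that equal
  eigenvalues need no grouping. The root and its pseudo-inverse are the two instances.\<close>

lemma psd_functional_calculus:
  fixes A :: "real^'n^'n"
  assumes BB: "orthonormal_eigenbasis A B"
  shows "\<exists>R :: real^'n^'n. transpose R = R \<and> (\<forall>v\<in>B. R *v v = \<phi> v *\<^sub>R v) \<and>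
    (\<forall>x. R *v x = (\<Sum>v\<in>B. (\<phi> v * (x \<bullet> v)) *\<^sub>R v)) \<and> (\<forall>x. x \<bullet> (R *v x) = (\<Sum>v\<in>B. \<phi> v * (x \<bullet> v)\<^sup>2))"
proof -
  note B = orthonormal_eigenbasisD[OF BB]
  define s where "s x = (\<Sum>v\<in>B. (\<phi> v * (x \<bullet> v)) *\<^sub>R v)" for x :: "real^'n"
  have "linear s" by (rule linearI) (simp_all add: s_def inner_add_left algebra_simps sum.distrib scaleR_sum_right)
  then have R: "matrix s *v x = s x" for x by (simp add: matrix_works)
  have xs: "y \<bullet> s x = (\<Sum>v\<in>B. \<phi> v * (x \<bullet> v) * (y \<bullet> v))" for x y
    by (simp add: s_def inner_sum_right)
  show ?thesis
  proof (intro exI[of _ "matrix s"] conjI allI ballI)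
    show "transpose (matrix s) = matrix s"
      unfolding symmetric_matrix_iff R by (simp add: xs inner_commute[of "s _"] mult.commute mult.left_commute)
    show "matrix s *v x = (\<Sum>v\<in>B. (\<phi> v * (x \<bullet> v)) *\<^sub>R v)" for x by (simp add: R s_def)
    show "x \<bullet> (matrix s *v x) = (\<Sum>v\<in>B. \<phi> v * (x \<bullet> v)\<^sup>2)" for x by (simp add: R xs power2_eq_square mult.assoc)
    show "matrix s *v v = \<phi> v *\<^sub>R v" if v: "v \<in> B" for v
    proof -
      have "s v = (\<Sum>u\<in>B. if u = v then \<phi> v *\<^sub>R v else 0)"
        unfolding s_def
      proof (rule sum.cong[OF refl])
        fix u assume u: "u \<in> B"
        show "(\<phi> u * (v \<bullet> u)) *\<^sub>R u = (if u = v then \<phi> v *\<^sub>R v else 0)"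
        proof (cases "u = v")
          case True then show ?thesis using B(3)[OF v] by (simp add: norm_eq_1)
        next
          case False
          then have "v \<bullet> u = 0" using pairwiseD[OF B(2) v u] by (simp add: orthogonal_def)
          then show ?thesis using False by simp
        qed
      qed
      then show ?thesis using v B(1) by (simp add: R)
    qed
  qed
qed

text \<open>For an eigenvector \<open>v\<close> of \<open>R\<close> with value \<open>b\<close>, the
  vector \<open>w = T v - b v\<close> satisfies \<open>T w = - b w\<close>. If \<open>b > 0\<close>,
  positivity of \<open>T\<close> forces \<open>w = 0\<close>; if \<open>b = 0\<close>, then
  \<open>T (T v) = 0\<close> and symmetry gives \<open>T v = 0\<close>. So \<open>T\<close> and
  \<open>R\<close> agree on a basis.\<close>

lemma psd_sqrt_unique:
  fixes A R T :: "real^'n^'n"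
  assumes R: "psd R" "R ** R = A" and T: "psd T" "T ** T = A"
  shows "T = R"
proof -
  obtain B where BB: "orthonormal_eigenbasis R B" using psd_eigenbasis[OF R(1)] by blast
  note B = orthonormal_eigenbasisD[OF BB]
  have saT: "(T *v x) \<bullet> y = x \<bullet> (T *v y)" for x y
    using T(1) unfolding psd_def symmetric_matrix_iff by blast
  have eig: "T *v v = R *v v" if v: "v \<in> B" for v
  proof -
    define b where "b = v \<bullet> (R *v v)"
    have b0: "b \<ge> 0" using R(1) by (simp add: b_def psd_def)
    have Rv: "R *v v = b *\<^sub>R v" using B(4)[OF v] by (simp add: b_def)
    have "T *v (T *v v) = R *v (R *v v)" using R(2) T(2) by (metis matrix_vector_mul_assoc)
    then have TT: "T *v (T *v v) = (b * b) *\<^sub>R v" by (simp add: Rv matrix_vector_mult_scaleR)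
    define w where "w = T *v v - b *\<^sub>R v"
    have "T *v w = - (b *\<^sub>R w)"
      by (simp add: w_def matrix_vector_mult_diff_distrib TT matrix_vector_mult_scaleR algebra_simps)
    then have "w \<bullet> (T *v w) = - b * (w \<bullet> w)" by simp
    moreover have "w \<bullet> (T *v w) \<ge> 0" using T(1) by (simp add: psd_def)
    ultimately have bw: "b * (w \<bullet> w) \<le> 0" by simp
    show ?thesis
    proof (cases "b = 0")
      case True
      then have "(T *v v) \<bullet> (T *v v) = 0" using saT[of v "T *v v"] TT by simp
      then show ?thesis using Rv True by simp
    next
      case False
      then have "w \<bullet> w \<le> 0" using bw b0 by (simp add: mult_le_0_iff)
      then have "w = 0" by (metis inner_eq_zero_iff inner_ge_zero order_antisym)
      then show ?thesis using Rv by (simp add: w_def)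
    qed
  qed
  have "T *v x = R *v x" for x
  proof -
    have "M *v x = (\<Sum>v\<in>B. (x \<bullet> v) *\<^sub>R (M *v v))" for M :: "real^'n^'n"
    proof -
      have "M *v x = M *v (\<Sum>v\<in>B. (x \<bullet> v) *\<^sub>R v)" using B(5)[of x] by simp
      also have "\<dots> = (\<Sum>v\<in>B. (x \<bullet> v) *\<^sub>R (M *v v))"
        using B(1) by (simp add: linear_sum[OF matrix_vector_mul_linear] matrix_vector_mult_scaleR)
      finally show ?thesis .
    qed
    then show ?thesis using eig by simp
  qed
  then show ?thesis by (simp add: matrix_eq)
qed

text \<open>The matrix \<open>G\<close> is the pseudo-inverse of the root: it maps into the
  orthogonal complement of the kernel of \<open>A\<close> and is a right inverse of the root on that
  complement.\<close>

lemma psd_matrix_sqrt: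
  fixes A :: "real^'n^'n"
  assumes A: "psd A"
  shows "psd (matrix_sqrt A)" "matrix_sqrt A ** matrix_sqrt A = A"
    and "\<exists>G::real^'n^'n. \<forall>x. (\<forall>z. A *v z = 0 \<longrightarrow> (G *v x) \<bullet> z = 0) \<and>
           ((\<forall>z. A *v z = 0 \<longrightarrow> x \<bullet> z = 0) \<longrightarrow> matrix_sqrt A *v (G *v x) = x)"
proof -
  obtain B where BB: "orthonormal_eigenbasis A B" using psd_eigenbasis[OF A] by blast
  note B = orthonormal_eigenbasisD[OF BB]
  define l where "l v = v \<bullet> (A *v v)" for v
  have l0: "l v \<ge> 0" for v using A by (simp add: l_def psd_def)
  have lin: "M *v x = (\<Sum>v\<in>B. (x \<bullet> v) *\<^sub>R (M *v v))" for M :: "real^'n^'n" and x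
  proof -
    have "M *v x = M *v (\<Sum>v\<in>B. (x \<bullet> v) *\<^sub>R v)" using B(5)[of x] by simp
    also have "\<dots> = (\<Sum>v\<in>B. (x \<bullet> v) *\<^sub>R (M *v v))"
      using B(1) by (simp add: linear_sum[OF matrix_vector_mul_linear] matrix_vector_mult_scaleR)
    finally show ?thesis .
  qed
  obtain R :: "real^'n^'n" where R': "transpose R = R \<and> (\<forall>v\<in>B. R *v v = (sqrt (l v)) *\<^sub>R v) \<and>
    (\<forall>x. R *v x = (\<Sum>v\<in>B. (sqrt (l v) * (x \<bullet> v)) *\<^sub>R v)) \<and> (\<forall>x. x \<bullet> (R *v x) = (\<Sum>v\<in>B. sqrt (l v) * (x \<bullet> v)\<^sup>2))"
    using psd_functional_calculus[OF BB, of "\<lambda>v. sqrt (l v)"] by (rule exE)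
  note R = conjunct1[OF R'] bspec[OF conjunct1[OF conjunct2[OF R']]] spec[OF conjunct1[OF conjunct2[OF conjunct2[OF R']]]]
    spec[OF conjunct2[OF conjunct2[OF conjunct2[OF R']]]]
  have pR: "psd R" using R(1) by (simp add: psd_def R(4) sum_nonneg l0)
  have "(R ** R) *v x = A *v x" for x
  proof -
    have "(R ** R) *v v = A *v v" if "v \<in> B" for v
      using B(4)[OF that] l0[of v] by (simp add: R(2)[OF that] matrix_vector_mul_assoc[symmetric] matrix_vector_mult_scaleR l_def)
    then show ?thesis using lin[of "R ** R" x] lin[of A x] by simp
  qed
  then have RA: "R ** R = A" by (simp add: matrix_eq)
  have sq: "matrix_sqrt A = R"
    unfolding matrix_sqrt_def
  proof (rule the_equality)
    show "psd R \<and> R ** R = A" using pR RA ..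
    show "T = R" if "psd T \<and> T ** T = A" for T
      using psd_sqrt_unique[OF pR RA conjunct1[OF that] conjunct2[OF that]] .
  qed
  then show "psd (matrix_sqrt A)" "matrix_sqrt A ** matrix_sqrt A = A" using pR RA by auto
  \<comment> \<open>As \<open>inverse 0 = 0\<close>, eigenvectors with eigenvalue 0 are sent to 0,
    as a pseudo-inverse has to do.\<close>
  obtain G :: "real^'n^'n" where G': "transpose G = G \<and> (\<forall>v\<in>B. G *v v = (inverse (sqrt (l v))) *\<^sub>R v) \<and>
    (\<forall>x. G *v x = (\<Sum>v\<in>B. (inverse (sqrt (l v)) * (x \<bullet> v)) *\<^sub>R v)) \<and> (\<forall>x. x \<bullet> (G *v x) = (\<Sum>v\<in>B. inverse (sqrt (l v)) * (x \<bullet> v)\<^sup>2))"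
    using psd_functional_calculus[OF BB, of "\<lambda>v. inverse (sqrt (l v))"] by (rule exE)
  note G = conjunct1[OF G'] bspec[OF conjunct1[OF conjunct2[OF G']]] spec[OF conjunct1[OF conjunct2[OF conjunct2[OF G']]]]
    spec[OF conjunct2[OF conjunct2[OF conjunct2[OF G']]]]
  have ker: "A *v v = 0" if "v \<in> B" "l v = 0" for v using B(4)[OF that(1)] that(2) by (simp add: l_def)
  have saA: "(A *v x) \<bullet> y = x \<bullet> (A *v y)" for x y
    using A unfolding psd_def symmetric_matrix_iff by blast
  have "(G *v x) \<bullet> z = 0" if z: "A *v z = 0" for x z
  proof -
    have "inverse (sqrt (l v)) * (x \<bullet> v) * (v \<bullet> z) = 0" if v: "v \<in> B" for v
    proof (cases "l v = 0")
      case False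
      have "l v * (v \<bullet> z) = (A *v v) \<bullet> z" using B(4)[OF v] by (metis inner_scaleR_left l_def)
      also have "\<dots> = 0" using saA z by simp
      finally show ?thesis using False by simp
    qed simp
    then show ?thesis unfolding G(3) inner_sum_left by (intro sum.neutral) simp
  qed
  moreover have "R *v (G *v x) = x" if x: "\<forall>z. A *v z = 0 \<longrightarrow> x \<bullet> z = 0" for x
  proof -
    have "R *v (G *v x) = (\<Sum>v\<in>B. (x \<bullet> v) *\<^sub>R (R *v (G *v v)))" using lin[of "R ** G" x] by (simp add: matrix_vector_mul_assoc)
    also have "\<dots> = (\<Sum>v\<in>B. (x \<bullet> v) *\<^sub>R v)"
    proof (rule sum.cong[OF refl])
      fix v assume v: "v \<in> B"
      show "(x \<bullet> v) *\<^sub>R (R *v (G *v v)) = (x \<bullet> v) *\<^sub>R v"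
      proof (cases "l v = 0")
        case True then show ?thesis using x ker[OF v] by simp
      next
        case False
        then show ?thesis using l0[of v] by (simp add: G(2)[OF v] R(2)[OF v] matrix_vector_mult_scaleR)
      qed
    qed
    also have "\<dots> = x" using B(5)[of x] by simp
    finally show ?thesis .
  qed
  ultimately show "\<exists>G::real^'n^'n. \<forall>x. (\<forall>z. A *v z = 0 \<longrightarrow> (G *v x) \<bullet> z = 0) \<and>
           ((\<forall>z. A *v z = 0 \<longrightarrow> x \<bullet> z = 0) \<longrightarrow> matrix_sqrt A *v (G *v x) = x)"
    unfolding sq by blast
qed

section \<open>The limit set described by linear functionals\<close>

definition incr :: "nat \<Rightarrow> nat \<Rightarrow> (real \<Rightarrow> 'a::real_normed_vector) \<Rightarrow> 'a" where
  "incr m k g = g (grid m (Suc k)) - g (grid m k)"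

definition lin_fun :: "nat \<Rightarrow> (nat \<Rightarrow> 'a::real_inner) \<Rightarrow> (real \<Rightarrow> 'a) \<Rightarrow> real" where
  "lin_fun m c g = (\<Sum>k<m. c k \<bullet> incr m k g)"

definition sdev :: "real^'n^'n \<Rightarrow> nat \<Rightarrow> (nat \<Rightarrow> real^'n) \<Rightarrow> real" where
  "sdev A m c = sqrt ((\<Sum>k<m. c k \<bullet> (A *v c k)) / real m)"

text \<open>Only the values on \<open>[0,1]\<close> are restricted, which is why paths are later
  identified up to \<open>restrict\<close>.\<close>

definition strassen_set :: "real^'n^'n \<Rightarrow> (real \<Rightarrow> real^'n) set" where
  "strassen_set A = {g \<in> C0. \<forall>m>0. \<forall>c. lin_fun m c g \<le> sdev A m c}"

lemma energy_incr: "energy m f = (\<Sum>k<m. real m * (norm (incr m k f))\<^sup>2)"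
  by (simp add: energy_def incr_def)

lemma psd_sqrt_norm:
  fixes A :: "real^'n^'n"
  assumes A: "psd A"
  shows "(matrix_sqrt A *v x) \<bullet> y = x \<bullet> (matrix_sqrt A *v y)"
    and "x \<bullet> (A *v x) = (norm (matrix_sqrt A *v x))\<^sup>2"
proof -
  show sa: "(matrix_sqrt A *v x) \<bullet> y = x \<bullet> (matrix_sqrt A *v y)" for x y
    using psd_matrix_sqrt(1)[OF A] unfolding psd_def symmetric_matrix_iff by blast
  have "A *v x = matrix_sqrt A *v (matrix_sqrt A *v x)"
    using psd_matrix_sqrt(2)[OF A] by (metis matrix_vector_mul_assoc)
  then show "x \<bullet> (A *v x) = (norm (matrix_sqrt A *v x))\<^sup>2" by (simp add: power2_norm_eq_inner sa)
qed

lemma U_continuous: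
  assumes "f \<in> U i0" shows "continuous_on {0..1} f"
proof -
  have "continuous_on {0..1} (\<lambda>t. f t $ i)" for i
    by (rule abs_cont_on_imp_continuous_on) (use assms in \<open>auto simp: U_def\<close>)
  then have "continuous_on {0..1} (\<lambda>t. \<chi> i. f t $ i)" by (rule continuous_on_vec_lambda)
  then show ?thesis by simp
qed

text \<open>Symmetry moves the root onto the coefficients; Cauchy-Schwarz over the grid then
  separates \<open>sdev\<close> from the energy of \<open>f\<close>, which is at most 1.\<close>

lemma sqrt_image_in_strassen_set:
  fixes A :: "real^'n^'n"
  assumes A: "psd A" and f: "f \<in> U i0"
  shows "(\<lambda>t. matrix_sqrt A *v f t) \<in> strassen_set A"
proof -
  let ?R = "matrix_sqrt A"
  have "continuous_on {0..1} (\<lambda>t. ?R *v f t)"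
    by (rule linear_continuous_on_compose[OF U_continuous[OF f] matrix_vector_mul_linear])
  then have C0: "(\<lambda>t. ?R *v f t) \<in> C0" using f by (simp add: C0_def U_def)
  have "lin_fun m c (\<lambda>t. ?R *v f t) \<le> sdev A m c" if m: "m > 0" for m c
  proof -
    define p where "p k = norm (?R *v c k)" for k
    define q where "q k = norm (incr m k f)" for k
    have "lin_fun m c (\<lambda>t. ?R *v f t) = (\<Sum>k<m. (?R *v c k) \<bullet> incr m k f)"
      unfolding lin_fun_def incr_def by (rule sum.cong) (simp_all add: psd_sqrt_norm(1)[OF A] matrix_vector_mult_diff_distrib)
    also have "\<dots> \<le> (\<Sum>k<m. p k * q k)"
      unfolding p_def q_def by (rule sum_mono) (rule norm_cauchy_schwarz)
    also have "\<dots> \<le> sqrt ((\<Sum>k<m. (p k)\<^sup>2) * (\<Sum>k<m. (q k)\<^sup>2))"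
      by (rule real_le_rsqrt) (rule Cauchy_Schwarz_ineq_sum)
    also have "\<dots> \<le> sqrt ((\<Sum>k<m. (p k)\<^sup>2) * (1 / real m))"
    proof (intro real_sqrt_le_mono mult_left_mono sum_nonneg)
      have "real m * (\<Sum>k<m. (q k)\<^sup>2) \<le> 1"
        using U_energy[OF f m] by (simp add: energy_incr q_def sum_distrib_left)
      then show "(\<Sum>k<m. (q k)\<^sup>2) \<le> 1 / real m" using m by (simp add: field_simps)
    qed simp
    also have "\<dots> = sdev A m c" by (simp add: sdev_def p_def psd_sqrt_norm(2)[OF A])
    finally show ?thesis .
  qed
  with C0 show ?thesis by (simp add: strassen_set_def)
qed

text \<open>A kernel vector \<open>y\<close> placed on the first \<open>k\<close> cells gives a
  functional of variance zero that telescopes to \<open>y \<bullet> g (grid m k)\<close>. Both signs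
  of the vector give equality at grid points, and continuity carries it to all times.\<close>

lemma strassen_set_kernel:
  fixes A :: "real^'n^'n"
  assumes g: "g \<in> strassen_set A" and x: "A *v x = 0" and t: "t \<in> {0..1}"
  shows "g t \<bullet> x = 0"
proof -
  have g0: "g 0 = 0" and gc: "continuous_on {0..1} g" using g by (auto simp: strassen_set_def C0_def)
  have *: "g (grid m k) \<bullet> y \<le> 0" if m: "m > 0" and k: "k \<le> m" and y: "A *v y = 0" for m k y
  proof -
    have "lin_fun m (\<lambda>j. if j < k then y else 0) g \<le> sdev A m (\<lambda>j. if j < k then y else 0)"
      using g m by (simp add: strassen_set_def)
    also have "sdev A m (\<lambda>j. if j < k then y else 0) = 0"
    proof -
      have "(\<Sum>j<m. (if j < k then y else 0) \<bullet> (A *v (if j < k then y else 0))) = 0"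
        by (rule sum.neutral) (use y in auto)
      then show ?thesis by (simp only: sdev_def) simp
    qed
    also have "lin_fun m (\<lambda>j. if j < k then y else 0) g = (\<Sum>j<k. y \<bullet> incr m j g)"
      unfolding lin_fun_def using k by (intro sum.mono_neutral_cong_right) auto
    also have "\<dots> = y \<bullet> (\<Sum>j<k. g (grid m (Suc j)) - g (grid m j))"
      by (simp only: incr_def inner_sum_right)
    also have "(\<Sum>j<k. g (grid m (Suc j)) - g (grid m j)) = g (grid m k) - g (grid m 0)"
      by (rule sum_lessThan_telescope)
    also have "\<dots> = g (grid m k)" by (simp add: grid_def g0)
    finally show ?thesis by (simp add: inner_commute)
  qed
  have z: "g (grid m k) \<bullet> x = 0" if "m > 0" "k \<le> m" for m k
    using *[OF that x] *[OF that, of "-x"] x matrix_vector_mult_scaleR[of A "-1" x] by simp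
  have k: "nat \<lfloor>real (Suc m) * t\<rfloor> \<le> Suc m" for m
  proof -
    have "real (Suc m) * t \<le> real (Suc m) * 1" using t by (intro mult_left_mono) auto
    then show ?thesis using t by (intro nat_floor_le) auto
  qed
  have "(\<lambda>m. g (grid (Suc m) (nat \<lfloor>real (Suc m) * t\<rfloor>)) \<bullet> x) \<longlonglongrightarrow> g t \<bullet> x"
    by (intro tendsto_inner tendsto_const continuous_on_tendsto_compose[OF gc floor_grid_tendsto])
      (use t grid_mem[OF k] in auto)

  moreover have "g (grid (Suc m) (nat \<lfloor>real (Suc m) * t\<rfloor>)) \<bullet> x = 0" for m by (rule z) (use k in auto)
  ultimately show ?thesis by (simp add: LIMSEQ_const_iff)
qed

text \<open>Take \<open>f = G g\<close>. The functional pairing \<open>g\<close> with coefficients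
  made from its own increments has the energy of \<open>f\<close> as value and the square root of
  that energy as standard deviation; the inequality between the two leaves only energies up to
  1.\<close>

lemma strassen_set_sqrt_preimage:
  fixes A :: "real^'n^'n"
  assumes A: "psd A" and g: "g \<in> strassen_set A" and i0: "A *v axis i0 1 = 0"
  obtains f where "f \<in> U i0" "\<And>t. t \<in> {0..1} \<Longrightarrow> g t = matrix_sqrt A *v f t"
proof -
  let ?R = "matrix_sqrt A"
  obtain G :: "real^'n^'n" where "\<forall>x. (\<forall>z. A *v z = 0 \<longrightarrow> (G *v x) \<bullet> z = 0) \<and>
           ((\<forall>z. A *v z = 0 \<longrightarrow> x \<bullet> z = 0) \<longrightarrow> ?R *v (G *v x) = x)"
    using psd_matrix_sqrt(3)[OF A] by (rule exE)
  then have Gk: "A *v z = 0 \<Longrightarrow> (G *v x) \<bullet> z = 0"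
    and RG: "(\<And>z. A *v z = 0 \<Longrightarrow> x \<bullet> z = 0) \<Longrightarrow> ?R *v (G *v x) = x" for x z
    by blast+
  have g0: "g 0 = 0" and gc: "continuous_on {0..1} g" using g by (auto simp: strassen_set_def C0_def)
  define f where "f t = G *v g t" for t
  have Rf: "?R *v f t = g t" if "t \<in> {0..1}" for t
    unfolding f_def by (rule RG) (rule strassen_set_kernel[OF g _ that])
  have fU: "f \<in> U i0"
  proof (rule finite_energy_in_U)
    show "continuous_on {0..1} f"
      unfolding f_def by (rule linear_continuous_on_compose[OF gc matrix_vector_mul_linear])
    show "f 0 = 0" by (simp add: f_def g0)
    show "f t $ i0 = 0" for t using Gk[OF i0, of "g t"] by (simp add: f_def inner_axis)
    fix m :: nat assume m: "0 < m"
    define u where "u k = incr m k f" for k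
    define c where "c k = real m *\<^sub>R (G *v u k)" for k
    have uG: "u k = G *v incr m k g" for k by (simp add: u_def incr_def f_def matrix_vector_mult_diff_distrib)
    have Ru: "?R *v (G *v u k) = u k" for k by (rule RG) (simp add: uG Gk)
    have ig: "incr m k g = ?R *v u k" if "k < m" for k
      using Rf[OF grid_mem[of k m]] Rf[OF grid_mem[of "Suc k" m]] that
      by (simp add: u_def incr_def matrix_vector_mult_diff_distrib)
    have Rc: "?R *v c k = real m *\<^sub>R u k" for k by (simp add: c_def matrix_vector_mult_scaleR Ru)
    have "lin_fun m c g = energy m f"
      unfolding lin_fun_def energy_incr
    proof (rule sum.cong[OF refl])
      fix k assume "k \<in> {..<m}"
      then have "c k \<bullet> incr m k g = (?R *v c k) \<bullet> u k" by (simp add: ig psd_sqrt_norm(1)[OF A])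
      then show "c k \<bullet> incr m k g = real m * (norm (incr m k f))\<^sup>2"
        by (simp add: Rc power2_norm_eq_inner u_def)
    qed
    moreover have "sdev A m c = sqrt (energy m f)"
    proof -
      have "(\<Sum>k<m. c k \<bullet> (A *v c k)) / real m = energy m f"
        using m by (simp add: psd_sqrt_norm(2)[OF A] Rc energy_incr u_def power_mult_distrib sum_divide_distrib power2_eq_square mult_ac)
      then show ?thesis by (simp add: sdev_def)
    qed
    moreover have "lin_fun m c g \<le> sdev A m c" using g m by (simp add: strassen_set_def)
    ultimately have le: "energy m f \<le> sqrt (energy m f)" by simp
    have "0 \<le> energy m f" by (simp add: energy_def sum_nonneg)
    then have sq: "(energy m f)\<^sup>2 \<le> energy m f" using power_mono[OF le, of 2] by simp
    show "energy m f \<le> 1"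
    proof (rule ccontr)
      assume "\<not> energy m f \<le> 1"
      then have "energy m f * 1 < energy m f * energy m f" by (intro mult_strict_left_mono) auto
      then show False using sq by (simp add: power2_eq_square)
    qed
  qed
  show ?thesis by (rule that[OF fU]) (rule Rf[symmetric])
qed

section \<open>Normalising sequences and exponential inequalities\<close>

text \<open>\<open>LL\<close> cuts off the junk values of \<open>ln (ln n)\<close> at small \<open>n\<close>. For large \<open>n\<close> one has
  \<open>ell n = sqrt 2 * aa n\<close>; the summands of the walk are truncated at multiples of \<open>bb n\<close>.\<close>

definition LL :: "nat \<Rightarrow> real" where "LL n = max 1 (ln (ln (real n)))"
definition bb :: "nat \<Rightarrow> real" where "bb n = sqrt (real n / LL n)"
definition aa :: "nat \<Rightarrow> real" where "aa n = sqrt (real n * LL n)"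

lemma LL_ge_1: "1 \<le> LL n" and LL_pos: "0 < LL n" by (auto simp: LL_def)

lemma bb_0: "bb 0 = 0" and aa_nonneg: "0 \<le> aa n" and bb_nonneg: "0 \<le> bb n"
  using LL_pos[of n] by (auto simp: bb_def aa_def)

lemma aa_pos: "0 < n \<Longrightarrow> 0 < aa n" and bb_pos: "0 < n \<Longrightarrow> 0 < bb n"
  using LL_pos[of n] by (auto simp: aa_def bb_def)

lemma aa_eq: "aa n = LL n * bb n"
proof -
  have "aa n = sqrt ((LL n)\<^sup>2 * (real n / LL n))" using LL_pos[of n] by (simp add: aa_def power2_eq_square mult.commute)
  also have "\<dots> = LL n * bb n" using LL_pos[of n] by (subst real_sqrt_mult) (simp add: bb_def)
  finally show ?thesis .
qed

lemma bb_aa: "bb n * aa n = real n"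
proof -
  have "bb n * aa n = sqrt (real n * real n)" using LL_pos[of n]
    unfolding bb_def aa_def real_sqrt_mult[symmetric] by simp
  then show ?thesis by simp
qed

lemma LL_mono: assumes "m \<le> n" shows "LL m \<le> LL n"
proof (cases "ln (ln (real m)) \<le> 1")
  case True then show ?thesis by (simp add: LL_def)
next
  case False
  have "m \<ge> 2"
  proof (rule ccontr)
    assume "\<not> 2 \<le> m" then have "m = 0 \<or> m = 1" by auto
    then show False using False by auto
  qed
  then have "0 < ln (real m)" by simp
  moreover have "ln (real m) \<le> ln (real n)" using assms \<open>m \<ge> 2\<close> by simp
  ultimately have "ln (ln (real m)) \<le> ln (ln (real n))" by simp
  then show ?thesis by (simp add: LL_def)
qed

lemma aa_mono: "m \<le> n \<Longrightarrow> aa m \<le> aa n"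
  unfolding aa_def using LL_mono[of m n] LL_pos[of m] by (intro real_sqrt_le_mono mult_mono) auto

text \<open>The derivative of \<open>sqrt (n / LL n)\<close> is close to
  \<open>1 / (2 * aa n)\<close>; the constant 6 leaves room for the growth of \<open>LL\<close> at
  every index. The bound turns sums of \<open>1 / aa i\<close> into telescoping sums and contains
  the monotonicity of \<open>bb\<close>.\<close>

lemma bb_increment: "1 / (6 * aa (Suc x)) \<le> bb (Suc x) - bb x"
proof (cases "x = 0")
  case True then show ?thesis by (simp add: aa_def bb_def LL_def)
next
  case False
  let ?i = "Suc x"
  have x: "real x \<ge> 1" using False by simp
  have lnx: "0 \<le> ln (real x)" using x by simp
  have lni: "ln (real ?i) \<le> ln (real x) + 1 / real x"
  proof -
    have e: "real ?i = real x * (1 + 1 / real x)" using x by (simp add: field_simps)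
    have "ln (real ?i) = ln (real x * (1 + 1 / real x))" by (simp only: e)
    also have "\<dots> = ln (real x) + ln (1 + 1 / real x)" using x by (subst ln_mult) (auto simp: field_simps add_pos_nonneg)
    also have "ln (1 + 1 / real x) \<le> 1 / real x" by (rule ln_add_one_self_le_self) simp
    finally show ?thesis by simp
  qed
  \<comment> \<open>One step of \<open>LL\<close> costs at most \<open>2/3\<close> of the unit by
    which the numerator of \<open>n / LL n\<close> grows, so that a third of it remains.\<close>
  have key: "real x * LL ?i \<le> (real x + 2/3) * LL x"
  proof (cases "ln (real x) \<ge> 3/2")
    case True
    have ux: "0 < ln (real ?i)" using x by simp
    have lp: "0 < ln (real x)" using True by linarith
    then have x1: "1 < real x" using x by simp
    have pos: "0 < 1 + 1 / (real x * ln (real x))" using lp x1 by (intro add_pos_nonneg) auto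
    have "ln (ln (real ?i)) \<le> ln (ln (real x) + 1 / real x)"
      by (subst ln_le_cancel_iff) (use lni ux in linarith)+
    also have "\<dots> = ln (ln (real x) * (1 + 1 / (real x * ln (real x))))" using True x by (simp add: field_simps)
    also have "\<dots> = ln (ln (real x)) + ln (1 + 1 / (real x * ln (real x)))"
      by (subst ln_mult) (use lp pos in auto)
    also have "ln (1 + 1 / (real x * ln (real x))) \<le> 1 / (real x * ln (real x))"
      by (rule ln_add_one_self_le_self) (use x1 in auto)
    also have "\<dots> \<le> 1 / (real x * (3/2))" using True x1 by (intro divide_left_mono mult_left_mono mult_pos_pos) auto
    finally have le: "ln (ln (real ?i)) \<le> ln (ln (real x)) + 2 / (3 * real x)" by simp
    have "0 \<le> 2 / (3 * real x)" by simp
    with le have "LL ?i \<le> LL x + 2 / (3 * real x)" unfolding LL_def by linarith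
    then have "real x * LL ?i \<le> real x * (LL x + 2 / (3 * real x))" using x by (intro mult_left_mono) auto
    also have "\<dots> = real x * LL x + 2/3" using x by (simp add: field_simps)
    also have "\<dots> \<le> real x * LL x + 2/3 * LL x" using LL_ge_1[of x] by simp
    finally show ?thesis by (simp add: algebra_simps)
  next
    case False
    \<comment> \<open>Here \<open>ln x < 3/2\<close>, so
      \<open>ln (x + 1) \<le> 5/2 \<le> exp 1\<close> and \<open>LL\<close> still has its minimal
      value 1.\<close>
    have "1 / real x \<le> 1" using x by simp
    then have "ln (real ?i) \<le> 5/2" using False lni by linarith
    also have "\<dots> \<le> exp 1" using exp_lower_Taylor_quadratic[of 1] by simp
    finally have "ln (real ?i) \<le> exp 1" .
    then have "ln (ln (real ?i)) \<le> ln (exp 1)"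
      using x by (subst ln_le_cancel_iff) auto
    then have "LL ?i = 1" by (simp add: LL_def)
    moreover have "LL x = 1" using LL_mono[of x ?i] LL_ge_1[of x] \<open>LL ?i = 1\<close> by simp
    ultimately show ?thesis by simp
  qed
  have "real x / LL x \<le> (real x + 2/3) / LL ?i"
    using key LL_pos[of x] LL_pos[of ?i] by (simp add: field_simps)
  then have d: "1 / (3 * LL ?i) \<le> (bb ?i)\<^sup>2 - (bb x)\<^sup>2"
  proof -
    have sq: "(bb k)\<^sup>2 = real k / LL k" for k using LL_pos[of k] by (simp add: bb_def)
    have "real ?i / LL ?i - (real x + 2/3) / LL ?i = 1 / (3 * LL ?i)"
      by (simp add: diff_divide_distrib[symmetric])
    then show ?thesis using \<open>real x / LL x \<le> (real x + 2/3) / LL ?i\<close> unfolding sq by linarith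
  qed
  have "0 < 1 / (3 * LL ?i)" using LL_pos[of ?i] by simp
  then have "(bb x)\<^sup>2 \<le> (bb ?i)\<^sup>2" using d by linarith
  then have le: "bb x \<le> bb ?i" using bb_nonneg by (rule power2_le_imp_le)
  have "(bb ?i)\<^sup>2 - (bb x)\<^sup>2 = (bb ?i - bb x) * (bb ?i + bb x)" by (simp add: power2_eq_square algebra_simps)
  also have "\<dots> \<le> (bb ?i - bb x) * (2 * bb ?i)" using le by (intro mult_left_mono) auto
  finally have "1 / (3 * LL ?i) \<le> (bb ?i - bb x) * (2 * bb ?i)" using d by linarith
  then show ?thesis using LL_pos[of ?i] bb_pos[of ?i] unfolding aa_eq
    by (simp add: field_simps)
qed

lemma bb_mono: "m \<le> n \<Longrightarrow> bb m \<le> bb n"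
proof (induction rule: dec_induct)
  case (step n)
  have "0 \<le> 1 / (6 * aa (Suc n))" using aa_nonneg[of "Suc n"] by simp
  then show ?case using bb_increment[of n] step by linarith
qed simp

text \<open>Each term is at most 6 times an increment of \<open>bb\<close>, and terms stop once
  \<open>bb\<close> passes \<open>y\<close>; the cap \<open>min (bb n) y\<close> carries the
  induction. In the truncation argument \<open>y\<close> is proportional to the size of a summand of
  the walk.\<close>

lemma sum_inverse_aa_le:
  assumes y: "0 \<le> y"
  shows "(\<Sum>i=1..n. (if bb i < y then 1 / aa i else 0)) \<le> 6 * y"
proof -
  have "(\<Sum>i=1..n. (if bb i < y then 1 / aa i else 0)) \<le> 6 * min (bb n) y"
  proof (induction n)
    case 0 then show ?case using y bb_0 by simp
  next
    case (Suc n)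
    have "bb n \<le> bb (Suc n)" by (rule bb_mono) simp
    moreover have "1 / aa (Suc n) \<le> 6 * (bb (Suc n) - bb n)" using bb_increment[of n] by (simp add: field_simps)
    ultimately show ?case using Suc by (auto simp: min_def split: if_splits)
  qed
  then show ?thesis by linarith
qed

lemma aa_at_top: "filterlim aa at_top sequentially"
proof (rule filterlim_at_top_mono)
  show "filterlim (\<lambda>n. sqrt (real n)) at_top sequentially"
    by (rule filterlim_compose[OF sqrt_at_top filterlim_real_sequentially])
  show "\<forall>\<^sub>F n in sequentially. sqrt (real n) \<le> aa n"
    unfolding aa_def by (intro always_eventually allI real_sqrt_le_mono) (use LL_ge_1 in \<open>simp add: mult_le_cancel_left1\<close>)
qed

lemma LL_eventually: "\<forall>\<^sub>F n in sequentially. LL n = ln (ln (real n)) \<and> ell n = sqrt 2 * aa n"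
proof -
  have "filterlim (\<lambda>n. ln (ln (real n))) at_top sequentially"
    by (intro filterlim_compose[OF ln_at_top] filterlim_real_sequentially)
  then have "\<forall>\<^sub>F n in sequentially. 1 \<le> ln (ln (real n))" by (simp add: filterlim_at_top)
  moreover have "\<forall>\<^sub>F n in sequentially. n \<ge> (3::nat)" by (rule eventually_ge_at_top)
  ultimately show ?thesis
  proof eventually_elim
    case (elim n)
    then show ?case by (simp add: LL_def ell_def aa_def real_sqrt_mult max_absorb2)
  qed
qed

lemma kronecker_nonneg:
  fixes r :: "nat \<Rightarrow> real"
  assumes r: "\<And>i. 0 \<le> r i" and s: "summable (\<lambda>i. r i / aa i)"
  shows "(\<lambda>n. (\<Sum>i=1..n. r i) / aa n) \<longlonglongrightarrow> 0"
proof (rule LIMSEQ_I)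
  fix e :: real assume e: "e > 0"
  obtain K where K: "\<And>m n. K \<le> m \<Longrightarrow> norm (sum (\<lambda>i. r i / aa i) {m..<n}) < e / 2"
    using s e unfolding summable_Cauchy by (metis half_gt_zero)
  define C where "C = (\<Sum>i=1..K. r i)"
  have C0: "0 \<le> C" unfolding C_def by (rule sum_nonneg) (simp add: r)
  have "\<forall>\<^sub>F n in sequentially. 2 * C / e + 1 \<le> aa n" using aa_at_top by (simp add: filterlim_at_top)
  then have "\<forall>\<^sub>F n in sequentially. norm ((\<Sum>i=1..n. r i) / aa n - 0) < e"
    using eventually_ge_at_top[of "Suc K"]
  proof eventually_elim
    case (elim n)
    have an: "0 < aa n" using elim(2) by (intro aa_pos) simp
    have "{1..n} = {1..K} \<union> {Suc K..<Suc n}" using elim(2) by auto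
    then have "(\<Sum>i=1..n. r i) = C + (\<Sum>i=Suc K..<Suc n. r i)"
      unfolding C_def by (simp only:) (rule sum.union_disjoint, auto)
    also have "(\<Sum>i=Suc K..<Suc n. r i) \<le> (\<Sum>i=Suc K..<Suc n. aa n * (r i / aa i))"
    proof (rule sum_mono)
      fix i assume i: "i \<in> {Suc K..<Suc n}"
      then have "0 < aa i" "aa i \<le> aa n" by (auto intro: aa_pos aa_mono)
      then show "r i \<le> aa n * (r i / aa i)"
        using r[of i] by (simp add: pos_le_divide_eq mult.commute[of "r i"] mult_right_mono)
    qed
    also have "\<dots> = aa n * (\<Sum>i=Suc K..<Suc n. r i / aa i)" by (simp only: sum_distrib_left)
    also have "\<dots> \<le> aa n * (e / 2)" using K[of "Suc K" "Suc n"] an by (intro mult_left_mono) auto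
    finally have "(\<Sum>i=1..n. r i) \<le> C + aa n * (e / 2)" by simp
    moreover have "C < aa n * (e / 2)" using elim(1) e by (simp add: field_simps)
    ultimately have "(\<Sum>i=1..n. r i) < e * aa n" by (simp add: algebra_simps)
    moreover have "0 \<le> (\<Sum>i=1..n. r i)" by (rule sum_nonneg) (simp add: r)
    ultimately show ?case using an by (simp add: divide_less_eq)
  qed
  then show "\<exists>no. \<forall>n\<ge>no. norm ((\<Sum>i=1..n. r i) / aa n - 0) < e"
    by (simp only: eventually_sequentially)
qed

section \<open>Exponential moments and a maximal inequality\<close>

lemma exp_le_quadratic:
  fixes x :: real
  shows "exp x \<le> 1 + x + x\<^sup>2 / 2 * exp \<bar>x\<bar>"
proof (cases "x = 0")
  case False
  obtain t where t: "\<bar>t\<bar> \<le> \<bar>x\<bar>" "exp x = (\<Sum>m<2. x ^ m / fact m) + exp t / fact 2 * x ^ 2"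
    using Maclaurin_exp_le[of x 2] by blast
  have "exp t \<le> exp \<bar>x\<bar>" using t(1) by simp
  then have "exp t / 2 * x\<^sup>2 \<le> exp \<bar>x\<bar> / 2 * x\<^sup>2" by (intro mult_right_mono) auto
  then show ?thesis using t(2) by (simp add: numeral_2_eq_2 algebra_simps)
qed simp

context prob_space
begin

text \<open>Mean zero removes the linear term of the quadratic bound and the variance remains.
  Boundedness enters only through the factor \<open>exp K\<close>, which a fine truncation brings
  close to 1.\<close>

lemma exp_moment_bound:
  fixes V :: "'a \<Rightarrow> real"
  assumes V[measurable]: "V \<in> borel_measurable M" and bd: "\<And>\<omega>. \<omega> \<in> space M \<Longrightarrow> \<bar>V \<omega>\<bar> \<le> K"
    and mean: "expectation V = 0" and s: "expectation (\<lambda>\<omega>. (V \<omega>)\<^sup>2) \<le> s"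
  shows "integrable M (\<lambda>\<omega>. exp (V \<omega>))" "expectation (\<lambda>\<omega>. exp (V \<omega>)) \<le> exp (s * exp K / 2)"
proof -
  have iV: "integrable M V" by (rule integrable_const_bound[of _ K]) (use bd in auto)
  have K0: "0 \<le> K" using bd not_empty by (metis abs_ge_zero all_not_in_conv order_trans)
  have iV2: "integrable M (\<lambda>\<omega>. (V \<omega>)\<^sup>2)"
    by (rule integrable_const_bound[of _ "K\<^sup>2"]) (use bd in \<open>auto intro!: AE_I2 simp: abs_le_square_iff[symmetric] K0\<close>)
  show iE: "integrable M (\<lambda>\<omega>. exp (V \<omega>))"
    by (rule integrable_const_bound[of _ "exp K"]) (use bd in \<open>auto intro!: AE_I2 dest: bd simp: abs_le_iff\<close>)
  have "expectation (\<lambda>\<omega>. exp (V \<omega>)) \<le> expectation (\<lambda>\<omega>. 1 + V \<omega> + (V \<omega>)\<^sup>2 * (exp K / 2))"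
  proof (rule integral_mono[OF iE])
    show "integrable M (\<lambda>\<omega>. 1 + V \<omega> + (V \<omega>)\<^sup>2 * (exp K / 2))"
      by (intro Bochner_Integration.integrable_add integrable_mult_left iV iV2) simp
    fix \<omega> assume w: "\<omega> \<in> space M"
    have "(V \<omega>)\<^sup>2 / 2 * exp \<bar>V \<omega>\<bar> \<le> (V \<omega>)\<^sup>2 / 2 * exp K" using bd[OF w] by (intro mult_left_mono) auto
    then show "exp (V \<omega>) \<le> 1 + V \<omega> + (V \<omega>)\<^sup>2 * (exp K / 2)" using exp_le_quadratic[of "V \<omega>"] by simp
  qed
  also have "\<dots> = 1 + expectation (\<lambda>\<omega>. (V \<omega>)\<^sup>2) * (exp K / 2)"
    using iV iV2 mean by (simp add: prob_space)
  also have "\<dots> \<le> 1 + s * exp K / 2" using s by (simp add: mult_right_mono)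
  also have "\<dots> \<le> exp (s * exp K / 2)" by (rule exp_ge_add_one_self)
  finally show "expectation (\<lambda>\<omega>. exp (V \<omega>)) \<le> exp (s * exp K / 2)" .
qed

text \<open>The exponential of the partial sums is stopped at the first passage above
  \<open>x\<close>: \<open>G k\<close> is the part not yet stopped. The quantity
  \<open>exp x * prob (D k) + expectation (G k)\<close> grows by a factor of at most
  \<open>exp (c (Suc k))\<close> per step, because at passage the exponential is at least
  \<open>exp x\<close> and the next summand is independent of \<open>G k\<close>. A union bound over
  \<open>k\<close> would lose a factor \<open>n\<close>.\<close>

lemma exponential_maximal_inequality:
  fixes V :: "nat \<Rightarrow> 'a \<Rightarrow> real"
  assumes ind: "indep_vars (\<lambda>_. borel) V {1..n}"
    and int: "\<And>i. i \<in> {1..n} \<Longrightarrow> integrable M (\<lambda>\<omega>. exp (V i \<omega>))"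
    and c: "\<And>i. i \<in> {1..n} \<Longrightarrow> expectation (\<lambda>\<omega>. exp (V i \<omega>)) \<le> exp (c i)" "\<And>i. i \<in> {1..n} \<Longrightarrow> 0 \<le> c i"
  shows "prob {\<omega> \<in> space M. \<exists>k\<in>{1..n}. x \<le> (\<Sum>i=1..k. V i \<omega>)} \<le> exp ((\<Sum>i=1..n. c i) - x)"
proof -
  have Vm[measurable]: "V i \<in> borel_measurable M" if "i \<in> {1..n}" for i
    using ind that unfolding indep_vars_def by auto
  define T where "T k \<omega> = (\<Sum>i=1..k. V i \<omega>)" for k \<omega>
  define Q where "Q k \<omega> \<longleftrightarrow> (\<exists>j\<in>{1..k}. x \<le> T j \<omega>)" for k \<omega>
  define D where "D k = {\<omega> \<in> space M. Q k \<omega>}" for k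
  have Tm[measurable]: "T k \<in> borel_measurable M" if "k \<le> n" for k
    unfolding T_def using that by (intro borel_measurable_sum Vm) auto
  have Dm[measurable]: "D k \<in> sets M" if "k \<le> n" for k
    unfolding D_def Q_def using that Tm by (intro sets.sets_Collect_finite_Ex) auto
  define G where "G k \<omega> = (if Q k \<omega> then 0 else exp (T k \<omega>))" for k \<omega>
  have Gm[measurable]: "G k \<in> borel_measurable M" if "k \<le> n" for k
    unfolding G_def using Dm[OF that] Tm[OF that] unfolding D_def by (intro measurable_If) auto
  have Gb: "0 \<le> G k \<omega>" "G k \<omega> \<le> max 1 (exp x)" for k \<omega>
  proof -
    show "0 \<le> G k \<omega>" by (simp add: G_def)
    show "G k \<omega> \<le> max 1 (exp x)"
    proof (cases "k = 0")
      case True then show ?thesis by (auto simp: G_def T_def)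
    next
      case False
      have "T k \<omega> < x" if "\<not> Q k \<omega>"
        using that False unfolding Q_def by (metis One_nat_def Suc_leI atLeastAtMost_iff le_refl linorder_not_le neq0_conv)
      then show ?thesis by (auto simp: G_def less_imp_le le_max_iff_disj)
    qed
  qed
  have Gi: "integrable M (G k)" if "k \<le> n" for k
    by (rule integrable_const_bound[of _ "max 1 (exp x)"]) (use Gb Gm[OF that] in auto)
  have main: "exp x * prob (D k) + expectation (G k) \<le> exp (\<Sum>i=1..k. c i)" if "k \<le> n" for k
    using that
  proof (induction k)
    case 0
    have "D 0 = {}" by (simp add: D_def Q_def)
    moreover have "expectation (G 0) = expectation (\<lambda>\<omega>. 1)"
      by (intro Bochner_Integration.integral_cong) (auto simp: G_def T_def Q_def)
    ultimately show ?case by (simp add: prob_space)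
  next
    case (Suc k)
    then have kn: "k \<le> n" "Suc k \<in> {1..n}" by auto
    \<comment> \<open>\<open>G k\<close> as a function of the first \<open>k\<close> summands alone;
      its independence of the next summand then follows from that of the restricted
      families.\<close>
    define h where "h w = (if \<exists>j\<in>{1..k}. x \<le> (\<Sum>i=1..j. w i) then 0 else exp (\<Sum>i=1..k. w i))" for w :: "nat \<Rightarrow> real"
    have hm: "h \<in> borel_measurable (PiM {1..k} (\<lambda>_. borel))"
      unfolding h_def
    proof (rule measurable_If)
      show "{w \<in> space (PiM {1..k} (\<lambda>_. borel)). \<exists>j\<in>{1..k}. x \<le> (\<Sum>i=1..j. w i)} \<in> sets (PiM {1..k} (\<lambda>_. borel :: real measure))"
      proof (rule sets.sets_Collect_finite_Ex)
        fix j assume "j \<in> {1..k}"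
        then have [measurable]: "(\<lambda>w. \<Sum>i=1..j. w i) \<in> borel_measurable (PiM {1..k} (\<lambda>_. borel :: real measure))"
          by (intro borel_measurable_sum measurable_component_singleton) auto
        show "{w \<in> space (PiM {1..k} (\<lambda>_. borel :: real measure)). x \<le> (\<Sum>i=1..j. w i)} \<in> sets (PiM {1..k} (\<lambda>_. borel))"
          by measurable
      qed simp
      show "(\<lambda>w. exp (\<Sum>i=1..k. w i)) \<in> borel_measurable (PiM {1..k} (\<lambda>_. borel :: real measure))"
        by (intro measurable_compose[OF _ borel_measurable_exp] borel_measurable_sum measurable_component_singleton) auto
    qed simp
    have ir: "indep_var (PiM {1..k} (\<lambda>_. borel)) (\<lambda>\<omega>. restrict (\<lambda>i. V i \<omega>) {1..k})
         (PiM {Suc k} (\<lambda>_. borel)) (\<lambda>\<omega>. restrict (\<lambda>i. V i \<omega>) {Suc k})"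
      by (rule indep_var_restrict[OF ind]) (use kn in auto)
    have "indep_var borel (h \<circ> (\<lambda>\<omega>. restrict (\<lambda>i. V i \<omega>) {1..k})) borel ((\<lambda>w. exp (w (Suc k))) \<circ> (\<lambda>\<omega>. restrict (\<lambda>i. V i \<omega>) {Suc k}))"
    proof (rule indep_var_compose[OF ir hm])
      show "(\<lambda>w. exp (w (Suc k))) \<in> borel_measurable (PiM {Suc k} (\<lambda>_. borel :: real measure))"
        by (intro measurable_compose[OF _ borel_measurable_exp] measurable_component_singleton) auto
    qed
    moreover have "h \<circ> (\<lambda>\<omega>. restrict (\<lambda>i. V i \<omega>) {1..k}) = G k"
    proof
      fix \<omega>
      have "(\<Sum>i=1..j. restrict (\<lambda>i. V i \<omega>) {1..k} i) = T j \<omega>" if "j \<le> k" for j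
        unfolding T_def by (rule sum.cong) (use that in auto)
      then show "(h \<circ> (\<lambda>\<omega>. restrict (\<lambda>i. V i \<omega>) {1..k})) \<omega> = G k \<omega>" by (auto simp: h_def G_def Q_def)
    qed
    moreover have "(\<lambda>w. exp (w (Suc k))) \<circ> (\<lambda>\<omega>. restrict (\<lambda>i. V i \<omega>) {Suc k}) = (\<lambda>\<omega>. exp (V (Suc k) \<omega>))"
      by (simp add: fun_eq_iff)
    ultimately have iv: "indep_var borel (G k) borel (\<lambda>\<omega>. exp (V (Suc k) \<omega>))" by simp
    have prodE: "expectation (\<lambda>\<omega>. G k \<omega> * exp (V (Suc k) \<omega>)) = expectation (G k) * expectation (\<lambda>\<omega>. exp (V (Suc k) \<omega>))"
      "integrable M (\<lambda>\<omega>. G k \<omega> * exp (V (Suc k) \<omega>))"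
      using indep_var_lebesgue_integral[OF iv Gi[OF kn(1)] int[OF kn(2)]]
        indep_var_integrable[OF iv Gi[OF kn(1)] int[OF kn(2)]] by auto
    have iD: "integrable M (\<lambda>\<omega>. exp x * indicator (D j) \<omega>)" if "j \<le> n" for j
      using Dm[OF that] by (intro integrable_mult_right integrable_real_indicator) (auto simp: emeasure_eq_measure)
    have eq: "exp x * prob (D j) + expectation (G j) = expectation (\<lambda>\<omega>. exp x * indicator (D j) \<omega> + G j \<omega>)" if "j \<le> n" for j
      using Gi[OF that] iD[OF that] Dm[OF that] sets.sets_into_space[OF Dm[OF that]]
      by (simp add: Bochner_Integration.integral_add Int_absorb2)
    have "exp x * prob (D (Suc k)) + expectation (G (Suc k)) = expectation (\<lambda>\<omega>. exp x * indicator (D (Suc k)) \<omega> + G (Suc k) \<omega>)"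
      by (rule eq[OF Suc.prems])
    also have "\<dots> \<le> expectation (\<lambda>\<omega>. exp x * indicator (D k) \<omega> + G k \<omega> * exp (V (Suc k) \<omega>))"
    proof (rule integral_mono)
      show "integrable M (\<lambda>\<omega>. exp x * indicator (D (Suc k)) \<omega> + G (Suc k) \<omega>)"
        by (intro Bochner_Integration.integrable_add iD Gi Suc.prems)
      show "integrable M (\<lambda>\<omega>. exp x * indicator (D k) \<omega> + G k \<omega> * exp (V (Suc k) \<omega>))"
        by (intro Bochner_Integration.integrable_add iD kn prodE)
      fix \<omega> assume w: "\<omega> \<in> space M"
      have T: "T (Suc k) \<omega> = T k \<omega> + V (Suc k) \<omega>" by (simp add: T_def)
      have "{1..Suc k} = insert (Suc k) {1..k}" by auto
      then have QS: "Q (Suc k) \<omega> \<longleftrightarrow> Q k \<omega> \<or> x \<le> T (Suc k) \<omega>" unfolding Q_def by (simp only:) blast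
      have DQ: "\<omega> \<in> D j \<longleftrightarrow> Q j \<omega>" for j using w by (simp add: D_def)
      consider "Q k \<omega>" | "\<not> Q k \<omega>" "x \<le> T (Suc k) \<omega>" | "\<not> Q k \<omega>" "\<not> x \<le> T (Suc k) \<omega>" by blast
      then show "exp x * indicator (D (Suc k)) \<omega> + G (Suc k) \<omega> \<le> exp x * indicator (D k) \<omega> + G k \<omega> * exp (V (Suc k) \<omega>)"
        by cases (auto simp: G_def QS DQ indicator_def exp_add[symmetric] T)
    qed
    also have "\<dots> = exp x * prob (D k) + expectation (G k) * expectation (\<lambda>\<omega>. exp (V (Suc k) \<omega>))"
      using prodE iD[OF kn(1)] Dm[OF kn(1)] sets.sets_into_space[OF Dm[OF kn(1)]]
      by (simp add: Bochner_Integration.integral_add Int_absorb2)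
    also have "\<dots> \<le> exp x * prob (D k) * exp (c (Suc k)) + expectation (G k) * exp (c (Suc k))"
    proof (intro add_mono mult_left_mono c kn)
      have "1 \<le> exp (c (Suc k))" using c(2)[OF kn(2)] by simp
      then show "exp x * prob (D k) \<le> exp x * prob (D k) * exp (c (Suc k))"
        using mult_left_mono[of 1 "exp (c (Suc k))" "exp x * prob (D k)"] by simp
      show "0 \<le> expectation (G k)" using Gb(1) by (simp add: integral_nonneg_AE)
    qed
    also have "\<dots> = (exp x * prob (D k) + expectation (G k)) * exp (c (Suc k))" by (simp add: algebra_simps)
    also have "\<dots> \<le> exp (\<Sum>i=1..k. c i) * exp (c (Suc k))"
      using Suc.IH kn(1) by (intro mult_right_mono) auto
    also have "\<dots> = exp (\<Sum>i=1..Suc k. c i)" by (simp add: exp_add)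
    finally show ?case .
  qed
  have "0 \<le> expectation (G n)" using Gb(1) by (simp add: integral_nonneg_AE)
  then have "exp x * prob (D n) \<le> exp (\<Sum>i=1..n. c i)" using main[of n] by simp
  then have "prob (D n) \<le> exp (\<Sum>i=1..n. c i) / exp x" by (simp add: field_simps)
  then show ?thesis by (simp add: D_def Q_def T_def exp_diff)
qed

end

section \<open>Geometric subsequences and blocks of indices\<close>

text \<open>Monotonicity of \<open>bb\<close> in disguise: \<open>n / LL n\<close> does not decrease
  when \<open>n\<close> is doubled.\<close>

lemma LL_double: "LL (2 * n) \<le> 2 * LL n"
proof (cases "n = 0")
  case True then show ?thesis by (simp add: LL_def)
next
  case False
  have "(bb n)\<^sup>2 \<le> (bb (2 * n))\<^sup>2" using bb_mono[of n "2 * n"] bb_nonneg[of n] by (intro power_mono) auto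
  then have "real n / LL n \<le> real (2 * n) / LL (2 * n)" using LL_pos[of n] LL_pos[of "2 * n"] by (simp add: bb_def)
  then show ?thesis using False LL_pos[of n] LL_pos[of "2 * n"] by (simp add: field_simps)
qed

lemma aa_double: "aa (2 * n) \<le> 2 * aa n"
proof -
  have "aa (2 * n) \<le> sqrt (4 * (real n * LL n))"
    unfolding aa_def using mult_left_mono[OF LL_double[of n], of "real n"] by (intro real_sqrt_le_mono) simp
  then show ?thesis by (simp add: aa_def real_sqrt_mult)
qed

text \<open>Under geometric growth \<open>LL (N j)\<close> is at least
  \<open>ln (j * ln \<rho>)\<close>, so the terms are dominated by a multiple of
  \<open>j powr (- p)\<close>; the threshold \<open>p = 1\<close> is the one behind the law of the
  iterated logarithm.\<close>

lemma summable_exp_LL: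
  assumes p: "p > 1" and \<rho>: "\<rho> > 1" and N: "\<And>j. \<rho> ^ j \<le> real (N j)"
  shows "summable (\<lambda>j. exp (- (p * LL (N j))))"
proof (rule summable_comparison_test_ev)
  have lr: "0 < ln \<rho>" using \<rho> by simp
  show "\<forall>\<^sub>F j in sequentially. norm (exp (- (p * LL (N j)))) \<le> (ln \<rho>) powr (- p) * (real j powr (- p))"
    using eventually_gt_at_top[of 0]
  proof eventually_elim
    case (elim j)
    have pos: "0 < real j * ln \<rho>" using elim lr by simp
    have "0 < real (N j)" using N[of j] \<rho> by (meson less_le_trans zero_less_one zero_less_power order_less_trans)
    then have "real j * ln \<rho> \<le> ln (real (N j))"
      using N[of j] \<rho> by (simp add: ln_realpow[symmetric])
    then have "ln (real j * ln \<rho>) \<le> ln (ln (real (N j)))" using pos by simp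
    also have "\<dots> \<le> LL (N j)" by (simp add: LL_def)
    finally have "- (p * LL (N j)) \<le> - p * ln (real j * ln \<rho>)" using p by (simp add: mult_left_mono)
    then have "exp (- (p * LL (N j))) \<le> exp (- p * ln (real j * ln \<rho>))" by simp
    also have "\<dots> = (real j * ln \<rho>) powr (- p)" using elim lr by (simp add: powr_def)
    also have "\<dots> = (ln \<rho>) powr (- p) * (real j powr (- p))" using elim lr by (simp add: powr_mult)
    finally show ?case by simp
  qed
  show "summable (\<lambda>j. (ln \<rho>) powr (- p) * (real j powr (- p)))"
    using p by (intro summable_mult) (simp add: summable_real_powr_iff)
qed

text \<open>Indices of the walk start at 1, so the block containing \<open>i\<close> has number
  \<open>(i - 1) div h\<close>.\<close>

lemma sum_block_div:
  fixes f :: "nat \<Rightarrow> nat \<Rightarrow> 'b::comm_monoid_add"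
  assumes h: "0 < h"
  shows "(\<Sum>i=1..m * h. f ((i - 1) div h) i) = (\<Sum>k<m. \<Sum>i=k * h + 1..(k + 1) * h. f k i)"
proof (induction m)
  case (Suc m)
  have "{1..Suc m * h} = {1..m * h} \<union> {m * h + 1..(m + 1) * h}" by auto
  then have "(\<Sum>i=1..Suc m * h. f ((i - 1) div h) i)
      = (\<Sum>i=1..m * h. f ((i - 1) div h) i) + (\<Sum>i=m * h + 1..(m + 1) * h. f ((i - 1) div h) i)"
    by (simp only:) (rule sum.union_disjoint, auto)
  also have "(\<Sum>i=m * h + 1..(m + 1) * h. f ((i - 1) div h) i) = (\<Sum>i=m * h + 1..(m + 1) * h. f m i)"
  proof (rule sum.cong[OF refl])
    fix i assume i: "i \<in> {m * h + 1..(m + 1) * h}"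
    then obtain j where j: "i = m * h + 1 + j" by (metis atLeastAtMost_iff le_iff_add)
    then have "j < h" using i h by (simp add: algebra_simps)
    then have "(i - 1) div h = m" using j h by simp
    then show "f ((i - 1) div h) i = f m i" by simp
  qed
  finally show ?case using Suc by simp
qed simp

section \<open>Truncated random walks\<close>

locale iid_walk = prob_space M for M :: "'a measure" +
  fixes X :: "nat \<Rightarrow> 'a \<Rightarrow> real^'n" and A :: "real^'n^'n"
  assumes indep: "indep_vars (\<lambda>_. borel) X {1..}"
    and ident: "\<And>i. 1 \<le> i \<Longrightarrow> distr M borel (X i) = distr M borel (X 1)"
    and sq_int: "integrable M (\<lambda>\<omega>. (norm (X 1 \<omega>))\<^sup>2)"
    and mean: "expectation (X 1) = 0"
    and cov: "A = (\<chi> i j. expectation (\<lambda>\<omega>. X 1 \<omega> $ i * X 1 \<omega> $ j))"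
begin

lemma X_measurable[measurable]: "1 \<le> i \<Longrightarrow> X i \<in> borel_measurable M"
  using indep unfolding indep_vars_def by auto

lemma X1_measurable[measurable]: "X (Suc 0) \<in> borel_measurable M" using X_measurable[of 1] by simp

lemma expectation_ident:
  fixes g :: "real^'n \<Rightarrow> 'b::{banach, second_countable_topology}"
  assumes g[measurable]: "g \<in> borel_measurable borel" and i: "1 \<le> i"
  shows "expectation (\<lambda>\<omega>. g (X i \<omega>)) = expectation (\<lambda>\<omega>. g (X 1 \<omega>))"
    and "integrable M (\<lambda>\<omega>. g (X i \<omega>)) \<longleftrightarrow> integrable M (\<lambda>\<omega>. g (X 1 \<omega>))"
proof -
  show "expectation (\<lambda>\<omega>. g (X i \<omega>)) = expectation (\<lambda>\<omega>. g (X 1 \<omega>))"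
    using integral_distr[OF X_measurable[OF i] g] integral_distr[OF X_measurable[of 1] g] ident[OF i] by simp
  show "integrable M (\<lambda>\<omega>. g (X i \<omega>)) \<longleftrightarrow> integrable M (\<lambda>\<omega>. g (X 1 \<omega>))"
    using integrable_distr_eq[OF X_measurable[OF i] g] integrable_distr_eq[OF X_measurable[of 1] g] ident[OF i] by simp
qed

lemma norm_int: "integrable M (\<lambda>\<omega>. norm (X 1 \<omega>))"
proof (rule Bochner_Integration.integrable_bound)
  show "integrable M (\<lambda>\<omega>. 1 + (norm (X 1 \<omega>))\<^sup>2)" using sq_int by simp
  have "norm x \<le> 1 + (norm x)\<^sup>2" for x :: "real^'n"
    using zero_le_power2[of "norm x - 1/2"] by (simp add: power2_eq_square algebra_simps)
  then show "AE \<omega> in M. norm (norm (X 1 \<omega>)) \<le> norm (1 + (norm (X 1 \<omega>))\<^sup>2)" by (intro AE_I2) simp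
qed simp

lemma X1_int: "integrable M (X 1)"
  using norm_int by (simp add: integrable_norm_iff)

lemma X1_coord[measurable]: "(\<lambda>\<omega>. X (Suc 0) \<omega> $ i) \<in> borel_measurable M"
  by (rule measurable_compose[OF X1_measurable], rule borel_measurable_continuous_onI) (intro continuous_intros)

lemma coord_int: "integrable M (\<lambda>\<omega>. X 1 \<omega> $ i * X 1 \<omega> $ j)"
proof (rule Bochner_Integration.integrable_bound[OF sq_int])
  have "\<bar>x $ i * x $ j\<bar> \<le> (norm x)\<^sup>2" for x :: "real^'n"
    unfolding abs_mult power2_eq_square by (intro mult_mono component_le_norm_cart) auto
  then show "AE \<omega> in M. norm (X 1 \<omega> $ i * X 1 \<omega> $ j) \<le> norm ((norm (X 1 \<omega>))\<^sup>2)" by (intro AE_I2) simp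
qed simp

lemma inner_sq_int: "integrable M (\<lambda>\<omega>. (d \<bullet> X 1 \<omega>)\<^sup>2)"
proof (rule Bochner_Integration.integrable_bound)
  show "integrable M (\<lambda>\<omega>. (norm d)\<^sup>2 * (norm (X 1 \<omega>))\<^sup>2)" using sq_int by simp
  have "(d \<bullet> x)\<^sup>2 \<le> (norm d)\<^sup>2 * (norm x)\<^sup>2" for x
    using Cauchy_Schwarz_ineq[of d x] by (simp add: power2_norm_eq_inner)
  then show "AE \<omega> in M. norm ((d \<bullet> X 1 \<omega>)\<^sup>2) \<le> norm ((norm d)\<^sup>2 * (norm (X 1 \<omega>))\<^sup>2)" by (intro AE_I2) simp
qed simp

lemma inner_prod_expectation: "expectation (\<lambda>\<omega>. (X 1 \<omega> \<bullet> d) * (X 1 \<omega> \<bullet> e)) = d \<bullet> (A *v e)"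
proof -
  have "(x \<bullet> d) * (x \<bullet> e) = (\<Sum>i\<in>UNIV. \<Sum>j\<in>UNIV. d $ i * e $ j * (x $ i * x $ j))" for x
    unfolding inner_vec_def sum_product by (simp add: mult_ac)
  then have "expectation (\<lambda>\<omega>. (X 1 \<omega> \<bullet> d) * (X 1 \<omega> \<bullet> e)) = expectation (\<lambda>\<omega>. \<Sum>i\<in>UNIV. \<Sum>j\<in>UNIV. d $ i * e $ j * (X 1 \<omega> $ i * X 1 \<omega> $ j))"
    by simp
  also have "\<dots> = (\<Sum>i\<in>UNIV. \<Sum>j\<in>UNIV. d $ i * e $ j * A $ i $ j)"
    using coord_int by (simp add: cov)
  also have "\<dots> = d \<bullet> (A *v e)"
    by (simp add: inner_vec_def matrix_vector_mult_def sum_distrib_left mult_ac)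
  finally show ?thesis .
qed

lemma inner_sq_expectation: "expectation (\<lambda>\<omega>. (d \<bullet> X 1 \<omega>)\<^sup>2) = d \<bullet> (A *v d)"
  using inner_prod_expectation[of d d] by (simp add: power2_eq_square inner_commute)

lemma A_nonneg: "0 \<le> d \<bullet> (A *v d)"
  unfolding inner_sq_expectation[symmetric] by (rule integral_nonneg_AE) simp

lemma A_psd: "psd A"
  unfolding psd_def using A_nonneg by (auto simp: vec_eq_iff transpose_def cov mult.commute)

text \<open>The level \<open>\<tau> * bb i\<close> fits the exponential inequality, whose parameter
  is of order \<open>1 / bb n\<close>: exponents stay bounded, and a small \<open>\<tau>\<close>
  makes them small.\<close>

definition trunc :: "real \<Rightarrow> nat \<Rightarrow> real^'n \<Rightarrow> real^'n" where
  "trunc \<tau> i x = (if norm x \<le> \<tau> * bb i then x else 0)"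

definition Y :: "real \<Rightarrow> nat \<Rightarrow> 'a \<Rightarrow> real^'n" where
  "Y \<tau> i \<omega> = trunc \<tau> i (X i \<omega>) - expectation (\<lambda>\<omega>. trunc \<tau> i (X i \<omega>))"

lemma trunc_measurable[measurable]: "trunc \<tau> i \<in> borel_measurable borel"
  unfolding trunc_def by measurable

lemma norm_trunc: "0 \<le> \<tau> \<Longrightarrow> norm (trunc \<tau> i x) \<le> \<tau> * bb i" "norm (trunc \<tau> i x) \<le> norm x"
  using bb_nonneg[of i] by (auto simp: trunc_def)

lemma trunc_int: assumes "1 \<le> i" shows "integrable M (\<lambda>\<omega>. trunc \<tau> i (X i \<omega>))"
proof -
  have "integrable M (\<lambda>\<omega>. trunc \<tau> i (X 1 \<omega>))"
    by (rule Bochner_Integration.integrable_bound[OF X1_int]) (auto intro!: AE_I2 norm_trunc)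
  then show ?thesis using expectation_ident(2)[of "trunc \<tau> i" i] assms by simp
qed

lemma Y_measurable[measurable]: "1 \<le> i \<Longrightarrow> Y \<tau> i \<in> borel_measurable M"
  unfolding Y_def by (intro borel_measurable_diff measurable_compose[OF X_measurable] trunc_measurable) auto

lemma norm_Y: assumes \<tau>: "0 \<le> \<tau>" and i: "1 \<le> i" shows "norm (Y \<tau> i \<omega>) \<le> 2 * \<tau> * bb i"
proof -
  have "norm (expectation (\<lambda>\<omega>. trunc \<tau> i (X i \<omega>))) \<le> expectation (\<lambda>\<omega>. norm (trunc \<tau> i (X i \<omega>)))"
    by (rule integral_norm_bound)
  also have "\<dots> \<le> expectation (\<lambda>\<omega>. \<tau> * bb i)"
    by (rule integral_mono) (use trunc_int[OF i] norm_trunc(1)[OF \<tau>] in auto)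
  finally have "norm (expectation (\<lambda>\<omega>. trunc \<tau> i (X i \<omega>))) \<le> \<tau> * bb i" by (simp add: prob_space)
  then show ?thesis unfolding Y_def
    using norm_trunc(1)[OF \<tau>, of i "X i \<omega>"] norm_triangle_ineq4[of "trunc \<tau> i (X i \<omega>)" "expectation (\<lambda>\<omega>. trunc \<tau> i (X i \<omega>))"] by linarith
qed

lemma Y_mean: assumes i: "1 \<le> i" shows "expectation (\<lambda>\<omega>. d \<bullet> Y \<tau> i \<omega>) = 0"
  unfolding Y_def using trunc_int[OF i] by (simp add: inner_diff_right prob_space)

text \<open>Truncation lowers the second moment and centring lowers it further, so \<open>A\<close>
  itself bounds the truncated variables at every index and no limit has to be taken.\<close>

lemma Y_variance: assumes i: "1 \<le> i" and \<tau>: "0 \<le> \<tau>"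
  shows "expectation (\<lambda>\<omega>. (d \<bullet> Y \<tau> i \<omega>)\<^sup>2) \<le> d \<bullet> (A *v d)"
proof -
  define V where "V \<omega> = d \<bullet> trunc \<tau> i (X i \<omega>)" for \<omega>
  have Vi: "integrable M V" unfolding V_def using trunc_int[OF i] by simp
  have Vm[measurable]: "V \<in> borel_measurable M" using Vi by (rule borel_measurable_integrable)
  have tr2: "(d \<bullet> trunc \<tau> i x)\<^sup>2 \<le> (d \<bullet> x)\<^sup>2" for x by (simp add: trunc_def)
  have i2: "integrable M (\<lambda>\<omega>. (d \<bullet> X i \<omega>)\<^sup>2)"
    using inner_sq_int expectation_ident(2)[of "\<lambda>x. (d \<bullet> x)\<^sup>2" i] i by simp
  have V2: "integrable M (\<lambda>\<omega>. (V \<omega>)\<^sup>2)"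
  proof (rule Bochner_Integration.integrable_bound[OF i2])
    show "(\<lambda>\<omega>. (V \<omega>)\<^sup>2) \<in> borel_measurable M" by measurable
  qed (use tr2 in \<open>auto simp: V_def\<close>)
  have "d \<bullet> Y \<tau> i \<omega> = V \<omega> - expectation V" for \<omega>
    unfolding Y_def V_def inner_diff_right using trunc_int[OF i] by simp
  then have "expectation (\<lambda>\<omega>. (d \<bullet> Y \<tau> i \<omega>)\<^sup>2) = variance V" by simp
  also have "\<dots> = expectation (\<lambda>\<omega>. (V \<omega>)\<^sup>2) - (expectation V)\<^sup>2" by (rule variance_eq[OF Vi V2])
  also have "\<dots> \<le> expectation (\<lambda>\<omega>. (V \<omega>)\<^sup>2)" by simp
  also have "\<dots> \<le> expectation (\<lambda>\<omega>. (d \<bullet> X i \<omega>)\<^sup>2)"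
    by (rule integral_mono[OF V2 i2]) (simp add: V_def tr2)
  also have "\<dots> = d \<bullet> (A *v d)"
    using inner_sq_expectation expectation_ident(1)[of "\<lambda>x. (d \<bullet> x)\<^sup>2" i] i by simp
  finally show ?thesis .
qed

lemma Y_indep: "indep_vars (\<lambda>_. borel) (\<lambda>i \<omega>. r i * (d i \<bullet> Y \<tau> i \<omega>)) {1..n}"
proof -
  have "indep_vars (\<lambda>_. borel) X {1..n}" by (rule indep_vars_subset[OF indep]) auto
  then have "indep_vars (\<lambda>_. borel) (\<lambda>i \<omega>. (\<lambda>x. r i * (d i \<bullet> (trunc \<tau> i x - expectation (\<lambda>\<omega>. trunc \<tau> i (X i \<omega>))))) (X i \<omega>)) {1..n}"
    by (rule indep_vars_compose2) measurable
  then show ?thesis by (simp add: Y_def)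
qed

text \<open>Variable weights serve both applications: a unit vector on a single block for the
  oscillation, the coefficients of a functional for the upper bound.\<close>

lemma weighted_maximal_inequality:
  assumes \<tau>: "0 \<le> \<tau>" and d: "\<And>i. i \<in> {1..n} \<Longrightarrow> norm (d i) \<le> D" and l: "0 < l"
  shows "prob {\<omega> \<in> space M. \<exists>k\<in>{1..n}. x \<le> (\<Sum>i=1..k. d i \<bullet> Y \<tau> i \<omega>)}
    \<le> exp (l\<^sup>2 * exp (2 * l * D * \<tau> * bb n) / 2 * (\<Sum>i=1..n. d i \<bullet> (A *v d i)) - l * x)"
proof -
  define K where "K = 2 * l * D * \<tau> * bb n"
  define V where "V i \<omega> = l * (d i \<bullet> Y \<tau> i \<omega>)" for i \<omega>
  have bd: "\<bar>V i \<omega>\<bar> \<le> K" if i: "i \<in> {1..n}" for i \<omega>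
  proof -
    have D0: "0 \<le> D" using d[OF i] norm_ge_zero order_trans by blast
    have "\<bar>d i \<bullet> Y \<tau> i \<omega>\<bar> \<le> norm (d i) * norm (Y \<tau> i \<omega>)" by (rule Cauchy_Schwarz_ineq2)
    also have "\<dots> \<le> D * (2 * \<tau> * bb n)"
    proof (intro mult_mono d i D0 norm_ge_zero)
      have "norm (Y \<tau> i \<omega>) \<le> 2 * \<tau> * bb i" by (rule norm_Y[OF \<tau>]) (use i in auto)
      also have "\<dots> \<le> 2 * \<tau> * bb n" using \<tau> bb_mono[of i n] i by (intro mult_left_mono) auto
      finally show "norm (Y \<tau> i \<omega>) \<le> 2 * \<tau> * bb n" .
    qed
    finally have "l * \<bar>d i \<bullet> Y \<tau> i \<omega>\<bar> \<le> l * (D * (2 * \<tau> * bb n))" using l by (intro mult_left_mono) auto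
    then show ?thesis using l by (simp add: V_def K_def abs_mult mult_ac)
  qed
  have Vm: "V i \<in> borel_measurable M" if "i \<in> {1..n}" for i
    unfolding V_def using Y_measurable[of i \<tau>] that by (intro borel_measurable_times borel_measurable_const borel_measurable_inner) auto
  have Vmean: "expectation (V i) = 0" if "i \<in> {1..n}" for i
    unfolding V_def using Y_mean[of i "d i" \<tau>] that by simp
  have Vvar: "expectation (\<lambda>\<omega>. (V i \<omega>)\<^sup>2) \<le> l\<^sup>2 * (d i \<bullet> (A *v d i))" if "i \<in> {1..n}" for i
    unfolding V_def power_mult_distrib using Y_variance[OF _ \<tau>, of i "d i"] that by (simp add: mult_left_mono)
  note em = exp_moment_bound[OF Vm bd Vmean Vvar]
  have "prob {\<omega> \<in> space M. \<exists>k\<in>{1..n}. l * x \<le> (\<Sum>i=1..k. V i \<omega>)}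
      \<le> exp ((\<Sum>i=1..n. l\<^sup>2 * (d i \<bullet> (A *v d i)) * exp K / 2) - l * x)"
  proof (rule exponential_maximal_inequality)
    show "indep_vars (\<lambda>_. borel) V {1..n}" unfolding V_def by (rule Y_indep)
    show "integrable M (\<lambda>\<omega>. exp (V i \<omega>))" "expectation (\<lambda>\<omega>. exp (V i \<omega>)) \<le> exp (l\<^sup>2 * (d i \<bullet> (A *v d i)) * exp K / 2)"
      if "i \<in> {1..n}" for i using em[OF that that that that] by auto
    show "0 \<le> l\<^sup>2 * (d i \<bullet> (A *v d i)) * exp K / 2" for i using A_nonneg[of "d i"] by simp
  qed
  moreover have "l * x \<le> (\<Sum>i=1..k. V i \<omega>) \<longleftrightarrow> x \<le> (\<Sum>i=1..k. d i \<bullet> Y \<tau> i \<omega>)" for k \<omega>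
    unfolding V_def sum_distrib_left[symmetric] using l by simp
  moreover have "(\<Sum>i=1..n. l\<^sup>2 * (d i \<bullet> (A *v d i)) * exp K / 2) = l\<^sup>2 * exp K / 2 * (\<Sum>i=1..n. d i \<bullet> (A *v d i))"
    by (simp add: sum_distrib_left mult_ac)
  ultimately show ?thesis by (simp only: K_def)
qed

text \<open>Kronecker's lemma reduces this to the summability of \<open>E |X i| 1{|X i| > \<tau> bb i} / aa i\<close>, which follows
  from the finite second moment.\<close>

lemma truncation_error:
  assumes \<tau>: "0 < \<tau>"
  shows "AE \<omega> in M. (\<lambda>n. (\<Sum>i=1..n. norm (X i \<omega> - Y \<tau> i \<omega>)) / aa n) \<longlonglongrightarrow> 0"
proof -
  \<comment> \<open>Index 0 is set to zero because the locale says nothing about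
    \<open>X 0\<close>.\<close>
  define R where "R i x = (if i = 0 then 0 else norm (x - trunc \<tau> i x))" for i x
  have Rm[measurable]: "R i \<in> borel_measurable borel" for i unfolding R_def by (cases "i = 0") (simp, measurable)
  have R0: "0 \<le> R i x" "R i x \<le> norm x" for i x by (auto simp: R_def trunc_def)
  have Ri1: "integrable M (\<lambda>\<omega>. R i (X 1 \<omega>))" for i
    by (rule Bochner_Integration.integrable_bound[OF norm_int]) (use R0 in \<open>auto intro!: AE_I2\<close>)
  define Ri where "Ri i = expectation (\<lambda>\<omega>. R i (X 1 \<omega>))" for i
  have Ri0: "0 \<le> Ri i" for i unfolding Ri_def by (rule integral_nonneg_AE) (simp add: R0)
  \<comment> \<open>Only indices with \<open>bb i < norm x / \<tau>\<close> contribute, each at most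
    \<open>norm x / aa i\<close>. The sum of \<open>1 / aa i\<close> over them is linear in
    \<open>norm x\<close>, so the total is quadratic, hence integrable.\<close>
  have bound: "(\<Sum>i<n. R i x / aa i) \<le> 6 / \<tau> * (norm x)\<^sup>2" for n x
  proof -
    have "(\<Sum>i<n. R i x / aa i) \<le> (\<Sum>i=1..n. R i x / aa i)"
    proof (rule sum_mono2[of "{1..n}" "{..<n} - {0}", THEN order_trans[rotated]])
      show "(\<Sum>i<n. R i x / aa i) \<le> (\<Sum>i\<in>{..<n} - {0}. R i x / aa i)"
        by (rule eq_refl, rule sum.mono_neutral_right) (auto simp: R_def)
    qed (auto intro!: divide_nonneg_nonneg R0 aa_nonneg)
    also have "\<dots> \<le> (\<Sum>i=1..n. norm x * (if bb i < norm x / \<tau> then 1 / aa i else 0))"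
    proof (rule sum_mono)
      fix i assume i: "i \<in> {1..n}"
      show "R i x / aa i \<le> norm x * (if bb i < norm x / \<tau> then 1 / aa i else 0)"
      proof (cases "norm x \<le> \<tau> * bb i")
        case True then show ?thesis using aa_nonneg[of i] aa_nonneg[of 0] by (simp add: R_def trunc_def)
      next
        case False
        then have "bb i < norm x / \<tau>" using \<tau> by (simp add: less_divide_eq mult.commute)
        then show ?thesis using R0(2)[of i x] aa_nonneg[of i] by (simp add: divide_right_mono)
      qed
    qed
    also have "\<dots> = norm x * (\<Sum>i=1..n. (if bb i < norm x / \<tau> then 1 / aa i else 0))"
      by (rule sum_distrib_left[symmetric])
    also have "\<dots> \<le> norm x * (6 * (norm x / \<tau>))"
      using \<tau> by (intro mult_left_mono sum_inverse_aa_le) auto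
    finally show ?thesis by (simp add: power2_eq_square mult_ac)
  qed
  have sRi: "summable (\<lambda>i. Ri i / aa i)"
  proof (rule summableI_nonneg_bounded)
    show "0 \<le> Ri i / aa i" for i using Ri0 aa_nonneg by simp
    fix n
    have "(\<Sum>i<n. Ri i / aa i) = expectation (\<lambda>\<omega>. \<Sum>i<n. R i (X 1 \<omega>) / aa i)"
      unfolding Ri_def using Ri1 by simp
    also have "\<dots> \<le> expectation (\<lambda>\<omega>. 6 / \<tau> * (norm (X 1 \<omega>))\<^sup>2)"
      using Ri1 sq_int bound by (intro integral_mono) auto
    finally show "(\<Sum>i<n. Ri i / aa i) \<le> expectation (\<lambda>\<omega>. 6 / \<tau> * (norm (X 1 \<omega>))\<^sup>2)" .
  qed
  have RiX: "expectation (\<lambda>\<omega>. R i (X i \<omega>)) = Ri i" "integrable M (\<lambda>\<omega>. R i (X i \<omega>))" for i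
  proof -
    consider "i = 0" | "1 \<le> i" by linarith
    then have "expectation (\<lambda>\<omega>. R i (X i \<omega>)) = Ri i \<and> integrable M (\<lambda>\<omega>. R i (X i \<omega>))"
    proof cases
      case 1 then show ?thesis by (simp add: Ri_def R_def)
    next
      case 2 then show ?thesis using expectation_ident[OF Rm 2, of i] Ri1[of i] by (simp add: Ri_def)
    qed
    then show "expectation (\<lambda>\<omega>. R i (X i \<omega>)) = Ri i" "integrable M (\<lambda>\<omega>. R i (X i \<omega>))" by auto
  qed
  have RXm[measurable]: "(\<lambda>\<omega>. R i (X i \<omega>)) \<in> borel_measurable M" for i
    using RiX(2) by (rule borel_measurable_integrable)
  have "(\<integral>\<^sup>+\<omega>. (\<Sum>i. ennreal (R i (X i \<omega>) / aa i)) \<partial>M) = (\<Sum>i. \<integral>\<^sup>+\<omega>. ennreal (R i (X i \<omega>) / aa i) \<partial>M)"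
    by (rule nn_integral_suminf) measurable
  also have "\<dots> = (\<Sum>i. ennreal (Ri i / aa i))"
  proof (rule suminf_cong)
    fix i
    have "(\<integral>\<^sup>+\<omega>. ennreal (R i (X i \<omega>) / aa i) \<partial>M) = ennreal (expectation (\<lambda>\<omega>. R i (X i \<omega>) / aa i))"
      by (rule nn_integral_eq_integral) (use RiX aa_nonneg R0 in auto)
    then show "(\<integral>\<^sup>+\<omega>. ennreal (R i (X i \<omega>) / aa i) \<partial>M) = ennreal (Ri i / aa i)" using RiX(1) by simp
  qed
  also have "\<dots> = ennreal (\<Sum>i. Ri i / aa i)"
    by (rule suminf_ennreal2) (use Ri0 aa_nonneg sRi in auto)
  finally have fin: "(\<integral>\<^sup>+\<omega>. (\<Sum>i. ennreal (R i (X i \<omega>) / aa i)) \<partial>M) \<noteq> \<infinity>" by simp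
  have "AE \<omega> in M. (\<Sum>i. ennreal (R i (X i \<omega>) / aa i)) \<noteq> \<infinity>"
    by (rule nn_integral_PInf_AE[OF _ fin]) measurable
  then show ?thesis
  proof eventually_elim
    case (elim \<omega>)
    have "summable (\<lambda>i. R i (X i \<omega>) / aa i)"
      by (rule summable_suminf_not_top) (use elim R0 aa_nonneg in auto)
    from kronecker_nonneg[OF R0(1) this] kronecker_nonneg[OF Ri0 sRi]
    have lim: "(\<lambda>n. (\<Sum>i=1..n. R i (X i \<omega>)) / aa n + (\<Sum>i=1..n. Ri i) / aa n) \<longlonglongrightarrow> 0 + 0" by (rule tendsto_add)
    \<comment> \<open>As \<open>X i\<close> has mean zero, the mean of the truncated variable is
      minus the mean of the part cut off; centring therefore costs at most
      \<open>Ri i\<close>.\<close>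
    have le: "norm (X i \<omega> - Y \<tau> i \<omega>) \<le> R i (X i \<omega>) + Ri i" if i: "1 \<le> i" for i
    proof -
      have iX: "integrable M (X i)" using expectation_ident(2)[of "\<lambda>x. x" i] X1_int i by simp
      have "expectation (X i) = 0" using expectation_ident(1)[of "\<lambda>x. x" i] mean i by simp
      then have "expectation (\<lambda>\<omega>. trunc \<tau> i (X i \<omega>)) = - expectation (\<lambda>\<omega>. X i \<omega> - trunc \<tau> i (X i \<omega>))"
        using iX trunc_int[OF i] by simp
      then have "norm (expectation (\<lambda>\<omega>. trunc \<tau> i (X i \<omega>))) \<le> expectation (\<lambda>\<omega>. norm (X i \<omega> - trunc \<tau> i (X i \<omega>)))"
        using integral_norm_bound[of M "\<lambda>\<omega>. X i \<omega> - trunc \<tau> i (X i \<omega>)"] by simp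
      also have "\<dots> = Ri i" using RiX(1)[of i] i by (simp add: R_def)
      finally have 1: "norm (expectation (\<lambda>\<omega>. trunc \<tau> i (X i \<omega>))) \<le> Ri i" .
      have "X i \<omega> - Y \<tau> i \<omega> = (X i \<omega> - trunc \<tau> i (X i \<omega>)) + expectation (\<lambda>\<omega>. trunc \<tau> i (X i \<omega>))" by (simp add: Y_def)
      then have "norm (X i \<omega> - Y \<tau> i \<omega>) \<le> norm (X i \<omega> - trunc \<tau> i (X i \<omega>)) + norm (expectation (\<lambda>\<omega>. trunc \<tau> i (X i \<omega>)))"
        by (simp only: norm_triangle_ineq)
      then show ?thesis using 1 i by (simp add: R_def)
    qed
    show ?case
    proof (rule tendsto_sandwich[OF _ _ tendsto_const[of 0]])
      show "\<forall>\<^sub>F n in sequentially. 0 \<le> (\<Sum>i=1..n. norm (X i \<omega> - Y \<tau> i \<omega>)) / aa n"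
        by (intro always_eventually allI divide_nonneg_nonneg sum_nonneg aa_nonneg) simp
      show "\<forall>\<^sub>F n in sequentially. (\<Sum>i=1..n. norm (X i \<omega> - Y \<tau> i \<omega>)) / aa n \<le> (\<Sum>i=1..n. R i (X i \<omega>)) / aa n + (\<Sum>i=1..n. Ri i) / aa n"
        unfolding add_divide_distrib[symmetric] sum.distrib[symmetric]
        by (intro always_eventually allI divide_right_mono sum_mono le aa_nonneg) auto
    qed (use lim in simp)
  qed
qed

end

text \<open>An interval no longer than a block meets at most two neighbouring blocks; comparison
  with the starting points of these blocks gives at most three errors of size
  \<open>\<eta>\<close>.\<close>

lemma block_increment_bound:
  fixes F :: "nat \<Rightarrow> 'b::real_normed_vector"
  assumes len: "0 < len" and k: "k \<le> l" "l \<le> m * len" "l - k \<le> len" and \<eta>: "0 \<le> \<eta>"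
    and F: "\<And>u j. u < m \<Longrightarrow> u * len \<le> j \<Longrightarrow> j \<le> (u + 1) * len \<Longrightarrow> norm (F j - F (u * len)) \<le> \<eta>"
  shows "norm (F l - F k) \<le> 3 * \<eta>"
proof (cases "k = m * len")
  case True then show ?thesis using k \<eta> by simp
next
  case False
  define u where "u = k div len"
  have u: "u * len \<le> k" "k < (u + 1) * len"
    using len by (auto simp: u_def dividend_less_times_div mult.commute)
  have um: "u < m" using False k by (simp add: u_def less_mult_imp_div_less)
  have 1: "norm (F k - F (u * len)) \<le> \<eta>" using F[OF um] u by simp
  show ?thesis
  proof (cases "l \<le> (u + 1) * len")
    case True
    then have "norm (F l - F (u * len)) \<le> \<eta>" using F[OF um] u k by simp
    then show ?thesis using 1 norm_triangle_ineq4[of "F l - F (u * len)" "F k - F (u * len)"] \<eta> by simp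
  next
    case False
    have "u + 1 < m"
    proof (rule ccontr)
      assume "\<not> u + 1 < m"
      then have "m * len \<le> (u + 1) * len" by (intro mult_right_mono) auto
      then show False using False k by simp
    qed
    moreover have "l \<le> (u + 1 + 1) * len" using k u by (simp add: algebra_simps)
    ultimately have 2: "norm (F l - F ((u + 1) * len)) \<le> \<eta>" using F[of "u + 1" l] False by simp
    have 3: "norm (F ((u + 1) * len) - F (u * len)) \<le> \<eta>" using F[OF um, of "(u + 1) * len"] by simp
    have "F l - F k = (F l - F ((u + 1) * len)) + ((F ((u + 1) * len) - F (u * len)) - (F k - F (u * len)))" by simp
    then have "norm (F l - F k) \<le> norm (F l - F ((u + 1) * len)) + norm ((F ((u + 1) * len) - F (u * len)) - (F k - F (u * len)))"
      by (metis norm_triangle_ineq)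
    also have "norm ((F ((u + 1) * len) - F (u * len)) - (F k - F (u * len))) \<le> norm (F ((u + 1) * len) - F (u * len)) + norm (F k - F (u * len))"
      by (rule norm_triangle_ineq4)
    finally show ?thesis using 1 2 3 by simp
  qed
qed

section \<open>Oscillation and upper bound\<close>

context iid_walk
begin

definition walk :: "nat \<Rightarrow> 'a \<Rightarrow> real^'n" where
  "walk n \<omega> = (\<Sum>i=1..n. X i \<omega>)"

lemma walk_diff: "k \<le> l \<Longrightarrow> walk l \<omega> - walk k \<omega> = (\<Sum>i=k+1..l. X i \<omega>)"
proof -
  assume "k \<le> l"
  then have "{1..l} = {1..k} \<union> {k+1..l}" by auto
  then have "walk l \<omega> = walk k \<omega> + (\<Sum>i=k+1..l. X i \<omega>)"
    unfolding walk_def by (simp only:) (rule sum.union_disjoint, auto)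
  then show ?thesis by simp
qed

text \<open>The summand 1 keeps it positive when \<open>A = 0\<close>, since it occurs as a
  denominator.\<close>

definition trace_bound :: real where "trace_bound = 1 + (\<Sum>r\<in>UNIV. axis r 1 \<bullet> (A *v axis r 1))"

lemma trace_bound_ge: "1 \<le> trace_bound" "axis r s \<bullet> (A *v axis r s) \<le> s\<^sup>2 * trace_bound"
proof -
  have nn: "0 \<le> (\<Sum>r\<in>UNIV. axis r 1 \<bullet> (A *v axis r 1))" by (rule sum_nonneg) (rule A_nonneg)
  then show "1 \<le> trace_bound" by (simp add: trace_bound_def)
  have "axis r 1 \<bullet> (A *v axis r 1) \<le> (\<Sum>r\<in>UNIV. axis r 1 \<bullet> (A *v axis r 1))"
    by (rule member_le_sum) (auto intro: A_nonneg)
  then have "axis r 1 \<bullet> (A *v axis r 1) \<le> trace_bound" by (simp add: trace_bound_def)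
  moreover have "axis r s = s *\<^sub>R (axis r 1 :: real^'n)" by (simp add: axis_def vec_eq_iff)
  then have "axis r s \<bullet> (A *v axis r s) = s\<^sup>2 * (axis r 1 \<bullet> (A *v axis r 1))"
    by (simp add: matrix_vector_mult_scaleR power2_eq_square)
  ultimately show "axis r s \<bullet> (A *v axis r s) \<le> s\<^sup>2 * trace_bound" by (simp add: mult_left_mono)
qed

text \<open>Twice the bound obtained at dyadic times: three block errors, each summed over
  \<open>CARD('n)\<close> coordinates at the level \<open>sqrt (8 * trace_bound / 2^q)\<close>, plus
  \<open>1 / 2^q\<close> for the truncation. The doubling pays for the passage from
  \<open>2^j\<close> to arbitrary \<open>n\<close>.\<close>

definition osc_const :: "nat \<Rightarrow> real" where
  "osc_const q = 6 * (real CARD('n) * sqrt (8 * trace_bound / 2 ^ q)) + 2 / 2 ^ q"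

lemma osc_const_tendsto: "osc_const \<longlonglongrightarrow> 0"
proof -
  have "(\<lambda>q. (1/2::real) ^ q) \<longlonglongrightarrow> 0" by (rule LIMSEQ_power_zero) simp
  then have 1: "(\<lambda>q. 1 / 2 ^ q :: real) \<longlonglongrightarrow> 0" by (simp add: power_divide)
  have "(\<lambda>q. 6 * (real CARD('n) * sqrt (8 * trace_bound * (1 / 2 ^ q))) + 2 * (1 / 2 ^ q)) \<longlonglongrightarrow> 6 * (real CARD('n) * sqrt (8 * trace_bound * 0)) + 2 * 0"
    by (intro tendsto_intros 1)
  then show ?thesis unfolding osc_const_def by simp
qed

text \<open>The range up to \<open>2^j\<close> is divided into \<open>m = 2^q\<close> blocks. On
  each, the maximal inequality controls all increments from the start of the block in the signed
  coordinate directions, and summability over \<open>j\<close> makes this hold for all large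
  \<open>j\<close>.\<close>

lemma oscillation_dyadic:
  "AE \<omega> in M. \<forall>\<^sub>F j in sequentially. \<forall>k l. k \<le> l \<and> l \<le> 2 ^ j \<and> (l - k) * 2 ^ q \<le> 2 ^ j \<longrightarrow>
     norm (walk l \<omega> - walk k \<omega>) \<le> osc_const q / 2 * aa (2 ^ j)"
proof -
  define m :: nat where "m = 2 ^ q"
  have m0: "0 < real m" by (simp add: m_def)
  define \<epsilon> where "\<epsilon> = sqrt (8 * trace_bound / real m)"
  have tr0: "0 < trace_bound" using trace_bound_ge(1) by simp
  have \<epsilon>0: "0 < \<epsilon>" using tr0 m0 by (simp add: \<epsilon>_def)
  have \<epsilon>2: "\<epsilon>\<^sup>2 = 8 * trace_bound / real m" using tr0 m0 by (simp add: \<epsilon>_def)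
  \<comment> \<open>This \<open>\<theta>\<close> minimises
    \<open>\<theta>^2 * trace_bound / m - \<theta> * \<epsilon>\<close>; with the
    \<open>\<epsilon>\<close> above, the minimum is \<open>- 2\<close>, an exponent beyond the
    summability threshold. Then \<open>\<tau>\<close> is chosen so that the truncation factor
    \<open>exp K\<close> equals 2.\<close>
  define \<theta> where "\<theta> = \<epsilon> * real m / (2 * trace_bound)"
  have \<theta>0: "0 < \<theta>" using \<epsilon>0 m0 tr0 by (simp add: \<theta>_def)
  define \<tau> where "\<tau> = ln 2 / (2 * \<theta>)"
  have \<tau>0: "0 < \<tau>" using \<theta>0 by (simp add: \<tau>_def)
  define E :: "(real^'n) set" where "E = (\<lambda>(r, s). axis r s) ` (UNIV \<times> {1, -1})"
  have finE: "finite E" unfolding E_def by (intro finite_imageI finite_cartesian_product) auto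
  have E1: "norm e = 1" "e \<bullet> (A *v e) \<le> trace_bound" if "e \<in> E" for e
    using that trace_bound_ge(2)[where s=1] trace_bound_ge(2)[where s="-1"] by (auto simp: E_def norm_eq_1 inner_axis_axis)
  define len :: "nat \<Rightarrow> nat" where "len j = 2 ^ (j - q)" for j
  \<comment> \<open>Weights supported in block \<open>u\<close> turn a maximum over partial sums
    starting at 1 into one over increments from the start of that block.\<close>
  define d where "d j u e i = (if u * len j < i \<and> i \<le> (u + 1) * len j then e else 0)" for j u i :: nat and e :: "real^'n"
  define Bad where "Bad u e j = {\<omega> \<in> space M. \<exists>k\<in>{1..2 ^ j}. \<epsilon> * aa (2 ^ j) \<le> (\<Sum>i=1..k. d j u e i \<bullet> Y \<tau> i \<omega>)}" for u j :: nat and e :: "real^'n"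
  have Badm[measurable]: "Bad u e j \<in> sets M" for u e j
  proof -
    have [measurable]: "(\<lambda>\<omega>. \<Sum>i=1..k. d j u e i \<bullet> Y \<tau> i \<omega>) \<in> borel_measurable M" for k
      by (intro borel_measurable_sum borel_measurable_inner Y_measurable) auto
    show ?thesis unfolding Bad_def by (intro sets.sets_Collect_finite_Ex) auto
  qed
  have Bprob: "prob (Bad u e j) \<le> exp (- (2 * LL (2 ^ j)))" if e: "e \<in> E" and u: "u < m" and j: "q \<le> j" for u e j
  proof -
    let ?N = "2 ^ j :: nat"
    have bN: "0 < bb ?N" by (rule bb_pos) simp
    have dn: "norm (d j u e i) \<le> 1" for i using E1(1)[OF e] by (simp add: d_def)
    have lenm: "real (len j) = real ?N / real m"
    proof -
      have "len j * m = ?N" using j by (simp add: len_def m_def power_add[symmetric])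
      then have "real (len j) * real m = real ?N" by (metis of_nat_mult)
      then show ?thesis using m0 by (simp add: eq_divide_eq)
    qed
    have "(\<Sum>i=1..?N. d j u e i \<bullet> (A *v d j u e i)) = (\<Sum>i\<in>{1..?N} \<inter> {u * len j <.. (u + 1) * len j}. e \<bullet> (A *v e))"
      by (rule sum.mono_neutral_cong_right) (auto simp: d_def)
    also have "\<dots> \<le> (\<Sum>i\<in>{u * len j <.. (u + 1) * len j}. e \<bullet> (A *v e))"
      by (rule sum_mono2) (auto intro: A_nonneg)
    also have "\<dots> = real (len j) * (e \<bullet> (A *v e))" by simp
    also have "\<dots> \<le> real (len j) * trace_bound" using E1(2)[OF e] by (intro mult_left_mono) auto
    finally have sum: "(\<Sum>i=1..?N. d j u e i \<bullet> (A *v d j u e i)) \<le> real ?N / real m * trace_bound" by (simp add: lenm)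
    have "prob (Bad u e j) \<le> exp ((\<theta> / bb ?N)\<^sup>2 * exp (2 * (\<theta> / bb ?N) * 1 * \<tau> * bb ?N) / 2 * (\<Sum>i=1..?N. d j u e i \<bullet> (A *v d j u e i))
        - (\<theta> / bb ?N) * (\<epsilon> * aa ?N))"
      unfolding Bad_def by (rule weighted_maximal_inequality) (use \<tau>0 dn \<theta>0 bN in auto)
    also have "2 * (\<theta> / bb ?N) * 1 * \<tau> * bb ?N = ln 2" using bN \<theta>0 by (simp add: \<tau>_def)
    also have "(\<theta> / bb ?N) * (\<epsilon> * aa ?N) = \<theta> * \<epsilon> * LL ?N" using bN by (simp add: aa_eq)
    also have "exp ((\<theta> / bb ?N)\<^sup>2 * exp (ln 2) / 2 * (\<Sum>i=1..?N. d j u e i \<bullet> (A *v d j u e i)) - \<theta> * \<epsilon> * LL ?N)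
       \<le> exp ((\<theta> / bb ?N)\<^sup>2 * (real ?N / real m * trace_bound) - \<theta> * \<epsilon> * LL ?N)"
      using mult_left_mono[OF sum, of "(\<theta> / bb ?N)\<^sup>2"] by simp
    also have "(\<theta> / bb ?N)\<^sup>2 * (real ?N / real m * trace_bound) = \<theta>\<^sup>2 * trace_bound / real m * LL ?N"
    proof -
      have "(bb ?N)\<^sup>2 = real ?N / LL ?N" using LL_pos[of ?N] by (simp add: bb_def)
      then show ?thesis by (simp add: power_divide)
    qed
    also have "\<theta>\<^sup>2 * trace_bound / real m * LL ?N - \<theta> * \<epsilon> * LL ?N = - (2 * LL ?N)"
    proof -
      have "\<theta>\<^sup>2 * trace_bound / real m - \<theta> * \<epsilon> = - (\<epsilon>\<^sup>2 * real m / (4 * trace_bound))"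
        using m0 tr0 by (simp add: \<theta>_def power2_eq_square field_simps)
      also have "\<dots> = - 2" unfolding \<epsilon>2 using m0 tr0 by simp
      finally show ?thesis by (metis left_diff_distrib mult_minus_left)
    qed
    finally show ?thesis .
  qed
  have "AE \<omega> in M. \<forall>\<^sub>F j in sequentially. \<omega> \<in> space M - Bad u e j" if e: "e \<in> E" and u: "u < m" for u e
  proof (rule borel_cantelli_AE1)
    have "summable (\<lambda>j. exp (- (2 * LL (2 ^ j))))"
      by (rule summable_exp_LL[of 2 2]) auto
    then show "summable (\<lambda>j. prob (Bad u e j))"
      by (rule summable_comparison_test_ev[rotated])
        (use Bprob[OF e u] in \<open>auto simp: eventually_sequentially intro!: exI[of _ q]\<close>)
  qed (auto simp: emeasure_eq_measure)
  then have "AE \<omega> in M. \<forall>u\<in>{..<m}. \<forall>e\<in>E. \<forall>\<^sub>F j in sequentially. \<omega> \<in> space M - Bad u e j"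
    using finE by (intro AE_finite_allI) auto
  moreover note truncation_error[OF \<tau>0]
  ultimately show ?thesis
  proof eventually_elim
    case (elim \<omega>)
    have ev1: "\<forall>\<^sub>F j in sequentially. \<forall>u\<in>{..<m}. \<forall>e\<in>E. \<omega> \<in> space M - Bad u e j"
      using elim(1) finE by (simp add: eventually_ball_finite_distrib)
    have "\<forall>\<^sub>F n in sequentially. (\<Sum>i=1..n. norm (X i \<omega> - Y \<tau> i \<omega>)) / aa n < 1 / real m"
      by (rule order_tendstoD(2)[OF elim(2)]) (use m0 in auto)
    then have ev2: "\<forall>\<^sub>F j in sequentially. (\<Sum>i=1..2^j. norm (X i \<omega> - Y \<tau> i \<omega>)) / aa (2 ^ j) < 1 / real m"
    proof (rule eventually_compose_filterlim)
      show "filterlim (\<lambda>j. 2 ^ j :: nat) sequentially sequentially"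
        by (rule filterlim_subseq) (simp add: strict_mono_def)
    qed
    show ?case using ev1 ev2 eventually_ge_at_top[of q]
    proof eventually_elim
      case (elim j)
      let ?N = "2 ^ j :: nat"
      have aN: "0 < aa ?N" by (rule aa_pos) simp
      define SY where "SY k = (\<Sum>i=1..k. Y \<tau> i \<omega>)" for k
      have N: "?N = m * len j" using elim(3) by (simp add: m_def len_def power_add[symmetric])
      define \<eta> where "\<eta> = real CARD('n) * (\<epsilon> * aa ?N)"
      have \<eta>0: "0 \<le> \<eta>" using \<epsilon>0 aN by (simp add: \<eta>_def)
      have blk: "norm (SY k - SY (u * len j)) \<le> \<eta>" if u: "u < m" and k: "u * len j \<le> k" "k \<le> (u + 1) * len j" for u k
      proof (cases "k = 0")
        case True
        then have "u * len j = 0" using k by simp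
        then show ?thesis using True \<eta>0 by (simp only:) simp
      next
        case False
        have "(u + 1) * len j \<le> m * len j" using u by (intro mult_right_mono) auto
        then have kN: "k \<in> {1..?N}" using False k N by simp
        have lt: "e \<bullet> (SY k - SY (u * len j)) < \<epsilon> * aa ?N" if e: "e \<in> E" for e
        proof -
          have eq: "(\<Sum>i=1..k. d j u e i \<bullet> Y \<tau> i \<omega>) = e \<bullet> (SY k - SY (u * len j))"
          proof -
            have "{1..k} = {1..u * len j} \<union> {u * len j + 1..k}" using k by auto
            then have "SY k = SY (u * len j) + (\<Sum>i=u * len j + 1..k. Y \<tau> i \<omega>)"
              unfolding SY_def by (simp only:) (rule sum.union_disjoint, auto)
            then have "e \<bullet> (SY k - SY (u * len j)) = (\<Sum>i=u * len j + 1..k. e \<bullet> Y \<tau> i \<omega>)" by (simp add: inner_sum_right)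
            also have "\<dots> = (\<Sum>i=1..k. d j u e i \<bullet> Y \<tau> i \<omega>)"
              by (rule sum.mono_neutral_cong_left) (use k in \<open>auto simp: d_def\<close>)
            finally show ?thesis by simp
          qed
          have "\<omega> \<in> space M" "\<omega> \<notin> Bad u e j" using elim(1) u e by auto
          then have "\<not> \<epsilon> * aa ?N \<le> (\<Sum>i=1..k. d j u e i \<bullet> Y \<tau> i \<omega>)" using kN unfolding Bad_def by blast
          then show ?thesis unfolding eq by simp
        qed
        have "\<bar>(SY k - SY (u * len j)) $ r\<bar> \<le> \<epsilon> * aa ?N" for r
        proof -
          have "axis r 1 \<in> E" "axis r (-1) \<in> E" by (auto simp: E_def)
          from lt[OF this(1)] lt[OF this(2)] show ?thesis by (auto simp: inner_axis' abs_le_iff)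
        qed
        then have "(\<Sum>r\<in>UNIV. \<bar>(SY k - SY (u * len j)) $ r\<bar>) \<le> (\<Sum>r\<in>(UNIV::'n set). \<epsilon> * aa ?N)" by (intro sum_mono)
        then show ?thesis using norm_le_l1_cart[of "SY k - SY (u * len j)"] by (simp add: \<eta>_def)
      qed
      show ?case
      proof (intro allI impI, elim conjE)
        fix k l assume kl: "k \<le> l" "l \<le> ?N" "(l - k) * 2 ^ q \<le> ?N"
        have "(l - k) * m \<le> len j * m" using kl(3) N by (simp add: m_def mult.commute)
        then have "l - k \<le> len j" using m0 by simp
        then have 1: "norm (SY l - SY k) \<le> 3 * \<eta>"
          using block_increment_bound[of "len j" k l m \<eta> SY] kl N \<eta>0 blk by (simp add: len_def)
        have "(walk l \<omega> - walk k \<omega>) - (SY l - SY k) = (\<Sum>i=k+1..l. X i \<omega> - Y \<tau> i \<omega>)"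
        proof -
          have "{1..l} = {1..k} \<union> {k+1..l}" using kl by auto
          then have "SY l = SY k + (\<Sum>i=k+1..l. Y \<tau> i \<omega>)"
            unfolding SY_def by (simp only:) (rule sum.union_disjoint, auto)
          then show ?thesis using walk_diff[OF kl(1)] by (simp add: sum_subtractf)
        qed
        then have "norm ((walk l \<omega> - walk k \<omega>) - (SY l - SY k)) \<le> (\<Sum>i=k+1..l. norm (X i \<omega> - Y \<tau> i \<omega>))"
          by (simp only: norm_sum)
        also have "\<dots> \<le> (\<Sum>i=1..?N. norm (X i \<omega> - Y \<tau> i \<omega>))" by (rule sum_mono2) (use kl in auto)
        also have "\<dots> \<le> aa ?N / real m" using elim(2) aN by (simp add: divide_less_eq)
        finally have 2: "norm ((walk l \<omega> - walk k \<omega>) - (SY l - SY k)) \<le> aa ?N / real m" .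
        have "norm (walk l \<omega> - walk k \<omega>) \<le> norm (SY l - SY k) + norm ((walk l \<omega> - walk k \<omega>) - (SY l - SY k))"
          by (rule norm_triangle_sub)
        also have "\<dots> \<le> 3 * \<eta> + aa ?N / real m" using 1 2 by simp
        also have "\<dots> = osc_const q / 2 * aa ?N"
          by (simp add: \<eta>_def osc_const_def \<epsilon>_def m_def algebra_simps)
        finally show "norm (walk l \<omega> - walk k \<omega>) \<le> osc_const q / 2 * aa ?N" .
      qed
    qed
  qed
qed

text \<open>For arbitrary \<open>n\<close>, pass to the least power of two that is at least
  \<open>n\<close>: it is at most \<open>2 * n\<close>, and \<open>aa\<close> at most
  doubles.\<close>

lemma oscillation:
  "AE \<omega> in M. \<forall>q. \<forall>\<^sub>F n in sequentially. \<forall>k l. k \<le> l \<and> l \<le> n \<and> (l - k) * 2 ^ q \<le> n \<longrightarrow>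
     norm (walk l \<omega> - walk k \<omega>) \<le> osc_const q * aa n"
  unfolding AE_all_countable
proof
  fix q
  show "AE \<omega> in M. \<forall>\<^sub>F n in sequentially. \<forall>k l. k \<le> l \<and> l \<le> n \<and> (l - k) * 2 ^ q \<le> n \<longrightarrow>
     norm (walk l \<omega> - walk k \<omega>) \<le> osc_const q * aa n"
    using oscillation_dyadic[of q]
  proof eventually_elim
    case (elim \<omega>)
    then obtain J where J: "\<And>j. J \<le> j \<Longrightarrow> \<forall>k l. k \<le> l \<and> l \<le> 2 ^ j \<and> (l - k) * 2 ^ q \<le> 2 ^ j \<longrightarrow>
       norm (walk l \<omega> - walk k \<omega>) \<le> osc_const q / 2 * aa (2 ^ j)" unfolding eventually_sequentially by blast
    have oc: "0 \<le> osc_const q" using trace_bound_ge(1) by (simp add: osc_const_def)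
    show ?case
      unfolding eventually_sequentially
    proof (intro exI[of _ "2 ^ J"] allI impI, elim conjE)
      fix n k l :: nat
      assume n: "2 ^ J \<le> n" and kl: "k \<le> l" "l \<le> n" "(l - k) * 2 ^ q \<le> n"
      define j where "j = (LEAST j. n \<le> 2 ^ j)"
      have nj: "n \<le> 2 ^ j" unfolding j_def by (rule LeastI[of _ n]) (simp add: less_imp_le)
      have Jj: "J \<le> j"
      proof (rule ccontr)
        assume "\<not> J \<le> j"
        then have "(2::nat) ^ j < 2 ^ J" by simp
        then show False using nj n by linarith
      qed
      have "2 ^ j \<le> 2 * n"
      proof (cases j)
        case 0 then show ?thesis using n by (metis dual_order.trans less_le_not_le mult_2 one_le_numeral one_le_power power_0 trans_le_add1)
      next
        case (Suc i)
        then have "\<not> n \<le> 2 ^ i" unfolding j_def by (metis Least_le j_def not_less_eq_eq order_refl)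
        then show ?thesis using Suc by simp
      qed
      then have "aa (2 ^ j) \<le> 2 * aa n" using aa_mono[of "2 ^ j" "2 * n"] aa_double[of n] by linarith
      then have "osc_const q / 2 * aa (2 ^ j) \<le> osc_const q * aa n"
        using mult_left_mono[of "aa (2 ^ j)" "2 * aa n" "osc_const q / 2"] oc by simp
      moreover have "norm (walk l \<omega> - walk k \<omega>) \<le> osc_const q / 2 * aa (2 ^ j)"
        using J[OF Jj] kl nj by (meson order_trans)
      ultimately show "norm (walk l \<omega> - walk k \<omega>) \<le> osc_const q * aa n" by linarith
    qed
  qed
qed

text \<open>A positive \<open>s0\<close> above \<open>sdev A m c\<close> instead of
  \<open>sdev A m c\<close> itself also covers functionals of variance zero, for which any positive
  level will do.\<close>

lemma upper_subsequence:
  assumes m: "0 < m" and s0: "0 < s0" "sdev A m c \<le> s0" and \<epsilon>: "0 < \<epsilon>" and \<rho>: "1 < (\<rho>::real)"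
  shows "AE \<omega> in M. \<forall>\<^sub>F j in sequentially.
     (\<Sum>k<m. c k \<bullet> (walk ((k + 1) * nat \<lceil>\<rho> ^ j\<rceil>) \<omega> - walk (k * nat \<lceil>\<rho> ^ j\<rceil>) \<omega>))
       \<le> (1 + 2 * \<epsilon>) * s0 * (sqrt 2 * aa (m * nat \<lceil>\<rho> ^ j\<rceil>))"
proof -
  define h where "h j = nat \<lceil>\<rho> ^ j\<rceil>" for j
  have h\<rho>: "\<rho> ^ j \<le> real (h j)" for j unfolding h_def by linarith
  have h0: "0 < h j" for j using h\<rho>[of j] \<rho> by (metis gr0I less_le_trans not_less of_nat_0 zero_less_one zero_less_power order_less_trans)
  define N where "N j = m * h j" for j
  have N0: "0 < N j" for j using m h0 by (simp add: N_def)
  have hN: "h j \<le> N j" for j using m by (simp add: N_def)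
  have N\<rho>: "\<rho> ^ j \<le> real (N j)" for j using h\<rho>[of j] hN[of j] by linarith
  define D where "D = 1 + (\<Sum>k<m. norm (c k))"
  have D0: "1 \<le> D" unfolding D_def by (simp add: sum_nonneg)
  \<comment> \<open>The exponent \<open>\<theta>^2 * s0^2 / 2 - \<theta> * sqrt 2 * (1 + \<epsilon>)
    * s0\<close> has its minimum \<open>- (1 + \<epsilon>)^2\<close> at the \<open>\<theta>\<close>
    below. Truncation multiplies the quadratic term by \<open>1 + \<eta>\<close>; with
    \<open>\<eta> = \<epsilon> / (1 + \<epsilon>)\<close> exactly \<open>- (1 + \<epsilon>)\<close>
    is left, which is still summable.\<close>
  define \<eta> where "\<eta> = \<epsilon> / (1 + \<epsilon>)"
  have \<eta>0: "0 < \<eta>" using \<epsilon> by (simp add: \<eta>_def)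
  define \<theta> where "\<theta> = sqrt 2 * (1 + \<epsilon>) / s0"
  have \<theta>0: "0 < \<theta>" using \<epsilon> s0 by (simp add: \<theta>_def)
  define \<tau> where "\<tau> = ln (1 + \<eta>) / (2 * \<theta> * D)"
  have \<tau>0: "0 < \<tau>" using \<theta>0 \<eta>0 D0 by (simp add: \<tau>_def)
  define d where "d j i = c ((i - 1) div h j)" for j i
  have dD: "norm (d j i) \<le> D" if "i \<in> {1..N j}" for j i
  proof -
    have "(i - 1) div h j < m" using that h0[of j] by (intro less_mult_imp_div_less) (auto simp: N_def)
    then have "norm (d j i) \<le> (\<Sum>k<m. norm (c k))" unfolding d_def by (intro member_le_sum) auto
    then show ?thesis by (simp add: D_def)
  qed
  define x where "x j = sqrt 2 * (1 + \<epsilon>) * s0 * aa (N j)" for j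
  define Bad where "Bad j = {\<omega> \<in> space M. \<exists>k\<in>{1..N j}. x j \<le> (\<Sum>i=1..k. d j i \<bullet> Y \<tau> i \<omega>)}" for j
  have Badm[measurable]: "Bad j \<in> sets M" for j
  proof -
    have [measurable]: "(\<lambda>\<omega>. \<Sum>i=1..k. d j i \<bullet> Y \<tau> i \<omega>) \<in> borel_measurable M" for k
      by (intro borel_measurable_sum borel_measurable_inner Y_measurable) auto
    show ?thesis unfolding Bad_def by (intro sets.sets_Collect_finite_Ex) auto
  qed
  have Bprob: "prob (Bad j) \<le> exp (- ((1 + \<epsilon>) * LL (N j)))" for j
  proof -
    let ?N = "N j"
    have bN: "0 < bb ?N" by (rule bb_pos) (rule N0)
    have "(\<Sum>i=1..?N. d j i \<bullet> (A *v d j i)) = (\<Sum>k<m. \<Sum>i=k * h j + 1..(k + 1) * h j. c k \<bullet> (A *v c k))"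
      unfolding N_def d_def by (rule sum_block_div[OF h0, of "\<lambda>k i. c k \<bullet> (A *v c k)"])
    also have "\<dots> = real (h j) * (\<Sum>k<m. c k \<bullet> (A *v c k))" by (simp add: sum_distrib_left)
    also have "\<dots> = real ?N * (sdev A m c)\<^sup>2"
      using m by (simp add: sdev_def N_def sum_nonneg A_nonneg)
    also have "\<dots> \<le> real ?N * s0\<^sup>2"
      using s0 by (intro mult_left_mono power_mono) (auto simp: sdev_def sum_nonneg A_nonneg)
    finally have sum: "(\<Sum>i=1..?N. d j i \<bullet> (A *v d j i)) \<le> real ?N * s0\<^sup>2" .
    have "prob (Bad j) \<le> exp ((\<theta> / bb ?N)\<^sup>2 * exp (2 * (\<theta> / bb ?N) * D * \<tau> * bb ?N) / 2 * (\<Sum>i=1..?N. d j i \<bullet> (A *v d j i))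
        - (\<theta> / bb ?N) * x j)"
      unfolding Bad_def by (rule weighted_maximal_inequality) (use \<tau>0 dD \<theta>0 bN in auto)
    also have "2 * (\<theta> / bb ?N) * D * \<tau> * bb ?N = ln (1 + \<eta>)" using bN \<theta>0 D0 by (simp add: \<tau>_def)
    also have "exp (ln (1 + \<eta>)) = 1 + \<eta>" using \<eta>0 by simp
    also have "(\<theta> / bb ?N) * x j = 2 * (1 + \<epsilon>)\<^sup>2 * LL ?N"
    proof -
      have "(\<theta> / bb ?N) * x j = (sqrt 2 * sqrt 2) * (1 + \<epsilon>)\<^sup>2 * LL ?N"
        using bN s0(1) by (simp add: aa_eq x_def \<theta>_def power2_eq_square)
      then show ?thesis by simp
    qed
    also have "exp ((\<theta> / bb ?N)\<^sup>2 * (1 + \<eta>) / 2 * (\<Sum>i=1..?N. d j i \<bullet> (A *v d j i)) - 2 * (1 + \<epsilon>)\<^sup>2 * LL ?N)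
       \<le> exp ((\<theta> / bb ?N)\<^sup>2 * (1 + \<eta>) / 2 * (real ?N * s0\<^sup>2) - 2 * (1 + \<epsilon>)\<^sup>2 * LL ?N)"
      using sum \<eta>0 by (simp add: mult_left_mono)
    also have "(\<theta> / bb ?N)\<^sup>2 * (1 + \<eta>) / 2 * (real ?N * s0\<^sup>2) = (1 + \<epsilon>)\<^sup>2 * (1 + \<eta>) * LL ?N"
    proof -
      have "(bb ?N)\<^sup>2 = real ?N / LL ?N" using LL_pos[of ?N] by (simp add: bb_def)
      then have 1: "(\<theta> / bb ?N)\<^sup>2 * real ?N = \<theta>\<^sup>2 * LL ?N" using N0[of j] by (simp add: power_divide)
      have 2: "\<theta>\<^sup>2 * s0\<^sup>2 = 2 * (1 + \<epsilon>)\<^sup>2" using s0 by (simp add: \<theta>_def power_divide power_mult_distrib)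
      have "(\<theta> / bb ?N)\<^sup>2 * (1 + \<eta>) / 2 * (real ?N * s0\<^sup>2) = ((\<theta> / bb ?N)\<^sup>2 * real ?N) * s0\<^sup>2 * (1 + \<eta>) / 2" by simp
      also have "\<dots> = (\<theta>\<^sup>2 * s0\<^sup>2) * LL ?N * (1 + \<eta>) / 2" unfolding 1 by simp
      also have "\<dots> = (1 + \<epsilon>)\<^sup>2 * (1 + \<eta>) * LL ?N" unfolding 2 by simp
      finally show ?thesis .
    qed
    also have "(1 + \<epsilon>)\<^sup>2 * (1 + \<eta>) * LL ?N - 2 * (1 + \<epsilon>)\<^sup>2 * LL ?N = - ((1 + \<epsilon>) * LL ?N)"
    proof -
      have "(1 + \<epsilon>)\<^sup>2 * (1 + \<eta>) - 2 * (1 + \<epsilon>)\<^sup>2 = - (1 + \<epsilon>)"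
        using \<epsilon> by (simp add: \<eta>_def power2_eq_square field_simps)
      then show ?thesis by (metis left_diff_distrib mult_minus_left)
    qed
    finally show ?thesis .
  qed
  have "AE \<omega> in M. \<forall>\<^sub>F j in sequentially. \<omega> \<in> space M - Bad j"
  proof (rule borel_cantelli_AE1)
    have "summable (\<lambda>j. exp (- ((1 + \<epsilon>) * LL (N j))))"
      by (rule summable_exp_LL[of "1 + \<epsilon>" \<rho>]) (use \<epsilon> \<rho> N\<rho> in auto)
    then show "summable (\<lambda>j. prob (Bad j))"
      by (rule summable_comparison_test'[of _ 0]) (use Bprob in auto)
  qed (auto simp: emeasure_eq_measure)
  moreover note truncation_error[OF \<tau>0]
  ultimately show ?thesis
  proof eventually_elim
    case (elim \<omega>)
    \<comment> \<open>Coefficients have norm at most \<open>D\<close>, hence the tolerance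
      \<open>\<epsilon> * s0 / D\<close>; this error is the second \<open>\<epsilon>\<close> in the
      factor \<open>1 + 2 * \<epsilon>\<close>.\<close>
    have "\<forall>\<^sub>F n in sequentially. (\<Sum>i=1..n. norm (X i \<omega> - Y \<tau> i \<omega>)) / aa n < \<epsilon> * s0 / D"
      by (rule order_tendstoD(2)[OF elim(2)]) (use \<epsilon> s0 D0 in auto)
    then have ev2: "\<forall>\<^sub>F j in sequentially. (\<Sum>i=1..N j. norm (X i \<omega> - Y \<tau> i \<omega>)) / aa (N j) < \<epsilon> * s0 / D"
    proof (rule eventually_compose_filterlim)
      have "filterlim (\<lambda>j. real (N j)) at_top sequentially"
        unfolding filterlim_at_top
      proof
        fix Z :: real
        obtain n where n: "Z < \<rho> ^ n" using real_arch_pow[OF \<rho>] by blast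
        have "Z \<le> real (N j)" if "n \<le> j" for j
          using n N\<rho>[of j] power_increasing[OF that, of \<rho>] \<rho> by linarith
        then show "\<forall>\<^sub>F j in sequentially. Z \<le> real (N j)" unfolding eventually_sequentially by blast
      qed
      then show "filterlim N sequentially sequentially"
        by (simp add: filterlim_sequentially_iff_filterlim_real)
    qed
    show ?case using elim(1) ev2
    proof eventually_elim
      case (elim j)
      have aN: "0 < aa (N j)" using N0 by (rule aa_pos)
      have "N j \<in> {1..N j}" using N0[of j] by simp
      then have lt: "(\<Sum>i=1..N j. d j i \<bullet> Y \<tau> i \<omega>) < x j" using elim(1) unfolding Bad_def by force
      have "(\<Sum>k<m. c k \<bullet> (walk ((k + 1) * h j) \<omega> - walk (k * h j) \<omega>)) = (\<Sum>k<m. \<Sum>i=k * h j + 1..(k + 1) * h j. c k \<bullet> X i \<omega>)"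
        by (rule sum.cong) (auto simp: walk_diff inner_sum_right)
      also have "\<dots> = (\<Sum>i=1..N j. d j i \<bullet> X i \<omega>)"
        unfolding N_def d_def by (rule sum_block_div[OF h0, symmetric])
      also have "\<dots> = (\<Sum>i=1..N j. d j i \<bullet> Y \<tau> i \<omega>) + (\<Sum>i=1..N j. d j i \<bullet> (X i \<omega> - Y \<tau> i \<omega>))"
        by (simp add: sum.distrib[symmetric] inner_diff_right)
      also have "(\<Sum>i=1..N j. d j i \<bullet> (X i \<omega> - Y \<tau> i \<omega>)) \<le> (\<Sum>i=1..N j. D * norm (X i \<omega> - Y \<tau> i \<omega>))"
      proof (rule sum_mono)
        fix i assume "i \<in> {1..N j}"
        then show "d j i \<bullet> (X i \<omega> - Y \<tau> i \<omega>) \<le> D * norm (X i \<omega> - Y \<tau> i \<omega>)"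
          using norm_cauchy_schwarz[of "d j i" "X i \<omega> - Y \<tau> i \<omega>"] dD by (meson mult_right_mono norm_ge_zero order_trans)
      qed
      also have "\<dots> = D * (\<Sum>i=1..N j. norm (X i \<omega> - Y \<tau> i \<omega>))" by (simp add: sum_distrib_left)
      also have "\<dots> \<le> \<epsilon> * s0 * aa (N j)"
      proof -
        have "(\<Sum>i=1..N j. norm (X i \<omega> - Y \<tau> i \<omega>)) \<le> \<epsilon> * s0 / D * aa (N j)"
          using elim(2) aN by (simp add: divide_less_eq)
        then have "D * (\<Sum>i=1..N j. norm (X i \<omega> - Y \<tau> i \<omega>)) \<le> D * (\<epsilon> * s0 / D * aa (N j))"
          using D0 by (intro mult_left_mono) auto
        then show ?thesis using D0 by simp
      qed
      also have "\<dots> \<le> sqrt 2 * (\<epsilon> * s0 * aa (N j))"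
        using \<epsilon> s0(1) aN mult_right_mono[of 1 "sqrt 2" "\<epsilon> * s0 * aa (N j)"] by simp
      finally have "(\<Sum>k<m. c k \<bullet> (walk ((k + 1) * h j) \<omega> - walk (k * h j) \<omega>)) \<le> x j + sqrt 2 * (\<epsilon> * s0 * aa (N j))"
        using lt by linarith
      also have "\<dots> = (1 + 2 * \<epsilon>) * s0 * (sqrt 2 * aa (N j))" by (simp add: x_def algebra_simps)
      finally show ?case by (simp add: h_def N_def)
    qed
  qed
qed

end

section \<open>Lower bound\<close>

lemma nat_div_block: "0 < q \<Longrightarrow> (N::nat) div q \<le> (i + 1) * N div q - i * N div q"
  using div_add1_eq[of "i * N" N q] by (simp add: algebra_simps)

text \<open>On \<open>(v, v + 1]\<close> the density is at least its value at the right end. The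
  exponent changes by a term linear in \<open>v\<close>, negligible against \<open>v^2 / 2\<close>
  for large \<open>v\<close>.\<close>

lemma std_normal_tail:
  "exp (- ((v + 1)\<^sup>2 / 2)) / sqrt (2 * pi) \<le> 1 - cdf std_normal_distribution v" if "0 \<le> v"
proof -
  interpret N: real_distribution std_normal_distribution by (rule real_dist_normal_dist)
  have "ennreal (exp (- ((v + 1)\<^sup>2 / 2)) / sqrt (2 * pi)) = (\<integral>\<^sup>+x\<in>{v<..v+1}. ennreal (exp (- ((v + 1)\<^sup>2 / 2)) / sqrt (2 * pi)) \<partial>lborel)"
    by (simp add: nn_integral_cmult_indicator)
  also have "\<dots> \<le> (\<integral>\<^sup>+x\<in>{v<..v+1}. ennreal (std_normal_density x) \<partial>lborel)"
  proof (intro nn_integral_mono)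
    fix x :: real
    have "std_normal_density x \<ge> exp (- ((v + 1)\<^sup>2 / 2)) / sqrt (2 * pi)" if "x \<in> {v<..v+1}"
    proof -
      have "x\<^sup>2 \<le> (v + 1)\<^sup>2" using that \<open>0 \<le> v\<close> by (intro power_mono) auto
      then show ?thesis by (simp add: std_normal_density_def divide_right_mono)
    qed
    then show "ennreal (exp (- ((v + 1)\<^sup>2 / 2)) / sqrt (2 * pi)) * indicator {v<..v+1} x
        \<le> ennreal (std_normal_density x) * indicator {v<..v+1} x"
      by (auto simp: indicator_def intro!: ennreal_leI)
  qed
  also have "\<dots> = emeasure std_normal_distribution {v<..v+1}"
    by (subst emeasure_density) auto
  also have "\<dots> \<le> emeasure std_normal_distribution {v<..}" by (rule emeasure_mono) auto
  also have "\<dots> = ennreal (measure std_normal_distribution {v<..})" by (rule N.emeasure_eq_measure)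
  finally have "exp (- ((v + 1)\<^sup>2 / 2)) / sqrt (2 * pi) \<le> measure std_normal_distribution {v<..}"
    by (simp add: ennreal_le_iff)
  also have "measure std_normal_distribution {v<..} = 1 - cdf std_normal_distribution v"
  proof -
    have "measure std_normal_distribution (space std_normal_distribution - {..v}) = 1 - measure std_normal_distribution {..v}"
      by (rule N.prob_compl) simp
    moreover have "space std_normal_distribution - {..v} = {v<..}" by auto
    ultimately show ?thesis by (simp add: cdf_def)
  qed
  finally show ?thesis .
qed

context prob_space
begin

text \<open>By independence and \<open>1 - x \<le> exp (- x)\<close>, the probability that all
  events from \<open>n\<close> on fail is at most the exponential of minus any partial sum of their
  probabilities. Were it positive, these sums would be bounded.\<close>

lemma borel_cantelli_2:
  fixes V :: "nat \<Rightarrow> 'a \<Rightarrow> real"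
  assumes ind: "indep_vars (\<lambda>_. borel) V UNIV"
    and div: "\<not> summable (\<lambda>j. prob {\<omega> \<in> space M. x j \<le> V j \<omega>})"
  shows "AE \<omega> in M. \<exists>\<^sub>F j in sequentially. x j \<le> V j \<omega>"
proof -
  have [measurable]: "V j \<in> borel_measurable M" for j using ind unfolding indep_vars_def by auto
  define G where "G j = prob {\<omega> \<in> space M. x j \<le> V j \<omega>}" for j
  have none: "AE \<omega> in M. \<not> (\<forall>j\<ge>n. V j \<omega> < x j)" for n
  proof -
    define Z where "Z = {\<omega> \<in> space M. \<forall>j\<ge>n. V j \<omega> < x j}"
    have Zm: "Z \<in> sets M" unfolding Z_def by measurable
    have le: "prob Z \<le> exp (- (\<Sum>j=n..n+k. G j))" for k
    proof -
      have "prob Z \<le> prob (\<Inter>j\<in>{n..n+k}. V j -` {..<x j} \<inter> space M)"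
        by (rule finite_measure_mono) (auto simp: Z_def intro!: sets.finite_INT)
      also have "\<dots> = (\<Prod>j\<in>{n..n+k}. prob (V j -` {..<x j} \<inter> space M))"
        by (rule indep_varsD[OF ind]) auto
      also have "\<dots> \<le> (\<Prod>j\<in>{n..n+k}. exp (- G j))"
      proof (rule prod_mono, intro conjI)
        fix j
        have "V j -` {..<x j} \<inter> space M = space M - {\<omega> \<in> space M. x j \<le> V j \<omega>}" by auto
        then have "prob (V j -` {..<x j} \<inter> space M) = 1 - G j" unfolding G_def by (simp add: prob_compl)
        then show "prob (V j -` {..<x j} \<inter> space M) \<le> exp (- G j)" using exp_ge_add_one_self[of "- G j"] by simp
      qed simp
      also have "\<dots> = exp (- (\<Sum>j=n..n+k. G j))" by (simp add: exp_sum[symmetric] sum_negf)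
      finally show ?thesis .
    qed
    have "prob Z = 0"
    proof (rule ccontr)
      assume "prob Z \<noteq> 0"
      then have pz: "0 < prob Z" by (simp add: zero_less_measure_iff)
      have "summable (\<lambda>j. G j)"
      proof (rule summableI_nonneg_bounded)
        fix k
        have "(\<Sum>j=n..n+k. G j) \<le> - ln (prob Z)"
        proof -
          have "ln (prob Z) \<le> ln (exp (- (\<Sum>j=n..n+k. G j)))"
            by (subst ln_le_cancel_iff) (use pz le[of k] in auto)
          then show ?thesis by simp
        qed
        moreover have "(\<Sum>j<k. G j) \<le> (\<Sum>j<n. G j) + (\<Sum>j=n..n+k. G j)"
        proof -
          have "(\<Sum>j<k. G j) \<le> (\<Sum>j\<in>{..<n} \<union> {n..n+k}. G j)" by (rule sum_mono2) (auto simp: G_def)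
          also have "\<dots> = (\<Sum>j<n. G j) + (\<Sum>j=n..n+k. G j)" by (rule sum.union_disjoint) auto
          finally show ?thesis .
        qed
        ultimately show "(\<Sum>j<k. G j) \<le> (\<Sum>j<n. G j) + - ln (prob Z)" by linarith
      qed (simp add: G_def)
      then show False using div by (simp add: G_def)
    qed
    then have "Z \<in> null_sets M" using Zm by (auto simp: emeasure_eq_measure)
    then have "AE \<omega> in M. \<omega> \<notin> Z" by (rule AE_not_in)
    then show ?thesis by (rule AE_mp) (auto intro!: AE_I2 simp: Z_def)
  qed
  then have "AE \<omega> in M. \<forall>n. \<not> (\<forall>j\<ge>n. V j \<omega> < x j)" by (simp add: AE_all_countable)
  then show ?thesis
    by (rule AE_mp) (auto intro!: AE_I2 simp: frequently_sequentially not_less)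
qed

lemma indep_joint_lower_bound:
  fixes V :: "'i \<Rightarrow> 'a \<Rightarrow> real"
  assumes ind: "indep_vars (\<lambda>_. borel) V L" and L: "finite L" "L \<noteq> {}"
    and p: "\<And>l. l \<in> L \<Longrightarrow> p l \<le> prob {\<omega> \<in> space M. x l \<le> V l \<omega>}" "\<And>l. l \<in> L \<Longrightarrow> 0 \<le> p l"
  shows "(\<Prod>l\<in>L. p l) \<le> prob {\<omega> \<in> space M. \<forall>l\<in>L. x l \<le> V l \<omega>}"
proof -
  have "(\<Prod>l\<in>L. p l) \<le> (\<Prod>l\<in>L. prob (V l -` {x l..} \<inter> space M))"
  proof (rule prod_mono, intro conjI p(2))
    fix l assume "l \<in> L"
    moreover have "V l -` {x l..} \<inter> space M = {\<omega> \<in> space M. x l \<le> V l \<omega>}" by auto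
    ultimately show "p l \<le> prob (V l -` {x l..} \<inter> space M)" using p(1) by simp
  qed
  also have "\<dots> = prob (\<Inter>l\<in>L. V l -` {x l..} \<inter> space M)"
    by (rule indep_varsD_finite[OF ind L(2,1), symmetric]) simp
  also have "(\<Inter>l\<in>L. V l -` {x l..} \<inter> space M) = {\<omega> \<in> space M. \<forall>l\<in>L. x l \<le> V l \<omega>}" using L(2) by auto
  finally show ?thesis .
qed

end

context iid_walk
begin

lemma indep_block_sums:
  assumes K: "disjoint_family_on K L" "\<And>l. l \<in> L \<Longrightarrow> K l \<subseteq> {1..}"
  shows "indep_vars (\<lambda>_. borel) (\<lambda>l \<omega>. \<Sum>i\<in>K l. w l i \<bullet> X i \<omega>) L"
proof -
  have "indep_vars (\<lambda>l. PiM (K l) (\<lambda>_. borel)) (\<lambda>l \<omega>. restrict (\<lambda>i. X i \<omega>) (K l)) L"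
    by (rule indep_vars_restrict[OF indep K(2) K(1)])
  then have "indep_vars (\<lambda>_. borel) (\<lambda>l \<omega>. (\<lambda>z. \<Sum>i\<in>K l. w l i \<bullet> z i) (restrict (\<lambda>i. X i \<omega>) (K l))) L"
  proof (rule indep_vars_compose2)
    fix l
    show "(\<lambda>z. \<Sum>i\<in>K l. w l i \<bullet> z i) \<in> borel_measurable (PiM (K l) (\<lambda>_. borel))"
      by (intro borel_measurable_sum borel_measurable_inner borel_measurable_const measurable_component_singleton) auto
  qed
  then show ?thesis by simp
qed

text \<open>Both characteristic functions are the same power of that of one summand. Hence tail
  estimates for block sums do not depend on the position of the block.\<close>

lemma block_law:
  "distr M borel (\<lambda>\<omega>. \<Sum>i\<in>{s+1..s+p}. c \<bullet> X i \<omega>) = distr M borel (\<lambda>\<omega>. \<Sum>i<p. c \<bullet> X (Suc i) \<omega>)"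
proof (rule Levy_uniqueness)
  have m: "(\<lambda>\<omega>. c \<bullet> X i \<omega>) \<in> borel_measurable M" if "1 \<le> i" for i
    using X_measurable[OF that] by simp
  show "real_distribution (distr M borel (\<lambda>\<omega>. \<Sum>i\<in>{s+1..s+p}. c \<bullet> X i \<omega>))"
    by (intro real_distribution_distr borel_measurable_sum m) auto
  show "real_distribution (distr M borel (\<lambda>\<omega>. \<Sum>i<p. c \<bullet> X (Suc i) \<omega>))"
    by (intro real_distribution_distr borel_measurable_sum m) auto
  have dl: "distr M borel (\<lambda>\<omega>. c \<bullet> X i \<omega>) = distr M borel (\<lambda>\<omega>. c \<bullet> X 1 \<omega>)" if i: "1 \<le> i" for i
  proof -
    have "distr M borel (\<lambda>\<omega>. c \<bullet> X i \<omega>) = distr (distr M borel (X i)) borel (\<lambda>x. c \<bullet> x)"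
      by (subst distr_distr) (use X_measurable[OF i] in \<open>auto simp: o_def\<close>)
    also have "\<dots> = distr (distr M borel (X 1)) borel (\<lambda>x. c \<bullet> x)" using ident[OF i] by simp
    also have "\<dots> = distr M borel (\<lambda>\<omega>. c \<bullet> X 1 \<omega>)"
      by (subst distr_distr) (auto simp: o_def)
    finally show ?thesis .
  qed
  have single: "indep_vars (\<lambda>_. borel) (\<lambda>l \<omega>. \<Sum>i\<in>{f l}. c \<bullet> X i \<omega>) L"
    if inj: "inj_on f L" and ge: "\<And>l. l \<in> L \<Longrightarrow> 1 \<le> f l" for f :: "nat \<Rightarrow> nat" and L
  proof (rule indep_block_sums[of "\<lambda>l. {f l}" L "\<lambda>_ _. c"])
    show "disjoint_family_on (\<lambda>l. {f l}) L"
      using inj unfolding disjoint_family_on_def inj_on_def by blast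
    show "{f l} \<subseteq> {1..}" if "l \<in> L" for l using ge[OF that] by simp
  qed
  have "indep_vars (\<lambda>_. borel) (\<lambda>l \<omega>. \<Sum>i\<in>{l}. c \<bullet> X i \<omega>) {s+1..s+p}"
    by (rule single) (simp_all add: inj_on_def)
  then have i1: "indep_vars (\<lambda>_. borel) (\<lambda>i \<omega>. c \<bullet> X i \<omega>) {s+1..s+p}" by simp
  have "indep_vars (\<lambda>_. borel) (\<lambda>l \<omega>. \<Sum>i\<in>{Suc l}. c \<bullet> X i \<omega>) {..<p}"
    by (rule single) (simp_all add: inj_on_def)
  then have i2: "indep_vars (\<lambda>_. borel) (\<lambda>i \<omega>. c \<bullet> X (Suc i) \<omega>) {..<p}" by simp
  show "char (distr M borel (\<lambda>\<omega>. \<Sum>i\<in>{s+1..s+p}. c \<bullet> X i \<omega>)) = char (distr M borel (\<lambda>\<omega>. \<Sum>i<p. c \<bullet> X (Suc i) \<omega>))"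
  proof
    fix t
    have "(\<Prod>i\<in>{s+1..s+p}. char (distr M borel (\<lambda>\<omega>. c \<bullet> X i \<omega>)) t) = (\<Prod>i\<in>{s+1..s+p}. char (distr M borel (\<lambda>\<omega>. c \<bullet> X 1 \<omega>)) t)"
      by (rule prod.cong[OF refl]) (subst dl, simp_all)
    moreover have "(\<Prod>i<p. char (distr M borel (\<lambda>\<omega>. c \<bullet> X (Suc i) \<omega>)) t) = (\<Prod>i<p. char (distr M borel (\<lambda>\<omega>. c \<bullet> X 1 \<omega>)) t)"
      by (rule prod.cong[OF refl]) (subst dl, simp_all)
    ultimately show "char (distr M borel (\<lambda>\<omega>. \<Sum>i\<in>{s+1..s+p}. c \<bullet> X i \<omega>)) t = char (distr M borel (\<lambda>\<omega>. \<Sum>i<p. c \<bullet> X (Suc i) \<omega>)) t"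
      unfolding char_distr_sum[OF i1] char_distr_sum[OF i2] by simp
  qed
qed

text \<open>The central limit theorem at a fixed level \<open>v\<close>. Half of the Gaussian tail
  bound is given away to turn the limit into an eventual inequality, and \<open>block_law\<close>
  makes the threshold \<open>p0\<close> uniform in the position \<open>s\<close>.\<close>

lemma block_tail_prob:
  assumes \<sigma>: "0 < \<sigma>" "\<sigma>\<^sup>2 = c \<bullet> (A *v c)" and v: "0 \<le> v"
  shows "\<exists>p0. \<forall>p s. p0 \<le> p \<longrightarrow> exp (- ((v + 1)\<^sup>2 / 2)) / (2 * sqrt (2 * pi))
     \<le> prob {\<omega> \<in> space M. v * \<sigma> * sqrt (real p) \<le> (\<Sum>i\<in>{s+1..s+p}. c \<bullet> X i \<omega>)}"
proof -
  let ?Q = "\<lambda>n \<omega>. (\<Sum>i<n. c \<bullet> X (Suc i) \<omega>)"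
  let ?\<kappa> = "exp (- ((v + 1)\<^sup>2 / 2)) / (2 * sqrt (2 * pi))"
  have cm: "(\<lambda>\<omega>. c \<bullet> X i \<omega>) \<in> borel_measurable M" if "1 \<le> i" for i
    using X_measurable[OF that] by simp
  have Qm[measurable]: "?Q n \<in> borel_measurable M" for n by (intro borel_measurable_sum cm) auto
  have e0: "expectation (\<lambda>\<omega>. c \<bullet> X (Suc i) \<omega>) = 0" for i
    using expectation_ident(1)[of "\<lambda>x. c \<bullet> x" "Suc i"] X1_int mean by simp
  have "weak_conv_m (\<lambda>n. distr M borel (\<lambda>\<omega>. ?Q n \<omega> / sqrt (n * \<sigma>\<^sup>2))) std_normal_distribution"
  proof (rule central_limit_theorem_zero_mean)
    show "indep_vars (\<lambda>_. borel) (\<lambda>i \<omega>. c \<bullet> X (Suc i) \<omega>) UNIV"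
      using indep_block_sums[of "\<lambda>l. {Suc l}" UNIV "\<lambda>_ _. c"] by (auto simp: disjoint_family_on_def)
    show "expectation (\<lambda>\<omega>. c \<bullet> X (Suc n) \<omega>) = 0" for n by (rule e0)
    show "0 < \<sigma>" by (rule \<sigma>)
    have sq: "integrable M (\<lambda>\<omega>. (c \<bullet> X (Suc n) \<omega>)\<^sup>2)" "expectation (\<lambda>\<omega>. (c \<bullet> X (Suc n) \<omega>)\<^sup>2) = \<sigma>\<^sup>2" for n
      using expectation_ident[of "\<lambda>x. (c \<bullet> x)\<^sup>2" "Suc n"] inner_sq_int inner_sq_expectation \<sigma> by auto
    show "integrable M (\<lambda>\<omega>. (c \<bullet> X (Suc n) \<omega>)\<^sup>2)" for n by (rule sq)
    show "variance (\<lambda>\<omega>. c \<bullet> X (Suc n) \<omega>) = \<sigma>\<^sup>2" for n using e0 sq(2) by simp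
    show "distr M borel (\<lambda>\<omega>. c \<bullet> X (Suc n) \<omega>) = distr M borel (\<lambda>\<omega>. c \<bullet> X (Suc 0) \<omega>)" for n
      using block_law[where s=n and p=1 and c=c] by simp
  qed
  moreover have "isCont (cdf std_normal_distribution) v"
  proof -
    interpret N: real_distribution std_normal_distribution by (rule real_dist_normal_dist)
    have "emeasure std_normal_distribution {v} = 0" by (subst emeasure_density) (auto simp: nn_integral_cmult_indicator)
    then show ?thesis by (simp add: N.isCont_cdf measure_def)
  qed
  ultimately have lim: "(\<lambda>n. cdf (distr M borel (\<lambda>\<omega>. ?Q n \<omega> / sqrt (n * \<sigma>\<^sup>2))) v) \<longlonglongrightarrow> cdf std_normal_distribution v"
    unfolding weak_conv_m_def weak_conv_def by blast
  have kpos: "0 < ?\<kappa>" by simp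
  have "cdf std_normal_distribution v < 1 - ?\<kappa>"
  proof -
    have "exp (- ((v + 1)\<^sup>2 / 2)) / sqrt (2 * pi) = 2 * ?\<kappa>" by simp
    then show ?thesis using std_normal_tail[OF v] kpos by linarith
  qed
  then have "\<forall>\<^sub>F n in sequentially. cdf (distr M borel (\<lambda>\<omega>. ?Q n \<omega> / sqrt (n * \<sigma>\<^sup>2))) v < 1 - ?\<kappa>"
    by (rule order_tendstoD(2)[OF lim])
  then obtain n0 where n0: "\<And>n. n0 \<le> n \<Longrightarrow> cdf (distr M borel (\<lambda>\<omega>. ?Q n \<omega> / sqrt (n * \<sigma>\<^sup>2))) v < 1 - ?\<kappa>"
    unfolding eventually_sequentially by blast
  show ?thesis
  proof (intro exI[of _ "Suc n0"] allI impI)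
    fix p s assume p: "Suc n0 \<le> p"
    have sp: "0 < sqrt (real p * \<sigma>\<^sup>2)" using p \<sigma>(1) by simp
    have sq: "sqrt (real p * \<sigma>\<^sup>2) = \<sigma> * sqrt (real p)" using \<sigma>(1) by (simp add: real_sqrt_mult)
    have "cdf (distr M borel (\<lambda>\<omega>. ?Q p \<omega> / sqrt (p * \<sigma>\<^sup>2))) v = prob {\<omega> \<in> space M. ?Q p \<omega> / sqrt (p * \<sigma>\<^sup>2) \<le> v}"
      unfolding cdf_def by (subst measure_distr) (auto intro!: arg_cong[where f=prob])
    also have "{\<omega> \<in> space M. ?Q p \<omega> / sqrt (p * \<sigma>\<^sup>2) \<le> v} = {\<omega> \<in> space M. ?Q p \<omega> \<le> v * \<sigma> * sqrt (real p)}"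
      using sp unfolding sq by (simp add: divide_le_eq mult_ac)
    finally have "prob {\<omega> \<in> space M. ?Q p \<omega> \<le> v * \<sigma> * sqrt (real p)} < 1 - ?\<kappa>" using n0[of p] p by simp
    moreover have "prob (space M - {\<omega> \<in> space M. ?Q p \<omega> \<le> v * \<sigma> * sqrt (real p)}) = 1 - prob {\<omega> \<in> space M. ?Q p \<omega> \<le> v * \<sigma> * sqrt (real p)}"
      by (rule prob_compl) measurable
    moreover have "prob (space M - {\<omega> \<in> space M. ?Q p \<omega> \<le> v * \<sigma> * sqrt (real p)}) \<le> prob {\<omega> \<in> space M. v * \<sigma> * sqrt (real p) \<le> ?Q p \<omega>}"
      by (rule finite_measure_mono) (auto, measurable)
    moreover have "prob {\<omega> \<in> space M. v * \<sigma> * sqrt (real p) \<le> ?Q p \<omega>} = prob {\<omega> \<in> space M. v * \<sigma> * sqrt (real p) \<le> (\<Sum>i\<in>{s+1..s+p}. c \<bullet> X i \<omega>)}"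
    proof -
      have "measure (distr M borel (?Q p)) {v * \<sigma> * sqrt (real p)..} = measure (distr M borel (\<lambda>\<omega>. \<Sum>i\<in>{s+1..s+p}. c \<bullet> X i \<omega>)) {v * \<sigma> * sqrt (real p)..}"
        unfolding block_law ..
      moreover have "(\<lambda>\<omega>. \<Sum>i\<in>{s+1..s+p}. c \<bullet> X i \<omega>) \<in> borel_measurable M" by (intro borel_measurable_sum cm) auto
      moreover have "f -` {y..} \<inter> space M = {\<omega> \<in> space M. y \<le> f \<omega>}" for f :: "'a \<Rightarrow> real" and y by auto
      ultimately show ?thesis by (simp add: measure_distr)
    qed
    ultimately show "?\<kappa> \<le> prob {\<omega> \<in> space M. v * \<sigma> * sqrt (real p) \<le> (\<Sum>i\<in>{s+1..s+p}. c \<bullet> X i \<omega>)}" by linarith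
  qed
qed

text \<open>The central limit theorem only controls sums at the scale of their standard deviation. A sum over
  \<open>N\<close> indices is therefore cut into a number of blocks proportional to \<open>l\<close>, and all block sums are asked to be
  large simultaneously: independence multiplies the Gaussian tail probabilities of the blocks.\<close>

lemma long_block_lower_bound:
  assumes \<sigma>: "0 < \<sigma>" "\<sigma>\<^sup>2 = c \<bullet> (A *v c)" and u: "0 \<le> u" and \<delta>: "0 < \<delta>"
  shows "\<exists>l0 R. \<forall>l N s. l0 \<le> l \<longrightarrow> R * l \<le> real N \<longrightarrow>
     exp (- ((u\<^sup>2 + \<delta>) * l)) \<le> prob {\<omega> \<in> space M. u * \<sigma> * sqrt (2 * real N * l) \<le> (\<Sum>i\<in>{s+1..s+N}. c \<bullet> X i \<omega>)}"
proof -
  \<comment> \<open>The factor \<open>1 + \<beta>\<close> is a margin in the level, spent on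
    rounding the block length down.\<close>
  define \<beta> where "\<beta> = min 1 (\<delta> / (8 * (u\<^sup>2 + 1)))"
  have u1: "0 < u\<^sup>2 + 1" by (simp add: add_nonneg_pos)
  have \<beta>: "0 < \<beta>" "\<beta> \<le> 1" using \<delta> u1 by (auto simp: \<beta>_def)
  have \<beta>u: "((1 + \<beta>) * u)\<^sup>2 < u\<^sup>2 + \<delta> / 2"
  proof -
    have "\<beta> \<le> \<delta> / (8 * (u\<^sup>2 + 1))" by (simp add: \<beta>_def)
    then have "\<beta> * (u\<^sup>2 + 1) \<le> \<delta> / 8" using u1 by (simp add: field_simps)
    moreover have "\<beta> * \<beta> * u\<^sup>2 \<le> 1 * \<beta> * u\<^sup>2" using \<beta> by (intro mult_right_mono) auto
    ultimately have "3 * \<beta> * u\<^sup>2 < \<delta> / 2" using \<beta> \<delta> by (simp add: algebra_simps)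
    moreover have "((1 + \<beta>) * u)\<^sup>2 = u\<^sup>2 + 2 * \<beta> * u\<^sup>2 + \<beta> * \<beta> * u\<^sup>2" by (simp add: power2_eq_square algebra_simps)
    ultimately show ?thesis using \<open>\<beta> * \<beta> * u\<^sup>2 \<le> 1 * \<beta> * u\<^sup>2\<close> by simp
  qed
  define C where "C = ln (2 * sqrt (2 * pi))"
  have pi1: "1 \<le> 2 * sqrt (2 * pi)"
  proof -
    have "1 \<le> sqrt (2 * pi)" using pi_gt3 by simp
    then show ?thesis by linarith
  qed
  have C0: "0 \<le> C" unfolding C_def using pi1 by simp
  \<comment> \<open>The parameter \<open>t\<close> tunes the block length: there will be about
    \<open>2 * l / t^2\<close> blocks, each asked to exceed \<open>v = (1 + \<beta>) * u * t\<close>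
    of its standard deviations, at the cost \<open>K = (v + 1)^2 / 2 + C\<close> in the exponent.
    The cost per unit of \<open>l\<close> is the expression below, in which the shift by 1 and the
    constant \<open>C\<close> disappear for large \<open>t\<close>.\<close>
  have "((\<lambda>t::real. ((1 + \<beta>) * u + 1 / t)\<^sup>2 + 2 * C * (1 / t)\<^sup>2) \<longlongrightarrow> ((1 + \<beta>) * u + 0)\<^sup>2 + 2 * C * 0\<^sup>2) at_top"
    by (intro tendsto_intros tendsto_divide_0[OF tendsto_const] filterlim_at_top_imp_at_infinity filterlim_ident)
  then have "\<forall>\<^sub>F t in at_top. ((1 + \<beta>) * u + 1 / t)\<^sup>2 + 2 * C * (1 / t)\<^sup>2 < u\<^sup>2 + \<delta> / 2"
    by (rule order_tendstoD(2)) (use \<beta>u in simp)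
  then have "\<forall>\<^sub>F t in at_top. 0 < t \<and> ((1 + \<beta>) * u + 1 / t)\<^sup>2 + 2 * C * (1 / t)\<^sup>2 < u\<^sup>2 + \<delta> / 2"
    using eventually_gt_at_top[of "0::real"] by eventually_elim simp
  then obtain t :: real where t: "0 < t" "((1 + \<beta>) * u + 1 / t)\<^sup>2 + 2 * C * (1 / t)\<^sup>2 < u\<^sup>2 + \<delta> / 2"
    using eventually_happens'[OF trivial_limit_at_top_linorder] by blast
  define v where "v = (1 + \<beta>) * u * t"
  have v0: "0 \<le> v" using \<beta> u t by (simp add: v_def)
  define K where "K = (v + 1)\<^sup>2 / 2 + C"
  have K0: "0 \<le> K" using C0 by (simp add: K_def)
  have K2: "K * (2 / t\<^sup>2) \<le> u\<^sup>2 + \<delta> / 2"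
  proof -
    have "K * (2 / t\<^sup>2) = ((v + 1) / t)\<^sup>2 + 2 * C * (1 / t)\<^sup>2"
      unfolding power_divide using t(1) by (simp add: K_def field_simps)
    also have "(v + 1) / t = (1 + \<beta>) * u + 1 / t" using t by (simp add: v_def field_simps)
    finally show ?thesis using t(2) by simp
  qed
  have \<kappa>: "exp (- ((v + 1)\<^sup>2 / 2)) / (2 * sqrt (2 * pi)) = exp (- K)"
  proof -
    have "exp (- K) = exp (- ((v + 1)\<^sup>2 / 2)) * exp (- C)" by (simp add: K_def exp_add[symmetric])
    also have "exp (- C) = 1 / (2 * sqrt (2 * pi))" using pi1 by (simp add: C_def exp_minus inverse_eq_divide)
    finally show ?thesis by simp
  qed
  obtain p0 where p0': "\<forall>p s. p0 \<le> p \<longrightarrow> exp (- K) \<le> prob {\<omega> \<in> space M. v * \<sigma> * sqrt (real p) \<le> (\<Sum>i\<in>{s+1..s+p}. c \<bullet> X i \<omega>)}"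
    using block_tail_prob[OF \<sigma> v0] unfolding \<kappa> by (rule exE)
  note p0 = p0'[rule_format]
  \<comment> \<open>If \<open>N / q\<close> is at least \<open>R0\<close>, rounding it down costs no
    more than the factor \<open>(1 + \<beta>)^2\<close>. The constant \<open>R\<close> lets
    \<open>N / q\<close> exceed \<open>R0\<close> and \<open>p0\<close> together, and
    \<open>l0\<close> absorbs the one extra block caused by rounding \<open>q\<close> up.\<close>
  define R0 where "R0 = (1 + \<beta>)\<^sup>2 / ((1 + \<beta>)\<^sup>2 - 1)"
  have b1: "1 < (1 + \<beta>)\<^sup>2" using \<beta> by (simp add: power2_eq_square algebra_simps add_pos_pos)
  have R00: "0 < R0" unfolding R0_def by (rule divide_pos_pos) (use b1 in auto)
  define R where "R = (2 / t\<^sup>2 + 1) * (R0 + real p0 + 1)"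
  define l0 where "l0 = max 1 (2 * K / \<delta>)"
  show ?thesis
  proof (rule exI[of _ l0], rule exI[of _ R], intro allI impI)
    fix l :: real and N s :: nat
    assume l: "l0 \<le> l" and N: "R * l \<le> real N"
    have l1: "1 \<le> l" and lK: "K \<le> \<delta> / 2 * l" using l \<delta> by (auto simp: l0_def field_simps)
    define q where "q = nat \<lceil>2 * l / t\<^sup>2\<rceil>"
    have lt: "0 < 2 * l / t\<^sup>2" using l1 t by simp
    then have q0: "0 < q" and q1: "2 * l / t\<^sup>2 \<le> real q" and q2: "real q \<le> 2 * l / t\<^sup>2 + 1" unfolding q_def by linarith+
    have "2 * l / t\<^sup>2 + 1 \<le> l * (2 / t\<^sup>2 + 1)" using l1 by (simp add: algebra_simps)
    then have "real q * (R0 + real p0 + 1) \<le> l * (2 / t\<^sup>2 + 1) * (R0 + real p0 + 1)"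
      using q2 R00 by (intro mult_right_mono) auto
    also have "\<dots> = R * l" by (simp add: R_def)
    finally have qN: "real q * (R0 + real p0 + 1) \<le> real N" using N by simp
    define p where "p = N div q"
    have Nq: "R0 + real p0 + 1 \<le> real N / real q" using qN q0 by (simp add: field_simps)
    have pN: "real N / real q - 1 \<le> real p"
    proof -
      have "N < (p + 1) * q" using q0 by (simp add: p_def dividend_less_times_div mult.commute)
      then have "real N < (real p + 1) * real q" by (metis of_nat_less_iff of_nat_mult of_nat_add of_nat_1)
      then show ?thesis using q0 by (simp add: divide_le_eq algebra_simps)
    qed
    have pp0: "p0 \<le> p" using pN Nq R00 by linarith
    have pl: "real N / real q / (1 + \<beta>)\<^sup>2 \<le> real p"
    proof -
      have "R0 \<le> real N / real q" using Nq by linarith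
      then have "(1 + \<beta>)\<^sup>2 \<le> real N / real q * ((1 + \<beta>)\<^sup>2 - 1)" using b1 by (simp add: R0_def pos_divide_le_eq)
      then have "real N / real q \<le> (real N / real q - 1) * (1 + \<beta>)\<^sup>2" by (simp add: algebra_simps)
      then have "real N / real q / (1 + \<beta>)\<^sup>2 \<le> real N / real q - 1" using b1 by (subst pos_divide_le_eq) auto
      then show ?thesis using pN by linarith
    qed
    \<comment> \<open>The cut points \<open>i * N div q\<close> use up all \<open>N\<close> indices
      and leave each block with at least \<open>N div q\<close> of them.\<close>
    define a where "a i = i * N div q" for i
    have a: "a 0 = 0" "a q = N" using q0 by (auto simp: a_def)
    have aS: "p \<le> a (i + 1) - a i" "a i \<le> a (i + 1)" for i
      using nat_div_block[OF q0, of N i] by (auto simp: a_def p_def intro!: div_le_mono)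
    have amono: "a i \<le> a j" if "i \<le> j" for i j using that by (auto simp: a_def intro!: div_le_mono)
    define Kb where "Kb i = {s + a i + 1..s + a i + (a (i + 1) - a i)}" for i
    define V where "V i \<omega> = (\<Sum>k\<in>Kb i. c \<bullet> X k \<omega>)" for i \<omega>
    have ind: "indep_vars (\<lambda>_. borel) V {..<q}"
      unfolding V_def
    proof (rule indep_block_sums[of Kb "{..<q}" "\<lambda>_ _. c"])
      show "disjoint_family_on Kb {..<q}"
        unfolding disjoint_family_on_def
      proof (intro ballI impI)
        fix i j :: nat assume "i \<noteq> j"
        then consider "i + 1 \<le> j" | "j + 1 \<le> i" by linarith
        then show "Kb i \<inter> Kb j = {}"
          using amono[of "i + 1" j] amono[of "j + 1" i] aS(2)[of i] aS(2)[of j] by cases (auto simp: Kb_def)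
      qed
    qed (auto simp: Kb_def)
    have "(\<Prod>i<q. exp (- K)) \<le> prob {\<omega> \<in> space M. \<forall>i\<in>{..<q}. v * \<sigma> * sqrt (real (a (i + 1) - a i)) \<le> V i \<omega>}"
    proof (rule indep_joint_lower_bound[OF ind])
      fix i
      show "exp (- K) \<le> prob {\<omega> \<in> space M. v * \<sigma> * sqrt (real (a (i + 1) - a i)) \<le> V i \<omega>}"
        unfolding V_def Kb_def by (rule p0) (use pp0 aS(1)[of i] in linarith)
    qed (use q0 in auto)
    also have "\<dots> \<le> prob {\<omega> \<in> space M. u * \<sigma> * sqrt (2 * real N * l) \<le> (\<Sum>i\<in>{s+1..s+N}. c \<bullet> X i \<omega>)}"
    proof (rule finite_measure_mono)
      have [measurable]: "(\<lambda>\<omega>. \<Sum>i\<in>{s+1..s+N}. c \<bullet> X i \<omega>) \<in> borel_measurable M"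
        by (intro borel_measurable_sum borel_measurable_inner X_measurable) auto
      show "{\<omega> \<in> space M. u * \<sigma> * sqrt (2 * real N * l) \<le> (\<Sum>i\<in>{s+1..s+N}. c \<bullet> X i \<omega>)} \<in> sets M" by measurable
      show "{\<omega> \<in> space M. \<forall>i\<in>{..<q}. v * \<sigma> * sqrt (real (a (i + 1) - a i)) \<le> V i \<omega>}
          \<subseteq> {\<omega> \<in> space M. u * \<sigma> * sqrt (2 * real N * l) \<le> (\<Sum>i\<in>{s+1..s+N}. c \<bullet> X i \<omega>)}"
      proof safe
        fix \<omega> assume H: "\<forall>i\<in>{..<q}. v * \<sigma> * sqrt (real (a (i + 1) - a i)) \<le> V i \<omega>"
        have "(\<Sum>i\<in>{s+1..s+N}. c \<bullet> X i \<omega>) = (\<Sum>i<q. V i \<omega>)"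
        proof -
          have "(\<Sum>k\<in>{s+1..s+a j}. c \<bullet> X k \<omega>) = (\<Sum>i<j. V i \<omega>)" for j
          proof (induction j)
            case 0 then show ?case by (simp add: a)
          next
            case (Suc j)
            have "{s+1..s+a (Suc j)} = {s+1..s+a j} \<union> Kb j" using aS(2)[of j] by (auto simp: Kb_def)
            then have "(\<Sum>k\<in>{s+1..s+a (Suc j)}. c \<bullet> X k \<omega>) = (\<Sum>k\<in>{s+1..s+a j}. c \<bullet> X k \<omega>) + V j \<omega>"
              unfolding V_def by (simp only:) (rule sum.union_disjoint, auto simp: Kb_def)
            then show ?case using Suc by simp
          qed
          from this[of q] show ?thesis by (simp only: a)
        qed
        also have "\<dots> \<ge> (\<Sum>i<q. v * \<sigma> * sqrt (real p))"
        proof (rule sum_mono)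
          fix i assume i: "i \<in> {..<q}"
          have "v * \<sigma> * sqrt (real p) \<le> v * \<sigma> * sqrt (real (a (i + 1) - a i))"
            using v0 \<sigma> aS(1)[of i] by (intro mult_left_mono) auto
          moreover have "v * \<sigma> * sqrt (real (a (i + 1) - a i)) \<le> V i \<omega>" using H i by blast
          ultimately show "v * \<sigma> * sqrt (real p) \<le> V i \<omega>" by (rule order_trans)
        qed
        also have "(\<Sum>i<q. v * \<sigma> * sqrt (real p)) = \<sigma> * (real q * v * sqrt (real p))" by simp
        also have "\<sigma> * (real q * v * sqrt (real p)) \<ge> \<sigma> * (u * sqrt (2 * real N * l))"
        proof (rule mult_left_mono)
          have "(u * sqrt (2 * real N * l))\<^sup>2 = u\<^sup>2 * (2 * real N * l)" using l1 by (simp add: power_mult_distrib)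
          also have "\<dots> = (2 * l / t\<^sup>2) * (u * t)\<^sup>2 * real N" using t by (simp add: power_mult_distrib)
          also have "\<dots> \<le> real q * (u * t)\<^sup>2 * real N" using q1 by (intro mult_right_mono) auto
          also have "\<dots> = (real q)\<^sup>2 * v\<^sup>2 * (real N / real q / (1 + \<beta>)\<^sup>2)"
            using q0 \<beta>(1) by (simp add: v_def power_mult_distrib power2_eq_square)
          also have "\<dots> \<le> (real q)\<^sup>2 * v\<^sup>2 * real p" using pl by (intro mult_left_mono) auto
          also have "\<dots> = (real q * v * sqrt (real p))\<^sup>2" by (simp add: power_mult_distrib)
          finally show "u * sqrt (2 * real N * l) \<le> real q * v * sqrt (real p)"
            by (rule power2_le_imp_le) (use v0 in auto)
        qed (use \<sigma> in auto)
        finally show "u * \<sigma> * sqrt (2 * real N * l) \<le> (\<Sum>i\<in>{s+1..s+N}. c \<bullet> X i \<omega>)" by (simp add: mult_ac)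
      qed
    qed
    finally have "exp (- K) ^ q \<le> prob {\<omega> \<in> space M. u * \<sigma> * sqrt (2 * real N * l) \<le> (\<Sum>i\<in>{s+1..s+N}. c \<bullet> X i \<omega>)}" by simp
    moreover have "exp (- ((u\<^sup>2 + \<delta>) * l)) \<le> exp (- K) ^ q"
    proof -
      have "K * real q \<le> K * (2 * l / t\<^sup>2 + 1)" using q2 K0 by (intro mult_left_mono)
      also have "\<dots> = K * (2 / t\<^sup>2) * l + K" by (simp add: algebra_simps)
      also have "\<dots> \<le> (u\<^sup>2 + \<delta> / 2) * l + \<delta> / 2 * l" using K2 lK l1 by (intro add_mono mult_right_mono) auto
      finally have "K * real q \<le> (u\<^sup>2 + \<delta>) * l" by (simp add: algebra_simps)
      then show ?thesis by (simp add: exp_of_nat_mult[symmetric] mult.commute)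
    qed
    ultimately show "exp (- ((u\<^sup>2 + \<delta>) * l)) \<le> prob {\<omega> \<in> space M. u * \<sigma> * sqrt (2 * real N * l) \<le> (\<Sum>i\<in>{s+1..s+N}. c \<bullet> X i \<omega>)}" by linarith
  qed
qed

end

section \<open>Independent functionals along geometric scales\<close>

text \<open>\<open>LL n\<close> is at most a multiple of \<open>sqrt n\<close>. This provides the
  requirement of \<open>long_block_lower_bound\<close> that a block be long compared with
  \<open>LL\<close> of the whole range.\<close>

lemma LL_power_little:
  assumes m: "2 \<le> (m::nat)"
  shows "\<forall>\<^sub>F j in sequentially. R * LL (m * m ^ j) \<le> real (m ^ j)"
proof -
  have le: "LL n \<le> 1 + 2 * sqrt (real n)" for n
  proof (cases "n \<le> 1")
    case True
    then have "n = 0 \<or> n = 1" by auto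
    then show ?thesis by (auto simp: LL_def)
  next
    case False
    then have ln0: "0 < ln (real n)" by simp
    have "ln (ln (real n)) \<le> ln (real n)" using ln_le_minus_one[OF ln0] by simp
    also have "\<dots> = 2 * ln (sqrt (real n))" using False by (simp add: ln_sqrt)
    also have "\<dots> \<le> 2 * sqrt (real n)" using ln_le_minus_one[of "sqrt (real n)"] False by simp
    finally show ?thesis by (auto simp: LL_def)
  qed
  define B where "B = \<bar>R\<bar> * (1 + 2 * sqrt (real m))"
  have "\<forall>\<^sub>F j in sequentially. max 1 (B\<^sup>2) \<le> real (m ^ j)"
  proof -
    have m1: "1 < real m" using m by simp
    obtain n where n: "max 1 (B\<^sup>2) < real m ^ n" using real_arch_pow[OF m1, of "max 1 (B\<^sup>2)"] by blast
    have "max 1 (B\<^sup>2) \<le> real (m ^ j)" if "n \<le> j" for j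
    proof -
      have "real m ^ n \<le> real m ^ j" by (rule power_increasing[OF that]) (use m1 in simp)
      then show ?thesis using n unfolding of_nat_power by linarith
    qed
    then show ?thesis unfolding eventually_sequentially by blast
  qed
  then show ?thesis
  proof eventually_elim
    case (elim j)
    let ?h = "real (m ^ j)"
    have h1: "1 \<le> ?h" "B\<^sup>2 \<le> ?h" using elim by auto
    have sh: "1 \<le> sqrt ?h" "B \<le> sqrt ?h" using h1 by (auto intro: real_le_rsqrt)
    have "R * LL (m * m ^ j) \<le> \<bar>R\<bar> * (1 + 2 * sqrt (real (m * m ^ j)))"
      using le[of "m * m ^ j"] LL_pos[of "m * m ^ j"] by (intro mult_mono) auto
    also have "\<dots> \<le> B * sqrt ?h"
    proof -
      have "1 + 2 * sqrt (real (m * m ^ j)) \<le> (1 + 2 * sqrt (real m)) * sqrt ?h"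
        using sh(1) by (simp add: real_sqrt_mult algebra_simps)
      then have "\<bar>R\<bar> * (1 + 2 * sqrt (real (m * m ^ j))) \<le> \<bar>R\<bar> * ((1 + 2 * sqrt (real m)) * sqrt ?h)"
        by (intro mult_left_mono) auto
      then show ?thesis by (simp add: B_def mult_ac)
    qed
    also have "\<dots> \<le> sqrt ?h * sqrt ?h" using sh by (intro mult_right_mono) auto
    also have "\<dots> = ?h" by simp
    finally show ?case .
  qed
qed

lemma filterlim_power_mult:
  assumes m: "2 \<le> (m::nat)" shows "filterlim (\<lambda>j. m * m ^ j) sequentially sequentially"
  by (rule filterlim_subseq) (use m in \<open>auto simp: strict_mono_Suc_iff\<close>)

lemma LL_at_top: "filterlim LL at_top sequentially"
proof (rule filterlim_at_top_mono)
  show "filterlim (\<lambda>n. ln (ln (real n))) at_top sequentially"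
    by (intro filterlim_compose[OF ln_at_top] filterlim_real_sequentially)
qed (simp add: LL_def)

text \<open>For large \<open>j\<close>, \<open>LL\<close> at \<open>m^(j+1)\<close> is
  \<open>ln ((j + 1) * ln m)\<close>, so the lower bounds are a multiple of the harmonic series:
  exponent 1 just diverges.\<close>

lemma not_summable_exp_LL:
  assumes m: "2 \<le> (m::nat)" and G: "\<forall>\<^sub>F j in sequentially. exp (- LL (m * m ^ j)) \<le> G j" and G0: "\<And>j. 0 \<le> G j"
  shows "\<not> summable (G :: nat \<Rightarrow> real)"
proof
  assume s: "summable G"
  have "\<forall>\<^sub>F n in sequentially. LL n = ln (ln (real n))"
    using LL_eventually by eventually_elim simp
  then have "\<forall>\<^sub>F j in sequentially. LL (m * m ^ j) = ln (ln (real (m * m ^ j)))"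
    by (rule eventually_compose_filterlim[OF _ filterlim_power_mult[OF m]])
  then have "\<forall>\<^sub>F j in sequentially. norm (inverse (real (Suc j))) \<le> ln (real m) * G j"
    using G
  proof eventually_elim
    case (elim j)
    have lm: "0 < ln (real m)" using m by simp
    have "ln (real (m * m ^ j)) = real (Suc j) * ln (real m)"
    proof -
      have "real (m * m ^ j) = real m ^ Suc j" by simp
      then show ?thesis using m by (simp only: ln_realpow)
    qed
    then have "exp (- LL (m * m ^ j)) = inverse (real (Suc j) * ln (real m))"
      using elim(1) lm by (simp add: exp_minus)
    then have "inverse (real (Suc j) * ln (real m)) \<le> G j" using elim(2) by simp
    then have le: "ln (real m) * inverse (real (Suc j) * ln (real m)) \<le> ln (real m) * G j" using lm by (intro mult_left_mono) auto
    have eq: "ln (real m) * inverse (real (Suc j) * ln (real m)) = inverse (real (Suc j))"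
      using lm by (simp del: of_nat_Suc)
    from le have "inverse (real (Suc j)) \<le> ln (real m) * G j" unfolding eq .
    then show ?case by (simp del: of_nat_Suc)
  qed
  then have "summable (\<lambda>j. inverse (real (Suc j)))"
    by (rule summable_comparison_test_ev) (intro summable_mult s)
  then have "summable (\<lambda>j. inverse (real j))" by (subst (asm) summable_Suc_iff)
  then show False using not_summable_harmonic[where 'a=real] by simp
qed

context iid_walk
begin

lemma inner_zero_AE:
  assumes c: "c \<bullet> (A *v c) = 0" and i: "1 \<le> i"
  shows "AE \<omega> in M. c \<bullet> X i \<omega> = 0"
proof -
  have "integrable M (\<lambda>\<omega>. (c \<bullet> X i \<omega>)\<^sup>2)" "expectation (\<lambda>\<omega>. (c \<bullet> X i \<omega>)\<^sup>2) = 0"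
    using expectation_ident[of "\<lambda>x. (c \<bullet> x)\<^sup>2" i] i inner_sq_int inner_sq_expectation c by auto
  then have "AE \<omega> in M. (c \<bullet> X i \<omega>)\<^sup>2 = 0" by (subst (asm) integral_nonneg_eq_0_iff_AE) auto
  then show ?thesis by simp
qed

text \<open>With \<open>c 0 = 0\<close> the functional at scale \<open>m * m^j\<close> reads only
  indices above \<open>m^j\<close> and up to \<open>m^(j+1)\<close>, so different \<open>j\<close>
  give independent variables. At each scale all cells are required to be large at once, which has
  probability at least \<open>exp (- LL (m * m ^ j))\<close> for large \<open>j\<close>.\<close>

lemma lower_subsequence:
  assumes m: "2 \<le> m" and c0: "c 0 = 0" and s: "0 < sdev A m c" and \<epsilon>: "0 < \<epsilon>" "\<epsilon> < 1"
  shows "AE \<omega> in M. \<exists>\<^sub>F j in sequentially.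
     (1 - \<epsilon>) * sdev A m c * (sqrt 2 * aa (m * m ^ j))
      \<le> (\<Sum>k<m. c k \<bullet> (walk ((k + 1) * m ^ j) \<omega> - walk (k * m ^ j) \<omega>))"
proof -
  define s where "s = sdev A m c"
  have s0: "0 < s" using assms(3) by (simp add: s_def)
  have m0: "0 < m" "0 < real m" using m by auto
  have s2: "(\<Sum>k<m. c k \<bullet> (A *v c k)) = real m * s\<^sup>2"
    using m0 by (simp add: s_def sdev_def sum_nonneg A_nonneg)
  define \<sigma> where "\<sigma> k = sqrt (c k \<bullet> (A *v c k))" for k
  have \<sigma>: "0 \<le> \<sigma> k" "(\<sigma> k)\<^sup>2 = c k \<bullet> (A *v c k)" for k by (auto simp: \<sigma>_def A_nonneg)
  \<comment> \<open>Levels, in units of each cell's own standard deviation, are proportional to that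
    deviation. This is the cheapest way to reach the total: the exponents \<open>(u k)^2\<close> add
    up to \<open>(1 - \<epsilon>)^2\<close>.\<close>
  define u where "u k = (1 - \<epsilon>) * \<sigma> k / (sqrt (real m) * s)" for k
  have u0: "0 \<le> u k" for k using \<epsilon> \<sigma>(1)[of k] s0 by (simp add: u_def)
  have su: "(\<Sum>k<m. (u k)\<^sup>2) = (1 - \<epsilon>)\<^sup>2"
  proof -
    have "(\<Sum>k<m. (u k)\<^sup>2) = (\<Sum>k<m. (1 - \<epsilon>)\<^sup>2 / (real m * s\<^sup>2) * (c k \<bullet> (A *v c k)))"
      by (rule sum.cong) (simp_all add: u_def power_divide power_mult_distrib \<sigma>(2))
    also have "\<dots> = (1 - \<epsilon>)\<^sup>2 / (real m * s\<^sup>2) * (real m * s\<^sup>2)" unfolding sum_distrib_left[symmetric] s2 ..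
    finally show ?thesis using m0 s0 by simp
  qed
  \<comment> \<open>The remaining \<open>1 - (1 - \<epsilon>)^2\<close> is shared evenly among the
    cells, so that all exponents together add up to exactly 1.\<close>
  define \<delta> where "\<delta> = (1 - (1 - \<epsilon>)\<^sup>2) / real m"
  have \<delta>0: "0 < \<delta>"
  proof -
    have "(1 - \<epsilon>)\<^sup>2 < 1" using \<epsilon> by (simp add: power2_eq_square algebra_simps mult_less_cancel_left1)
    then show ?thesis using m0 by (simp add: \<delta>_def)
  qed
  define h where "h j = m ^ j" for j
  define N where "N j = m * m ^ j" for j
  have hN: "N j = m * h j" for j by (simp add: N_def h_def)
  have h0: "0 < h j" for j using m by (simp add: h_def)
  define x where "x j k = u k * \<sigma> k * sqrt (2 * real (h j) * LL (N j))" for j k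
  define Kb where "Kb j k = {k * h j + 1..k * h j + h j}" for j k
  have Xcm[measurable]: "(\<lambda>\<omega>. \<Sum>i\<in>Kb j k. d \<bullet> X i \<omega>) \<in> borel_measurable M" for j k d
    unfolding Kb_def by (intro borel_measurable_sum borel_measurable_inner X_measurable) auto
  have single: "\<forall>\<^sub>F j in sequentially. exp (- (((u k)\<^sup>2 + \<delta>) * LL (N j)))
      \<le> prob {\<omega> \<in> space M. x j k \<le> (\<Sum>i\<in>Kb j k. c k \<bullet> X i \<omega>)}" for k
  proof (cases "\<sigma> k = 0")
    \<comment> \<open>The central limit theorem does not apply to a cell of variance zero, but its
      sum is 0 almost surely and its level is 0.\<close>
    case True
    then have "c k \<bullet> (A *v c k) = 0" using \<sigma>(2)[of k] by simp
    then have z: "AE \<omega> in M. \<forall>i\<in>Kb j k. c k \<bullet> X i \<omega> = 0" for j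
      by (intro AE_finite_allI inner_zero_AE) (auto simp: Kb_def)
    have "AE \<omega> in M. x j k \<le> (\<Sum>i\<in>Kb j k. c k \<bullet> X i \<omega>)" for j
      by (rule AE_mp[OF z[of j] AE_I2]) (auto simp: x_def True)
    then have "prob {\<omega> \<in> space M. x j k \<le> (\<Sum>i\<in>Kb j k. c k \<bullet> X i \<omega>)} = 1" for j
      by (subst prob_Collect_eq_1) auto
    then show ?thesis using \<delta>0 LL_pos by (auto simp: add_nonneg_nonneg less_imp_le)
  next
    case False
    then have \<sigma>p: "0 < \<sigma> k" using \<sigma>(1)[of k] by simp
    obtain l0 where "\<exists>R. \<forall>l N s. l0 \<le> l \<longrightarrow> R * l \<le> real N \<longrightarrow>
     exp (- (((u k)\<^sup>2 + \<delta>) * l)) \<le> prob {\<omega> \<in> space M. u k * \<sigma> k * sqrt (2 * real N * l) \<le> (\<Sum>i\<in>{s+1..s+N}. c k \<bullet> X i \<omega>)}"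
      using long_block_lower_bound[OF \<sigma>p \<sigma>(2) u0[of k] \<delta>0] by (rule exE)
    then obtain R where R: "\<forall>l N s. l0 \<le> l \<longrightarrow> R * l \<le> real N \<longrightarrow>
     exp (- (((u k)\<^sup>2 + \<delta>) * l)) \<le> prob {\<omega> \<in> space M. u k * \<sigma> k * sqrt (2 * real N * l) \<le> (\<Sum>i\<in>{s+1..s+N}. c k \<bullet> X i \<omega>)}"
      by (rule exE)
    have "\<forall>\<^sub>F n in sequentially. l0 \<le> LL n" using LL_at_top by (simp add: filterlim_at_top)
    then have "\<forall>\<^sub>F j in sequentially. l0 \<le> LL (m * m ^ j)"
      by (rule eventually_compose_filterlim[OF _ filterlim_power_mult[OF m]])
    then show ?thesis using LL_power_little[OF m, of R]
    proof eventually_elim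
      case (elim j)
      show ?case
        unfolding x_def Kb_def using R[rule_format, of "LL (N j)" "h j" "k * h j"] elim by (simp add: N_def h_def)
    qed
  qed
  define V where "V j \<omega> = (\<Sum>i\<in>{h j + 1..N j}. c ((i - 1) div h j) \<bullet> X i \<omega>)" for j \<omega>
  have Vw: "V j \<omega> = (\<Sum>k<m. \<Sum>i\<in>Kb j k. c k \<bullet> X i \<omega>)" for j \<omega>
  proof -
    have "h j \<le> N j" using m0 by (simp add: hN)
    then have "{1..m * h j} = {1..h j} \<union> {h j + 1..N j}" unfolding hN[symmetric] by auto
    then have "(\<Sum>i=1..m * h j. c ((i - 1) div h j) \<bullet> X i \<omega>) = (\<Sum>i=1..h j. c ((i - 1) div h j) \<bullet> X i \<omega>) + V j \<omega>"
      unfolding V_def by (simp only:) (rule sum.union_disjoint, auto)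
    moreover have "(\<Sum>i=1..h j. c ((i - 1) div h j) \<bullet> X i \<omega>) = 0"
      by (rule sum.neutral) (auto simp: c0)
    moreover have "(\<Sum>i=1..m * h j. c ((i - 1) div h j) \<bullet> X i \<omega>) = (\<Sum>k<m. \<Sum>i=k * h j + 1..(k + 1) * h j. c k \<bullet> X i \<omega>)"
      by (rule sum_block_div[OF h0, of "\<lambda>k i. c k \<bullet> X i \<omega>"])
    ultimately show ?thesis by (simp add: Kb_def add.commute)
  qed
  have sumx: "(\<Sum>k<m. x j k) = (1 - \<epsilon>) * s * (sqrt 2 * aa (N j))" for j
  proof -
    have "sqrt (2 * real (N j) * LL (N j)) = sqrt (real m) * sqrt (2 * real (h j) * LL (N j))"
      unfolding real_sqrt_mult[symmetric] by (simp add: hN mult_ac)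
    then have q: "sqrt 2 * aa (N j) = sqrt (real m) * sqrt (2 * real (h j) * LL (N j))"
      by (simp add: aa_def real_sqrt_mult mult_ac)
    have "(\<Sum>k<m. x j k) = (\<Sum>k<m. (1 - \<epsilon>) / (sqrt (real m) * s) * sqrt (2 * real (h j) * LL (N j)) * (c k \<bullet> (A *v c k)))"
      by (rule sum.cong) (simp_all add: x_def u_def \<sigma>(2)[symmetric] power2_eq_square)
    also have "\<dots> = (1 - \<epsilon>) / (sqrt (real m) * s) * sqrt (2 * real (h j) * LL (N j)) * (real m * s\<^sup>2)"
      unfolding sum_distrib_left[symmetric] s2 ..
    also have "\<dots> = (1 - \<epsilon>) * s * (real m / sqrt (real m)) * sqrt (2 * real (h j) * LL (N j))"
      using s0 m0 by (simp add: power2_eq_square)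
    also have "real m / sqrt (real m) = sqrt (real m)" using m0 by (simp add: real_div_sqrt)
    finally show ?thesis using q by simp
  qed
  have Gle: "\<forall>\<^sub>F j in sequentially. exp (- LL (m * m ^ j)) \<le> prob {\<omega> \<in> space M. (1 - \<epsilon>) * s * (sqrt 2 * aa (N j)) \<le> V j \<omega>}"
  proof -
    have "\<forall>\<^sub>F j in sequentially. \<forall>k\<in>{..<m}. exp (- (((u k)\<^sup>2 + \<delta>) * LL (N j)))
      \<le> prob {\<omega> \<in> space M. x j k \<le> (\<Sum>i\<in>Kb j k. c k \<bullet> X i \<omega>)}"
      using single by (simp add: eventually_ball_finite_distrib)
    then show ?thesis
    proof eventually_elim
      case (elim j)
      have ind: "indep_vars (\<lambda>_. borel) (\<lambda>k \<omega>. \<Sum>i\<in>Kb j k. c k \<bullet> X i \<omega>) {..<m}"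
      proof (rule indep_block_sums[of "Kb j" "{..<m}" "\<lambda>k _. c k"])
        show "disjoint_family_on (Kb j) {..<m}"
          unfolding disjoint_family_on_def
        proof (intro ballI impI)
          fix k l :: nat assume "k \<noteq> l"
          then consider "k + 1 \<le> l" | "l + 1 \<le> k" by linarith
          then show "Kb j k \<inter> Kb j l = {}"
            using mult_right_mono[of "k + 1" l "h j"] mult_right_mono[of "l + 1" k "h j"] by cases (auto simp: Kb_def)
        qed
      qed (auto simp: Kb_def)
      have "exp (- LL (m * m ^ j)) = (\<Prod>k<m. exp (- (((u k)\<^sup>2 + \<delta>) * LL (N j))))"
      proof -
        have "(\<Sum>k<m. (u k)\<^sup>2 + \<delta>) = 1" using m0 by (simp add: sum.distrib su \<delta>_def)
        then have "(\<Sum>k<m. ((u k)\<^sup>2 + \<delta>) * LL (N j)) = LL (N j)" by (simp add: sum_distrib_right[symmetric])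
        then show ?thesis by (simp add: exp_sum[symmetric] sum_negf N_def)
      qed
      also have "\<dots> \<le> prob {\<omega> \<in> space M. \<forall>k\<in>{..<m}. x j k \<le> (\<Sum>i\<in>Kb j k. c k \<bullet> X i \<omega>)}"
        by (rule indep_joint_lower_bound[OF ind]) (use elim m0 in auto)
      also have "\<dots> \<le> prob {\<omega> \<in> space M. (1 - \<epsilon>) * s * (sqrt 2 * aa (N j)) \<le> V j \<omega>}"
      proof (rule finite_measure_mono)
        show "{\<omega> \<in> space M. (1 - \<epsilon>) * s * (sqrt 2 * aa (N j)) \<le> V j \<omega>} \<in> sets M" unfolding Vw by measurable
        show "{\<omega> \<in> space M. \<forall>k\<in>{..<m}. x j k \<le> (\<Sum>i\<in>Kb j k. c k \<bullet> X i \<omega>)} \<subseteq> {\<omega> \<in> space M. (1 - \<epsilon>) * s * (sqrt 2 * aa (N j)) \<le> V j \<omega>}"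
          unfolding sumx[symmetric] Vw by (auto intro: sum_mono)
      qed
      finally show ?case .
    qed
  qed
  have "AE \<omega> in M. \<exists>\<^sub>F j in sequentially. (1 - \<epsilon>) * s * (sqrt 2 * aa (N j)) \<le> V j \<omega>"
  proof (rule borel_cantelli_2)
    show "indep_vars (\<lambda>_. borel) V UNIV"
      unfolding V_def
    proof (rule indep_block_sums[of "\<lambda>j. {h j + 1..N j}" UNIV "\<lambda>j i. c ((i - 1) div h j)"])
      show "disjoint_family_on (\<lambda>j. {h j + 1..N j}) UNIV"
        unfolding disjoint_family_on_def
      proof (intro ballI impI)
        fix i j :: nat assume "i \<noteq> j"
        then consider "i + 1 \<le> j" | "j + 1 \<le> i" by linarith
        then show "{h i + 1..N i} \<inter> {h j + 1..N j} = {}"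
          using power_increasing[of "i + 1" j m] power_increasing[of "j + 1" i m] m by cases (auto simp: h_def N_def)
      qed
    qed auto
    show "\<not> summable (\<lambda>j. prob {\<omega> \<in> space M. (1 - \<epsilon>) * s * (sqrt 2 * aa (N j)) \<le> V j \<omega>})"
      by (rule not_summable_exp_LL[OF m Gle]) simp
  qed
  then show ?thesis
  proof (rule AE_mp[OF _ AE_I2], intro impI)
    fix \<omega> assume f: "\<exists>\<^sub>F j in sequentially. (1 - \<epsilon>) * s * (sqrt 2 * aa (N j)) \<le> V j \<omega>"
    have "V j \<omega> = (\<Sum>k<m. c k \<bullet> (walk ((k + 1) * h j) \<omega> - walk (k * h j) \<omega>))" for j
      unfolding Vw by (rule sum.cong) (auto simp: walk_diff inner_sum_right Kb_def add.commute)
    then show "\<exists>\<^sub>F j in sequentially. (1 - \<epsilon>) * sdev A m c * (sqrt 2 * aa (m * m ^ j))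
      \<le> (\<Sum>k<m. c k \<bullet> (walk ((k + 1) * m ^ j) \<omega> - walk (k * m ^ j) \<omega>))"
      using f by (simp add: N_def h_def s_def)
  qed
qed

end

section \<open>Polygonal paths and uniform convergence\<close>

definition pol :: "(nat \<Rightarrow> 'a::real_normed_vector) \<Rightarrow> real \<Rightarrow> 'a" where
  "pol S x = S (nat \<lfloor>x\<rfloor>) + (x - of_int \<lfloor>x\<rfloor>) *\<^sub>R (S (nat \<lfloor>x\<rfloor> + 1) - S (nat \<lfloor>x\<rfloor>))"

lemma pol_nat: "pol S (real n) = S n"
  by (simp add: pol_def)

text \<open>A sum of clamped ramps is visibly continuous, whereas the floors in \<open>pol\<close>
  would require matching neighbouring pieces.\<close>

lemma pol_eq_sum:
  assumes "0 \<le> x" "x \<le> real n"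
  shows "pol S x = S 0 + (\<Sum>i<n. max 0 (min 1 (x - real i)) *\<^sub>R (S (Suc i) - S i))"
proof -
  define k where "k = nat \<lfloor>x\<rfloor>"
  have k: "real k \<le> x" "x < real k + 1" "of_int \<lfloor>x\<rfloor> = real k" using assms(1) by (auto simp: k_def)
  have kn: "k \<le> n" unfolding k_def using assms by (intro nat_floor_le)
  have c1: "max 0 (min 1 (x - real i)) = 1" if "i < k" for i
  proof -
    have "real i + 1 \<le> real k" using that by linarith
    then show ?thesis using k by (auto simp: max_def min_def)
  qed
  have s1: "(\<Sum>i<k. max 0 (min 1 (x - real i)) *\<^sub>R (S (Suc i) - S i)) = S k - S 0"
    using c1 sum_lessThan_telescope[of S k] by simp
  show ?thesis
  proof (cases "k = n")
    case True
    then have "x = real k" using k assms by simp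
    then show ?thesis using True s1 by (simp add: pol_nat)
  next
    case False
    then have eq: "{..<n} = {..<k} \<union> insert k {Suc k..<n}" using kn by auto
    have "(\<Sum>i<n. max 0 (min 1 (x - real i)) *\<^sub>R (S (Suc i) - S i))
      = (S k - S 0) + (\<Sum>i\<in>insert k {Suc k..<n}. max 0 (min 1 (x - real i)) *\<^sub>R (S (Suc i) - S i))"
      unfolding s1[symmetric] eq by (rule sum.union_disjoint) auto
    also have "(\<Sum>i\<in>insert k {Suc k..<n}. max 0 (min 1 (x - real i)) *\<^sub>R (S (Suc i) - S i)) = (x - real k) *\<^sub>R (S (Suc k) - S k)"
    proof -
      have "(\<Sum>i\<in>{Suc k..<n}. max 0 (min 1 (x - real i)) *\<^sub>R (S (Suc i) - S i)) = 0"
        by (rule sum.neutral) (use k in \<open>auto simp: max_def min_def\<close>)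
      moreover have "max 0 (min 1 (x - real k)) = x - real k" using k by auto
      ultimately show ?thesis by simp
    qed
    finally show ?thesis using k(3) by (simp add: pol_def k_def[symmetric])
  qed
qed

lemma pol_scaled_continuous: "continuous_on {0..1} (\<lambda>t. pol S (real n * t))"
proof -
  have "continuous_on {0..1} (\<lambda>t. S 0 + (\<Sum>i<n. max 0 (min 1 (real n * t - real i)) *\<^sub>R (S (Suc i) - S i)))"
    by (intro continuous_intros)
  moreover have "pol S (real n * t) = S 0 + (\<Sum>i<n. max 0 (min 1 (real n * t - real i)) *\<^sub>R (S (Suc i) - S i))"
    if "t \<in> {0..1}" for t
    by (rule pol_eq_sum) (use that in \<open>auto simp: mult_left_le\<close>)
  ultimately show ?thesis by (metis (no_types, lifting) continuous_on_cong)
qed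

lemma rho_inf_le:
  assumes "\<And>t. t \<in> {0..1} \<Longrightarrow> norm (f t - g t) \<le> B" shows "rho_inf f g \<le> B"
  unfolding rho_inf_def by (rule cSUP_least) (use assms in auto)

lemma rho_inf_bdd:
  assumes "f \<in> C0" "g \<in> C0"
  shows "bdd_above ((\<lambda>t. norm (f t - g t)) ` {0..1::real})"
proof -
  have "compact ((\<lambda>t. norm (f t - g t)) ` {0..1::real})"
    using assms by (intro compact_continuous_image continuous_intros) (auto simp: C0_def)
  then show ?thesis by (intro bounded_imp_bdd_above compact_imp_bounded)
qed

lemma norm_le_rho_inf:
  assumes "f \<in> C0" "g \<in> C0" "t \<in> {0..1}"
  shows "norm (f t - g t) \<le> rho_inf f g"
  unfolding rho_inf_def by (rule cSUP_upper[OF assms(3) rho_inf_bdd[OF assms(1,2)]])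

lemma rho_inf_nonneg:
  assumes "f \<in> C0" "g \<in> C0" shows "0 \<le> rho_inf f g"
proof -
  have "norm (f 0 - g 0) \<le> rho_inf f g" by (rule norm_le_rho_inf[OF assms]) simp
  then show ?thesis by (rule order_trans[OF norm_ge_zero])
qed

lemma rho_inf_triangle:
  assumes "f \<in> C0" "g \<in> C0" "h \<in> C0"
  shows "rho_inf f h \<le> rho_inf f g + rho_inf g h"
proof (rule rho_inf_le)
  fix t :: real assume t: "t \<in> {0..1}"
  have "norm (f t - h t) \<le> norm (f t - g t) + norm (g t - h t)" using norm_triangle_ineq[of "f t - g t" "g t - h t"] by simp
  then show "norm (f t - h t) \<le> rho_inf f g + rho_inf g h"
    using norm_le_rho_inf[OF assms(1,2) t] norm_le_rho_inf[OF assms(2,3) t] by linarith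
qed

lemma rho_inf_tendsto_pointwise:
  assumes y: "\<And>k. x k \<in> C0" and g: "g \<in> C0" and lim: "(\<lambda>k. rho_inf (x k) g) \<longlonglongrightarrow> 0" and t: "t \<in> {0..1}"
  shows "(\<lambda>k. x k t) \<longlonglongrightarrow> g t"
proof (rule Lim_null[THEN iffD2], rule tendsto_norm_zero_cancel)
  show "(\<lambda>k. norm (x k t - g t)) \<longlonglongrightarrow> 0"
    by (rule tendsto_sandwich[OF _ _ tendsto_const lim]) (use norm_le_rho_inf[OF y g t] in auto)
qed

text \<open>The set of limit points is closed: for every \<open>e\<close> there are arbitrarily late
  \<open>y n\<close> within \<open>e\<close> of \<open>f\<close>, and they are picked one after
  another with errors below \<open>1 / (k + 1)\<close>.\<close>

lemma limit_points_approx: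
  assumes y: "\<And>n. y n \<in> C0" and f: "f \<in> C0"
    and ap: "\<And>e. 0 < e \<Longrightarrow> \<exists>g\<in>limit_points y. rho_inf g f < e"
  shows "f \<in> limit_points y"
proof -
  have ex: "\<exists>n>N. rho_inf (y n) f < e" if e: "0 < e" for N e
  proof -
    obtain g where g: "g \<in> limit_points y" "rho_inf g f < e / 2" using ap[of "e/2"] e by auto
    then obtain r :: "nat \<Rightarrow> nat" where r: "strict_mono r" "(\<lambda>k. rho_inf (y (r k)) g) \<longlonglongrightarrow> 0" and gC: "g \<in> C0"
      unfolding limit_points_def by blast
    have "\<forall>\<^sub>F k in sequentially. rho_inf (y (r k)) g < e / 2"
      by (rule order_tendstoD(2)[OF r(2)]) (use e in simp)
    moreover have "\<forall>\<^sub>F k in sequentially. Suc N \<le> k" by (rule eventually_ge_at_top)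
    ultimately have "\<forall>\<^sub>F k in sequentially. rho_inf (y (r k)) g < e / 2 \<and> Suc N \<le> k" by (rule eventually_conj)
    then obtain k where k: "rho_inf (y (r k)) g < e / 2" "Suc N \<le> k"
      using eventually_happens'[OF sequentially_bot] by blast
    have "N < r k" using k(2) seq_suble[OF r(1), of k] by simp
    moreover have "rho_inf (y (r k)) f < e"
      using rho_inf_triangle[OF y gC f, of "r k"] k(1) g(2) by simp
    ultimately show ?thesis by blast
  qed
  have "\<exists>r. \<forall>k. rho_inf (y (r k)) f < 1 / real (Suc k) \<and> r k < r (Suc k)"
  proof (rule dependent_nat_choice)
    show "\<exists>x. rho_inf (y x) f < 1 / real (Suc 0)" using ex[of 1 0] by auto
    show "\<exists>z. rho_inf (y z) f < 1 / real (Suc (Suc n)) \<and> x < z" for x n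
      using ex[of "1 / real (Suc (Suc n))" x] by auto
  qed
  then obtain r where r: "\<And>k. rho_inf (y (r k)) f < 1 / real (Suc k)" "\<And>k. r k < r (Suc k)" by blast
  have "strict_mono r" using r(2) by (simp add: strict_mono_Suc_iff)
  moreover have "(\<lambda>k. rho_inf (y (r k)) f) \<longlonglongrightarrow> 0"
  proof (rule tendsto_sandwich[OF _ _ tendsto_const LIMSEQ_inverse_real_of_nat])
    show "\<forall>\<^sub>F k in sequentially. rho_inf (y (r k)) f \<le> inverse (real (Suc k))"
      using r(1) by (auto simp: inverse_eq_divide intro!: always_eventually less_imp_le)
  qed (auto intro!: always_eventually rho_inf_nonneg y f)
  ultimately show ?thesis using f unfolding limit_points_def by blast
qed

lemma rel_compact_limit_point:
  assumes y: "rel_compact_seq y" and r: "strict_mono (r :: nat \<Rightarrow> nat)"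
  shows "\<exists>s g. strict_mono (s :: nat \<Rightarrow> nat) \<and> g \<in> limit_points y \<and> (\<lambda>k. rho_inf (y (r (s k))) g) \<longlonglongrightarrow> 0"
proof -
  obtain s g where s: "strict_mono (s :: nat \<Rightarrow> nat)" "g \<in> C0" "(\<lambda>k. rho_inf (y (r (s k))) g) \<longlonglongrightarrow> 0"
    using y r unfolding rel_compact_seq_def by blast
  have "strict_mono (\<lambda>k. r (s k))" using r s(1) by (simp add: strict_mono_def)
  then have "g \<in> limit_points y" using s(2,3) unfolding limit_points_def by blast
  with s show ?thesis by blast
qed

text \<open>Arzela-Ascoli. The common modulus is given for large \<open>n\<close> only; the finitely
  many other paths are uniformly continuous by compactness. A uniform bound follows from the value 0
  at time 0 by chaining \<open>K\<close> steps of length below \<open>d\<close>.\<close>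

lemma equicontinuous_imp_rel_compact:
  fixes y :: "nat \<Rightarrow> real \<Rightarrow> 'a::euclidean_space"
  assumes y: "\<And>n. y n \<in> C0"
    and eq: "\<And>e. 0 < e \<Longrightarrow> \<exists>d>0. \<forall>\<^sub>F n in sequentially. \<forall>s\<in>{0..1}. \<forall>t\<in>{0..1}. \<bar>s - t\<bar> < d \<longrightarrow> norm (y n s - y n t) < e"
  shows "rel_compact_seq y"
proof -
  have equi: "\<exists>d>0. \<forall>n. \<forall>s\<in>{0..1}. \<forall>t\<in>{0..1}. \<bar>s - t\<bar> < d \<longrightarrow> norm (y n s - y n t) < e" if e: "0 < e" for e
  proof -
    obtain d N where d: "0 < d" "\<And>n s t. N \<le> n \<Longrightarrow> s \<in> {0..1} \<Longrightarrow> t \<in> {0..1} \<Longrightarrow> \<bar>s - t\<bar> < d \<Longrightarrow> norm (y n s - y n t) < e"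
      using eq[OF e] unfolding eventually_sequentially by meson
    have "\<exists>d>0. \<forall>n<k. \<forall>s\<in>{0..1}. \<forall>t\<in>{0..1}. \<bar>s - t\<bar> < d \<longrightarrow> norm (y n s - y n t) < e" for k
    proof (induction k)
      case 0 then show ?case by (intro exI[of _ 1]) simp
    next
      case (Suc k)
      then obtain d1 where d1: "0 < d1" "\<And>n s t. n < k \<Longrightarrow> s \<in> {0..1} \<Longrightarrow> t \<in> {0..1} \<Longrightarrow> \<bar>s - t\<bar> < d1 \<Longrightarrow> norm (y n s - y n t) < e"
        by blast
      have "uniformly_continuous_on {0..1} (y k)"
        using y[of k] by (intro compact_uniformly_continuous) (auto simp: C0_def)
      then obtain d2 where d2: "0 < d2" "\<And>s t. s \<in> {0..1} \<Longrightarrow> t \<in> {0..1} \<Longrightarrow> \<bar>s - t\<bar> < d2 \<Longrightarrow> norm (y k s - y k t) < e"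
        using e unfolding uniformly_continuous_on_def dist_norm real_norm_def by meson
      show ?case
        using d1 d2 by (intro exI[of _ "min d1 d2"]) (auto simp: less_Suc_eq)
    qed
    from this[of N] obtain d1 where d1: "0 < d1" "\<And>n s t. n < N \<Longrightarrow> s \<in> {0..1} \<Longrightarrow> t \<in> {0..1} \<Longrightarrow> \<bar>s - t\<bar> < d1 \<Longrightarrow> norm (y n s - y n t) < e"
      by blast
    show ?thesis
    proof (intro exI[of _ "min d d1"] conjI allI ballI impI)
      show "0 < min d d1" using d d1 by simp
      fix n s t assume "s \<in> {0..1::real}" "t \<in> {0..1::real}" "\<bar>s - t\<bar> < min d d1"
      then show "norm (y n s - y n t) < e" using d(2)[of n s t] d1(2)[of n s t] by (cases "n < N") auto
    qed
  qed
  obtain d where d: "0 < d" "\<And>n s t. s \<in> {0..1} \<Longrightarrow> t \<in> {0..1} \<Longrightarrow> \<bar>s - t\<bar> < d \<Longrightarrow> norm (y n s - y n t) < 1"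
    using equi[OF zero_less_one] by blast
  obtain K :: nat where K: "1 / d < real K" using reals_Archimedean2 by blast
  have K0: "0 < K" using K d(1) by (metis divide_pos_pos less_trans of_nat_0_less_iff zero_less_one)
  have bound: "norm (y n t) \<le> real K" if t: "t \<in> {0..1}" for n t
  proof -
    have "norm (y n (t * (real i / real K))) \<le> real i" if "i \<le> K" for i
      using that
    proof (induction i)
      case 0 then show ?case using y[of n] by (simp add: C0_def)
    next
      case (Suc i)
      have mem: "t * (real j / real K) \<in> {0..1}" if "j \<le> K" for j
        using t that K0 by (auto intro!: mult_le_one mult_nonneg_nonneg simp del: times_divide_eq_right)
      have "\<bar>t * (real (Suc i) / real K) - t * (real i / real K)\<bar> = t * (1 / real K)"
        using t K0 by (simp add: right_diff_distrib[symmetric] diff_divide_distrib[symmetric])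
      also have "\<dots> \<le> 1 / real K" using t by (simp add: divide_right_mono)
      also have "\<dots> < d" using K d(1) K0 by (simp add: field_simps)
      finally have "norm (y n (t * (real (Suc i) / real K)) - y n (t * (real i / real K))) < 1"
        using d(2)[OF mem mem, of "Suc i" i] Suc.prems by simp
      moreover have "norm (y n (t * (real i / real K))) \<le> real i" using Suc by simp
      ultimately show ?case
        using norm_triangle_sub[of "y n (t * (real (Suc i) / real K))" "y n (t * (real i / real K))"] by simp
    qed
    from this[of K] show ?thesis using K0 by simp
  qed
  show ?thesis
    unfolding rel_compact_seq_def
  proof (intro allI impI)
    fix r :: "nat \<Rightarrow> nat" assume r: "strict_mono r"
    have eq': "\<exists>d. 0 < d \<and> (\<forall>n t. t \<in> {0..1} \<and> norm (s - t) < d \<longrightarrow> norm (y (r n) s - y (r n) t) < e)"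
      if "s \<in> {0..1}" "0 < e" for s e
      using equi[OF that(2)] that(1) unfolding real_norm_def by blast
    have "\<exists>g k. continuous_on {0..1} g \<and> strict_mono (k :: nat \<Rightarrow> nat) \<and>
       (\<forall>e>0. \<exists>N. \<forall>n x. n \<ge> N \<and> x \<in> {0..1} \<longrightarrow> norm (y (r (k n)) x - g x) < e)"
    proof (rule Arzela_Ascoli[of "{0..1}" "\<lambda>n. y (r n)" "real K"], goal_cases)
      case 1 then show ?case by simp
    next
      case 2 then show ?case using bound by blast
    next
      case 3 then show ?case using eq' by blast
    next
      case (4 g k) then show ?case by (intro exI[of _ g] exI[of _ k]) auto
    qed
    then obtain g k where g: "continuous_on {0..1} g" and k: "strict_mono (k :: nat \<Rightarrow> nat)"
      and unif: "\<forall>e>0. \<exists>N. \<forall>n x. n \<ge> N \<and> x \<in> {0..1} \<longrightarrow> norm (y (r (k n)) x - g x) < e" by blast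
    have g0: "g 0 = 0"
    proof (rule ccontr)
      assume "g 0 \<noteq> 0"
      then have "0 < norm (g 0)" by simp
      then obtain N where "norm (y (r (k N)) 0 - g 0) < norm (g 0)" using unif by (meson atLeastAtMost_iff order_refl zero_le_one)
      then show False using y[of "r (k N)"] by (simp add: C0_def)
    qed
    have gC: "g \<in> C0" using g g0 by (simp add: C0_def)
    have "(\<lambda>n. rho_inf (y (r (k n))) g) \<longlonglongrightarrow> 0"
    proof (rule LIMSEQ_I)
      fix e :: real assume "0 < e"
      then obtain N where N: "\<forall>n x. n \<ge> N \<and> x \<in> {0..1} \<longrightarrow> norm (y (r (k n)) x - g x) < e / 2"
        using unif half_gt_zero by blast
      have "norm (rho_inf (y (r (k n))) g - 0) < e" if "N \<le> n" for n
      proof -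
        have "rho_inf (y (r (k n))) g \<le> e / 2" by (rule rho_inf_le) (use N that in \<open>auto intro: less_imp_le\<close>)
        then show ?thesis using rho_inf_nonneg[OF y gC, of "r (k n)"] \<open>0 < e\<close> by simp
      qed
      then show "\<exists>no. \<forall>n\<ge>no. norm (rho_inf (y (r (k n))) g - 0) < e" by blast
    qed
    then show "\<exists>s g. strict_mono (s :: nat \<Rightarrow> nat) \<and> g \<in> C0 \<and> (\<lambda>k. rho_inf (y (r (s k))) g) \<longlonglongrightarrow> 0"
      using k gC by blast
  qed
qed

section \<open>From increment bounds to the limit set\<close>

lemma pol_floor_diff_le:
  fixes S :: "nat \<Rightarrow> 'a::real_normed_vector"
  assumes x: "0 \<le> x" "x \<le> real n" and B: "\<And>i. i < n \<Longrightarrow> norm (S (Suc i) - S i) \<le> B" and B0: "0 \<le> B"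
  shows "norm (pol S x - S (nat \<lfloor>x\<rfloor>)) \<le> B"
proof -
  define k where "k = nat \<lfloor>x\<rfloor>"
  have k: "real k \<le> x" "x < real k + 1" unfolding k_def using nat_floor_bounds[OF x(1)] by auto
  have fl: "of_int \<lfloor>x\<rfloor> = real k" using x(1) by (simp add: k_def)
  have e: "pol S x - S k = (x - real k) *\<^sub>R (S (Suc k) - S k)"
    by (simp add: pol_def k_def[symmetric] fl)
  show ?thesis
  proof (cases "k < n")
    case True
    have "norm (pol S x - S k) = \<bar>x - real k\<bar> * norm (S (Suc k) - S k)" unfolding e by simp
    also have "\<dots> \<le> 1 * B" using k B[OF True] by (intro mult_mono) auto
    finally show ?thesis by (simp add: k_def)
  next
    case False
    then have "real n \<le> real k" by simp
    then have "x = real k" using k x by linarith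
    then show ?thesis using B0 e by (simp add: k_def)
  qed
qed

lemma lin_fun_diff_le:
  fixes f g :: "real \<Rightarrow> 'a::real_inner"
  assumes B: "\<And>k. k \<le> m \<Longrightarrow> norm (f (grid m k) - g (grid m k)) \<le> B"
  shows "lin_fun m c f \<le> lin_fun m c g + 2 * B * (\<Sum>k<m. norm (c k))"
proof -
  have "lin_fun m c f - lin_fun m c g = (\<Sum>k<m. c k \<bullet> (incr m k f - incr m k g))"
    by (simp add: lin_fun_def inner_diff_right sum_subtractf)
  also have "\<dots> \<le> (\<Sum>k<m. norm (c k) * (2 * B))"
  proof (rule sum_mono)
    fix k assume "k \<in> {..<m}"
    then have "norm (f (grid m (Suc k)) - g (grid m (Suc k))) \<le> B" "norm (f (grid m k) - g (grid m k)) \<le> B"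
      using B by auto
    moreover have e: "incr m k f - incr m k g = (f (grid m (Suc k)) - g (grid m (Suc k))) - (f (grid m k) - g (grid m k))"
      by (simp add: incr_def)
    ultimately have "norm (incr m k f - incr m k g) \<le> 2 * B"
      unfolding e using norm_triangle_ineq4[of "f (grid m (Suc k)) - g (grid m (Suc k))" "f (grid m k) - g (grid m k)"] by linarith
    then have "norm (c k) * norm (incr m k f - incr m k g) \<le> norm (c k) * (2 * B)" by (intro mult_left_mono) auto
    then show "c k \<bullet> (incr m k f - incr m k g) \<le> norm (c k) * (2 * B)"
      using norm_cauchy_schwarz[of "c k" "incr m k f - incr m k g"] by linarith
  qed
  also have "\<dots> = 2 * B * (\<Sum>k<m. norm (c k))" by (simp add: sum_distrib_right[symmetric] mult.commute)
  finally show ?thesis by linarith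
qed

lemma tendsto_lin_fun:
  fixes g :: "real \<Rightarrow> 'a::real_inner"
  assumes c: "\<And>k. k < m \<Longrightarrow> (\<lambda>i. c i k) \<longlonglongrightarrow> c0 k"
    and f: "\<And>k. k \<le> m \<Longrightarrow> (\<lambda>i. f i (grid m k)) \<longlonglongrightarrow> g (grid m k)"
  shows "(\<lambda>i::nat. lin_fun m (c i) (f i)) \<longlonglongrightarrow> lin_fun m c0 g"
  unfolding lin_fun_def incr_def
  by (intro tendsto_sum tendsto_inner tendsto_diff c f) auto

lemma tendsto_sdev:
  fixes A :: "real^'n^'n"
  assumes c: "\<And>k. k < m \<Longrightarrow> (\<lambda>i. c i k) \<longlonglongrightarrow> c0 k"
  shows "(\<lambda>i::nat. sdev A m (c i)) \<longlonglongrightarrow> sdev A m c0"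
proof -
  have "(\<lambda>i. A *v c i k) \<longlonglongrightarrow> A *v c0 k" if "k < m" for k
    using tendsto_compose[OF _ c[OF that], of "\<lambda>x. A *v x"] linear_continuous_at[OF matrix_vector_mul_bounded_linear[of A]]
    unfolding isCont_def by blast
  then have "(\<lambda>i. (\<Sum>k<m. c i k \<bullet> (A *v c i k)) * inverse (real m)) \<longlonglongrightarrow> (\<Sum>k<m. c0 k \<bullet> (A *v c0 k)) * inverse (real m)"
    by (intro tendsto_mult tendsto_const tendsto_sum tendsto_inner c) auto
  then show ?thesis unfolding sdev_def divide_inverse by (rule tendsto_real_sqrt)
qed

lemma sdev_nonneg: "psd A \<Longrightarrow> 0 \<le> sdev A m c"
  unfolding sdev_def psd_def by (simp add: sum_nonneg)

text \<open>\<open>aa n / n\<close> equals \<open>1 / bb n\<close>, which decreases.\<close>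

lemma aa_le_ratio:
  assumes "0 < n" "n \<le> N" shows "aa N \<le> real N / real n * aa n"
proof -
  have "aa N * real n = aa N * bb n * aa n" using bb_aa[of n] by simp
  also have "\<dots> \<le> aa N * bb N * aa n"
    using bb_mono[OF assms(2)] aa_nonneg by (intro mult_right_mono mult_left_mono) auto
  also have "\<dots> = real N * aa n" using bb_aa[of N] by (simp add: mult.commute)
  finally show ?thesis using assms(1) by (simp add: field_simps)
qed

text \<open>The almost sure bounds are available for countably many functionals only; this is the family
  obtained from a countable dense set of coefficient vectors.\<close>

definition coeffs_in :: "'a::zero set \<Rightarrow> nat \<Rightarrow> (nat \<Rightarrow> 'a) set" where
  "coeffs_in D m = {c. (\<forall>k<m. c k \<in> D) \<and> (\<forall>k\<ge>m. c k = 0)}"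

lemma countable_coeffs_in:
  assumes "countable D" shows "countable (coeffs_in D m)"
proof (rule countable_image_inj_on)
  show "countable ((\<lambda>c. map c [0..<m]) ` coeffs_in D m)"
    by (rule countable_subset[OF _ countable_lists[OF assms]]) (auto simp: coeffs_in_def)
  show "inj_on (\<lambda>c. map c [0..<m]) (coeffs_in D m)"
  proof (rule inj_onI)
    fix c d assume c: "c \<in> coeffs_in D m" "d \<in> coeffs_in D m" and e: "map c [0..<m] = map d [0..<m]"
    show "c = d"
    proof
      fix k show "c k = d k"
        using c e by (cases "k < m") (auto simp: coeffs_in_def map_eq_conv)
    qed
  qed
qed

text \<open>A vanishing initial coefficient is approximated by zero itself, since the lower bound is
  available for \<open>c 0 = 0\<close> only.\<close>

lemma coeffs_in_dense:
  fixes c :: "nat \<Rightarrow> 'a::real_normed_vector"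
  assumes D: "\<And>x e. 0 < e \<Longrightarrow> \<exists>d\<in>D. norm (d - x) < e" and D0: "0 \<in> D"
  shows "\<exists>c'. (\<forall>i. c' i \<in> coeffs_in D m \<and> (c 0 = 0 \<longrightarrow> c' i 0 = 0)) \<and> (\<forall>k<m. (\<lambda>i. c' i k) \<longlonglongrightarrow> c k)"
proof -
  have "\<exists>d\<in>D. norm (d - x) < 1 / real (Suc i) \<and> (x = 0 \<longrightarrow> d = 0)" for x :: 'a and i
    using D[of "1 / real (Suc i)" x] D0 by (cases "x = 0") auto
  then obtain \<delta> where \<delta>: "\<And>x i. \<delta> x i \<in> D" "\<And>x i. norm (\<delta> x i - x) < 1 / real (Suc i)" "\<And>i. \<delta> 0 i = 0"
    by metis
  have "(\<lambda>i. \<delta> x i) \<longlonglongrightarrow> x" for x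
  proof (rule Lim_null[THEN iffD2], rule tendsto_norm_zero_cancel)
    show "(\<lambda>i. norm (\<delta> x i - x)) \<longlonglongrightarrow> 0"
      by (rule tendsto_sandwich[OF _ _ tendsto_const LIMSEQ_inverse_real_of_nat])
        (use \<delta>(2) in \<open>auto simp: inverse_eq_divide intro!: always_eventually less_imp_le\<close>)
  qed
  then show ?thesis
    by (intro exI[of _ "\<lambda>i k. if k < m then \<delta> (c k) i else 0"]) (use \<delta>(1,3) in \<open>auto simp: coeffs_in_def\<close>)
qed

section \<open>Limit points of a single path\<close>

text \<open>The last three assumptions collect everything probabilistic; their parameters are
  countable, so they hold on one almost sure event. From here on \<open>S\<close> is one
  deterministic sequence. The powers of \<open>1/2\<close> and the fractions
  \<open>1 / (p + 2)\<close> discretise the small parameters of the almost sure bounds, the latter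
  staying inside \<open>(0, 1)\<close>.\<close>

locale strassen_walk =
  fixes S :: "nat \<Rightarrow> real^'n" and A :: "real^'n^'n" and w :: "nat \<Rightarrow> real" and D :: "(real^'n) set"
  assumes S_0: "S 0 = 0" and A_psd: "psd A"
    and w_nonneg: "0 \<le> w q" and w_lim: "w \<longlonglongrightarrow> 0"
    and D_0: "0 \<in> D" and D_dense: "0 < (e::real) \<Longrightarrow> \<exists>d\<in>D. norm (d - x) < e"
    and osc: "\<forall>\<^sub>F n in sequentially. \<forall>k l. k \<le> l \<and> l \<le> n \<and> (l - k) * 2 ^ q \<le> n \<longrightarrow> norm (S l - S k) \<le> w q * aa n"
    and upper: "0 < m \<Longrightarrow> c \<in> coeffs_in D m \<Longrightarrow> \<forall>\<^sub>F j in sequentially.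
     (\<Sum>k<m. c k \<bullet> (S ((k + 1) * nat \<lceil>(1 + (1/2) ^ (q + 2) :: real) ^ j\<rceil>) - S (k * nat \<lceil>(1 + (1/2) ^ (q + 2) :: real) ^ j\<rceil>)))
       \<le> (1 + 2 * (1/2) ^ q) * (sdev A m c + (1/2) ^ q) * (sqrt 2 * aa (m * nat \<lceil>(1 + (1/2) ^ (q + 2) :: real) ^ j\<rceil>))"
    and lower: "2 \<le> m \<Longrightarrow> c \<in> coeffs_in D m \<Longrightarrow> c 0 = 0 \<Longrightarrow> 0 < sdev A m c \<Longrightarrow> \<exists>\<^sub>F j in sequentially.
     (1 - 1 / real (p + 2)) * sdev A m c * (sqrt 2 * aa (m * m ^ j))
      \<le> (\<Sum>k<m. c k \<bullet> (S ((k + 1) * m ^ j) - S (k * m ^ j)))"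
begin

definition y :: "nat \<Rightarrow> real \<Rightarrow> real^'n" where
  "y n t = (1 / ell n) *\<^sub>R pol S (real n * t)"

lemma y_C0: "y n \<in> C0"
proof -
  have "pol S 0 = 0" using pol_nat[of S 0] S_0 by simp
  moreover have "continuous_on {0..1} (\<lambda>t. (1 / ell n) *\<^sub>R pol S (real n * t))"
    by (intro continuous_intros pol_scaled_continuous)
  ultimately show ?thesis by (simp add: C0_def y_def)
qed

lemma y_osc: "\<forall>\<^sub>F n in sequentially. \<forall>s\<in>{0..1}. \<forall>t\<in>{0..1}. \<bar>t - s\<bar> * 2 ^ (q + 1) \<le> 1 \<longrightarrow> norm (y n t - y n s) \<le> 3 * w q"
  using osc[of q] LL_eventually eventually_ge_at_top[of "2 ^ (q + 1)"]
proof eventually_elim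
  case (elim n)
  have n: "2 ^ (q + 1) \<le> real n" using elim(3) by (metis of_nat_le_iff of_nat_numeral of_nat_power)
  then have n0: "0 < n" by (metis gr0I not_one_le_zero of_nat_0 one_le_numeral one_le_power order_trans zero_le_one
        linorder_not_le zero_less_numeral zero_less_power)
  have ln: "ell n = sqrt 2 * aa n" using elim(2) by simp
  have aa0: "0 < aa n" by (rule aa_pos[OF n0])
  define B where "B = w q * aa n"
  have B0: "0 \<le> B" using w_nonneg aa_nonneg by (simp add: B_def)
  have one: "norm (S (Suc i) - S i) \<le> B" if "i < n" for i
  proof -
    have "(2::nat) ^ q \<le> n" using elim(3) by simp
    then show ?thesis using elim(1)[rule_format, of i "Suc i"] that by (simp add: B_def)
  qed
  have main: "norm (y n t - y n s) \<le> 3 * w q"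
    if s: "s \<in> {0..1}" and t: "t \<in> {0..1}" and st: "s \<le> t" and d: "(t - s) * 2 ^ (q + 1) \<le> 1" for s t
  proof -
    define k where "k = nat \<lfloor>real n * s\<rfloor>"
    define l where "l = nat \<lfloor>real n * t\<rfloor>"
    have ns: "0 \<le> real n * s" "real n * s \<le> real n" "0 \<le> real n * t" "real n * t \<le> real n" "real n * s \<le> real n * t"
      using s t st by (auto intro!: mult_left_le mult_left_mono)
    have kl: "k \<le> l" unfolding k_def l_def using ns by (intro nat_mono floor_mono) auto
    have ln': "l \<le> n" unfolding l_def by (rule nat_floor_le) (use ns in auto)
    have "real (l - k) \<le> real n * (t - s) + 1"
      using nat_floor_bounds[OF ns(1)] nat_floor_bounds[OF ns(3)] kl unfolding k_def[symmetric] l_def[symmetric]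
      by (simp add: of_nat_diff right_diff_distrib)
    then have "real (l - k) * 2 ^ q \<le> (real n * (t - s) + 1) * 2 ^ q" by (rule mult_right_mono) simp
    also have "\<dots> = real n * ((t - s) * 2 ^ (q + 1)) / 2 + 2 ^ (q + 1) / 2" by (simp add: field_simps)
    also have "\<dots> \<le> real n * 1 / 2 + real n / 2"
      using d n by (intro add_mono divide_right_mono mult_left_mono) auto
    finally have "real ((l - k) * 2 ^ q) \<le> real n" by simp
    then have "(l - k) * 2 ^ q \<le> n" by (simp only: of_nat_le_iff)
    then have 1: "norm (S l - S k) \<le> B" using elim(1) kl ln' by (simp add: B_def)
    have 2: "norm (pol S (real n * t) - S l) \<le> B" unfolding l_def by (rule pol_floor_diff_le[OF ns(3,4) _ B0]) (rule one)
    have 3: "norm (pol S (real n * s) - S k) \<le> B" unfolding k_def by (rule pol_floor_diff_le[OF ns(1,2) _ B0]) (rule one)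
    have e: "pol S (real n * t) - pol S (real n * s) = (pol S (real n * t) - S l) + (S l - S k) - (pol S (real n * s) - S k)"
      by simp
    have "norm (pol S (real n * t) - pol S (real n * s)) \<le> 3 * B"
      unfolding e using 1 2 3 norm_triangle_ineq4[of "(pol S (real n * t) - S l) + (S l - S k)" "pol S (real n * s) - S k"]
        norm_triangle_ineq[of "pol S (real n * t) - S l" "S l - S k"] by linarith
    also have "\<dots> \<le> 3 * w q * ell n" unfolding ln B_def using w_nonneg[of q] aa0 by (simp add: mult_left_mono)
    finally have "norm (pol S (real n * t) - pol S (real n * s)) / ell n \<le> 3 * w q"
      using aa0 by (simp add: ln divide_le_eq)
    moreover have "norm (y n t - y n s) = norm (pol S (real n * t) - pol S (real n * s)) / ell n"
      unfolding y_def scaleR_diff_right[symmetric] using aa0 by (simp add: ln)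
    ultimately show ?thesis by simp
  qed
  show ?case
  proof (intro ballI impI)
    fix s t :: real assume "s \<in> {0..1}" "t \<in> {0..1}" "\<bar>t - s\<bar> * 2 ^ (q + 1) \<le> 1"
    then show "norm (y n t - y n s) \<le> 3 * w q"
      using main[of s t] main[of t s] norm_minus_commute[of "y n t" "y n s"] by (cases "s \<le> t") auto
  qed
qed

lemma y_rel_compact: "rel_compact_seq y"
proof (rule equicontinuous_imp_rel_compact[OF y_C0])
  fix e :: real assume e: "0 < e"
  have "\<forall>\<^sub>F q in sequentially. w q < e / 3" by (rule order_tendstoD(2)[OF w_lim]) (use e in simp)
  then obtain q where q: "w q < e / 3" using eventually_happens'[OF sequentially_bot] by blast
  show "\<exists>d>0. \<forall>\<^sub>F n in sequentially. \<forall>s\<in>{0..1}. \<forall>t\<in>{0..1}. \<bar>s - t\<bar> < d \<longrightarrow> norm (y n s - y n t) < e"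
  proof (intro exI conjI)
    show "(0::real) < 1 / 2 ^ (q + 1)" by simp
    show "\<forall>\<^sub>F n in sequentially. \<forall>s\<in>{0..1}. \<forall>t\<in>{0..1}. \<bar>s - t\<bar> < 1 / 2 ^ (q + 1) \<longrightarrow> norm (y n s - y n t) < e"
      using y_osc[of q]
    proof eventually_elim
      case (elim n)
      show ?case
      proof (intro ballI impI)
        fix s t :: real assume "s \<in> {0..1}" "t \<in> {0..1}" and d: "\<bar>s - t\<bar> < 1 / 2 ^ (q + 1)"
        moreover have "\<bar>s - t\<bar> * 2 ^ (q + 1) \<le> 1" using d by (simp add: less_divide_eq)
        ultimately have "norm (y n s - y n t) \<le> 3 * w q" using elim by blast
        then show "norm (y n s - y n t) < e" using q by simp
      qed
    qed
  qed
qed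

text \<open>For a path of length \<open>m * h\<close> the grid of mesh \<open>1/m\<close> consists
  of integer times, so no interpolation enters.\<close>

lemma lin_fun_y_block:
  assumes m: "0 < m" and h: "0 < h" and l: "ell (m * h) = sqrt 2 * aa (m * h)"
  shows "(\<Sum>k<m. c k \<bullet> (S ((k + 1) * h) - S (k * h))) = sqrt 2 * aa (m * h) * lin_fun m c (y (m * h))"
proof -
  have g: "real (m * h) * grid m k = real (k * h)" for k using m by (simp add: grid_def)
  have yk: "y (m * h) (grid m k) = (1 / ell (m * h)) *\<^sub>R S (k * h)" for k
    unfolding y_def g pol_nat ..
  have pos: "0 < sqrt 2 * aa (m * h)" using m h aa_pos[of "m * h"] by simp
  have "lin_fun m c (y (m * h)) = (\<Sum>k<m. (1 / ell (m * h)) * (c k \<bullet> (S ((k + 1) * h) - S (k * h))))"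
    unfolding lin_fun_def incr_def yk by (simp only: scaleR_diff_right[symmetric] inner_scaleR_right Suc_eq_plus1)
  also have "\<dots> = (1 / ell (m * h)) * (\<Sum>k<m. c k \<bullet> (S ((k + 1) * h) - S (k * h)))"
    by (rule sum_distrib_left[symmetric])
  finally have "lin_fun m c (y (m * h)) = (\<Sum>k<m. c k \<bullet> (S ((k + 1) * h) - S (k * h))) / (sqrt 2 * aa (m * h))"
    by (simp add: l)
  moreover have "b = x * a" if "a = b / x" "0 < x" for a b x :: real using that by simp
  ultimately show ?thesis using pos by blast
qed

text \<open>From the subsequence to all \<open>n\<close>: for the least \<open>N = m * h j\<close>
  with \<open>n \<le> N\<close>, the path \<open>y n\<close> is an initial piece of
  \<open>y N\<close>, rescaled in time and multiplied by \<open>R = ell N / ell n\<close>. As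
  \<open>N / n \<le> 1 + \<delta>\<close>, the factor is at most \<open>1 + \<delta>\<close> and the
  arguments move by at most \<open>\<delta>\<close>, which \<open>y_osc\<close> tolerates.\<close>

lemma lin_fun_y_upper:
  assumes m: "0 < m" and c: "c \<in> coeffs_in D m"
  shows "\<forall>\<^sub>F n in sequentially. lin_fun m c (y n) \<le>
    (1 + (1/2) ^ (q + 1)) * ((1 + 2 * (1/2) ^ q) * (sdev A m c + (1/2) ^ q) + 6 * w q * (\<Sum>k<m. norm (c k)))"
proof -
  define \<rho> :: real where "\<rho> = 1 + (1/2) ^ (q + 2)"
  define h where "h j = nat \<lceil>\<rho> ^ j\<rceil>" for j
  define B where "B = (1 + 2 * (1/2) ^ q) * (sdev A m c + (1/2) ^ q)"
  define T where "T = (\<Sum>k<m. norm (c k))"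
  define \<delta> :: real where "\<delta> = (1/2) ^ (q + 1)"
  have \<delta>0: "0 < \<delta>" by (simp add: \<delta>_def)
  have B0: "0 \<le> B" unfolding B_def using sdev_nonneg[OF A_psd] by (intro mult_nonneg_nonneg add_nonneg_nonneg) auto
  have T0: "0 \<le> T" by (simp add: T_def sum_nonneg)
  have \<rho>1: "1 < \<rho>" by (simp add: \<rho>_def)
  have h_ge: "\<rho> ^ j \<le> real (h j)" and h_le: "real (h j) \<le> \<rho> ^ j + 1" for j
  proof -
    have "0 \<le> \<rho> ^ j" using \<rho>1 by simp
    then show "\<rho> ^ j \<le> real (h j)" "real (h j) \<le> \<rho> ^ j + 1" unfolding h_def by linarith+
  qed
  have h0: "0 < h j" for j
  proof -
    have "0 < \<rho> ^ j" using \<rho>1 by simp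
    then show ?thesis using h_ge[of j] by linarith
  qed
  have h_mono: "h i \<le> h j" if "i \<le> j" for i j
    unfolding h_def by (intro nat_mono ceiling_mono power_increasing that) (use \<rho>1 in simp)
  have "\<forall>\<^sub>F j in sequentially. (\<Sum>k<m. c k \<bullet> (S ((k + 1) * h j) - S (k * h j))) \<le> B * (sqrt 2 * aa (m * h j))"
    using upper[OF m c, of q] unfolding h_def \<rho>_def B_def .
  then obtain J where J: "\<And>j. J \<le> j \<Longrightarrow> (\<Sum>k<m. c k \<bullet> (S ((k + 1) * h j) - S (k * h j))) \<le> B * (sqrt 2 * aa (m * h j))"
    unfolding eventually_sequentially by blast
  obtain N0 where N0: "\<And>n. N0 \<le> n \<Longrightarrow> ell n = sqrt 2 * aa n"
     "\<And>n s t. N0 \<le> n \<Longrightarrow> s \<in> {0..1} \<Longrightarrow> t \<in> {0..1} \<Longrightarrow> \<bar>t - s\<bar> * 2 ^ (q + 1) \<le> 1 \<Longrightarrow> norm (y n t - y n s) \<le> 3 * w q"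
    using eventually_conj[OF LL_eventually y_osc[of q]] unfolding eventually_sequentially by blast
  have "lin_fun m c (y n) \<le> (1 + \<delta>) * (B + 6 * w q * T)"
    if n: "N0 \<le> n" "m * h J < n" "m * 2 ^ (q + 2) \<le> n" for n
  proof -
    have n0: "0 < n" using n(2) by simp
    have ex: "\<exists>j. n \<le> m * h j"
    proof -
      obtain j where "real n < \<rho> ^ j" using real_arch_pow[OF \<rho>1] by blast
      then have "n \<le> h j" using h_ge[of j] by linarith
      then show ?thesis using m by (intro exI[of _ j]) (metis One_nat_def Suc_leI le_trans mult.left_neutral mult_le_mono1)
    qed
    define j where "j = (LEAST j. n \<le> m * h j)"
    define N where "N = m * h j"
    have nN: "n \<le> N" unfolding j_def N_def by (rule LeastI_ex[OF ex])
    have N00: "0 < N" "0 < real N" using n0 nN by auto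
    have jJ: "J < j"
    proof (rule ccontr)
      assume "\<not> J < j" then have "m * h j \<le> m * h J" by (intro mult_le_mono2 h_mono) simp
      then show False using nN n(2) unfolding N_def by linarith
    qed
    then obtain i where i: "j = Suc i" by (cases j) auto
    have "\<not> n \<le> m * h i" using not_less_Least[of i "\<lambda>j. n \<le> m * h j"] i by (simp add: j_def)
    then have "real (m * h i) \<le> real n" by linarith
    moreover have "real m * \<rho> ^ i \<le> real (m * h i)" using h_ge[of i] m by simp
    ultimately have ni: "real m * \<rho> ^ i \<le> real n" by linarith
    have "real N = real m * real (h j)" by (simp add: N_def)
    also have "\<dots> \<le> real m * (\<rho> ^ j + 1)" using h_le[of j] by (intro mult_left_mono) auto
    also have "\<dots> = \<rho> * (real m * \<rho> ^ i) + real m" by (simp add: i algebra_simps)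
    also have "\<dots> \<le> \<rho> * real n + real m" using ni \<rho>1 by simp
    \<comment> \<open>Of \<open>\<delta> = 2 * (1/2)^(q+2)\<close> one half is used up by the ratio
      \<open>\<rho>\<close> and the other by rounding \<open>\<rho> ^ j\<close> up to an
      integer.\<close>
    also have "real m \<le> real n * (1/2) ^ (q + 2)"
    proof -
      have "real (m * 2 ^ (q + 2)) \<le> real n" using n(3) by (simp only: of_nat_le_iff)
      then show ?thesis by (simp add: power_divide field_simps)
    qed
    also have "\<rho> * real n + real n * (1/2) ^ (q + 2) = real n * (1 + \<delta>)"
      by (simp add: \<rho>_def \<delta>_def algebra_simps power_divide)
    finally have N\<delta>: "real N \<le> real n * (1 + \<delta>)" by simp
    have lN: "ell N = sqrt 2 * aa N" and ln: "ell n = sqrt 2 * aa n" using N0(1) n(1) nN by auto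
    have aN: "0 < aa N" "0 < aa n" using aa_pos N00 n0 by auto
    define R where "R = ell N / ell n"
    have R: "0 \<le> R" "R \<le> 1 + \<delta>"
    proof -
      show "0 \<le> R" using aN by (simp add: R_def lN ln)
      have "real N / real n \<le> 1 + \<delta>" using N\<delta> n0 by (simp add: divide_le_eq mult.commute)
      then have "real N / real n * aa n \<le> (1 + \<delta>) * aa n" using aN by (intro mult_right_mono) auto
      with aa_le_ratio[OF n0 nN] have "aa N \<le> (1 + \<delta>) * aa n" by linarith
      then show "R \<le> 1 + \<delta>" using aN by (simp add: R_def lN ln divide_le_eq)
    qed
    define z where "z t = y N (t * real n / real N)" for t
    have yz: "y n t = R *\<^sub>R z t" for t
    proof -
      have "real N * (t * real n / real N) = real n * t" using N00 by simp
      then show ?thesis using aN by (simp add: z_def y_def R_def lN ln)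
    qed
    have "lin_fun m c (y n) = R * lin_fun m c z"
      unfolding lin_fun_def incr_def yz scaleR_diff_right[symmetric] inner_scaleR_right by (rule sum_distrib_left[symmetric])
    also have "\<dots> \<le> R * (B + 6 * w q * T)"
    proof (rule mult_left_mono[OF _ R(1)])
      have "lin_fun m c z \<le> lin_fun m c (y N) + 2 * (3 * w q) * (\<Sum>k<m. norm (c k))"
      proof (rule lin_fun_diff_le)
        fix k assume "k \<le> m"
        define t where "t = grid m k"
        have t: "0 \<le> t" "t \<le> 1" using grid_mem[OF \<open>k \<le> m\<close>] by (auto simp: t_def)
        have q0: "0 \<le> real n / real N" "real n / real N \<le> 1" using nN N00 by auto
        have "t * real n / real N \<in> {0..1}" using t q0 mult_mono[OF t(2) q0(2)] by simp
        moreover have "\<bar>t * real n / real N - t\<bar> * 2 ^ (q + 1) \<le> 1"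
        proof -
          have "1 - real n / real N \<le> \<delta>"
          proof -
            have "real N \<le> real n + real n * \<delta>" using N\<delta> by (simp add: distrib_left)
            also have "\<dots> \<le> real n + real N * \<delta>" using nN \<delta>0 by (intro add_left_mono mult_right_mono) auto
            finally show ?thesis using N00 by (simp add: field_simps)
          qed
          moreover have "t * real n / real N - t = - (t * (1 - real n / real N))" by (simp add: right_diff_distrib)
          moreover have "t * (1 - real n / real N) \<le> 1 * (1 - real n / real N)" using t q0 by (intro mult_right_mono) auto
          moreover have "0 \<le> t * (1 - real n / real N)" using t q0 by simp
          ultimately have "\<bar>t * real n / real N - t\<bar> \<le> \<delta>" by (simp only: abs_minus_cancel abs_of_nonneg) simp
          then show ?thesis by (simp add: \<delta>_def power_divide field_simps)
        qed
        ultimately show "norm (z (grid m k) - y N (grid m k)) \<le> 3 * w q"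
          using N0(2)[of N t "t * real n / real N"] n(1) nN t by (simp add: z_def t_def)
      qed
      moreover have "lin_fun m c (y N) \<le> B"
      proof -
        have "sqrt 2 * aa N * lin_fun m c (y N) \<le> B * (sqrt 2 * aa N)"
          using J[of j] jJ lin_fun_y_block[OF m h0 lN[unfolded N_def], of c] by (simp add: N_def)
        then show ?thesis using aN by (simp add: mult.commute)
      qed
      ultimately show "lin_fun m c z \<le> B + 6 * w q * T" by (simp add: T_def)
    qed
    also have "\<dots> \<le> (1 + \<delta>) * (B + 6 * w q * T)"
      using R(2) B0 T0 w_nonneg[of q] by (intro mult_right_mono add_nonneg_nonneg) auto
    finally show ?thesis .
  qed
  then show ?thesis
    unfolding eventually_sequentially B_def[symmetric] T_def[symmetric] \<delta>_def[symmetric]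
    by (intro exI[of _ "N0 + Suc (m * h J) + m * 2 ^ (q + 2)"]) auto
qed

text \<open>Letting \<open>q\<close> grow removes all margins for coefficients from
  \<open>D\<close>; both sides depend continuously on the coefficients, so density of
  \<open>D\<close> yields the rest.\<close>

lemma limit_point_in_strassen_set:
  assumes g: "g \<in> limit_points y"
  shows "g \<in> strassen_set A"
proof -
  have gC: "g \<in> C0" using g by (simp add: limit_points_def)
  obtain r :: "nat \<Rightarrow> nat" where r: "strict_mono r" "(\<lambda>k. rho_inf (y (r k)) g) \<longlonglongrightarrow> 0"
    using g unfolding limit_points_def by blast
  have pt: "(\<lambda>k. y (r k) t) \<longlonglongrightarrow> g t" if "t \<in> {0..1}" for t
    by (rule rho_inf_tendsto_pointwise[OF y_C0 gC r(2) that])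
  have 1: "lin_fun m c g \<le> sdev A m c" if m: "0 < m" and c: "c \<in> coeffs_in D m" for m c
  proof -
    define T where "T = (\<Sum>k<m. norm (c k))"
    have "lin_fun m c g \<le> (1 + (1/2) ^ (q + 1)) * ((1 + 2 * (1/2) ^ q) * (sdev A m c + (1/2) ^ q) + 6 * w q * T)" for q
    proof (rule tendsto_upperbound[OF _ _ sequentially_bot])
      show "(\<lambda>k. lin_fun m c (y (r k))) \<longlonglongrightarrow> lin_fun m c g"
        by (rule tendsto_lin_fun) (rule tendsto_const, rule pt[OF grid_mem])
      show "\<forall>\<^sub>F k in sequentially. lin_fun m c (y (r k)) \<le> (1 + (1/2) ^ (q + 1)) * ((1 + 2 * (1/2) ^ q) * (sdev A m c + (1/2) ^ q) + 6 * w q * T)"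
        using eventually_compose_filterlim[OF lin_fun_y_upper[OF m c, of q] filterlim_subseq[OF r(1)]] by (simp add: T_def)
    qed
    moreover have "(\<lambda>q. (1 + (1/2::real) ^ (q + 1)) * ((1 + 2 * (1/2) ^ q) * (sdev A m c + (1/2) ^ q) + 6 * w q * T))
       \<longlonglongrightarrow> (1 + 0) * ((1 + 2 * 0) * (sdev A m c + 0) + 6 * 0 * T)"
      by (intro tendsto_intros w_lim LIMSEQ_power_zero LIMSEQ_ignore_initial_segment[of "\<lambda>q. (1/2::real) ^ q"]) auto
    ultimately show ?thesis using LIMSEQ_le_const[of _ "(1 + 0) * ((1 + 2 * 0) * (sdev A m c + 0) + 6 * 0 * T)" "lin_fun m c g"] by auto
  qed
  have "lin_fun m c g \<le> sdev A m c" if m: "0 < m" for m c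
  proof -
    obtain c' where c': "\<And>i. c' i \<in> coeffs_in D m" "\<And>k. k < m \<Longrightarrow> (\<lambda>i. c' i k) \<longlonglongrightarrow> c k"
      using coeffs_in_dense[OF D_dense D_0, of m c] by blast
    show ?thesis
      by (rule LIMSEQ_le[OF tendsto_lin_fun[OF c'(2) tendsto_const] tendsto_sdev[OF c'(2)]])
        (use 1[OF m c'(1)] in auto)
  qed
  then show ?thesis using gC by (simp add: strassen_set_def)
qed

end

section \<open>Maximisers of functionals and their density\<close>

lemma incr_grid_sum:
  assumes "g 0 = 0" shows "g (grid m k) = (\<Sum>i<k. incr m i g)"
proof -
  have "(\<Sum>i<k. incr m i g) = g (grid m k) - g (grid m 0)"
    unfolding incr_def by (rule sum_lessThan_telescope)
  then show ?thesis using assms by (simp add: grid_def)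
qed

lemma incr_double: "incr m k g = incr (2 * m) (2 * k) g + incr (2 * m) (2 * k + 1) g"
proof -
  have "grid (2 * m) (2 * k) = grid m k" for k by (simp add: grid_def)
  from this[of k] this[of "Suc k"] show ?thesis by (simp add: incr_def)
qed

lemma sum_double: "(\<Sum>i<2 * m. f i) = (\<Sum>k<m. f (2 * k) + f (2 * k + 1))" for f :: "nat \<Rightarrow> 'a::comm_monoid_add"
  by (induction m) (simp_all add: add.assoc)

lemma sdev_power2: "psd A \<Longrightarrow> (sdev A m c)\<^sup>2 = (\<Sum>k<m. c k \<bullet> (A *v c k)) / real m"
  unfolding sdev_def psd_def by (simp add: sum_nonneg)

text \<open>A functional that attains its bound on the Strassen set has vanishing first variation, which
  determines all increments of the maximiser.\<close>

lemma strassen_set_maximiser: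
  fixes A :: "real^'n^'n"
  assumes A: "psd A" and g: "g \<in> strassen_set A" and m: "0 < m" and k: "k < m"
    and s: "0 < sdev A m c" and eq: "lin_fun m c g = sdev A m c"
  shows "incr m k g = (1 / (real m * sdev A m c)) *\<^sub>R (A *v c k)"
proof -
  define \<sigma> where "\<sigma> = sdev A m c"
  have sym: "(A *v x) \<bullet> z = x \<bullet> (A *v z)" for x z using A unfolding psd_def symmetric_matrix_iff by blast
  have "v \<bullet> (incr m k g - (1 / (real m * \<sigma>)) *\<^sub>R (A *v c k)) = 0" for v
  proof -
    define L where "L = v \<bullet> incr m k g"
    define B where "B = v \<bullet> (A *v c k) / real m"
    \<comment> \<open>Perturb the coefficient of cell \<open>k\<close> by \<open>t v\<close>. The
      bound may be squared because it also holds for \<open>- d\<close>; the result is a quadratic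
      in \<open>t\<close> whose constant terms cancel by \<open>eq\<close>.\<close>
    have key: "t * (2 * (\<sigma> * L - B)) + t\<^sup>2 * (L\<^sup>2 - v \<bullet> (A *v v) / real m) \<le> 0" for t
    proof -
      define d where "d i = c i + (if i = k then t *\<^sub>R v else 0)" for i
      have lin: "lin_fun m d g = \<sigma> + t * L"
      proof -
        have "lin_fun m d g = (\<Sum>i<m. c i \<bullet> incr m i g + (if i = k then t * L else 0))"
          unfolding lin_fun_def by (rule sum.cong) (auto simp: d_def inner_add_left L_def)
        also have "\<dots> = lin_fun m c g + t * L" using k by (simp add: sum.distrib lin_fun_def)
        finally show ?thesis by (simp add: eq \<sigma>_def)
      qed
      have mv: "A *v (- x) = - (A *v x)" for x using matrix_vector_mult_scaleR[of A "-1" x] by simp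
      have neg: "lin_fun m (\<lambda>i. - d i) g = - lin_fun m d g" "sdev A m (\<lambda>i. - d i) = sdev A m d"
        by (simp_all add: lin_fun_def sum_negf sdev_def mv)
      have "lin_fun m d g \<le> sdev A m d" "lin_fun m (\<lambda>i. - d i) g \<le> sdev A m (\<lambda>i. - d i)"
        using g m by (auto simp: strassen_set_def)
      then have "\<bar>lin_fun m d g\<bar> \<le> sdev A m d" unfolding neg by linarith
      then have "(lin_fun m d g)\<^sup>2 \<le> (sdev A m d)\<^sup>2" by (simp add: abs_le_square_iff[symmetric] sdev_nonneg[OF A])
      also have "(sdev A m d)\<^sup>2 = (\<Sum>i<m. c i \<bullet> (A *v c i) + (if i = k then 2 * t * (v \<bullet> (A *v c k)) + t\<^sup>2 * (v \<bullet> (A *v v)) else 0)) / real m"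
        unfolding sdev_power2[OF A]
      proof (rule arg_cong[of _ _ "\<lambda>x. x / real m"], rule sum.cong)
        fix i
        have "c k \<bullet> (A *v v) = v \<bullet> (A *v c k)" using sym[of "c k" v] by (simp add: inner_commute)
        then show "d i \<bullet> (A *v d i) = c i \<bullet> (A *v c i) + (if i = k then 2 * t * (v \<bullet> (A *v c k)) + t\<^sup>2 * (v \<bullet> (A *v v)) else 0)"
          by (simp add: d_def matrix_vector_right_distrib matrix_vector_mult_scaleR inner_add_left inner_add_right power2_eq_square algebra_simps)
      qed simp
      also have "\<dots> = \<sigma>\<^sup>2 + (2 * t * B + t\<^sup>2 * (v \<bullet> (A *v v) / real m))"
        using k by (simp add: sum.distrib \<sigma>_def sdev_power2[OF A] B_def add_divide_distrib)
      finally show ?thesis unfolding lin by (simp add: power2_eq_square algebra_simps)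
    qed
    have "\<sigma> * L = B" using quadratic_nonpos_imp_zero[OF key] by simp
    then show ?thesis using s m by (simp add: inner_diff_right L_def B_def \<sigma>_def[symmetric] field_simps)
  qed
  then have "incr m k g - (1 / (real m * \<sigma>)) *\<^sub>R (A *v c k) = 0" by (metis inner_eq_zero_iff)
  then show ?thesis by (simp add: \<sigma>_def)
qed

context strassen_walk
begin

text \<open>The lower bound supplies arbitrarily late times at which the functional is nearly
  \<open>sdev\<close>. Compactness gives a limit point along them, and the upper bound excludes a
  larger value there.\<close>

lemma lin_fun_attained:
  assumes m: "2 \<le> m" and c: "c \<in> coeffs_in D m" "c 0 = 0" and s: "0 < sdev A m c"
  shows "\<exists>g\<in>limit_points y. lin_fun m c g = sdev A m c"
proof -
  have m0: "0 < m" using m by simp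
  have ex: "\<exists>n>K. (1 - 1 / real (p + 2)) * sdev A m c \<le> lin_fun m c (y n)" for K p
  proof -
    have "\<forall>\<^sub>F n in sequentially. ell n = sqrt 2 * aa n \<and> K < n"
      using LL_eventually eventually_gt_at_top[of K] by eventually_elim auto
    then obtain N where N: "\<And>n. N \<le> n \<Longrightarrow> ell n = sqrt 2 * aa n \<and> K < n"
      unfolding eventually_sequentially by blast
    have "\<exists>\<^sub>F j in sequentially. N \<le> j \<and> (1 - 1 / real (p + 2)) * sdev A m c * (sqrt 2 * aa (m * m ^ j))
      \<le> (\<Sum>k<m. c k \<bullet> (S ((k + 1) * m ^ j) - S (k * m ^ j)))"
      by (rule frequently_eventually_conj[OF lower[OF m c s] eventually_ge_at_top])
    then obtain j where j: "N \<le> j" "(1 - 1 / real (p + 2)) * sdev A m c * (sqrt 2 * aa (m * m ^ j))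
      \<le> (\<Sum>k<m. c k \<bullet> (S ((k + 1) * m ^ j) - S (k * m ^ j)))"
      using frequently_ex by blast
    have "j < m ^ j" using m by (intro power_gt_expt) simp
    also have "\<dots> \<le> m * m ^ j" using m0 by simp
    finally have n: "N \<le> m * m ^ j" using j(1) by simp
    have h: "0 < m ^ j" using m0 by simp
    have pos: "0 < sqrt 2 * aa (m * m ^ j)" using aa_pos[of "m * m ^ j"] m0 by simp
    have "(1 - 1 / real (p + 2)) * sdev A m c * (sqrt 2 * aa (m * m ^ j)) \<le> lin_fun m c (y (m * m ^ j)) * (sqrt 2 * aa (m * m ^ j))"
      using j(2) lin_fun_y_block[OF m0 h, of c] N[OF n] by (simp only: mult.commute)
    then have "(1 - 1 / real (p + 2)) * sdev A m c \<le> lin_fun m c (y (m * m ^ j))"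
      using pos by (rule mult_right_le_imp_le)
    then show ?thesis using N[OF n] by blast
  qed
  have "\<exists>r. \<forall>p. (1 - 1 / real (p + 2)) * sdev A m c \<le> lin_fun m c (y (r p)) \<and> r p < r (Suc p)"
  proof (rule dependent_nat_choice)
    show "\<exists>x. (1 - 1 / real (0 + 2)) * sdev A m c \<le> lin_fun m c (y x)" using ex[of 0 0] by blast
    show "\<exists>z. (1 - 1 / real (Suc p + 2)) * sdev A m c \<le> lin_fun m c (y z) \<and> x < z" for x p
      using ex[of x "Suc p"] by blast
  qed
  then obtain r where r: "\<And>p. (1 - 1 / real (p + 2)) * sdev A m c \<le> lin_fun m c (y (r p))" "\<And>p. r p < r (Suc p)" by blast
  have rm: "strict_mono r" using r(2) by (simp add: strict_mono_Suc_iff)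
  obtain s g where sg: "strict_mono (s :: nat \<Rightarrow> nat)" "g \<in> limit_points y" "(\<lambda>k. rho_inf (y (r (s k))) g) \<longlonglongrightarrow> 0"
    using rel_compact_limit_point[OF y_rel_compact rm] by blast
  have gK: "g \<in> strassen_set A" by (rule limit_point_in_strassen_set[OF sg(2)])
  then have gC: "g \<in> C0" by (simp add: strassen_set_def)
  have "sdev A m c \<le> lin_fun m c g"
  proof (rule LIMSEQ_le)
    show "(\<lambda>k. lin_fun m c (y (r (s k)))) \<longlonglongrightarrow> lin_fun m c g"
      by (rule tendsto_lin_fun) (rule tendsto_const, rule rho_inf_tendsto_pointwise[OF y_C0 gC sg(3) grid_mem])
    have "(\<lambda>p. 1 / real (p + 2)) \<longlonglongrightarrow> 0" using LIMSEQ_ignore_initial_segment[OF lim_1_over_n, of 2] .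
    then have "(\<lambda>p. (1 - 1 / real (p + 2)) * sdev A m c) \<longlonglongrightarrow> (1 - 0) * sdev A m c" by (intro tendsto_intros)
    from LIMSEQ_subseq_LIMSEQ[OF this sg(1)]
    show "(\<lambda>k. (1 - 1 / real (s k + 2)) * sdev A m c) \<longlonglongrightarrow> sdev A m c" by (simp add: o_def)
    show "\<exists>N. \<forall>k\<ge>N. (1 - 1 / real (s k + 2)) * sdev A m c \<le> lin_fun m c (y (r (s k)))" using r(1) by blast
  qed
  moreover have "lin_fun m c g \<le> sdev A m c" using gK m0 by (simp add: strassen_set_def)
  ultimately show ?thesis using sg(2) by auto
qed

text \<open>Attainment is known for coefficients in \<open>D\<close>; an arbitrary \<open>c\<close>
  is approximated by these, since the increments of the maximiser depend continuously on its
  coefficients as long as \<open>sdev\<close> is positive.\<close>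

lemma limit_point_increments:
  assumes m: "2 \<le> m" and c0: "c 0 = 0" and s: "0 < sdev A m c" and e: "0 < e"
  shows "\<exists>g\<in>limit_points y. \<forall>k<m. norm (incr m k g - (1 / (real m * sdev A m c)) *\<^sub>R (A *v c k)) < e"
proof -
  have m0: "0 < m" using m by simp
  obtain c' where c': "\<And>i. c' i \<in> coeffs_in D m" "\<And>i. c' i 0 = 0" "\<And>k. k < m \<Longrightarrow> (\<lambda>i. c' i k) \<longlonglongrightarrow> c k"
    using coeffs_in_dense[OF D_dense D_0, of m c] c0 by blast
  have sl: "(\<lambda>i. sdev A m (c' i)) \<longlonglongrightarrow> sdev A m c" by (rule tendsto_sdev[OF c'(3)])
  have lim: "(\<lambda>i. (1 / (real m * sdev A m (c' i))) *\<^sub>R (A *v c' i k)) \<longlonglongrightarrow> (1 / (real m * sdev A m c)) *\<^sub>R (A *v c k)"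
    if "k < m" for k
  proof -
    have "(\<lambda>i. A *v c' i k) \<longlonglongrightarrow> A *v c k"
      using tendsto_compose[OF _ c'(3)[OF that], of "\<lambda>x. A *v x"] linear_continuous_at[OF matrix_vector_mul_bounded_linear[of A]]
      unfolding isCont_def by blast
    then show ?thesis using s m0 by (intro tendsto_intros sl) auto
  qed
  have "\<forall>\<^sub>F i in sequentially. 0 < sdev A m (c' i)" by (rule order_tendstoD(1)[OF sl s])
  moreover have "\<forall>\<^sub>F i in sequentially. \<forall>k\<in>{..<m}. dist ((1 / (real m * sdev A m (c' i))) *\<^sub>R (A *v c' i k)) ((1 / (real m * sdev A m c)) *\<^sub>R (A *v c k)) < e"
    by (rule eventually_ball_finite) (use tendstoD[OF lim e] in auto)
  ultimately have "\<forall>\<^sub>F i in sequentially. 0 < sdev A m (c' i) \<and> (\<forall>k\<in>{..<m}. dist ((1 / (real m * sdev A m (c' i))) *\<^sub>R (A *v c' i k)) ((1 / (real m * sdev A m c)) *\<^sub>R (A *v c k)) < e)"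
    by (rule eventually_conj)
  then obtain i where i: "0 < sdev A m (c' i)"
     "\<And>k. k < m \<Longrightarrow> dist ((1 / (real m * sdev A m (c' i))) *\<^sub>R (A *v c' i k)) ((1 / (real m * sdev A m c)) *\<^sub>R (A *v c k)) < e"
    using eventually_happens'[OF sequentially_bot] by blast
  obtain g where g: "g \<in> limit_points y" "lin_fun m (c' i) g = sdev A m (c' i)"
    using lin_fun_attained[OF m c'(1) c'(2) i(1)] by blast
  have "incr m k g = (1 / (real m * sdev A m (c' i))) *\<^sub>R (A *v c' i k)" if "k < m" for k
    by (rule strassen_set_maximiser[OF A_psd limit_point_in_strassen_set[OF g(1)] m0 that i(1) g(2)])
  then show ?thesis using g(1) i(2) by (intro bexI[of _ g]) (auto simp: dist_norm)
qed

lemma limit_point_modulus: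
  assumes g: "g \<in> limit_points y" and st: "s \<in> {0..1}" "t \<in> {0..1}" "\<bar>t - s\<bar> * 2 ^ (q + 1) \<le> 1"
  shows "norm (g t - g s) \<le> 3 * w q"
proof -
  have gC: "g \<in> C0" using g by (simp add: limit_points_def)
  obtain r :: "nat \<Rightarrow> nat" where r: "strict_mono r" "(\<lambda>k. rho_inf (y (r k)) g) \<longlonglongrightarrow> 0"
    using g unfolding limit_points_def by blast
  have "(\<lambda>k. norm (y (r k) t - y (r k) s)) \<longlonglongrightarrow> norm (g t - g s)"
    by (intro tendsto_intros rho_inf_tendsto_pointwise[OF y_C0 gC r(2)] st)
  moreover have "\<forall>\<^sub>F k in sequentially. norm (y (r k) t - y (r k) s) \<le> 3 * w q"
    using eventually_compose_filterlim[OF y_osc[of q] filterlim_subseq[OF r(1)]]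
    by eventually_elim (use st in blast)
  ultimately show ?thesis by (rule tendsto_upperbound) simp
qed

text \<open>Each increment of f over a coarse cell is produced by coefficients b; adding the zigzag
  \<open>b + u, b - u\<close> on the two halves of the cell leaves the coarse increment unchanged and is used to
  raise the standard deviation of the functional to 1.\<close>

lemma coefficients_for_increments:
  assumes f: "f \<in> strassen_set A" and v: "0 < v \<bullet> (A *v v)" and m: "2 \<le> m"
  shows "\<exists>c. c 0 = 0 \<and> c 1 = 0 \<and> sdev A (2 * m) c = 1 \<and>
    (\<forall>k\<in>{1..<m}. A *v (c (2 * k) + c (2 * k + 1)) = (2 * real m) *\<^sub>R incr m k f)"
proof -
  have m0: "0 < m" "0 < real m" "0 < real m - 1" using m by auto
  let ?R = "matrix_sqrt A"
  obtain G :: "real^'n^'n" where "\<forall>x. (\<forall>z. A *v z = 0 \<longrightarrow> (G *v x) \<bullet> z = 0) \<and>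
           ((\<forall>z. A *v z = 0 \<longrightarrow> x \<bullet> z = 0) \<longrightarrow> ?R *v (G *v x) = x)"
    using psd_matrix_sqrt(3)[OF A_psd] by (rule exE)
  then have G1: "\<And>x z. A *v z = 0 \<Longrightarrow> (G *v x) \<bullet> z = 0"
    and G2: "\<And>x. (\<And>z. A *v z = 0 \<Longrightarrow> x \<bullet> z = 0) \<Longrightarrow> ?R *v (G *v x) = x" by auto
  have RR: "A *v x = ?R *v (?R *v x)" for x
    using psd_matrix_sqrt(2)[OF A_psd] by (metis matrix_vector_mul_assoc)
  have sym: "(A *v x) \<bullet> z = x \<bullet> (A *v z)" for x z using A_psd unfolding psd_def symmetric_matrix_iff by blast
  \<comment> \<open>Applying the pseudo-inverse of the root twice inverts \<open>A\<close> on the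
    increments of \<open>f\<close>, which are orthogonal to its kernel.\<close>
  define b where "b k = real m *\<^sub>R (G *v (G *v incr m k f))" for k
  have Ab: "A *v b k = real m *\<^sub>R incr m k f" if "k < m" for k
  proof -
    have "incr m k f \<bullet> z = 0" if "A *v z = 0" for z
      using strassen_set_kernel[OF f that grid_mem] \<open>k < m\<close> by (simp add: incr_def inner_diff_left)
    then have "?R *v (?R *v (G *v (G *v incr m k f))) = incr m k f" using G1 G2 by simp
    then show ?thesis by (simp add: b_def RR matrix_vector_mult_scaleR)
  qed
  define E where "E = (\<Sum>k<m. b k \<bullet> (A *v b k)) / real m"
  define E' where "E' = (\<Sum>k\<in>{1..<m}. b k \<bullet> (A *v b k)) / real m"
  have A0: "0 \<le> x \<bullet> (A *v x)" for x using A_psd by (simp add: psd_def)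
  have "E' \<le> E" unfolding E_def E'_def using A0 m0 by (intro divide_right_mono sum_mono2) auto
  \<comment> \<open>\<open>E\<close> is the value of the functional with coefficients
    \<open>b\<close> at \<open>f\<close> and at the same time its variance, whence
    \<open>E \<le> sqrt E\<close>.\<close>
  also have "E \<le> 1"
  proof -
    have "E = lin_fun m b f" using m0 by (simp add: E_def lin_fun_def Ab sum_distrib_left[symmetric])
    also have "\<dots> \<le> sdev A m b" using f m0 by (simp add: strassen_set_def)
    also have "\<dots> = sqrt E" by (simp add: sdev_def E_def)
    finally have le: "E \<le> sqrt E" .
    have "0 \<le> E" unfolding E_def using A0 by (simp add: sum_nonneg)
    show "E \<le> 1"
    proof (rule ccontr)
      assume "\<not> E \<le> 1"
      then have "1 < sqrt E" by simp
      then have "sqrt E * 1 < sqrt E * sqrt E" by (intro mult_strict_left_mono) auto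
      then show False using le \<open>0 \<le> E\<close> by simp
    qed
  qed
  finally have E': "E' \<le> 1" .
  \<comment> \<open>The amount \<open>1 - E'\<close> is what the cells \<open>1..<m\<close> leave of
    the unit variance; it is spread evenly over their \<open>m - 1\<close> pairs of halves. Division
    by \<open>m - 1\<close> is the reason for \<open>m \<ge> 2\<close>.\<close>
  define \<beta> where "\<beta> = sqrt ((1 - E') * real m / ((real m - 1) * (v \<bullet> (A *v v))))"
  define u where "u = \<beta> *\<^sub>R v"
  have "\<beta>\<^sup>2 = (1 - E') * real m / ((real m - 1) * (v \<bullet> (A *v v)))"
    unfolding \<beta>_def using E' m0 v by simp
  then have u: "u \<bullet> (A *v u) * (real m - 1) = (1 - E') * real m"
    using v m0 by (simp add: u_def matrix_vector_mult_scaleR power2_eq_square[symmetric] mult.assoc[symmetric])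
  \<comment> \<open>Cell 0 of the fine grid has to carry no coefficient; giving up the fine cells 0
    and 1 together keeps the remaining pairs intact.\<close>
  define c where "c i = (if i < 2 then 0 else if even i then b (i div 2) + u else b (i div 2) - u)" for i
  have c2: "c (2 * k) = b k + u" "c (2 * k + 1) = b k - u" if "1 \<le> k" for k
    using that by (auto simp: c_def)
  have c01: "c 0 = 0" "c 1 = 0" by (auto simp: c_def)
  have "sdev A (2 * m) c = 1"
  proof -
    have "(\<Sum>i<2 * m. c i \<bullet> (A *v c i)) = (\<Sum>k<m. c (2 * k) \<bullet> (A *v c (2 * k)) + c (2 * k + 1) \<bullet> (A *v c (2 * k + 1)))"
      by (rule sum_double)
    also have "\<dots> = (\<Sum>k\<in>{1..<m}. c (2 * k) \<bullet> (A *v c (2 * k)) + c (2 * k + 1) \<bullet> (A *v c (2 * k + 1)))"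
      by (rule sum.mono_neutral_right) (auto simp: c01[unfolded One_nat_def] not_le)
    also have "\<dots> = (\<Sum>k\<in>{1..<m}. 2 * (b k \<bullet> (A *v b k)) + 2 * (u \<bullet> (A *v u)))"
    proof (rule sum.cong)
      fix k assume "k \<in> {1..<m}"
      then have "1 \<le> k" by simp
      then show "c (2 * k) \<bullet> (A *v c (2 * k)) + c (2 * k + 1) \<bullet> (A *v c (2 * k + 1)) = 2 * (b k \<bullet> (A *v b k)) + 2 * (u \<bullet> (A *v u))"
        unfolding c2[OF \<open>1 \<le> k\<close>]
        by (simp add: matrix_vector_right_distrib matrix_vector_mult_diff_distrib inner_add_left inner_diff_left inner_add_right inner_diff_right)
    qed simp
    also have "\<dots> = 2 * (real m * E') + 2 * ((real m - 1) * (u \<bullet> (A *v u)))"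
      using m0 by (simp add: sum.distrib sum_distrib_left[symmetric] E'_def of_nat_diff)
    also have "\<dots> = 2 * real m" using u by (simp add: algebra_simps)
    finally show ?thesis using m0 by (simp add: sdev_def)
  qed
  moreover have "A *v (c (2 * k) + c (2 * k + 1)) = (2 * real m) *\<^sub>R incr m k f" if "k \<in> {1..<m}" for k
  proof -
    have k: "1 \<le> k" "k < m" using that by auto
    have "A *v (c (2 * k) + c (2 * k + 1)) = A *v b k + A *v b k" unfolding c2[OF k(1)]
      by (simp only: matrix_vector_right_distrib matrix_vector_mult_diff_distrib) simp
    then show ?thesis by (simp add: Ab[OF k(2)] scaleR_left_distrib[symmetric])
  qed
  ultimately show ?thesis using c01 by blast
qed

text \<open>A limit point \<open>g\<close> is found whose coarse increments nearly equal those of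
  \<open>f\<close>, except on the first cell, where both are small. Closeness at grid points extends
  to all times by the moduli of continuity of \<open>f\<close> and of limit points, and
  \<open>m\<close> is large enough for both. If the quadratic form of \<open>A\<close> vanishes
  there is no direction for a zigzag, but then all paths involved are zero on
  \<open>[0,1]\<close>.\<close>

lemma strassen_set_limit_point:
  assumes f: "f \<in> strassen_set A"
  shows "f \<in> limit_points y"
proof (rule limit_points_approx[OF y_C0])
  show fC: "f \<in> C0" using f by (simp add: strassen_set_def)
  have f0: "f 0 = 0" using fC by (simp add: C0_def)
  fix e :: real assume e: "0 < e"
  show "\<exists>g\<in>limit_points y. rho_inf g f < e"
  proof (cases "\<exists>v. 0 < v \<bullet> (A *v v)")
    case False
    have "A *v x = 0" for x
    proof -
      have "(norm (matrix_sqrt A *v x))\<^sup>2 = 0"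
        using False A_psd unfolding psd_sqrt_norm(2)[OF A_psd, symmetric] psd_def by (meson antisym_conv2 not_less order_le_less)
      then have "matrix_sqrt A *v x = 0" by simp
      moreover have "A *v x = matrix_sqrt A *v (matrix_sqrt A *v x)"
        using psd_matrix_sqrt(2)[OF A_psd] by (metis matrix_vector_mul_assoc)
      ultimately show ?thesis by simp
    qed
    then have z: "h t = 0" if "h \<in> strassen_set A" "t \<in> {0..1}" for h t
      using strassen_set_kernel[OF that(1) _ that(2), of "h t"] by simp
    obtain g where g: "g \<in> limit_points y"
      using rel_compact_limit_point[OF y_rel_compact, of "\<lambda>n. n"] by (auto simp: strict_mono_def)
    have "rho_inf g f \<le> 0"
      by (rule rho_inf_le) (use z[OF f] z[OF limit_point_in_strassen_set[OF g]] in simp)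
    then show ?thesis using g e by (intro bexI[of _ g]) auto
  next
    case True
    then obtain v where v: "0 < v \<bullet> (A *v v)" by blast
    \<comment> \<open>The final error is at most \<open>4 * \<eta>\<close>: twice
      \<open>\<eta>\<close> at grid points and once for the modulus of each of \<open>g\<close> and
      \<open>f\<close>.\<close>
    define \<eta> where "\<eta> = e / 10"
    have \<eta>0: "0 < \<eta>" using e by (simp add: \<eta>_def)
    have "uniformly_continuous_on {0..1} f"
      using fC by (intro compact_uniformly_continuous) (auto simp: C0_def)
    then obtain d where d: "0 < d" "\<And>s t. s \<in> {0..1} \<Longrightarrow> t \<in> {0..1} \<Longrightarrow> \<bar>s - t\<bar> < d \<Longrightarrow> norm (f s - f t) < \<eta>"
      using \<eta>0 unfolding uniformly_continuous_on_def dist_norm real_norm_def by meson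
    have "\<forall>\<^sub>F q in sequentially. w q < \<eta> / 3" by (rule order_tendstoD(2)[OF w_lim]) (use \<eta>0 in simp)
    then obtain q where q: "w q < \<eta> / 3" using eventually_happens'[OF sequentially_bot] by blast
    obtain m0 :: nat where m0: "1 / d < real m0" using reals_Archimedean2 by blast
    define m where "m = m0 + 2 ^ (q + 1) + 2"
    have m: "2 \<le> m" "0 < m" "0 < real m" by (simp_all add: m_def add_nonneg_pos)
    have "real m0 \<le> real m" by (simp add: m_def)
    then have "1 / d < real m" using m0 by linarith
    then have md: "1 / real m < d" using d(1) m by (simp add: field_simps)
    have "2 ^ (q + 1) \<le> real m" by (simp add: m_def)
    then have mq: "1 / real m * 2 ^ (q + 1) \<le> 1" using m by (simp add: divide_le_eq)
    obtain c where c: "c 0 = 0" "c 1 = 0" "sdev A (2 * m) c = 1"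
      "\<And>k. k \<in> {1..<m} \<Longrightarrow> A *v (c (2 * k) + c (2 * k + 1)) = (2 * real m) *\<^sub>R incr m k f"
      using coefficients_for_increments[OF f v m(1)] by blast
    \<comment> \<open>Two fine cells contribute \<open>2 * \<delta>\<close> to each coarse
      increment, which adds up to \<open>\<eta>\<close> over \<open>m\<close> coarse cells.\<close>
    define \<delta> where "\<delta> = \<eta> / (2 * real m)"
    have \<delta>0: "0 < \<delta>" using \<eta>0 m by (simp add: \<delta>_def)
    have "\<exists>g\<in>limit_points y. \<forall>i<2 * m. norm (incr (2 * m) i g - (1 / (real (2 * m) * sdev A (2 * m) c)) *\<^sub>R (A *v c i)) < \<delta>"
      by (rule limit_point_increments) (use m c \<delta>0 in auto)
    then obtain g where g: "g \<in> limit_points y" and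
      gi: "\<And>i. i < 2 * m \<Longrightarrow> norm (incr (2 * m) i g - (1 / real (2 * m)) *\<^sub>R (A *v c i)) < \<delta>"
      by (auto simp: c(3))
    have g0: "g 0 = 0" using g by (simp add: limit_points_def C0_def)
    have coarse: "norm (incr m k g - (1 / real (2 * m)) *\<^sub>R (A *v (c (2 * k) + c (2 * k + 1)))) \<le> 2 * \<delta>" if "k < m" for k
    proof -
      have "incr m k g - (1 / real (2 * m)) *\<^sub>R (A *v (c (2 * k) + c (2 * k + 1)))
        = (incr (2 * m) (2 * k) g - (1 / real (2 * m)) *\<^sub>R (A *v c (2 * k))) + (incr (2 * m) (2 * k + 1) g - (1 / real (2 * m)) *\<^sub>R (A *v c (2 * k + 1)))"
        unfolding incr_double[of m k] by (simp only: matrix_vector_right_distrib scaleR_right_distrib) simp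
      then show ?thesis using gi[of "2 * k"] gi[of "2 * k + 1"] that norm_triangle_lt[of "incr (2 * m) (2 * k) g - (1 / real (2 * m)) *\<^sub>R (A *v c (2 * k))" "incr (2 * m) (2 * k + 1) g - (1 / real (2 * m)) *\<^sub>R (A *v c (2 * k + 1))" "2 * \<delta>"]
        by auto
    qed
    have i0: "norm (incr m 0 g) \<le> 2 * \<delta>" using coarse[of 0] c m by simp
    have ik: "norm (incr m k g - incr m k f) \<le> 2 * \<delta>" if "k \<in> {1..<m}" for k
      using coarse[of k] c(4)[OF that] that m by simp
    have f1: "norm (incr m 0 f) < \<eta>"
    proof -
      have "grid m (Suc 0) \<in> {0..1}" "grid m 0 \<in> {0..1}" by (rule grid_mem; use m in simp)+
      then show ?thesis using d(2)[of "grid m (Suc 0)" "grid m 0"] md m grid_diff[OF m(2), of 0] by (simp add: incr_def)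
    qed
    have at_grid: "norm (g (grid m k) - f (grid m k)) \<le> 2 * \<eta>" if k: "k \<le> m" for k
    proof -
      have "g (grid m k) - f (grid m k) = (\<Sum>i<k. incr m i g - incr m i f)"
        unfolding incr_grid_sum[of g, OF g0] incr_grid_sum[of f, OF f0] by (simp add: sum_subtractf)
      also have "norm \<dots> \<le> (\<Sum>i<k. 2 * \<delta> + (if i = 0 then norm (incr m 0 f) else 0))"
      proof (rule sum_norm_le)
        fix i assume "i \<in> {..<k}"
        then have "i < m" using k by simp
        then show "norm (incr m i g - incr m i f) \<le> 2 * \<delta> + (if i = 0 then norm (incr m 0 f) else 0)"
          using ik[of i] i0 norm_triangle_ineq4[of "incr m 0 g" "incr m 0 f"] by (cases "i = 0") auto
      qed
      also have "\<dots> \<le> real k * (2 * \<delta>) + norm (incr m 0 f)" by (simp add: sum.distrib)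
      also have "\<dots> \<le> real m * (2 * \<delta>) + \<eta>" using k \<delta>0 f1 by (intro add_mono mult_right_mono) auto
      also have "\<dots> = 2 * \<eta>" using m by (simp add: \<delta>_def)
      finally show ?thesis .
    qed
    have "rho_inf g f \<le> 4 * \<eta>"
    proof (rule rho_inf_le)
      fix t :: real assume t: "t \<in> {0..1}"
      define k where "k = nat \<lfloor>real m * t\<rfloor>"
      have mt: "0 \<le> real m * t" "real m * t \<le> real m" using t m by (auto simp: mult_left_le)
      have k: "k \<le> m" unfolding k_def by (rule nat_floor_le[OF mt])
      have gm: "grid m k \<in> {0..1}" by (rule grid_mem[OF k])
      have "\<bar>real m * t - real k\<bar> \<le> 1" using nat_floor_bounds[OF mt(1)] unfolding k_def by linarith
      moreover have "t - grid m k = (real m * t - real k) / real m" using m(3) by (simp add: grid_def diff_divide_distrib)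
      ultimately have near: "\<bar>t - grid m k\<bar> \<le> 1 / real m" using m(3) by (simp add: abs_divide divide_right_mono)
      have "\<bar>t - grid m k\<bar> * 2 ^ (q + 1) \<le> 1 / real m * 2 ^ (q + 1)" by (rule mult_right_mono[OF near]) simp
      with mq have "\<bar>t - grid m k\<bar> * 2 ^ (q + 1) \<le> 1" by linarith
      then have 1: "norm (g t - g (grid m k)) \<le> \<eta>" using limit_point_modulus[OF g gm t] q by fastforce
      have 2: "norm (f t - f (grid m k)) < \<eta>" by (rule d(2)[OF t gm]) (use near md in linarith)
      have e: "g t - f t = (g t - g (grid m k)) + (g (grid m k) - f (grid m k)) - (f t - f (grid m k))" by simp
      show "norm (g t - f t) \<le> 4 * \<eta>"
        unfolding e using 1 2 at_grid[OF k] norm_triangle_ineq4[of "(g t - g (grid m k)) + (g (grid m k) - f (grid m k))" "f t - f (grid m k)"]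
          norm_triangle_ineq[of "g t - g (grid m k)" "g (grid m k) - f (grid m k)"] by linarith
    qed
    also have "\<dots> < e" using e by (simp add: \<eta>_def)
    finally show ?thesis using g by blast
  qed
qed

lemma limit_points_y: "limit_points y = strassen_set A"
  using strassen_set_limit_point limit_point_in_strassen_set by blast

end

section \<open>Removing the drift\<close>

lemma C0_add: "f \<in> C0 \<Longrightarrow> g \<in> C0 \<Longrightarrow> (\<lambda>t. f t + g t) \<in> C0"
  by (auto simp: C0_def intro!: continuous_intros)

lemma rho_inf_shift: "rho_inf (\<lambda>t. h t + f t) (\<lambda>t. h t + g t) = rho_inf f g"
  by (simp add: rho_inf_def)

lemma rho_inf_commute: "rho_inf f g = rho_inf g f"
  by (simp add: rho_inf_def norm_minus_commute)

lemma rho_inf_tendsto_trans: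
  assumes C: "\<And>k. f k \<in> C0" "\<And>k. g k \<in> C0" "h \<in> C0"
    and lim: "(\<lambda>k. rho_inf (f k) (g k)) \<longlonglongrightarrow> 0" "(\<lambda>k. rho_inf (g k) h) \<longlonglongrightarrow> 0"
  shows "(\<lambda>k. rho_inf (f k) h) \<longlonglongrightarrow> 0"
proof (rule tendsto_sandwich[OF _ _ tendsto_const])
  show "\<forall>\<^sub>F k in sequentially. 0 \<le> rho_inf (f k) h" using rho_inf_nonneg[OF C(1,3)] by simp
  show "\<forall>\<^sub>F k in sequentially. rho_inf (f k) h \<le> rho_inf (f k) (g k) + rho_inf (g k) h"
    using rho_inf_triangle[OF C] by simp
  show "(\<lambda>k. rho_inf (f k) (g k) + rho_inf (g k) h) \<longlonglongrightarrow> 0" using tendsto_add[OF lim] by simp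
qed

text \<open>Adding \<open>h\<close> is an isometry for \<open>rho_inf\<close>, and uniformly
  vanishing errors do not affect limits along subsequences.\<close>

lemma asymptotic_shift:
  fixes x y :: "nat \<Rightarrow> real \<Rightarrow> 'a::real_normed_vector"
  assumes x: "\<And>n. x n \<in> C0" and y: "\<And>n. y n \<in> C0" and h: "h \<in> C0"
    and lim: "(\<lambda>n. rho_inf (x n) (\<lambda>t. h t + y n t)) \<longlonglongrightarrow> 0"
  shows "rel_compact_seq y \<Longrightarrow> rel_compact_seq x"
    and "(\<lambda>t. h t + g t) \<in> limit_points x \<longleftrightarrow> g \<in> limit_points y"
proof -
  have sub: "(\<lambda>k. rho_inf (x (r k)) (\<lambda>t. h t + y (r k) t)) \<longlonglongrightarrow> 0" if "strict_mono r" for r :: "nat \<Rightarrow> nat"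
    using LIMSEQ_subseq_LIMSEQ[OF lim that] by (simp add: o_def)
  have to_x: "(\<lambda>k. rho_inf (x (r k)) (\<lambda>t. h t + g t)) \<longlonglongrightarrow> 0"
    if "strict_mono r" "g \<in> C0" "(\<lambda>k. rho_inf (y (r k)) g) \<longlonglongrightarrow> 0" for r :: "nat \<Rightarrow> nat" and g
    by (rule rho_inf_tendsto_trans[OF x _ _ sub[OF that(1)]]) (use that C0_add[OF h] y in \<open>auto simp: rho_inf_shift\<close>)
  have to_y: "(\<lambda>k. rho_inf (y (r k)) g) \<longlonglongrightarrow> 0"
    if "strict_mono r" "g \<in> C0" "(\<lambda>k. rho_inf (x (r k)) (\<lambda>t. h t + g t)) \<longlonglongrightarrow> 0" for r :: "nat \<Rightarrow> nat" and g
  proof -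
    have "(\<lambda>k. rho_inf (\<lambda>t. h t + y (r k) t) (\<lambda>t. h t + g t)) \<longlonglongrightarrow> 0"
      by (rule rho_inf_tendsto_trans[where g = "\<lambda>k. x (r k)"])
        (use sub[OF that(1)] that C0_add[OF h] x y in \<open>auto simp: rho_inf_commute[of "x _"]\<close>)
    then show ?thesis by (simp only: rho_inf_shift)
  qed
  show "rel_compact_seq x" if rc: "rel_compact_seq y"
    unfolding rel_compact_seq_def
  proof (intro allI impI)
    fix r :: "nat \<Rightarrow> nat" assume r: "strict_mono r"
    obtain s g where s: "strict_mono (s :: nat \<Rightarrow> nat)" "g \<in> C0" "(\<lambda>k. rho_inf (y (r (s k))) g) \<longlonglongrightarrow> 0"
      using rc r unfolding rel_compact_seq_def by blast
    have "strict_mono (\<lambda>k. r (s k))" using r s(1) by (simp add: strict_mono_def)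
    then have "(\<lambda>k. rho_inf (x (r (s k))) (\<lambda>t. h t + g t)) \<longlonglongrightarrow> 0" using to_x[of "\<lambda>k. r (s k)" g] s by simp
    then show "\<exists>s g. strict_mono (s :: nat \<Rightarrow> nat) \<and> g \<in> C0 \<and> (\<lambda>k. rho_inf (x (r (s k))) g) \<longlonglongrightarrow> 0"
      using s(1) C0_add[OF h s(2)] by blast
  qed
  have "g \<in> C0" if "(\<lambda>t. h t + g t) \<in> C0"
  proof -
    have "continuous_on {0..1} (\<lambda>t. (h t + g t) - h t)"
      using that h by (intro continuous_on_diff) (auto simp: C0_def)
    then show ?thesis using that h by (simp add: C0_def)
  qed
  then show "(\<lambda>t. h t + g t) \<in> limit_points x \<longleftrightarrow> g \<in> limit_points y"
    using to_x to_y C0_add[OF h] unfolding limit_points_def by blast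
qed

lemma ell_over_n_tendsto: "(\<lambda>n. ell n / real n) \<longlonglongrightarrow> 0"
proof (rule tendsto_sandwich[OF _ _ tendsto_const])
  show "\<forall>\<^sub>F n in sequentially. 0 \<le> ell n / real n"
    using LL_eventually by eventually_elim (simp add: aa_nonneg)
  show "\<forall>\<^sub>F n in sequentially. ell n / real n \<le> sqrt (2 * (1 / real n + ln (real n) / real n))"
    using LL_eventually eventually_gt_at_top[of 1]
  proof eventually_elim
    case (elim n)
    have n: "1 < real n" using elim(2) by simp
    have "LL n \<le> 1 + ln (real n)"
    proof -
      have "0 < ln (real n)" using n by simp
      moreover have "ln (ln (real n)) \<le> ln (real n) - 1" using ln_le_minus_one[OF calculation] .
      ultimately show ?thesis by (simp add: LL_def)
    qed
    then have "2 * (real n * LL n) / (real n)\<^sup>2 \<le> 2 * (real n * (1 + ln (real n))) / (real n)\<^sup>2"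
      using n by (intro divide_right_mono mult_left_mono) auto
    also have "\<dots> = 2 * (1 / real n + ln (real n) / real n)" using n by (simp add: power2_eq_square add_divide_distrib)
    finally have le: "2 * (real n * LL n) / (real n)\<^sup>2 \<le> 2 * (1 / real n + ln (real n) / real n)" .
    have "ell n / real n = sqrt (2 * (real n * LL n)) / sqrt ((real n)\<^sup>2)"
      using elim(1) by (simp add: aa_def real_sqrt_mult)
    also have "\<dots> = sqrt (2 * (real n * LL n) / (real n)\<^sup>2)" by (simp only: real_sqrt_divide)
    finally show ?case using le by simp
  qed
  have "(\<lambda>n. sqrt (2 * (1 / real n + ln (real n) / real n))) \<longlonglongrightarrow> sqrt (2 * (0 + 0))"
    by (intro tendsto_intros lim_1_over_n lim_ln_over_n)
  then show "(\<lambda>n. sqrt (2 * (1 / real n + ln (real n) / real n))) \<longlonglongrightarrow> 0" by simp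
qed

lemma pol_add: "pol (\<lambda>k. f k + g k) x = pol f x + pol g x"
  by (simp add: pol_def algebra_simps)

lemma pol_linear:
  assumes "linear L" shows "pol (\<lambda>k. L (S k)) x = L (pol S x)"
  using assms by (simp add: pol_def linear_add linear_diff linear_scale)

lemma pol_drift: "0 \<le> x \<Longrightarrow> pol (\<lambda>k. real k *\<^sub>R v) x = x *\<^sub>R v"
  by (simp add: pol_def algebra_simps)

lemma Ypoly_eq_pol: "Ypoly Z n \<omega> t = pol (\<lambda>k. \<Sum>i\<in>{1..k}. Z i \<omega>) (real n * t)"
  by (simp add: Ypoly_def pol_def)

text \<open>Two steps of length at most \<open>1/2\<close> from the value 0 at time 0, each
  controlled by the modulus for \<open>q = 0\<close>.\<close>

lemma (in strassen_walk) y_bound: "\<forall>\<^sub>F n in sequentially. \<forall>t\<in>{0..1}. norm (y n t) \<le> 6 * w 0"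
  using y_osc[of 0]
proof eventually_elim
  case (elim n)
  have y0: "y n 0 = 0" using y_C0[of n] by (simp add: C0_def)
  have half: "norm (y n t) \<le> 3 * w 0" if "t \<in> {0..1/2}" for t
    using elim[rule_format, of 0 t] that y0 by simp
  show ?case
  proof
    fix t :: real assume t: "t \<in> {0..1}"
    show "norm (y n t) \<le> 6 * w 0"
    proof (cases "t \<le> 1/2")
      case True then show ?thesis using half[of t] t w_nonneg[of 0] by simp
    next
      case False
      then have "norm (y n t - y n (1/2)) \<le> 3 * w 0" using elim[rule_format, of "1/2" t] t by simp
      moreover have "norm (y n (1/2)) \<le> 3 * w 0" by (rule half) simp
      ultimately show ?thesis using norm_triangle_sub[of "y n t" "y n (1/2)"] by linarith
    qed
  qed
qed

text \<open>The coordinate \<open>i0\<close> is kept and set to zero, in accordance with the way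
  \<open>U\<close> and \<open>Sigma_perp\<close> realise the orthogonal complement.\<close>

definition orth_part :: "('d::finite \<Rightarrow> real^'d) \<Rightarrow> 'd \<Rightarrow> real^'d \<Rightarrow> real^'d" where
  "orth_part e i0 x = (\<chi> j. if j = i0 then 0 else x \<bullet> e j)"

lemma orth_part_linear: "bounded_linear (orth_part e i0)"
proof -
  have "linear (orth_part e i0)"
    by (rule linearI) (auto simp: orth_part_def vec_eq_iff inner_add_left)
  then show ?thesis by (simp add: linear_conv_bounded_linear)
qed

definition drift_line :: "'d::finite \<Rightarrow> real^'d \<Rightarrow> real \<Rightarrow> real^'d" where
  "drift_line i0 \<mu> t = (\<chi> i. if i = i0 then norm \<mu> * t else 0)"

lemma drift_line_C0: "drift_line i0 \<mu> \<in> C0"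
proof -
  have "continuous_on {0..1} (\<lambda>t. \<chi> i. if i = i0 then norm \<mu> * t else 0)"
  proof (rule continuous_on_vec_lambda)
    show "continuous_on {0..1} (\<lambda>t. if i = i0 then norm \<mu> * t else 0)" for i
      by (cases "i = i0") (auto intro!: continuous_intros)
  qed
  then show ?thesis by (simp add: C0_def drift_line_def[abs_def] vec_eq_iff)
qed

text \<open>Two walks are used at once. Of the full centred walk one only needs that it is of order
  \<open>ell n\<close>, so that its component along \<open>\<mu>\<close> vanishes after division by
  \<open>n\<close>. The projected walk carries the fluctuations and has no drift, since
  \<open>\<mu>\<close> is a multiple of \<open>e i0\<close>.\<close>

lemma psi_Ypoly_limit_points:
  fixes Z :: "nat \<Rightarrow> 'a \<Rightarrow> real^'d" and e :: "'d \<Rightarrow> real^'d"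
  assumes onb: "\<forall>i j. e i \<bullet> e j = (if i = j then 1 else 0)" and e1: "e i0 = (1 / norm \<mu>) *\<^sub>R \<mu>" and \<mu>: "\<mu> \<noteq> 0"
    and N: "strassen_walk (\<lambda>n. \<Sum>i=1..n. Z i \<omega> - \<mu>) \<Sigma> wN D"
    and V: "strassen_walk (\<lambda>n. \<Sum>i=1..n. orth_part e i0 (Z i \<omega> - \<mu>)) A wV D"
  defines "x \<equiv> \<lambda>n t. psi e i0 n (Ypoly Z n \<omega> t)"
  shows "x n \<in> C0" and "rel_compact_seq x"
    and "(\<lambda>t. drift_line i0 \<mu> t + g t) \<in> limit_points x \<longleftrightarrow> g \<in> strassen_set A"
proof -
  interpret N: strassen_walk "\<lambda>n. \<Sum>i=1..n. Z i \<omega> - \<mu>" \<Sigma> wN D by (rule N)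
  interpret V: strassen_walk "\<lambda>n. \<Sum>i=1..n. orth_part e i0 (Z i \<omega> - \<mu>)" A wV D by (rule V)
  have lin: "linear (orth_part e i0)" using orth_part_linear[of e i0] by (simp add: linear_conv_bounded_linear)
  define P where "P = pol (\<lambda>n. \<Sum>i=1..n. Z i \<omega> - \<mu>)"
  have mu: "\<mu> = norm \<mu> *\<^sub>R e i0" using \<mu> by (simp add: e1)
  have muj: "\<mu> \<bullet> e j = (if j = i0 then norm \<mu> else 0)" for j
    using onb by (subst mu) (simp add: inner_commute)
  have Y: "Ypoly Z n \<omega> t = P (real n * t) + (real n * t) *\<^sub>R \<mu>" if "0 \<le> t" for n t
  proof -
    have "(\<Sum>i\<in>{1..k}. Z i \<omega>) = (\<Sum>i=1..k. Z i \<omega> - \<mu>) + real k *\<^sub>R \<mu>" for k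
      by (simp add: sum_subtractf scaleR_conv_of_real sum_constant_scaleR)
    then show ?thesis using that unfolding Ypoly_eq_pol P_def by (simp add: pol_add pol_drift)
  qed
  define yV where "yV = V.y"
  define yN where "yN = N.y"
  have yV: "yV n t = (1 / ell n) *\<^sub>R orth_part e i0 (P (real n * t))" for n t
    unfolding yV_def V.y_def P_def pol_linear[OF lin, symmetric] by (simp only: linear_sum[OF lin])
  have yN: "yN n t = (1 / ell n) *\<^sub>R P (real n * t)" for n t
    unfolding yN_def N.y_def P_def ..
  have xC0: "x n \<in> C0" for n
  proof -
    have "continuous_on {0..1} (\<lambda>t. psi e i0 n (Ypoly Z n \<omega> t))"
      unfolding psi_def Ypoly_eq_pol divide_inverse
    proof (rule continuous_on_vec_lambda)
      fix i
      show "continuous_on {0..1} (\<lambda>t. if i = i0 then pol (\<lambda>k. \<Sum>i = 1..k. Z i \<omega>) (real n * t) \<bullet> e i * inverse (real n)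
          else pol (\<lambda>k. \<Sum>i = 1..k. Z i \<omega>) (real n * t) \<bullet> e i * inverse (ell n))"
        by (cases "i = i0") (auto intro!: continuous_intros pol_scaled_continuous)
    qed
    moreover have "psi e i0 n (Ypoly Z n \<omega> 0) = 0" by (simp add: psi_def Ypoly_def vec_eq_iff)
    ultimately show ?thesis by (simp add: C0_def x_def)
  qed
  then show "x n \<in> C0" .
  have lim: "(\<lambda>n. rho_inf (x n) (\<lambda>t. drift_line i0 \<mu> t + yV n t)) \<longlonglongrightarrow> 0"
  proof (rule tendsto_sandwich[OF _ _ tendsto_const])
    show "\<forall>\<^sub>F n in sequentially. 0 \<le> rho_inf (x n) (\<lambda>t. drift_line i0 \<mu> t + yV n t)"
      using rho_inf_nonneg[OF xC0 C0_add[OF drift_line_C0 V.y_C0]] by (simp only: yV_def[symmetric]) simp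
    have "(\<lambda>n. 6 * wN 0 * (ell n / real n)) \<longlonglongrightarrow> 6 * wN 0 * 0" by (intro tendsto_intros ell_over_n_tendsto)
    then show "(\<lambda>n. 6 * wN 0 * (ell n / real n)) \<longlonglongrightarrow> 0" by simp
    show "\<forall>\<^sub>F n in sequentially. rho_inf (x n) (\<lambda>t. drift_line i0 \<mu> t + yV n t) \<le> 6 * wN 0 * (ell n / real n)"
      using N.y_bound[folded yN_def] LL_eventually eventually_gt_at_top[of 0]
    proof eventually_elim
      case (elim n)
      have l: "0 < ell n" using elim(2) aa_pos[OF elim(3)] by simp
      have n: "0 < real n" using elim(3) by simp
      show ?case
      proof (rule rho_inf_le)
        fix t :: real assume t: "t \<in> {0..1}"
        \<comment> \<open>The two paths differ in the coordinate \<open>i0\<close> only: there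
          \<open>psi\<close> divides by \<open>n\<close> and \<open>yV\<close> is zero.\<close>
        have "x n t - (drift_line i0 \<mu> t + yV n t) = axis i0 (P (real n * t) \<bullet> e i0 / real n)"
          using t n l unfolding x_def psi_def yV drift_line_def orth_part_def
          by (auto simp: Y vec_eq_iff axis_def inner_add_left muj add_divide_distrib)
        then have "norm (x n t - (drift_line i0 \<mu> t + yV n t)) = \<bar>P (real n * t) \<bullet> e i0\<bar> / real n"
          using n by (simp add: norm_eq_sqrt_inner inner_axis_axis real_sqrt_divide)
        also have "\<dots> \<le> norm (P (real n * t)) / real n"
        proof -
          have "norm (e i0) = 1" using onb by (simp add: norm_eq_sqrt_inner)
          then show ?thesis using Cauchy_Schwarz_ineq2[of "P (real n * t)" "e i0"] n by (intro divide_right_mono) auto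
        qed
        also have "P (real n * t) = ell n *\<^sub>R yN n t" using l by (simp add: yN)
        also have "norm (ell n *\<^sub>R yN n t) / real n \<le> (ell n * (6 * wN 0)) / real n"
          using elim(1) t l n by (intro divide_right_mono) auto
        finally show "norm (x n t - (drift_line i0 \<mu> t + yV n t)) \<le> 6 * wN 0 * (ell n / real n)" by (simp add: mult.commute)
      qed
    qed
  qed
  show "rel_compact_seq x" by (rule asymptotic_shift(1)[OF xC0 V.y_C0 drift_line_C0 lim[unfolded yV_def] V.y_rel_compact])
  show "(\<lambda>t. drift_line i0 \<mu> t + g t) \<in> limit_points x \<longleftrightarrow> g \<in> strassen_set A"
    using asymptotic_shift(2)[OF xC0 V.y_C0 drift_line_C0 lim[unfolded yV_def]] V.limit_points_y by blast
qed

section \<open>Almost sure properties of the centred and the projected walk\<close>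

context iid_walk
begin

text \<open>The parameters \<open>m\<close>, \<open>c\<close>, \<open>q\<close> and \<open>p\<close>
  range over countable sets, so all exceptional null sets can be united into one.\<close>

lemma AE_strassen_walk:
  assumes D: "countable D" "0 \<in> D" and dense: "\<And>(x::real^'n) (e::real). 0 < e \<Longrightarrow> \<exists>d\<in>D. norm (d - x) < e"
  shows "AE \<omega> in M. strassen_walk (\<lambda>n. \<Sum>i=1..n. X i \<omega>) A osc_const D"
proof -
  have s0: "0 < sdev A m c + (1/2) ^ q" for m c q
    using sdev_nonneg[OF A_psd, of m c] by (simp add: add_nonneg_pos)
  have up: "AE \<omega> in M. \<forall>m\<in>{0<..}. \<forall>c\<in>coeffs_in D m. \<forall>q. \<forall>\<^sub>F j in sequentially.
     (\<Sum>k<m. c k \<bullet> (walk ((k + 1) * nat \<lceil>(1 + (1/2) ^ (q + 2) :: real) ^ j\<rceil>) \<omega> - walk (k * nat \<lceil>(1 + (1/2) ^ (q + 2) :: real) ^ j\<rceil>) \<omega>))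
       \<le> (1 + 2 * (1/2) ^ q) * (sdev A m c + (1/2) ^ q) * (sqrt 2 * aa (m * nat \<lceil>(1 + (1/2) ^ (q + 2) :: real) ^ j\<rceil>))"
    by (intro AE_ball_countable' AE_all_countable[THEN iffD2] allI countableI_type countable_coeffs_in[OF D(1)] upper_subsequence s0) auto
  have lo: "AE \<omega> in M. \<forall>m\<in>{2..}. \<forall>c\<in>{c \<in> coeffs_in D m. c 0 = 0 \<and> 0 < sdev A m c}. \<forall>p. \<exists>\<^sub>F j in sequentially.
     (1 - 1 / real (p + 2)) * sdev A m c * (sqrt 2 * aa (m * m ^ j))
      \<le> (\<Sum>k<m. c k \<bullet> (walk ((k + 1) * m ^ j) \<omega> - walk (k * m ^ j) \<omega>))"
    by (intro AE_ball_countable' AE_all_countable[THEN iffD2] allI countableI_type lower_subsequence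
        countable_subset[OF _ countable_coeffs_in[OF D(1)]]) auto
  from oscillation up lo show ?thesis
  proof eventually_elim
    case (elim \<omega>)
    show ?case
      unfolding walk_def[symmetric]
    proof
      show "walk 0 \<omega> = 0" by (simp add: walk_def)
      show "psd A" by (rule A_psd)
      show "0 \<le> osc_const q" for q using trace_bound_ge by (simp add: osc_const_def)
      show "osc_const \<longlonglongrightarrow> 0" by (rule osc_const_tendsto)
      show "0 \<in> D" by (rule D(2))
      show "\<exists>d\<in>D. norm (d - x) < e" if "0 < e" for x e by (rule dense[OF that])
    qed (use elim in auto)
  qed
qed

lemma linear_image:
  fixes L :: "real^'n \<Rightarrow> real^'n"
  assumes L: "bounded_linear L"
  shows "iid_walk M (\<lambda>i \<omega>. L (X i \<omega>)) (\<chi> i j. expectation (\<lambda>\<omega>. L (X 1 \<omega>) $ i * L (X 1 \<omega>) $ j))"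
proof -
  interpret L: bounded_linear L by (rule L)
  have Lm[measurable]: "L \<in> borel_measurable borel"
    by (intro borel_measurable_continuous_onI linear_continuous_on L)
  show ?thesis
  proof
    show "indep_vars (\<lambda>_. borel) (\<lambda>i \<omega>. L (X i \<omega>)) {1..}"
      by (rule indep_vars_compose2[OF indep]) simp
    show "distr M borel (\<lambda>\<omega>. L (X i \<omega>)) = distr M borel (\<lambda>\<omega>. L (X 1 \<omega>))" if "1 \<le> i" for i
    proof -
      have "distr M borel (\<lambda>\<omega>. L (X i \<omega>)) = distr (distr M borel (X i)) borel L" if "1 \<le> i" for i
        using X_measurable[OF that] by (subst distr_distr) (auto simp: o_def)
      then show ?thesis using ident[OF that] that by simp
    qed
    obtain K where K: "\<And>x. norm (L x) \<le> norm x * K" using L.bounded by blast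
    show "integrable M (\<lambda>\<omega>. (norm (L (X 1 \<omega>)))\<^sup>2)"
    proof (rule Bochner_Integration.integrable_bound)
      show "integrable M (\<lambda>\<omega>. K\<^sup>2 * (norm (X 1 \<omega>))\<^sup>2)" using sq_int by simp
      have "(norm (L x))\<^sup>2 \<le> K\<^sup>2 * (norm x)\<^sup>2" for x
        using power_mono[OF K[of x], of 2] by (simp add: power_mult_distrib mult.commute)
      then show "AE \<omega> in M. norm ((norm (L (X 1 \<omega>)))\<^sup>2) \<le> norm (K\<^sup>2 * (norm (X 1 \<omega>))\<^sup>2)" by (intro AE_I2) simp
    qed simp
    show "expectation (\<lambda>\<omega>. L (X 1 \<omega>)) = 0"
      using integral_bounded_linear[OF L X1_int] mean by (simp add: L.zero)
  qed simp
qed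

lemma orth_part_walk: "iid_walk M (\<lambda>i \<omega>. orth_part e i0 (X i \<omega>)) (Sigma_perp e i0 A)"
proof -
  have "(\<chi> i j. expectation (\<lambda>\<omega>. orth_part e i0 (X 1 \<omega>) $ i * orth_part e i0 (X 1 \<omega>) $ j)) = Sigma_perp e i0 A"
    using inner_prod_expectation by (auto simp: vec_eq_iff Sigma_perp_def orth_part_def)
  with linear_image[OF orth_part_linear[of e i0]] show ?thesis by simp
qed

end

lemma (in prob_space) iid_walk_centered:
  fixes Z :: "nat \<Rightarrow> 'a \<Rightarrow> real^'n"
  assumes indep: "indep_vars (\<lambda>_. borel) Z {1..}"
    and ident: "\<forall>i\<ge>1. distr M borel (Z i) = distr M borel (Z 1)"
    and sq: "integrable M (\<lambda>\<omega>. (norm (Z 1 \<omega>))\<^sup>2)"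
    and \<mu>: "\<mu> = expectation (Z 1)"
    and \<Sigma>: "\<Sigma> = (\<chi> i j. expectation (\<lambda>\<omega>. (Z 1 \<omega> - \<mu>) $ i * (Z 1 \<omega> - \<mu>) $ j))"
  shows "iid_walk M (\<lambda>i \<omega>. Z i \<omega> - \<mu>) \<Sigma>"
proof
  have Zm[measurable]: "Z i \<in> borel_measurable M" if "1 \<le> i" for i
    using indep that unfolding indep_vars_def by auto
  have Z1[measurable]: "Z (Suc 0) \<in> borel_measurable M" using Zm[of 1] by simp
  show "indep_vars (\<lambda>_. borel) (\<lambda>i \<omega>. Z i \<omega> - \<mu>) {1..}"
    by (rule indep_vars_compose2[OF indep, where Y = "\<lambda>_ z. z - \<mu>"]) simp
  show "distr M borel (\<lambda>\<omega>. Z i \<omega> - \<mu>) = distr M borel (\<lambda>\<omega>. Z 1 \<omega> - \<mu>)" if "1 \<le> i" for i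
  proof -
    have "distr M borel (\<lambda>\<omega>. Z i \<omega> - \<mu>) = distr (distr M borel (Z i)) borel (\<lambda>z. z - \<mu>)" if "1 \<le> i" for i
      using Zm[OF that] by (subst distr_distr) (auto simp: o_def)
    then show ?thesis using ident[rule_format, OF that] that by simp
  qed
  have int: "integrable M (Z 1)"
  proof -
    have "norm z \<le> 1 + (norm z)\<^sup>2" for z :: "real^'n"
      using zero_le_power2[of "norm z - 1/2"] by (simp add: power2_eq_square algebra_simps)
    then have ae: "AE \<omega> in M. norm (Z 1 \<omega>) \<le> norm (1 + (norm (Z 1 \<omega>))\<^sup>2)" by (intro AE_I2) simp
    have "integrable M (\<lambda>\<omega>. 1 + (norm (Z 1 \<omega>))\<^sup>2)" using sq by simp
    from Bochner_Integration.integrable_bound[OF this _ ae] show ?thesis by simp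
  qed
  show "expectation (\<lambda>\<omega>. Z 1 \<omega> - \<mu>) = 0"
    using int by (simp add: \<mu> prob_space)
  show "integrable M (\<lambda>\<omega>. (norm (Z 1 \<omega> - \<mu>))\<^sup>2)"
  proof (rule Bochner_Integration.integrable_bound)
    show "integrable M (\<lambda>\<omega>. 2 * (norm (Z 1 \<omega>))\<^sup>2 + 2 * (norm \<mu>)\<^sup>2)" using sq by simp
    have "(norm (z - \<mu>))\<^sup>2 \<le> 2 * (norm z)\<^sup>2 + 2 * (norm \<mu>)\<^sup>2" for z
    proof -
      have "(norm (z - \<mu>))\<^sup>2 \<le> (norm z + norm \<mu>)\<^sup>2" by (intro power_mono norm_triangle_ineq4) simp
      also have "\<dots> \<le> 2 * (norm z)\<^sup>2 + 2 * (norm \<mu>)\<^sup>2"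
        using zero_le_power2[of "norm z - norm \<mu>"] by (simp add: power2_eq_square algebra_simps)
      finally show ?thesis .
    qed
    then show "AE \<omega> in M. norm ((norm (Z 1 \<omega> - \<mu>))\<^sup>2) \<le> norm (2 * (norm (Z 1 \<omega>))\<^sup>2 + 2 * (norm \<mu>)\<^sup>2)"
      by (intro AE_I2) simp
  qed simp
qed (rule \<Sigma>)

section \<open>Continuous functionals and the identification of the limit set\<close>

text \<open>A subsequence realising the limsup has a further subsequence converging to a limit
  point, so the limsup is a value of \<open>F\<close> there; conversely every limit point is
  approached along a subsequence.\<close>

lemma limsup_eq_SUP_limit_points:
  fixes F :: "(real \<Rightarrow> 'a::real_normed_vector) \<Rightarrow> real"
  assumes x: "\<And>n. x n \<in> C0" and rc: "rel_compact_seq x"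
    and F: "\<forall>f\<in>C0. \<forall>\<epsilon>>0. \<exists>\<delta>>0. \<forall>g\<in>C0. rho_inf f g < \<delta> \<longrightarrow> \<bar>F g - F f\<bar> < \<epsilon>"
  shows "limsup (\<lambda>n. ereal (F (x n))) = (SUP h\<in>limit_points x. ereal (F h))"
proof -
  have conv: "(\<lambda>k. ereal (F (x (r k)))) \<longlonglongrightarrow> ereal (F h)"
    if h: "h \<in> C0" and lim: "(\<lambda>k. rho_inf (x (r k)) h) \<longlonglongrightarrow> 0" for r :: "nat \<Rightarrow> nat" and h
  proof -
    have "(\<lambda>k. F (x (r k))) \<longlonglongrightarrow> F h"
    proof (rule tendstoI)
      fix \<epsilon> :: real assume "0 < \<epsilon>"
      then obtain \<delta> where \<delta>: "0 < \<delta>" "\<And>g. g \<in> C0 \<Longrightarrow> rho_inf h g < \<delta> \<Longrightarrow> \<bar>F g - F h\<bar> < \<epsilon>"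
        using F h by blast
      have "\<forall>\<^sub>F k in sequentially. rho_inf (x (r k)) h < \<delta>" by (rule order_tendstoD(2)[OF lim \<delta>(1)])
      then show "\<forall>\<^sub>F k in sequentially. dist (F (x (r k))) (F h) < \<epsilon>"
        by eventually_elim (use \<delta>(2) x in \<open>auto simp: rho_inf_commute[of h] dist_real_def\<close>)
    qed
    then show ?thesis by simp
  qed
  show ?thesis
  proof (rule antisym)
    obtain r :: "nat \<Rightarrow> nat" where r: "strict_mono r" "((\<lambda>n. ereal (F (x n))) \<circ> r) \<longlonglongrightarrow> limsup (\<lambda>n. ereal (F (x n)))"
      using limsup_subseq_lim by blast
    obtain s h where s: "strict_mono (s :: nat \<Rightarrow> nat)" "h \<in> limit_points x" "(\<lambda>k. rho_inf (x (r (s k))) h) \<longlonglongrightarrow> 0"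
      using rel_compact_limit_point[OF rc r(1)] by blast
    have "(\<lambda>k. ereal (F (x (r (s k))))) \<longlonglongrightarrow> ereal (F h)"
      by (rule conv[of h "\<lambda>k. r (s k)"]) (use s in \<open>auto simp: limit_points_def\<close>)
    moreover have "(\<lambda>k. ereal (F (x (r (s k))))) \<longlonglongrightarrow> limsup (\<lambda>n. ereal (F (x n)))"
      using LIMSEQ_subseq_LIMSEQ[OF r(2) s(1)] by (simp add: o_def)
    ultimately have "limsup (\<lambda>n. ereal (F (x n))) = ereal (F h)" by (rule LIMSEQ_unique[symmetric])
    also have "\<dots> \<le> (SUP h\<in>limit_points x. ereal (F h))" by (rule SUP_upper[OF s(2)])
    finally show "limsup (\<lambda>n. ereal (F (x n))) \<le> (SUP h\<in>limit_points x. ereal (F h))" .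
    show "(SUP h\<in>limit_points x. ereal (F h)) \<le> limsup (\<lambda>n. ereal (F (x n)))"
    proof (rule SUP_least)
      fix h assume "h \<in> limit_points x"
      then obtain r :: "nat \<Rightarrow> nat" where r: "h \<in> C0" "strict_mono r" "(\<lambda>k. rho_inf (x (r k)) h) \<longlonglongrightarrow> 0"
        unfolding limit_points_def by blast
      have "limsup ((\<lambda>n. ereal (F (x n))) \<circ> r) = ereal (F h)"
        by (rule lim_imp_Limsup) (use conv[OF r(1,3)] in \<open>auto simp: o_def\<close>)
      then show "ereal (F h) \<le> limsup (\<lambda>n. ereal (F (x n)))"
        using limsup_subseq_mono[OF r(2), of "\<lambda>n. ereal (F (x n))"] by simp
    qed
  qed
qed

text \<open>Paths are functions on the whole line, and \<open>rho_inf\<close> does not separate two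
  that agree on \<open>[0,1]\<close>; a continuous \<open>F\<close> cannot separate them
  either.\<close>

lemma continuous_functional_restrict:
  assumes F: "\<forall>f\<in>C0. \<forall>\<epsilon>>0. \<exists>\<delta>>0. \<forall>g\<in>C0. rho_inf f g < \<delta> \<longrightarrow> \<bar>F g - F f\<bar> < (\<epsilon>::real)"
    and C: "f \<in> C0" "g \<in> C0" and eq: "restrict f {0..1} = restrict g {0..1}"
  shows "F f = F g"
proof -
  have e: "f t = g t" if "t \<in> {0..1}" for t using fun_cong[OF eq, of t] that by simp
  have 0: "rho_inf f g \<le> 0" by (rule rho_inf_le) (use e in simp)
  have "\<bar>F g - F f\<bar> < \<epsilon>" if \<epsilon>: "0 < \<epsilon>" for \<epsilon>
  proof -
    obtain \<delta> where "0 < \<delta>" "\<And>g. g \<in> C0 \<Longrightarrow> rho_inf f g < \<delta> \<Longrightarrow> \<bar>F g - F f\<bar> < \<epsilon>" using F C(1) \<epsilon> by meson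
    then show ?thesis using 0 C(2) by simp
  qed
  from this[of "\<bar>F g - F f\<bar>"] show ?thesis by force
qed

lemma Sigma_perp_axis: "Sigma_perp e i0 \<Sigma> *v axis i0 1 = 0"
  by (simp add: matrix_vector_mul_component vec_eq_iff inner_axis Sigma_perp_def)

text \<open>Equality holds after restriction: limit points are arbitrary off \<open>[0,1]\<close>,
  while elements of \<open>W\<close> have their prescribed form there as well. The preimage of a
  limit point lies in \<open>U i0\<close> because the axis \<open>i0\<close> belongs to the kernel
  of \<open>Sigma_perp\<close>.\<close>

lemma restrict_limit_points_eq_W:
  fixes x :: "nat \<Rightarrow> real \<Rightarrow> real^'d"
  assumes A: "psd (Sigma_perp e i0 \<Sigma>)"
    and lp: "\<And>g. (\<lambda>t. drift_line i0 \<mu> t + g t) \<in> limit_points x \<longleftrightarrow> g \<in> strassen_set (Sigma_perp e i0 \<Sigma>)"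
  shows "W e i0 \<mu> \<Sigma> \<subseteq> limit_points x"
    and "(\<lambda>f. restrict f {0..1}) ` limit_points x = (\<lambda>f. restrict f {0..1}) ` W e i0 \<mu> \<Sigma>"
proof -
  let ?A = "Sigma_perp e i0 \<Sigma>"
  have W_eq: "W e i0 \<mu> \<Sigma> = {(\<lambda>t. drift_line i0 \<mu> t + matrix_sqrt ?A *v f t) | f. f \<in> U i0}"
    by (simp add: W_def drift_line_def)
  show sub: "W e i0 \<mu> \<Sigma> \<subseteq> limit_points x"
    unfolding W_eq
  proof safe
    fix f assume "f \<in> U i0"
    from sqrt_image_in_strassen_set[OF A this]
    show "(\<lambda>t. drift_line i0 \<mu> t + matrix_sqrt ?A *v f t) \<in> limit_points x" by (simp only: lp)
  qed
  show "(\<lambda>f. restrict f {0..1}) ` limit_points x = (\<lambda>f. restrict f {0..1}) ` W e i0 \<mu> \<Sigma>"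
  proof (rule antisym)
    show "(\<lambda>f. restrict f {0..1}) ` W e i0 \<mu> \<Sigma> \<subseteq> (\<lambda>f. restrict f {0..1}) ` limit_points x"
      using sub by (rule image_mono)
    show "(\<lambda>f. restrict f {0..1}) ` limit_points x \<subseteq> (\<lambda>f. restrict f {0..1}) ` W e i0 \<mu> \<Sigma>"
    proof (rule image_subsetI)
      fix h assume h: "h \<in> limit_points x"
      then have "(\<lambda>t. h t - drift_line i0 \<mu> t) \<in> strassen_set ?A" using lp[of "\<lambda>t. h t - drift_line i0 \<mu> t"] by simp
      then obtain f where f: "f \<in> U i0" "\<And>t. t \<in> {0..1} \<Longrightarrow> h t - drift_line i0 \<mu> t = matrix_sqrt ?A *v f t"
        by (rule strassen_set_sqrt_preimage[OF A _ Sigma_perp_axis]) (erule that, simp)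
      have "h t = drift_line i0 \<mu> t + matrix_sqrt ?A *v f t" if "t \<in> {0..1}" for t
        using f(2)[OF that] by (simp add: diff_eq_eq add.commute)
      then have "restrict h {0..1} = restrict (\<lambda>t. drift_line i0 \<mu> t + matrix_sqrt ?A *v f t) {0..1}" by (rule restrict_ext)
      moreover have "(\<lambda>t. drift_line i0 \<mu> t + matrix_sqrt ?A *v f t) \<in> W e i0 \<mu> \<Sigma>" using f(1) unfolding W_eq by blast
      ultimately show "restrict h {0..1} \<in> (\<lambda>f. restrict f {0..1}) ` W e i0 \<mu> \<Sigma>" by (rule image_eqI)
    qed
  qed
qed

section \<open>Functional law of the iterated logarithm for walks with drift\<close>

theorem theorem3p2:
  fixes M :: "'a measure" and Z :: "nat \<Rightarrow> 'a \<Rightarrow> real^'d"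
    and e :: "'d \<Rightarrow> real^'d" and i0 :: 'd
    and \<mu> :: "real^'d" and \<Sigma> :: "real^'d^'d"
  assumes "prob_space M"
    and indep: "prob_space.indep_vars M (\<lambda>_. borel) Z {1..}"
    and ident: "\<forall>i\<ge>1. distr M borel (Z i) = distr M borel (Z 1)"
    and sq_int: "integrable M (\<lambda>\<omega>. (norm (Z 1 \<omega>))\<^sup>2)"
    and mu_def: "\<mu> = prob_space.expectation M (Z 1)"
    and mu_nz: "\<mu> \<noteq> 0"
    and Sigma_def: "\<Sigma> = (\<chi> i j. prob_space.expectation M
                          (\<lambda>\<omega>. (Z 1 \<omega> - \<mu>) $ i * (Z 1 \<omega> - \<mu>) $ j))"
    and onb: "\<forall>i j. e i \<bullet> e j = (if i = j then 1 else 0)"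
    and e1: "e i0 = (1 / norm \<mu>) *\<^sub>R \<mu>"
  shows "(AE \<omega> in M.
            rel_compact_seq (\<lambda>n t. psi e i0 n (Ypoly Z n \<omega> t)) \<and>
            (\<lambda>f. restrict f {0..1}) ` limit_points (\<lambda>n t. psi e i0 n (Ypoly Z n \<omega> t))
              = (\<lambda>f. restrict f {0..1}) ` W e i0 \<mu> \<Sigma>)
         \<and> (\<forall>F :: (real \<Rightarrow> real^'d) \<Rightarrow> real.
              (\<forall>f\<in>C0. \<forall>\<epsilon>>0. \<exists>\<delta>>0. \<forall>g\<in>C0. rho_inf f g < \<delta> \<longrightarrow> \<bar>F g - F f\<bar> < \<epsilon>) \<longrightarrow>
              (AE \<omega> in M. limsup (\<lambda>n. ereal (F (\<lambda>t. psi e i0 n (Ypoly Z n \<omega> t))))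
                           = (SUP h\<in>W e i0 \<mu> \<Sigma>. ereal (F h))))"
proof -
  interpret prob_space M by fact
  interpret N: iid_walk M "\<lambda>i \<omega>. Z i \<omega> - \<mu>" \<Sigma>
    by (rule iid_walk_centered[OF indep ident sq_int mu_def Sigma_def])
  interpret V: iid_walk M "\<lambda>i \<omega>. orth_part e i0 (Z i \<omega> - \<mu>)" "Sigma_perp e i0 \<Sigma>"
    by (rule N.orth_part_walk)
  obtain D0 :: "(real^'d) set" where D0: "countable D0" "\<And>X. open X \<Longrightarrow> X \<noteq> {} \<Longrightarrow> \<exists>d\<in>D0. d \<in> X"
    using countable_dense_exists by blast
  \<comment> \<open>Zero is added for the coefficients that have to vanish exactly.\<close>
  define D where "D = insert 0 D0"
  have D: "countable D" "0 \<in> D" using D0(1) by (auto simp: D_def)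
  have dense: "\<exists>d\<in>D. norm (d - x) < \<epsilon>" if "0 < \<epsilon>" for x :: "real^'d" and \<epsilon> :: real
    using D0(2)[of "ball x \<epsilon>"] that by (auto simp: D_def dist_norm norm_minus_commute)
  have NW: "AE \<omega> in M. strassen_walk (\<lambda>n. \<Sum>i=1..n. Z i \<omega> - \<mu>) \<Sigma> N.osc_const D"
    by (rule N.AE_strassen_walk[OF D]) (rule dense)
  have VW: "AE \<omega> in M. strassen_walk (\<lambda>n. \<Sum>i=1..n. orth_part e i0 (Z i \<omega> - \<mu>)) (Sigma_perp e i0 \<Sigma>) V.osc_const D"
    by (rule V.AE_strassen_walk[OF D]) (rule dense)
  define x where "x \<omega> = (\<lambda>n t. psi e i0 n (Ypoly Z n \<omega> t))" for \<omega>
  have good: "AE \<omega> in M. (\<forall>n. x \<omega> n \<in> C0) \<and> rel_compact_seq (x \<omega>) \<and>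
    (\<forall>g. (\<lambda>t. drift_line i0 \<mu> t + g t) \<in> limit_points (x \<omega>) \<longleftrightarrow> g \<in> strassen_set (Sigma_perp e i0 \<Sigma>))"
    using NW VW
  proof eventually_elim
    case (elim \<omega>)
    note P = psi_Ypoly_limit_points[where Z = Z and \<omega> = \<omega>, OF onb e1 mu_nz elim]
    show ?case unfolding x_def by (intro conjI allI P)
  qed
  have F_part: "AE \<omega> in M. limsup (\<lambda>n. ereal (F (x \<omega> n))) = (SUP h\<in>W e i0 \<mu> \<Sigma>. ereal (F h))"
    if F: "\<forall>f\<in>C0. \<forall>\<epsilon>>0. \<exists>\<delta>>0. \<forall>g\<in>C0. rho_inf f g < \<delta> \<longrightarrow> \<bar>F g - F f\<bar> < \<epsilon>" for F :: "(real \<Rightarrow> real^'d) \<Rightarrow> real"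
    using good
  proof eventually_elim
    case (elim \<omega>)
    note W = restrict_limit_points_eq_W[OF V.A_psd elim[THEN conjunct2, THEN conjunct2, rule_format]]
    \<comment> \<open>A limit point and an element of \<open>W\<close> with the same restriction
      give \<open>F\<close> the same value, so both suprema run over the same set of
      numbers.\<close>
    have "ereal (F h) \<in> (\<lambda>h. ereal (F h)) ` W e i0 \<mu> \<Sigma>" if h: "h \<in> limit_points (x \<omega>)" for h
    proof -
      have "restrict h {0..1} \<in> (\<lambda>f. restrict f {0..1}) ` W e i0 \<mu> \<Sigma>" unfolding W(2)[symmetric] using h by (rule imageI)
      then obtain h' where h': "h' \<in> W e i0 \<mu> \<Sigma>" "restrict h {0..1} = restrict h' {0..1}" by blast
      have "h \<in> C0" "h' \<in> C0" using h h'(1) W(1) by (auto simp: limit_points_def)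
      then have "F h = F h'" using continuous_functional_restrict[OF F] h'(2) by blast
      then show ?thesis using h'(1) by blast
    qed
    then have "(\<lambda>h. ereal (F h)) ` limit_points (x \<omega>) = (\<lambda>h. ereal (F h)) ` W e i0 \<mu> \<Sigma>" using W(1) by blast
    moreover have "limsup (\<lambda>n. ereal (F (x \<omega> n))) = (SUP h\<in>limit_points (x \<omega>). ereal (F h))"
      by (rule limsup_eq_SUP_limit_points) (use elim F in auto)
    ultimately show ?case by simp
  qed
  have "AE \<omega> in M. rel_compact_seq (x \<omega>) \<and> (\<lambda>f. restrict f {0..1}) ` limit_points (x \<omega>) = (\<lambda>f. restrict f {0..1}) ` W e i0 \<mu> \<Sigma>"
    using good
  proof eventually_elim
    case (elim \<omega>)
    show ?case using elim restrict_limit_points_eq_W(2)[OF V.A_psd elim[THEN conjunct2, THEN conjunct2, rule_format]] by simp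
  qed
  with F_part show ?thesis unfolding x_def by simp
qed

end
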